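(* Let $T>0$ and let $\phi:\mathbb{R}\to\mathbb{R}$ be $C^2$ with $\sup_{x}|\phi''(x)|<+\infty$ and $\phi(x)\ge c_0(1+|x|^2)$ for all $x$, for some $c_0>0$. For each $N\in\mathbb{N}$ let $\mathbf{X}_N^0=(x_1^0,\dots,x_N^0)\in\mathbb{R}^N$ (depending on $N$) satisfy $x_{i+1}^0-x_i^0\ge\frac1N$ for $i=1,\dots,N-1$, let $(x_1,\dots,x_N)$, $(\lambda_0,\dots,\lambda_N)$ be the solution of the $N$-particle system with this initial datum, and let $X_N,\tilde\Lambda_N$ be its piecewise constant and piecewise linear interpolations (all defined in the context). Set $X_N^0(s):=X_N(0,s)$ and assume $$\sup_{N}\int_0^1\phi(X_N^0(s))\,\mathrm{d}s<+\infty,\qquad \sup_N|x_N^0-x_1^0|<+\infty,\qquad \|X_N^0-X^0\|_{L^1(0,1)}\xrightarrow[N\to\infty]{}0,$$ for some $X^0:[0,1]\to\mathbb{R}$ satisfying $X^0(s_2)-X^0(s_1)\ge s_2-s_1$ for all $0\le s_1<s_2\le1$. Then, as $N\to\infty$, $$X_N\to X\ \text{ strongly in } C([0,T];L^p(0,1))\ \text{ for any } p\in[1,2),\qquad \tilde\Lambda_N\rightharpoonup\Lambda\ \text{ weakly in } L^2(0,T;H^1(0,1)),$$ where $(X,\Lambda)\in H^1(0,T;L^2(0,1))\times L^2(0,T;H^1(0,1))$ is the unique solution of the Lagrangian system $$\partial_tX=-\phi'(X)-\partial_s\Lambda \ \text{ in } [0,T]\times[0,1],\qquad \Lambda(t,0)=\Lambda(t,1)=0,\qquad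 \Lambda\ge0,\ \ \partial_sX\ge1,\ \ \Lambda(1-\partial_sX)=0,$$ with initial condition $X(0,\cdot)=X^0$.
   Context: $N$-particle system (with $2r=\frac1N$): $(x_1,\dots,x_N)\in H^1(0,T;\mathbb{R}^N)$, $(\lambda_0,\dots,\lambda_N)\in L^2(0,T;\mathbb{R}^{N+1})$ is the unique pair with $x_i(0)=x_i^0$, $\dot x_i=-\phi'(x_i)-N(\lambda_i-\lambda_{i-1})$ for $i=1,\dots,N$, $x_{i+1}-x_i\ge\frac1N$, $\lambda_i\ge0$, $\lambda_i(x_{i+1}-x_i-\frac1N)=0$ for $i=1,\dots,N-1$, and $\lambda_0=\lambda_N=0$, for a.e. $t\in[0,T]$. Interpolations: $X_N(t,s)=x_i(t)$ for $s\in(\frac{i-1}N,\frac iN]$, $i=1,\dots,N$; $\tilde\Lambda_N(t,s)=N(\lambda_i(t)-\lambda_{i-1}(t))(s-\frac{i-1}N)+\lambda_{i-1}(t)$ for $s\in[\frac{i-1}N,\frac iN]$, $i=1,\dots,N$. Meaning of the Lagrangian system: the evolution equation holds for a.e. $(t,s)$, the boundary conditions for a.e. $t$. $\partial_sX(t,\cdot)$ is the distributional derivative on $(0,1)$, in general a Radon measure; the constraint means that for a.e. $t$, $\Lambda(t,\cdot)\ge0$, the measure $\partial_sX(t,\cdot)-\mathrm{d}s$ is nonnegative, and the measure $\Lambda(t,\cdot)(\partial_sX(t,\cdot)-\mathrm{d}s)$ vanishes ($\Lambda(t,\cdot)$ being its continuous representative). *)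

theory Defs
  imports "HOL-Analysis.Analysis"
begin

section \<open>Lebesgue and Sobolev spaces\<close>

text \<open>Elements of Lebesgue and Sobolev spaces are represented by Borel functions, with almost
  everywhere equality written explicitly. Functions of time and space are curried, time first.\<close>

abbreviation leb :: "real \<Rightarrow> real \<Rightarrow> real measure" where
  "leb a b \<equiv> restrict_space lborel {a<..<b}"

abbreviation leb2 :: "real \<Rightarrow> (real \<times> real) measure" where
  "leb2 T \<equiv> leb 0 T \<Otimes>\<^sub>M leb 0 1"

definition Lp :: "real \<Rightarrow> 'a measure \<Rightarrow> ('a \<Rightarrow> real) \<Rightarrow> bool" where
  "Lp p M f \<longleftrightarrow> f \<in> borel_measurable M \<and> integrable M (\<lambda>x. \<bar>f x\<bar> powr p)"

definition Lp_norm :: "real \<Rightarrow> 'a measure \<Rightarrow> ('a \<Rightarrow> real) \<Rightarrow> real" where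
  "Lp_norm p M f = (LINT x|M. \<bar>f x\<bar> powr p) powr (1 / p)"

definition test_function :: "real \<Rightarrow> real \<Rightarrow> (real \<Rightarrow> real) \<Rightarrow> bool" where
  "test_function a b \<theta> \<longleftrightarrow>
     (\<forall>n x. (deriv ^^ n) \<theta> differentiable (at x)) \<and>
     compact (closure {x. \<theta> x \<noteq> 0}) \<and> closure {x. \<theta> x \<noteq> 0} \<subseteq> {a<..<b}"

text \<open>\<open>f\<close> lies in \<open>H\<^sup>1(a,b)\<close>, with weak derivative \<open>g\<close>.\<close>

definition H1_deriv :: "real \<Rightarrow> real \<Rightarrow> (real \<Rightarrow> real) \<Rightarrow> (real \<Rightarrow> real) \<Rightarrow> bool" where
  "H1_deriv a b f g \<longleftrightarrow> Lp 2 (leb a b) f \<and> Lp 2 (leb a b) g \<and>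
     (\<forall>\<theta>. test_function a b \<theta> \<longrightarrow>
        (LINT x|leb a b. f x * deriv \<theta> x) = - (LINT x|leb a b. g x * \<theta> x))"

text \<open>\<open>u\<close> lies in \<open>H\<^sup>1(0,T;L\<^sup>2(0,1))\<close>, with weak time derivative \<open>v\<close>. The identity between
  \<open>L\<^sup>2(0,1)\<close>-valued integrals is written for almost every \<open>s\<close>; the exceptional set may
  depend on \<open>\<theta>\<close>.\<close>

definition H1L2_deriv :: "real \<Rightarrow> (real \<Rightarrow> real \<Rightarrow> real) \<Rightarrow> (real \<Rightarrow> real \<Rightarrow> real) \<Rightarrow> bool" where
  "H1L2_deriv T u v \<longleftrightarrow>
     Lp 2 (leb2 T) (\<lambda>(t, s). u t s) \<and> Lp 2 (leb2 T) (\<lambda>(t, s). v t s) \<and>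
     (\<forall>\<theta>. test_function 0 T \<theta> \<longrightarrow>
        (AE s in leb 0 1.
           (LINT t|leb 0 T. u t s * deriv \<theta> t) = - (LINT t|leb 0 T. v t s * \<theta> t)))"

text \<open>\<open>u\<close> lies in \<open>L\<^sup>2(0,T;H\<^sup>1(0,1))\<close>, with weak space derivative \<open>v\<close>.\<close>

definition L2H1_deriv :: "real \<Rightarrow> (real \<Rightarrow> real \<Rightarrow> real) \<Rightarrow> (real \<Rightarrow> real \<Rightarrow> real) \<Rightarrow> bool" where
  "L2H1_deriv T u v \<longleftrightarrow>
     Lp 2 (leb2 T) (\<lambda>(t, s). u t s) \<and> Lp 2 (leb2 T) (\<lambda>(t, s). v t s) \<and>
     (AE t in leb 0 T. H1_deriv 0 1 (u t) (v t))"

definition L2H1 :: "real \<Rightarrow> (real \<Rightarrow> real \<Rightarrow> real) \<Rightarrow> bool" where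
  "L2H1 T u \<longleftrightarrow> (\<exists>v. L2H1_deriv T u v)"

text \<open>Bounded linear functionals on \<open>L\<^sup>2(0,T;H\<^sup>1(0,1))\<close>. Linearity and the bound imply that they
  only depend on the almost everywhere class of their argument.\<close>

definition L2H1_dual :: "real \<Rightarrow> ((real \<Rightarrow> real \<Rightarrow> real) \<Rightarrow> real) \<Rightarrow> bool" where
  "L2H1_dual T F \<longleftrightarrow>
     (\<forall>u w. L2H1 T u \<longrightarrow> L2H1 T w \<longrightarrow> F (\<lambda>t s. u t s + w t s) = F u + F w) \<and>
     (\<forall>c u. L2H1 T u \<longrightarrow> F (\<lambda>t s. c * u t s) = c * F u) \<and>
     (\<exists>C. \<forall>u v. L2H1_deriv T u v \<longrightarrow>
        \<bar>F u\<bar> \<le> C * sqrt ((Lp_norm 2 (leb2 T) (\<lambda>(t, s). u t s))\<^sup>2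
                       + (Lp_norm 2 (leb2 T) (\<lambda>(t, s). v t s))\<^sup>2))"

text \<open>Sequences are indexed by \<open>N \<ge> 1\<close>; their value at \<open>0\<close> is irrelevant.\<close>

definition L2H1_weakly_tendsto ::
    "real \<Rightarrow> (nat \<Rightarrow> real \<Rightarrow> real \<Rightarrow> real) \<Rightarrow> (real \<Rightarrow> real \<Rightarrow> real) \<Rightarrow> bool" where
  "L2H1_weakly_tendsto T w u \<longleftrightarrow>
     (\<forall>N\<ge>1. L2H1 T (w N)) \<and> L2H1 T u \<and>
     (\<forall>F. L2H1_dual T F \<longrightarrow> (\<lambda>N. F (w N)) \<longlonglongrightarrow> F u)"

definition C_Lp :: "real \<Rightarrow> real \<Rightarrow> (real \<Rightarrow> real \<Rightarrow> real) \<Rightarrow> bool" where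
  "C_Lp p T u \<longleftrightarrow> (\<forall>t\<in>{0..T}. Lp p (leb 0 1) (u t) \<and>
     ((\<lambda>\<tau>. Lp_norm p (leb 0 1) (\<lambda>s. u \<tau> s - u t s)) \<longlongrightarrow> 0) (at t within {0..T}))"

definition C_Lp_tendsto ::
    "real \<Rightarrow> real \<Rightarrow> (nat \<Rightarrow> real \<Rightarrow> real \<Rightarrow> real) \<Rightarrow> (real \<Rightarrow> real \<Rightarrow> real) \<Rightarrow> bool" where
  "C_Lp_tendsto p T w u \<longleftrightarrow>
     (\<forall>N\<ge>1. C_Lp p T (w N)) \<and> C_Lp p T u \<and>
     uniform_limit {0..T} (\<lambda>N t. Lp_norm p (leb 0 1) (\<lambda>s. w N t s - u t s)) (\<lambda>_. 0) sequentially"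

section \<open>The particle system\<close>

text \<open>\<open>x\<close> is the continuous representative of its class, so that the initial condition makes
  sense; \<open>v i\<close> is the time derivative of \<open>x i\<close>. The potential enters through its
  derivative \<open>d\<phi>\<close>.\<close>

definition particle_solution ::
    "real \<Rightarrow> (real \<Rightarrow> real) \<Rightarrow> nat \<Rightarrow> (nat \<Rightarrow> real) \<Rightarrow> (nat \<Rightarrow> real \<Rightarrow> real) \<Rightarrow> (nat \<Rightarrow> real \<Rightarrow> real) \<Rightarrow> bool"
  where
  "particle_solution T d\<phi> N x0 x \<Lambda> \<longleftrightarrow>
     (\<forall>i\<in>{1..N}. continuous_on {0..T} (x i) \<and> x i 0 = x0 i) \<and>
     (\<forall>i\<in>{0..N}. Lp 2 (leb 0 T) (\<Lambda> i)) \<and>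
     (\<exists>v. (\<forall>i\<in>{1..N}. H1_deriv 0 T (x i) (v i)) \<and>
        (AE t in leb 0 T.
           (\<forall>i\<in>{1..N}. v i t = - d\<phi> (x i t) - real N * (\<Lambda> i t - \<Lambda> (i - 1) t)) \<and>
           (\<forall>i\<in>{1..<N}. x (i + 1) t - x i t \<ge> 1 / real N \<and> \<Lambda> i t \<ge> 0 \<and>
              \<Lambda> i t * (x (i + 1) t - x i t - 1 / real N) = 0) \<and>
           \<Lambda> 0 t = 0 \<and> \<Lambda> N t = 0))"

text \<open>The index \<open>i\<close> with \<open>s \<in> ((i-1)/N, i/N]\<close>, and \<open>1\<close> for \<open>s = 0\<close>.\<close>

definition cell :: "nat \<Rightarrow> real \<Rightarrow> nat" where
  "cell N s = max 1 (nat \<lceil>real N * s\<rceil>)"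

definition interp_const :: "nat \<Rightarrow> (nat \<Rightarrow> real \<Rightarrow> real) \<Rightarrow> real \<Rightarrow> real \<Rightarrow> real" where
  "interp_const N x t s = x (cell N s) t"

definition interp_lin :: "nat \<Rightarrow> (nat \<Rightarrow> real \<Rightarrow> real) \<Rightarrow> real \<Rightarrow> real \<Rightarrow> real" where
  "interp_lin N \<Lambda> t s =
     (let i = cell N s in
        real N * (\<Lambda> i t - \<Lambda> (i - 1) t) * (s - (real i - 1) / real N) + \<Lambda> (i - 1) t)"

lemma cell_eq:
  assumes "i \<ge> 1" "N \<ge> 1" "s \<in> {(real i - 1) / real N <.. real i / real N}"
  shows "cell N s = i"
proof -
  have "real i - 1 < real N * s" "real N * s \<le> real i"
    using assms by (auto simp: field_simps)
  then have "\<lceil>real N * s\<rceil> = int i"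
    by (intro ceiling_unique) auto
  then show ?thesis
    using assms(1) by (simp add: cell_def)
qed

lemma interp_const_eq:
  assumes "i \<ge> 1" "N \<ge> 1" "s \<in> {(real i - 1) / real N <.. real i / real N}"
  shows "interp_const N x t s = x i t"
  using cell_eq[OF assms] by (simp add: interp_const_def)

lemma interp_lin_eq:
  assumes "i \<ge> 1" "N \<ge> 1" "s \<in> {(real i - 1) / real N .. real i / real N}"
  shows "interp_lin N \<Lambda> t s =
    real N * (\<Lambda> i t - \<Lambda> (i - 1) t) * (s - (real i - 1) / real N) + \<Lambda> (i - 1) t"
proof (cases "s = (real i - 1) / real N")
  case False
  then have "cell N s = i"
    using assms by (intro cell_eq) auto
  then show ?thesis
    by (simp add: interp_lin_def)
next
  case s: True
  show ?thesis
  proof (cases "i = 1")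
    case True
    then show ?thesis
      using s by (simp add: interp_lin_def cell_def)
  next
    case False
    have "cell N s = i - 1"
      using assms(1,2) False s by (intro cell_eq) (auto simp: field_simps)
    moreover have "s - (real (i - 1) - 1) / real N = 1 / real N"
      unfolding s using assms(1) by (simp add: of_nat_diff diff_divide_distrib)
    ultimately have "interp_lin N \<Lambda> t s = \<Lambda> (i - 1) t"
      using assms(2) by (simp add: interp_lin_def Let_def)
    then show ?thesis
      using s by simp
  qed
qed

section \<open>The Lagrangian system\<close>

text \<open>\<open>\<mu>\<close> is the measure \<open>\<partial>\<^sub>s f - ds\<close> on \<open>(0,1)\<close>: a nonnegative Radon measure such that
  the distributional derivative of \<open>f\<close> is \<open>ds + \<mu>\<close>.\<close>

definition excess_measure :: "(real \<Rightarrow> real) \<Rightarrow> real measure \<Rightarrow> bool" where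
  "excess_measure f \<mu> \<longleftrightarrow>
     sets \<mu> = sets (restrict_space borel {0<..<1::real}) \<and>
     (\<forall>K. compact K \<longrightarrow> K \<subseteq> {0<..<1} \<longrightarrow> emeasure \<mu> K < \<infinity>) \<and>
     (\<forall>\<theta>. test_function 0 1 \<theta> \<longrightarrow>
        - (LINT s|leb 0 1. f s * deriv \<theta> s) = (LINT s|leb 0 1. \<theta> s) + (LINT s|\<mu>. \<theta> s))"

text \<open>\<open>X\<close> is the representative that is continuous in time with values in \<open>L\<^sup>2(0,1)\<close>, so that the
  initial condition makes sense, and \<open>\<Lambda> t\<close> is the continuous representative on \<open>[0,1]\<close>
  for almost every \<open>t\<close>. Since \<open>\<Lambda> t \<ge> 0\<close>, the measure
  \<open>\<Lambda> t (\<partial>\<^sub>s X t - ds)\<close> is a density with respect to the excess measure.\<close>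

definition lagrangian_solution ::
    "real \<Rightarrow> (real \<Rightarrow> real) \<Rightarrow> (real \<Rightarrow> real) \<Rightarrow> (real \<Rightarrow> real \<Rightarrow> real) \<Rightarrow> (real \<Rightarrow> real \<Rightarrow> real) \<Rightarrow> bool"
  where
  "lagrangian_solution T d\<phi> X0 X \<Lambda> \<longleftrightarrow>
     (\<exists>V L. H1L2_deriv T X V \<and> L2H1_deriv T \<Lambda> L \<and>
        (AE (t, s) in leb2 T. V t s = - d\<phi> (X t s) - L t s)) \<and>
     C_Lp 2 T X \<and> (AE s in leb 0 1. X 0 s = X0 s) \<and>
     (AE t in leb 0 T.
        continuous_on {0..1} (\<Lambda> t) \<and> \<Lambda> t 0 = 0 \<and> \<Lambda> t 1 = 0 \<and>
        (\<forall>s\<in>{0..1}. \<Lambda> t s \<ge> 0) \<and>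
        (\<exists>\<mu>. excess_measure (X t) \<mu> \<and>
             density \<mu> (\<lambda>s. ennreal (\<Lambda> t s)) = null_measure \<mu>))"

end

theory Submission
  imports Defs
begin

text \<open>With \<open>g = X - s\<close> the constraint says that \<open>g\<close> is nondecreasing, that is, \<open>\<integral> g m ds \<le> 0\<close> for every
  derivative \<open>m\<close> of a nonnegative function in \<open>H\<^sup>1\<^sub>0(0,1)\<close>, with equality for \<open>m = \<partial>\<^sub>s \<Lambda>\<close>. Hence
  \<open>\<integral> (X - Y) (\<partial>\<^sub>s \<Lambda> - \<partial>\<^sub>s M) ds \<ge> 0\<close> for two solutions, and Gronwall's inequality gives uniqueness.
  The \<open>N\<close>-particle interpolation satisfies the same relations up to an error \<open>1 / N\<close>, because
  \<open>X\<^sub>N - \<lceil>N s\<rceil> / N\<close> is nondecreasing and the complementarity conditions hold cell by cell. The same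
  comparison, together with an \<open>L\<^sup>2\<close> bound for \<open>\<partial>\<^sub>s \<Lambda>\<^sub>N\<close> that is uniform in \<open>N\<close> and \<open>t\<close>, shows that
  \<open>X\<^sub>N\<close> is a Cauchy sequence in \<open>C([0,T]; L\<^sup>2(0,1))\<close>, without any compactness argument. Mazur
  combinations of any subsequence of \<open>\<partial>\<^sub>s \<Lambda>\<^sub>N\<close> converge strongly, to a multiplier for the limit \<open>X\<close>;
  since this multiplier is unique, the whole sequence converges weakly.\<close>

section \<open>Smooth functions\<close>

text \<open>The uniform bound on the multipliers is an orthogonality. The velocity is
  \<open>V = - d\<phi> (X) - L\<close> with \<open>L = \<partial>\<^sub>s \<Lambda>\<close>, and
  summation by parts turns the space integral of \<open>V L\<close> into minus the sum of the
  \<open>\<Lambda> i (v (i + 1) - v i)\<close>. Each term vanishes at almost every time: either the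
  multiplier is 0, or the gap sits at its minimum, and the derivative of a function vanishes almost
  everywhere on its zero set. So the squared norm of \<open>d\<phi> (X)\<close> is the sum of those
  of \<open>V\<close> and \<open>L\<close>, and both are controlled by \<open>X\<close> alone. The
  comparison needs initial data close in L2, while only L1 closeness is assumed. The energy and
  width bounds make the initial positions bounded uniformly in \<open>N\<close>, which upgrades the
  convergence. The weak formulations shape the preliminaries: test functions call for explicit
  smooth cut-offs; exceptional null sets depend on the time or on the test function, so Fubini
  exchanges recur; and the excess measure of a competing solution is arbitrary, so it is recovered
  from its distribution function by du Bois-Reymond.\<close>

definition flat :: "real poly \<Rightarrow> real \<Rightarrow> real" where
  "flat p x = (if x > 0 then poly p (1 / x) * exp (- (1 / x)) else 0)"

lemma poly_over_exp_tendsto_0: "((\<lambda>y. poly p y * exp (- y)) \<longlongrightarrow> (0::real)) at_top"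
proof -
  have "((\<lambda>y. \<Sum>i\<le>degree p. coeff p i * (y ^ i / exp y)) \<longlongrightarrow> (\<Sum>i\<le>degree p. coeff p i * 0)) at_top"
    by (intro tendsto_intros tendsto_power_div_exp_0)
  then show ?thesis
    by (simp add: poly_altdef sum_distrib_right exp_minus divide_inverse mult.assoc)
qed

text \<open>In the variable y = 1/x the derivative of p(y) exp(-y) is y^2 (p(y) - p'(y)) exp(-y), so
  the polynomial parameter makes the family closed under differentiation. At 0 the difference
  quotient from the right is the function with polynomial y p(y), which the exponential sends to
  0.\<close>

lemma flat_has_derivative:
  "(flat p has_real_derivative flat (monom 1 2 * (p - pderiv p)) x) (at x)"
proof -
  consider "x < 0" | "x > 0" | "x = 0" by linarith
  then show ?thesis
  proof cases
    case 1
    have "((\<lambda>_. 0) has_real_derivative 0) (at x)" by simp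
    then have "(flat p has_real_derivative 0) (at x)"
      by (rule has_field_derivative_transform_within_open[of _ _ _ "{..<0}"])
         (use 1 in \<open>auto simp: flat_def\<close>)
    then show ?thesis using 1 by (simp add: flat_def)
  next
    case 2
    have "((\<lambda>x. poly p (1 / x) * exp (- (1 / x))) has_real_derivative
        (poly (pderiv p) (1/x) * (- (1 / x^2)) * exp (- (1/x))
           + poly p (1/x) * (exp (- (1/x)) * (1 / x^2)))) (at x)"
      using 2 by (auto intro!: derivative_eq_intros DERIV_chain2[where f="poly p"] poly_DERIV
          simp: power2_eq_square)
    then have "(flat p has_real_derivative
        (poly (pderiv p) (1/x) * (- (1 / x^2)) * exp (- (1/x))
           + poly p (1/x) * (exp (- (1/x)) * (1 / x^2)))) (at x)"
      by (rule has_field_derivative_transform_within_open[of _ _ _ "{0<..}"])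
         (use 2 in \<open>auto simp: flat_def\<close>)
    moreover have "poly (pderiv p) (1/x) * (- (1 / x^2)) * exp (- (1/x))
           + poly p (1/x) * (exp (- (1/x)) * (1 / x^2)) = flat (monom 1 2 * (p - pderiv p)) x"
      using 2 by (simp add: flat_def poly_monom field_simps)
    ultimately show ?thesis by simp
  next
    case 3
    have "((\<lambda>h. poly (monom 1 1 * p) (inverse h) * exp (- inverse h)) \<longlongrightarrow> 0) (at_right 0)"
      by (rule filterlim_compose[OF poly_over_exp_tendsto_0 filterlim_inverse_at_top_right])
    then have "((\<lambda>h. flat p h / h) \<longlongrightarrow> 0) (at_right 0)"
      by (rule Lim_transform_eventually)
         (auto simp: eventually_at_right_field flat_def poly_monom field_simps intro!: exI[of _ 1])
    moreover have "((\<lambda>h. flat p h / h) \<longlongrightarrow> 0) (at_left 0)"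
      by (rule Lim_transform_eventually[OF tendsto_const])
         (auto simp: eventually_at_left_field flat_def intro!: exI[of _ "-1"])
    ultimately have "((\<lambda>h. flat p h / h) \<longlongrightarrow> 0) (at 0)"
      by (simp add: filterlim_split_at)
    then show ?thesis
      using 3 by (simp add: has_field_derivative_iff flat_def)
  qed
qed

text \<open>Every rule produces a function whose derivative is again of this form, so that all members
  are infinitely differentiable; no estimate of higher derivatives is ever needed.\<close>

inductive elem_smooth :: "(real \<Rightarrow> real) \<Rightarrow> bool" where
  flat: "elem_smooth (flat p)"
| const: "elem_smooth (\<lambda>_. c)"
| add: "elem_smooth f \<Longrightarrow> elem_smooth g \<Longrightarrow> elem_smooth (\<lambda>x. f x + g x)"
| mult: "elem_smooth f \<Longrightarrow> elem_smooth g \<Longrightarrow> elem_smooth (\<lambda>x. f x * g x)"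
| inverse: "elem_smooth f \<Longrightarrow> (\<And>x. f x > 0) \<Longrightarrow> elem_smooth (\<lambda>x. inverse (f x))"
| affine: "elem_smooth f \<Longrightarrow> elem_smooth (\<lambda>x. f (a * x + b))"
| antideriv: "elem_smooth f \<Longrightarrow> (\<And>x. (F has_real_derivative f x) (at x)) \<Longrightarrow> elem_smooth F"

lemma elem_smooth_deriv:
  "elem_smooth f \<Longrightarrow> \<exists>f'. elem_smooth f' \<and> (\<forall>x. (f has_real_derivative f' x) (at x))"
proof (induction rule: elem_smooth.induct)
  case (flat p)
  then show ?case using flat_has_derivative elem_smooth.flat by blast
next
  case (const c)
  then show ?case using elem_smooth.const[of 0] by fastforce
next
  case (add f g)
  then obtain f' g' where "elem_smooth f'" "\<forall>x. (f has_real_derivative f' x) (at x)"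
    "elem_smooth g'" "\<forall>x. (g has_real_derivative g' x) (at x)" by blast
  then show ?case
    by (intro exI[of _ "\<lambda>x. f' x + g' x"]) (auto intro!: elem_smooth.add DERIV_add)
next
  case (mult f g)
  then obtain f' g' where "elem_smooth f'" "\<forall>x. (f has_real_derivative f' x) (at x)"
    "elem_smooth g'" "\<forall>x. (g has_real_derivative g' x) (at x)" by blast
  then show ?case using mult.hyps
    by (intro exI[of _ "\<lambda>x. f x * g' x + f' x * g x"])
       (auto intro!: elem_smooth.add elem_smooth.mult DERIV_mult')
next
  case (inverse f)
  then obtain f' where f': "elem_smooth f'" "\<forall>x. (f has_real_derivative f' x) (at x)" by blast
  have "f x \<noteq> 0" for x using inverse.hyps(2)[of x] by simp
  then have "((\<lambda>x. inverse (f x)) has_real_derivative (-1) * (inverse (f x) * f' x * inverse (f x))) (at x)" for x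
    using DERIV_inverse'[of f "f' x" x UNIV] f'(2) by simp
  moreover have "elem_smooth (\<lambda>x. (-1) * (inverse (f x) * f' x * inverse (f x)))"
    by (intro elem_smooth.mult elem_smooth.const elem_smooth.inverse f' inverse.hyps)
  ultimately show ?case by blast
next
  case (affine f a b)
  then obtain f' where f': "elem_smooth f'" "\<forall>x. (f has_real_derivative f' x) (at x)" by blast
  have "((\<lambda>x. f (a * x + b)) has_real_derivative f' (a * x + b) * a) (at x)" for x
    by (rule DERIV_chain2[of f]) (use f'(2) in \<open>auto intro!: derivative_eq_intros\<close>)
  moreover have "elem_smooth (\<lambda>x. f' (a * x + b) * a)"
    by (intro elem_smooth.mult elem_smooth.const elem_smooth.affine f')
  ultimately show ?case by blast
next
  case (antideriv f F)
  then show ?case by blast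
qed

lemma elem_smooth_deriv':
  assumes "elem_smooth f"
  shows "elem_smooth (deriv f)" and "(f has_real_derivative deriv f x) (at x)"
proof -
  obtain f' where f': "elem_smooth f'" "\<forall>x. (f has_real_derivative f' x) (at x)"
    using elem_smooth_deriv[OF assms] by blast
  then have "deriv f = f'" by (auto intro: DERIV_imp_deriv)
  with f' show "elem_smooth (deriv f)" "(f has_real_derivative deriv f x) (at x)" by auto
qed

lemma elem_smooth_continuous: "elem_smooth f \<Longrightarrow> continuous_on A f"
  by (meson elem_smooth_deriv'(2) DERIV_isCont continuous_at_imp_continuous_on)

lemma elem_smooth_borel [measurable]: "elem_smooth f \<Longrightarrow> f \<in> borel_measurable borel"
  by (rule borel_measurable_continuous_onI) (rule elem_smooth_continuous)

lemma elem_smooth_diff: "elem_smooth f \<Longrightarrow> elem_smooth g \<Longrightarrow> elem_smooth (\<lambda>x. f x - g x)"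
  using elem_smooth.add[OF _ elem_smooth.mult[OF elem_smooth.const[of "-1"]], of f g] by simp

lemma elem_smooth_higher: "elem_smooth f \<Longrightarrow> elem_smooth ((deriv ^^ n) f)"
  by (induction n) (auto intro: elem_smooth_deriv')

lemma test_functionI:
  assumes f: "elem_smooth \<theta>" and ab: "A < a" "b < B" and z: "\<And>x. x \<notin> {a..b} \<Longrightarrow> \<theta> x = 0"
  shows "test_function A B \<theta>"
proof -
  have "closure {x. \<theta> x \<noteq> 0} \<subseteq> {a..b}"
    by (rule closure_minimal) (use z in blast, simp)
  moreover from this have "compact (closure {x. \<theta> x \<noteq> 0})"
    by (meson bounded_closed_interval bounded_subset closed_closure compact_eq_bounded_closed)
  moreover have "(deriv ^^ n) \<theta> differentiable (at x)" for n x
    using elem_smooth_deriv'(2)[OF elem_smooth_higher[OF f]]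
    by (meson differentiableI has_field_derivative_imp_has_derivative)
  ultimately show ?thesis
    using ab unfolding test_function_def by force
qed

text \<open>Written with \<open>inverse\<close> instead of a quotient so that the closure rules of
  \<open>elem_smooth\<close> apply directly. The denominator is positive because \<open>x\<close>
  and \<open>1 - x\<close> are never both nonpositive.\<close>

definition smooth_step :: "real \<Rightarrow> real" where
  "smooth_step x = flat 1 x * inverse (flat 1 x + flat 1 (1 - x))"

lemma flat_1_mono: "x \<le> y \<Longrightarrow> flat 1 x \<le> flat 1 y"
  by (auto simp: flat_def field_simps)

lemma flat_1_nonneg: "flat 1 x \<ge> 0" and flat_1_pos: "x > 0 \<Longrightarrow> flat 1 x > 0"
  by (auto simp: flat_def)

lemma smooth_step_denom: "flat 1 x + flat 1 (1 - x) > 0"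
  using flat_1_pos[of x] flat_1_pos[of "1 - x"] flat_1_nonneg[of x] flat_1_nonneg[of "1 - x"]
  by (cases "x > 0") (auto simp: add_pos_nonneg add_nonneg_pos)

lemma smooth_step_smooth: "elem_smooth smooth_step"
proof -
  have "elem_smooth (\<lambda>x. flat 1 (1 - x))"
    using elem_smooth.affine[OF elem_smooth.flat, of 1 "-1" 1] by simp
  then show ?thesis
    unfolding smooth_step_def[abs_def]
    by (intro elem_smooth.mult elem_smooth.inverse elem_smooth.add elem_smooth.flat smooth_step_denom)
qed

lemma smooth_step_0: "x \<le> 0 \<Longrightarrow> smooth_step x = 0"
  and smooth_step_1: "x \<ge> 1 \<Longrightarrow> smooth_step x = 1"
  by (auto simp: smooth_step_def flat_def)

text \<open>Cross-multiplication cancels \<open>flat 1 x * flat 1 y\<close> and leaves an inequality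
  between products that are monotone factor by factor.\<close>

lemma smooth_step_mono:
  assumes "x \<le> y" shows "smooth_step x \<le> smooth_step y"
proof -
  have 1: "flat 1 x \<le> flat 1 y" "flat 1 (1 - y) \<le> flat 1 (1 - x)"
    using assms by (auto intro: flat_1_mono)
  have "flat 1 x * flat 1 (1 - y) \<le> flat 1 y * flat 1 (1 - x)"
    by (intro mult_mono 1 flat_1_nonneg)
  then have "flat 1 x / (flat 1 x + flat 1 (1 - x)) \<le> flat 1 y / (flat 1 y + flat 1 (1 - y))"
    using smooth_step_denom[of x] smooth_step_denom[of y] by (simp add: divide_simps algebra_simps)
  then show ?thesis by (simp add: smooth_step_def divide_inverse)
qed

lemma smooth_step_ge_0: "smooth_step x \<ge> 0" and smooth_step_le_1: "smooth_step x \<le> 1"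
  using smooth_step_mono[of "min x 0" x] smooth_step_mono[of x "max x 1"]
  by (auto simp: smooth_step_0 smooth_step_1)

text \<open>Rises on \<open>[a, a + \<epsilon>]\<close> and falls on
  \<open>[b, b + \<epsilon>]\<close>, so it approximates the indicator of \<open>{a<..b}\<close>,
  and its derivative is a difference of two bumps of mass one. As a test function it produces values
  at \<open>a\<close> and \<open>b\<close> on one side of a weak derivative identity and an integral
  over \<open>{a<..b}\<close> on the other.\<close>

definition plateau :: "real \<Rightarrow> real \<Rightarrow> real \<Rightarrow> real \<Rightarrow> real" where
  "plateau a b \<epsilon> x = smooth_step ((x - a) / \<epsilon>) - smooth_step ((x - b) / \<epsilon>)"

text \<open>The derivative of the shifted step, hence for \<open>\<epsilon> > 0\<close> a one-sided
  approximate identity: nonnegative, of mass one and carried by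
  \<open>[a, a + \<epsilon>]\<close>.\<close>

definition mollifier :: "real \<Rightarrow> real \<Rightarrow> real \<Rightarrow> real" where
  "mollifier a \<epsilon> x = deriv smooth_step ((x - a) / \<epsilon>) / \<epsilon>"

lemma shifted_step_smooth: "elem_smooth (\<lambda>x. smooth_step ((x - a) / \<epsilon>))"
  using elem_smooth.affine[OF smooth_step_smooth, of "1 / \<epsilon>" "- a / \<epsilon>"]
  by (simp add: diff_divide_distrib)

lemma shifted_step_deriv:
  "\<epsilon> \<noteq> 0 \<Longrightarrow> ((\<lambda>x. smooth_step ((x - a) / \<epsilon>)) has_real_derivative mollifier a \<epsilon> x) (at x)"
  unfolding mollifier_def
  by (rule DERIV_chain2[of smooth_step, THEN DERIV_cong, OF elem_smooth_deriv'(2)[OF smooth_step_smooth]])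
     (auto intro!: derivative_eq_intros)

lemma mollifier_nonneg: "\<epsilon> > 0 \<Longrightarrow> mollifier a \<epsilon> x \<ge> 0"
proof -
  have "deriv smooth_step y \<ge> 0" for y
    by (rule mono_on_imp_deriv_nonneg[of UNIV smooth_step])
      (auto intro: smooth_step_mono elem_smooth_deriv'(2)[OF smooth_step_smooth] mono_onI)
  then show "\<epsilon> > 0 \<Longrightarrow> mollifier a \<epsilon> x \<ge> 0" by (simp add: mollifier_def)
qed

section \<open>Primitives of integrable functions\<close>

lemma space_leb [simp]: "space (leb a b) = {a<..<b}"
  by (simp add: space_restrict_space)

lemma finite_measure_leb [intro, simp]: "finite_measure (leb a b)"
proof
  have "emeasure (leb a b) (space (leb a b)) = emeasure lborel {a<..<b}"
    by (subst space_leb, subst emeasure_restrict_space) auto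
  also have "\<dots> \<le> emeasure lborel {a..b}" by (intro emeasure_mono) auto
  also have "\<dots> < \<infinity>" by (simp add: emeasure_lborel_Icc_eq)
  finally show "emeasure (leb a b) (space (leb a b)) \<noteq> \<infinity>" by simp
qed

lemma sigma_finite_leb [intro, simp]: "sigma_finite_measure (leb a b)"
  using finite_measure.axioms(1)[OF finite_measure_leb] .

lemma measure_leb: "a \<le> b \<Longrightarrow> measure (leb a b) {a<..<b} = b - a"
  by (subst measure_restrict_space) auto

interpretation pair_leb: pair_sigma_finite "leb a b" "leb c d" for a b c d
  by (simp add: pair_sigma_finite_def)

lemma finite_measure_leb2 [intro, simp]: "finite_measure (leb2 T)"
proof
  interpret a: finite_measure "leb 0 T" by simp
  interpret b: finite_measure "leb 0 1" by simp
  have "emeasure (leb2 T) (space (leb2 T)) =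
      emeasure (leb 0 T) (space (leb 0 T)) * emeasure (leb 0 1) (space (leb 0 1))"
    unfolding space_pair_measure by (rule sigma_finite_measure.emeasure_pair_measure_Times[OF sigma_finite_leb]) (rule sets.top)+
  then show "emeasure (leb2 T) (space (leb2 T)) \<noteq> \<infinity>"
    by (simp add: a.emeasure_eq_measure b.emeasure_eq_measure ennreal_mult_eq_top_iff del: space_leb)
qed

lemma leb_integral: "(LINT x|leb a b. f x) = (LINT x|lborel. indicator {a<..<b} x * (f x :: real))"
  by (subst integral_restrict_space) auto

lemma leb_integrable:
  "integrable (leb a b) f \<longleftrightarrow> integrable lborel (\<lambda>x. indicator {a<..<b} x * (f x :: real))"
  by (subst integrable_restrict_space) auto

lemma measurable_leb: "f \<in> borel_measurable borel \<Longrightarrow> f \<in> borel_measurable (leb a b)"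
  by (rule measurable_restrict_space1) simp

lemma indicator_mult_le: "\<bar>indicator A x * (y::real)\<bar> \<le> \<bar>y\<bar>"
  by (simp add: indicator_def)

lemma integrable_bounded_mult:
  fixes f g :: "'a \<Rightarrow> real"
  assumes "integrable M f" "g \<in> borel_measurable M" "\<And>x. x \<in> space M \<Longrightarrow> \<bar>g x\<bar> \<le> C"
  shows "integrable M (\<lambda>x. g x * f x)" "integrable M (\<lambda>x. f x * g x)"
proof -
  show "integrable M (\<lambda>x. g x * f x)"
  proof (rule Bochner_Integration.integrable_bound[of M "\<lambda>x. C * f x"])
    show "AE x in M. norm (g x * f x) \<le> norm (C * f x)"
      using assms(3) by (intro AE_I2) (fastforce simp: abs_mult intro!: mult_right_mono)
  qed (use assms in auto)
  then show "integrable M (\<lambda>x. f x * g x)" by (simp add: mult.commute)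
qed

lemma integrable_continuous_leb:
  assumes "continuous_on {a..b} f"
  shows "integrable (leb a b) (f :: real \<Rightarrow> real)"
proof -
  have "integrable lborel (\<lambda>x. indicator {a..b} x * f x)"
    using borel_integrable_atLeastAtMost'[OF assms] by (simp add: set_integrable_def)
  from integrable_bounded_mult(1)[OF this, of "indicator {a<..<b}" 1]
  have "integrable lborel (\<lambda>x. indicator {a<..<b} x * (indicator {a..b} x * f x))"
    by (auto simp: indicator_def)
  also have "(\<lambda>x. indicator {a<..<b} x * (indicator {a..b} x * f x)) = (\<lambda>x. indicator {a<..<b} x * f x)"
    by (auto simp: indicator_def)
  finally show ?thesis by (simp add: leb_integrable)
qed

text \<open>The cut-off is an indicator under one fixed measure, so that dominated convergence,
  Fubini and measurability in \<open>t\<close> never involve a varying domain of integration. For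
  \<open>t\<close> outside the interval the value stays at 0 on the left and at the full integral on
  the right.\<close>

definition prim :: "real \<Rightarrow> real \<Rightarrow> (real \<Rightarrow> real) \<Rightarrow> real \<Rightarrow> real" where
  "prim a b f t = (LINT r|leb a b. indicator {..t} r * f r)"

lemma prim_integrable: "integrable (leb a b) f \<Longrightarrow> integrable (leb a b) (\<lambda>r. indicator {..t} r * f r :: real)"
  by (rule integrable_bounded_mult(1)[where C=1]) (auto intro!: measurable_leb)

lemma prim_cong: "(\<And>r. r \<in> {a<..<b} \<Longrightarrow> f r = g r) \<Longrightarrow> prim a b f t = prim a b g t"
  unfolding prim_def by (intro Bochner_Integration.integral_cong) auto

lemma prim_cong_AE:
  assumes "AE r in leb a b. f r = g r" "f \<in> borel_measurable (leb a b)" "g \<in> borel_measurable (leb a b)"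
  shows "prim a b f t = prim a b g t"
  unfolding prim_def using assms
  by (intro integral_cong_AE borel_measurable_times) (auto intro!: measurable_leb)

lemma prim_left: "t \<le> a \<Longrightarrow> prim a b f t = 0"
  unfolding prim_def by (subst Bochner_Integration.integral_cong[where g="\<lambda>_. 0"]) (auto simp: indicator_def)

lemma prim_right: "b \<le> t \<Longrightarrow> prim a b f t = (LINT r|leb a b. f r)"
  unfolding prim_def by (intro Bochner_Integration.integral_cong) (auto simp: indicator_def)

lemma prim_bound: "integrable (leb a b) f \<Longrightarrow> \<bar>prim a b f t\<bar> \<le> (LINT r|leb a b. \<bar>f r\<bar>)"
  unfolding prim_def
  by (rule order_trans[OF integral_abs_bound integral_mono])
    (auto intro!: integrable_abs prim_integrable simp: indicator_mult_le)

lemma prim_add: "integrable (leb a b) f \<Longrightarrow> integrable (leb a b) g \<Longrightarrow>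
   prim a b (\<lambda>r. f r + g r) t = prim a b f t + prim a b g t"
  by (simp add: prim_def prim_integrable ring_distribs)

lemma prim_diff: "integrable (leb a b) f \<Longrightarrow> integrable (leb a b) g \<Longrightarrow>
   prim a b (\<lambda>r. f r - g r) t = prim a b f t - prim a b g t"
  by (simp add: prim_def prim_integrable ring_distribs)

lemma prim_cmult: "prim a b (\<lambda>r. c * f r) t = c * prim a b f t"
  unfolding prim_def by (subst integral_mult_right_zero[symmetric]) (simp add: mult_ac)

lemma AE_leb_neq: "AE x in leb a b. x \<noteq> t"
  by (subst AE_restrict_space_iff) (auto intro: AE_mp[OF AE_lborel_singleton])

lemma prim_continuous:
  assumes f: "integrable (leb a b) f"
  shows "continuous_on A (prim a b f)"
  unfolding continuous_on_sequentially
proof (intro ballI allI impI, elim conjE)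
  fix u :: "nat \<Rightarrow> real" and t assume u: "u \<longlonglongrightarrow> t"
  have "(\<lambda>n. prim a b f (u n)) \<longlonglongrightarrow> prim a b f t"
    unfolding prim_def
  proof (rule integral_dominated_convergence[where w="\<lambda>r. \<bar>f r\<bar>"])
    have "(\<lambda>n. indicator {..u n} r * f r) \<longlonglongrightarrow> indicator {..t} r * f r" if "r \<noteq> t" for r
    proof (rule tendsto_eventually)
      show "\<forall>\<^sub>F n in sequentially. indicator {..u n} r * f r = indicator {..t} r * f r"
      proof (cases "r < t")
        case True
        from order_tendstoD(1)[OF u this] show ?thesis
          by eventually_elim (use True in \<open>auto simp: indicator_def\<close>)
      next
        case False
        then have "t < r" using that by simp
        from order_tendstoD(2)[OF u this] show ?thesis
          by eventually_elim (use False that in \<open>auto simp: indicator_def\<close>)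
      qed
    qed
    then show "AE r in leb a b. (\<lambda>n. indicator {..u n} r * f r) \<longlonglongrightarrow> indicator {..t} r * f r"
      using AE_leb_neq[of t a b] by (auto elim: AE_mp)
  qed (use f in \<open>auto intro!: borel_measurable_integrable[OF prim_integrable] simp: indicator_mult_le\<close>)
  then show "(prim a b f \<circ> u) \<longlonglongrightarrow> prim a b f t" by (simp add: o_def)
qed

text \<open>The half-lines form an intersection-stable generator of the Borel sets, and the sets
  over which \<open>f\<close> integrates to 0 are closed under complements (by the case
  \<open>t = b\<close>) and countable disjoint unions. So \<open>f\<close> integrates to 0 over
  every Borel set.\<close>

lemma prim_eq_0_imp_AE:
  assumes f: "integrable (leb a b) f" and z: "\<And>t. prim a b f t = 0"
  shows "AE x in leb a b. f x = 0"
proof -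
  let ?M = "leb a b"
  have set0: "(LINT x|?M. indicator A x * f x) = 0" if "A \<in> sets borel" for A
  proof -
    let ?G = "range (\<lambda>t::real. {..t})"
    have int: "integrable ?M (\<lambda>x. indicator A x * f x)" if "A \<in> sets borel" for A
      by (rule integrable_bounded_mult(1)[where C=1])
        (use f that in \<open>auto intro!: measurable_leb\<close>)
    have "Int_stable ?G" "?G \<subseteq> Pow UNIV" "A \<in> sigma_sets UNIV ?G" using that
      by (auto simp: borel_eq_atMost sets_measure_of_conv Int_stable_def)
    then show ?thesis
    proof (induction rule: sigma_sets_induct_disjoint)
      case (basic A)
      then show ?case using z by (auto simp: prim_def)
    next
      case empty
      then show ?case by simp
    next
      case (compl A)
      then have A: "A \<in> sets borel" by (simp add: borel_eq_atMost sets_measure_of_conv)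
      have "(LINT x|?M. indicator (UNIV - A) x * f x) = (LINT x|?M. f x - indicator A x * f x)"
        by (intro Bochner_Integration.integral_cong) (auto simp: indicator_def)
      also have "\<dots> = (LINT x|?M. f x) - (LINT x|?M. indicator A x * f x)"
        by (rule Bochner_Integration.integral_diff[OF f int[OF A]])
      also have "\<dots> = 0" using z[of b] compl by (simp add: prim_right)
      finally show ?case .
    next
      case (union A)
      then have A: "A i \<in> sets borel" for i
        by (auto simp: borel_eq_atMost sets_measure_of_conv image_subset_iff)
      have "(\<lambda>n. LINT x|?M. indicator (\<Union>i\<in>{..<n}. A i) x * f x) \<longlonglongrightarrow> (LINT x|?M. indicator (\<Union>i. A i) x * f x)"
      proof (rule integral_dominated_convergence[where w="\<lambda>r. \<bar>f r\<bar>"])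
        have "(\<lambda>n. indicator (\<Union>i\<in>{..<n}. A i) x :: real) \<longlonglongrightarrow> indicator (\<Union>i. A i) x" for x
          by (rule LIMSEQ_indicator_UN)
        then show "AE x in ?M. (\<lambda>n. indicator (\<Union>i\<in>{..<n}. A i) x * f x) \<longlonglongrightarrow> indicator (\<Union>i. A i) x * f x"
          by (intro AE_I2 tendsto_mult) auto
      qed (use f A int in \<open>auto intro!: int[THEN borel_measurable_integrable] simp: indicator_mult_le\<close>)
      moreover have "(LINT x|?M. indicator (\<Union>i\<in>{..<n}. A i) x * f x) = 0" for n
      proof -
        have "(LINT x|?M. indicator (\<Union>i\<in>{..<n}. A i) x * f x) = (LINT x|?M. (\<Sum>i<n. indicator (A i) x * f x))"
          using union by (subst indicator_UN_disjoint)
            (auto simp: disjoint_family_on_def sum_distrib_right simp del: sum_indicator_mult sum_mult_indicator)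
        also have "\<dots> = (\<Sum>i<n. LINT x|?M. indicator (A i) x * f x)"
          by (intro Bochner_Integration.integral_sum int A)
        finally show ?thesis using union by simp
      qed
      ultimately show ?case by (simp add: LIMSEQ_const_iff)
    qed
  qed
  have "AE x in ?M. f x = 0"
  proof (rule density_unique_real[OF f integrable_zero])
    fix A assume "A \<in> sets ?M"
    then have "A \<in> sets borel"
      by (auto simp: sets_restrict_space)
    from set0[OF this] show "set_lebesgue_integral ?M A f = set_lebesgue_integral ?M A (\<lambda>_. 0)"
      by (simp add: set_lebesgue_integral_def)
  qed
  then show ?thesis .
qed

section \<open>Weak derivatives\<close>

lemma leb_sub_eq:
  fixes f :: "real \<Rightarrow> real"
  assumes "A \<le> c" "d \<le> B"
  shows "(LINT x|leb A B. indicator {c<..<d} x * f x) = (LINT x|leb c d. f x)"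
    and "integrable (leb A B) (\<lambda>x. indicator {c<..<d} x * f x) \<longleftrightarrow> integrable (leb c d) f"
proof -
  have "(\<lambda>x. indicator {A<..<B} x * (indicator {c<..<d} x * f x)) = (\<lambda>x. indicator {c<..<d} x * f x)"
    using assms by (auto simp: indicator_def)
  then show "(LINT x|leb A B. indicator {c<..<d} x * f x) = (LINT x|leb c d. f x)"
    "integrable (leb A B) (\<lambda>x. indicator {c<..<d} x * f x) \<longleftrightarrow> integrable (leb c d) f"
    by (simp_all add: leb_integral leb_integrable)
qed

lemma leb_FTC:
  fixes F f :: "real \<Rightarrow> real"
  assumes "a \<le> b" "\<And>x. (F has_real_derivative f x) (at x)" "continuous_on {a..b} f"
  shows "(LINT x|leb a b. f x) = F b - F a"
proof -
  have "(LINT x|leb a b. f x) = (LINT x|lborel. indicator {a<..<b} x * f x)"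
    by (rule leb_integral)
  also have "\<dots> = (LINT x|lborel. indicator {a..b} x * f x)"
  proof (rule integral_cong_AE)
    have i: "integrable lborel (\<lambda>x. indicator {a..b} x * f x)"
      using borel_integrable_atLeastAtMost'[OF assms(3)] by (simp add: set_integrable_def)
    then show "(\<lambda>x. indicator {a..b} x * f x) \<in> borel_measurable lborel" by simp
    have "integrable lborel (\<lambda>x. indicator {a<..<b} x * f x)"
      using integrable_continuous_leb[OF assms(3)] by (simp add: leb_integrable)
    then show "(\<lambda>x. indicator {a<..<b} x * f x) \<in> borel_measurable lborel" by simp
    show "AE x in lborel. indicator {a<..<b} x * f x = indicator {a..b} x * f x"
      using AE_lborel_singleton[of a] AE_lborel_singleton[of b]
      by eventually_elim (auto simp: indicator_def)
  qed
  also have "\<dots> = F b - F a"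
    using integral_FTC_atLeastAtMost[OF assms(1), of F f] assms(2,3)
    by (simp add: has_real_derivative_iff_has_vector_derivative[symmetric] has_field_derivative_at_within)
  finally show ?thesis .
qed

lemma mollifier_smooth: "elem_smooth (mollifier a \<epsilon>)"
proof -
  have "elem_smooth (\<lambda>x. deriv smooth_step ((1 / \<epsilon>) * x + - a / \<epsilon>) * (1 / \<epsilon>))"
    by (intro elem_smooth.mult elem_smooth.const elem_smooth.affine elem_smooth_deriv'(1) smooth_step_smooth)
  then show ?thesis by (simp add: mollifier_def[abs_def] diff_divide_distrib)
qed

lemma mollifier_outside:
  assumes "\<epsilon> > 0" "x \<notin> {a..a + \<epsilon>}"
  shows "mollifier a \<epsilon> x = 0"
proof -
  let ?S = "if x < a then {..<a} else {a + \<epsilon><..}"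
  let ?c = "if x < a then 0 else 1 :: real"
  have "((\<lambda>x. smooth_step ((x - a) / \<epsilon>)) has_real_derivative 0) (at x)"
  proof (rule has_field_derivative_transform_within_open[of "\<lambda>_. ?c" _ _ ?S])
    show "?c = smooth_step ((y - a) / \<epsilon>)" if "y \<in> ?S" for y
      using that assms by (auto simp: smooth_step_0 smooth_step_1 field_simps split: if_splits)
  qed (use assms in auto)
  from DERIV_unique[OF shifted_step_deriv this] assms show ?thesis by auto
qed

lemma integrable_mollifier: "integrable (leb A B) (mollifier a \<epsilon>)"
  by (intro integrable_continuous_leb elem_smooth_continuous mollifier_smooth)

lemma mollifier_integral:
  assumes "\<epsilon> > 0" "A \<le> a" "a + \<epsilon> \<le> B"
  shows "(LINT x|leb A B. mollifier a \<epsilon> x) = 1"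
proof -
  have "(LINT x|leb A B. mollifier a \<epsilon> x) = smooth_step ((B - a) / \<epsilon>) - smooth_step ((A - a) / \<epsilon>)"
    using assms by (intro leb_FTC shifted_step_deriv elem_smooth_continuous mollifier_smooth) auto
  also have "smooth_step ((B - a) / \<epsilon>) = 1" using assms by (intro smooth_step_1) (simp add: field_simps)
  also have "smooth_step ((A - a) / \<epsilon>) = 0" using assms by (intro smooth_step_0) (simp add: field_simps)
  finally show ?thesis by simp
qed

lemma mollify_tendsto:
  assumes f: "continuous_on {A..B} f" and a: "A < a" "a < B"
  shows "(\<lambda>n. LINT x|leb A B. f x * mollifier a (1 / real (Suc n)) x) \<longlonglongrightarrow> f a"
proof (rule LIMSEQ_I)
  fix r :: real assume "r > 0"
  have "\<exists>d>0. \<forall>x\<in>{A..B}. dist x a < d \<longrightarrow> dist (f x) (f a) < r / 2"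
    using f a \<open>r > 0\<close> unfolding continuous_on_iff by (meson atLeastAtMost_iff half_gt_zero less_imp_le)
  then obtain d where d: "d > 0" "\<And>x. x \<in> {A..B} \<Longrightarrow> dist x a < d \<Longrightarrow> \<bar>f x - f a\<bar> < r / 2"
    by (auto simp: dist_real_def)
  \<comment> \<open>Small enough for the bump on \<open>[a, a + e]\<close> to lie inside the
    interval and where \<open>f\<close> is close to \<open>f a\<close>.\<close>
  obtain n0 where n0: "1 / real (Suc n0) < min d (B - a)"
    using a d reals_Archimedean[of "min d (B - a)"] by (auto simp: inverse_eq_divide)
  show "\<exists>no. \<forall>n\<ge>no. norm ((LINT x|leb A B. f x * mollifier a (1 / real (Suc n)) x) - f a) < r"
  proof (intro exI[of _ n0] allI impI)
    fix n assume "n \<ge> n0"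
    define e where "e = 1 / real (Suc n)"
    have "e \<le> 1 / real (Suc n0)" unfolding e_def using \<open>n \<ge> n0\<close> by (simp add: field_simps)
    then have e: "e > 0" "e < d" "a + e \<le> B" using n0 by (auto simp: e_def)
    have i: "integrable (leb A B) (\<lambda>x. f x * mollifier a e x)"
      by (intro integrable_continuous_leb continuous_on_mult f elem_smooth_continuous mollifier_smooth)
    have i2: "integrable (leb A B) (\<lambda>x. c * mollifier a e x)" for c
      by (intro integrable_mult_right integrable_mollifier)
    have "(LINT x|leb A B. f x * mollifier a e x) - f a
        = (LINT x|leb A B. f x * mollifier a e x) - (LINT x|leb A B. f a * mollifier a e x)"
      using mollifier_integral[of e A a B] e a by simp
    also have "\<dots> = (LINT x|leb A B. f x * mollifier a e x - f a * mollifier a e x)"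
      using i i2 by simp
    also have "\<bar>\<dots>\<bar> \<le> (LINT x|leb A B. r / 2 * mollifier a e x)"
    proof (rule order_trans[OF integral_abs_bound integral_mono])
      show "integrable (leb A B) (\<lambda>x. \<bar>f x * mollifier a e x - f a * mollifier a e x\<bar>)"
        using i i2 by auto
      show "\<bar>f x * mollifier a e x - f a * mollifier a e x\<bar> \<le> r / 2 * mollifier a e x"
        if "x \<in> space (leb A B)" for x
      proof (cases "x \<in> {a..a + e}")
        case True
        then have "\<bar>f x - f a\<bar> \<le> r / 2"
          using d(2)[of x] that e by (auto simp: dist_real_def intro!: less_imp_le)
        then show ?thesis using mollifier_nonneg[OF e(1), of a x]
            mult_right_mono[of "\<bar>f x - f a\<bar>" "r / 2" "mollifier a e x"]
          by (simp only: left_diff_distrib[symmetric] abs_mult abs_of_nonneg)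
      qed (use e mollifier_outside in simp)
    qed (rule i2)
    also have "\<dots> = r / 2" using mollifier_integral[of e A a B] e a by simp
    finally show "norm ((LINT x|leb A B. f x * mollifier a (1 / real (Suc n)) x) - f a) < r"
      using \<open>r > 0\<close> by (simp add: e_def)
  qed
qed

lemma shifted_step_tendsto:
  "(\<lambda>n. smooth_step ((x - a) / (1 / real (Suc n)))) \<longlonglongrightarrow> indicator {a<..} x"
proof (rule tendsto_eventually)
  show "\<forall>\<^sub>F n in sequentially. smooth_step ((x - a) / (1 / real (Suc n))) = indicator {a<..} x"
  proof (cases "x > a")
    case True
    then obtain n0 where n0: "1 / real (Suc n0) < x - a"
      using reals_Archimedean[of "x - a"] by (auto simp: inverse_eq_divide)
    show ?thesis
    proof (intro eventually_sequentiallyI[of n0])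
      fix n assume "n \<ge> n0"
      then have "1 / real (Suc n) \<le> 1 / real (Suc n0)" by (simp add: field_simps)
      then have "1 / real (Suc n) \<le> x - a" using n0 by linarith
      then have "(x - a) / (1 / real (Suc n)) \<ge> 1" by (simp add: field_simps)
      then show "smooth_step ((x - a) / (1 / real (Suc n))) = indicator {a<..} x"
        using True smooth_step_1 by simp
    qed
  next
    case False
    then have "(x - a) / (1 / real (Suc n)) \<le> 0" for n
      by (simp add: mult_nonpos_nonneg)
    then show ?thesis using False smooth_step_0 by simp
  qed
qed

lemma plateau_tendsto:
  "a \<le> b \<Longrightarrow> (\<lambda>n. plateau a b (1 / real (Suc n)) x) \<longlonglongrightarrow> indicator {a<..b} x"
proof -
  assume "a \<le> b"
  then have "indicator {a<..b} x = indicator {a<..} x - (indicator {b<..} x :: real)"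
    by (auto simp: indicator_def)
  then show ?thesis
    unfolding plateau_def by (simp only:) (intro tendsto_diff shifted_step_tendsto)
qed

lemma plateau_smooth: "elem_smooth (plateau a b \<epsilon>)"
  unfolding plateau_def[abs_def] by (intro elem_smooth_diff shifted_step_smooth)

lemma abs_plateau_le: "\<bar>plateau a b \<epsilon> x\<bar> \<le> 1"
  using smooth_step_ge_0[of "(x - a) / \<epsilon>"] smooth_step_ge_0[of "(x - b) / \<epsilon>"]
    smooth_step_le_1[of "(x - a) / \<epsilon>"] smooth_step_le_1[of "(x - b) / \<epsilon>"]
  by (simp add: plateau_def)

lemma plateau_outside:
  assumes "\<epsilon> > 0" "a \<le> b" "x \<notin> {a..b + \<epsilon>}"
  shows "plateau a b \<epsilon> x = 0"
proof (cases "x < a")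
  case True
  then show ?thesis using assms by (simp add: plateau_def smooth_step_0 divide_nonpos_pos)
next
  case False
  then have "x > b + \<epsilon>" using assms by auto
  then show ?thesis using assms by (simp add: plateau_def smooth_step_1 field_simps)
qed

lemma deriv_plateau: "\<epsilon> \<noteq> 0 \<Longrightarrow> deriv (plateau a b \<epsilon>) x = mollifier a \<epsilon> x - mollifier b \<epsilon> x"
  unfolding plateau_def[abs_def] by (intro DERIV_imp_deriv DERIV_diff shifted_step_deriv)

lemma plateau_test:
  assumes "\<epsilon> > 0" "A < a" "a \<le> b" "b + \<epsilon> < B"
  shows "test_function A B (plateau a b \<epsilon>)"
  by (rule test_functionI[OF plateau_smooth assms(2,4)]) (use assms plateau_outside in blast)

text \<open>Plateaus over \<open>{a<..b}\<close> serve as test functions. As the flanks shrink, the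
  side with \<open>f\<close> tends to \<open>f a - f b\<close>, because the derivative of a plateau
  is a difference of two mollifiers, and the side with \<open>g\<close> tends to minus the integral
  over \<open>{a<..b}\<close>. So \<open>f\<close> minus the primitive of \<open>g\<close> is
  constant.\<close>

theorem continuous_weak_deriv_prim:
  fixes f g :: "real \<Rightarrow> real"
  assumes AB: "A < B" and f: "continuous_on {A..B} f" and g: "integrable (leb A B) g"
    and weak: "\<And>\<theta>. test_function A B \<theta> \<Longrightarrow>
      (LINT x|leb A B. f x * deriv \<theta> x) = - (LINT x|leb A B. g x * \<theta> x)"
    and t: "t \<in> {A..B}"
  shows "f t = f A + prim A B g t"
proof -
  let ?e = "\<lambda>n. 1 / real (Suc n)"
  have main: "f b - f a = prim A B g b - prim A B g a" if ab: "A < a" "a < b" "b < B" for a b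
  proof -
    obtain n0 where n0: "?e n0 < B - b"
      using ab reals_Archimedean[of "B - b"] by (auto simp: inverse_eq_divide)
    have "(\<lambda>n. (LINT x|leb A B. f x * mollifier a (?e n) x) - (LINT x|leb A B. f x * mollifier b (?e n) x))
        \<longlonglongrightarrow> f a - f b"
      using ab by (intro tendsto_diff mollify_tendsto f) auto
    moreover have "\<forall>\<^sub>F n in sequentially.
        (LINT x|leb A B. f x * mollifier a (?e n) x) - (LINT x|leb A B. f x * mollifier b (?e n) x)
        = - (LINT x|leb A B. g x * plateau a b (?e n) x)"
    proof (intro eventually_sequentiallyI[of n0])
      fix n assume "n \<ge> n0"
      then have "?e n \<le> ?e n0" by (simp add: field_simps)
      then have e: "?e n > 0" "b + ?e n < B" using n0 by auto
      have i: "integrable (leb A B) (\<lambda>x. f x * mollifier c (?e n) x)" for c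
        by (intro integrable_continuous_leb continuous_on_mult f elem_smooth_continuous mollifier_smooth)
      have "(LINT x|leb A B. f x * mollifier a (?e n) x) - (LINT x|leb A B. f x * mollifier b (?e n) x)
        = (LINT x|leb A B. f x * deriv (plateau a b (?e n)) x)"
        using i by (simp add: deriv_plateau right_diff_distrib)
      also have "\<dots> = - (LINT x|leb A B. g x * plateau a b (?e n) x)"
        using ab e by (intro weak plateau_test) auto
      finally show "(LINT x|leb A B. f x * mollifier a (?e n) x) - (LINT x|leb A B. f x * mollifier b (?e n) x)
        = - (LINT x|leb A B. g x * plateau a b (?e n) x)" .
    qed
    ultimately have l1: "(\<lambda>n. - (LINT x|leb A B. g x * plateau a b (?e n) x)) \<longlonglongrightarrow> f a - f b"
      by (rule Lim_transform_eventually)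
    have l2: "(\<lambda>n. LINT x|leb A B. g x * plateau a b (?e n) x) \<longlonglongrightarrow> (LINT x|leb A B. g x * indicator {a<..b} x)"
    proof (rule integral_dominated_convergence[where w="\<lambda>x. \<bar>g x\<bar>"])
      show "AE x in leb A B. (\<lambda>n. g x * plateau a b (?e n) x) \<longlonglongrightarrow> g x * indicator {a<..b} x"
        using ab by (intro AE_I2 tendsto_intros plateau_tendsto) auto
      show "AE x in leb A B. norm (g x * plateau a b (?e n) x) \<le> \<bar>g x\<bar>" for n
        using abs_plateau_le by (auto simp: abs_mult intro!: AE_I2 mult_left_le)
      show "(\<lambda>x. g x * plateau a b (?e n) x) \<in> borel_measurable (leb A B)" for n
        using g by (intro borel_measurable_times measurable_leb[OF elem_smooth_borel[OF plateau_smooth]]) auto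
    qed (use g in \<open>auto intro!: borel_measurable_times measurable_leb[OF borel_measurable_indicator]\<close>)
    have "f a - f b = - (LINT x|leb A B. g x * indicator {a<..b} x)"
      by (rule LIMSEQ_unique[OF l1 tendsto_minus[OF l2]])
    also have "(LINT x|leb A B. g x * indicator {a<..b} x)
        = (LINT x|leb A B. indicator {..b} x * g x - indicator {..a} x * g x)"
      using ab by (intro Bochner_Integration.integral_cong) (auto simp: indicator_def)
    also have "\<dots> = prim A B g b - prim A B g a"
      using g by (simp add: prim_def prim_integrable)
    finally show ?thesis by simp
  qed
  \<comment> \<open>Compact support confines \<open>main\<close> to interior points; continuity
    carries the constant to both endpoints.\<close>
  define h where "h x = f x - prim A B g x" for x
  define m where "m = (A + B) / 2"
  have cl: "closure {A<..<B} = {A..B}" using AB by simp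
  have hc: "continuous_on (closure {A<..<B}) h"
    unfolding h_def cl by (intro continuous_on_diff f prim_continuous g)
  have hm: "\<forall>x\<in>{A<..<B}. h x = h m"
  proof
    fix x assume "x \<in> {A<..<B}"
    then show "h x = h m"
      using main[of x m] main[of m x] AB unfolding h_def
      by (cases x m rule: linorder_cases) (simp_all, (simp_all add: m_def)?)
  qed
  have "h t = h m" "h A = h m"
    by (rule continuous_constant_on_closure[OF hc hm[rule_format]]; use t AB cl in auto)+
  then show ?thesis by (simp add: h_def prim_left)
qed

lemma H1_deriv_continuous_prim:
  assumes "A < B" "continuous_on {A..B} f" "H1_deriv A B f g" "t \<in> {A..B}"
    and "integrable (leb A B) g"
  shows "f t = f A + prim A B g t"
  using assms by (intro continuous_weak_deriv_prim) (auto simp: H1_deriv_def)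

lemma test_function_facts:
  assumes "test_function A B \<theta>"
  shows "(\<theta> has_real_derivative deriv \<theta> x) (at x)" "continuous_on S (deriv \<theta>)" "continuous_on S \<theta>"
    "x \<notin> {A<..<B} \<Longrightarrow> \<theta> x = 0" "deriv \<theta> \<in> borel_measurable borel" "\<theta> \<in> borel_measurable borel"
proof -
  have d: "(deriv ^^ n) \<theta> differentiable (at x)" for n x
    using assms by (auto simp: test_function_def)
  show "(\<theta> has_real_derivative deriv \<theta> x) (at x)"
    using d[of 0 x] by (simp add: DERIV_deriv_iff_real_differentiable)
  have c: "continuous_on S (deriv \<theta>)" "continuous_on S \<theta>" for S
    using d[of 1] d[of 0]
    by (auto intro!: continuous_at_imp_continuous_on differentiable_imp_continuous_within)
  show "continuous_on S (deriv \<theta>)" "continuous_on S \<theta>" by fact+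
  show "deriv \<theta> \<in> borel_measurable borel" "\<theta> \<in> borel_measurable borel"
    by (intro borel_measurable_continuous_onI c)+
  show "x \<notin> {A<..<B} \<Longrightarrow> \<theta> x = 0"
    using assms closure_subset[of "{x. \<theta> x \<noteq> 0}"] by (auto simp: test_function_def)
qed

lemma continuous_bounded_Icc:
  assumes "continuous_on {A..B} (f :: real \<Rightarrow> real)"
  obtains C where "C \<ge> 0" "\<And>x. x \<in> {A..B} \<Longrightarrow> \<bar>f x\<bar> \<le> C"
proof -
  have "bounded (f ` {A..B})" using assms by (intro compact_imp_bounded compact_continuous_image) auto
  then obtain C where "\<forall>y\<in>f ` {A..B}. norm y \<le> C" by (auto simp: bounded_iff)
  then show ?thesis by (intro that[of "max C 0"]) (auto simp: le_max_iff_disj)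
qed

text \<open>Integration by parts through Fubini: once \<open>prim\<close> is written as an integral
  and the order is exchanged, the inner integral of \<open>deriv \<theta>\<close> over
  \<open>{r..}\<close> is \<open>- \<theta> r\<close>, as \<open>\<theta>\<close> vanishes at
  \<open>B\<close>. The constant contributes
  \<open>c * (\<theta> B - \<theta> A) = 0\<close>.\<close>

theorem prim_weak_deriv:
  fixes g :: "real \<Rightarrow> real"
  assumes AB: "A < B" and g: "integrable (leb A B) g" and \<theta>: "test_function A B \<theta>"
  shows "(LINT x|leb A B. (c + prim A B g x) * deriv \<theta> x) = - (LINT x|leb A B. g x * \<theta> x)"
proof -
  note tf = test_function_facts[OF \<theta>]
  obtain C where C: "C \<ge> 0" "\<And>x. x \<in> {A..B} \<Longrightarrow> \<bar>deriv \<theta> x\<bar> \<le> C"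
    using continuous_bounded_Icc[OF tf(2)] by metis
  have gm [measurable]: "g \<in> borel_measurable (leb A B)" using g by simp
  have dm [measurable]: "deriv \<theta> \<in> borel_measurable (leb A B)" using tf(5) by (rule measurable_leb)
  have id [measurable]: "(\<lambda>x. x) \<in> borel_measurable (leb A B)" by (rule measurable_leb) simp
  interpret M: finite_measure "leb A B" by simp
  have idt: "integrable (leb A B) (deriv \<theta>)" by (intro integrable_continuous_leb tf)
  have joint: "integrable (leb A B \<Otimes>\<^sub>M leb A B) (\<lambda>(x, r). indicator {r..} x * deriv \<theta> x * g r)"
  proof (rule pair_leb.Fubini_integrable)
    have "(\<lambda>(x, r). (if r \<le> x then 1 else 0) * deriv \<theta> x * g r) \<in> borel_measurable (leb A B \<Otimes>\<^sub>M leb A B)"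
      by measurable
    then show m: "(\<lambda>(x, r). indicator {r..} x * deriv \<theta> x * g r) \<in> borel_measurable (leb A B \<Otimes>\<^sub>M leb A B)"
      by (rule measurable_cong[THEN iffD1, rotated]) (auto simp: indicator_def)
    have i: "integrable (leb A B) (\<lambda>r. indicator {r..} x * deriv \<theta> x * g r)" for x
    proof -
      have "integrable (leb A B) (\<lambda>r. deriv \<theta> x * (indicator {..x} r * g r))"
        by (intro integrable_mult_right prim_integrable g)
      also have "(\<lambda>r. deriv \<theta> x * (indicator {..x} r * g r)) = (\<lambda>r. indicator {r..} x * deriv \<theta> x * g r)"
        by (auto simp: indicator_def)
      finally show ?thesis .
    qed
    then show "AE x in leb A B. integrable (leb A B) (\<lambda>r. case (x, r) of (x, r) \<Rightarrow> indicator {r..} x * deriv \<theta> x * g r)"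
      by simp
    show "integrable (leb A B) (\<lambda>x. LINT y|leb A B. norm (case (x, y) of (x, r) \<Rightarrow> indicator {r..} x * deriv \<theta> x * g r))"
    proof (rule M.integrable_const_bound[where B="C * (LINT r|leb A B. \<bar>g r\<bar>)"])
      show "AE x in leb A B. norm (LINT y|leb A B. norm (case (x, y) of (x, r) \<Rightarrow> indicator {r..} x * deriv \<theta> x * g r))
          \<le> C * (LINT r|leb A B. \<bar>g r\<bar>)"
      proof (rule AE_I2)
        fix x assume x: "x \<in> space (leb A B)"
        have "(LINT y|leb A B. \<bar>indicator {y..} x * deriv \<theta> x * g y\<bar>) \<le> (LINT y|leb A B. C * \<bar>g y\<bar>)"
        proof (rule integral_mono)
          show "\<bar>indicator {y..} x * deriv \<theta> x * g y\<bar> \<le> C * \<bar>g y\<bar>" for y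
            using C x by (auto simp: indicator_def abs_mult intro!: mult_right_mono)
        qed (use i g in auto)
        then show "norm (LINT y|leb A B. norm (case (x, y) of (x, r) \<Rightarrow> indicator {r..} x * deriv \<theta> x * g r))
          \<le> C * (LINT r|leb A B. \<bar>g r\<bar>)" by (simp add: abs_of_nonneg[OF Bochner_Integration.integral_nonneg])
      qed
      from measurable_compose[OF m borel_measurable_norm] have "(\<lambda>(x, y). norm (case (x, y) of (x, r) \<Rightarrow> indicator {r..} x * deriv \<theta> x * g r)) \<in> borel_measurable (leb A B \<Otimes>\<^sub>M leb A B)"
        by (simp add: case_prod_beta')
      from sigma_finite_measure.borel_measurable_lebesgue_integral[OF sigma_finite_leb this]
      show "(\<lambda>x. LINT y|leb A B. norm (case (x, y) of (x, r) \<Rightarrow> indicator {r..} x * deriv \<theta> x * g r)) \<in> borel_measurable (leb A B)"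
        by simp
    qed
  qed
  have tail: "(LINT x|leb A B. indicator {r..} x * deriv \<theta> x) = - \<theta> r" if r: "r \<in> {A<..<B}" for r
  proof -
    have "(LINT x|leb A B. indicator {r..} x * deriv \<theta> x) = (LINT x|leb A B. indicator {r<..<B} x * deriv \<theta> x)"
    proof (intro integral_cong_AE borel_measurable_times dm measurable_leb)
      show "AE x in leb A B. indicator {r..} x * deriv \<theta> x = indicator {r<..<B} x * deriv \<theta> x"
        using AE_leb_neq[of r A B] AE_space[of "leb A B"]
        by eventually_elim (auto simp: indicator_def)
    qed auto
    also have "\<dots> = (LINT x|leb r B. deriv \<theta> x)" using r by (intro leb_sub_eq) auto
    also have "\<dots> = \<theta> B - \<theta> r" using r by (intro leb_FTC tf) auto
    finally show ?thesis using tf(4)[of B] by simp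
  qed
  have "(LINT x|leb A B. prim A B g x * deriv \<theta> x)
      = (LINT x|leb A B. LINT r|leb A B. indicator {r..} x * deriv \<theta> x * g r)"
    unfolding prim_def
    by (subst integral_mult_left_zero[symmetric], intro Bochner_Integration.integral_cong refl)
      (auto simp: indicator_def)
  also have "\<dots> = (LINT r|leb A B. LINT x|leb A B. indicator {r..} x * deriv \<theta> x * g r)"
    by (rule pair_leb.Fubini_integral[OF joint, symmetric])
  also have "\<dots> = (LINT r|leb A B. - \<theta> r * g r)"
    by (intro Bochner_Integration.integral_cong refl) (simp add: tail)
  also have "\<dots> = - (LINT x|leb A B. g x * \<theta> x)"
    by (simp add: mult.commute)
  finally have 1: "(LINT x|leb A B. prim A B g x * deriv \<theta> x) = - (LINT x|leb A B. g x * \<theta> x)" .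
  have "(LINT x|leb A B. (c + prim A B g x) * deriv \<theta> x)
      = (LINT x|leb A B. c * deriv \<theta> x) + (LINT x|leb A B. prim A B g x * deriv \<theta> x)"
    unfolding ring_distribs
    by (intro Bochner_Integration.integral_add integrable_mult_right idt integrable_continuous_leb
        continuous_on_mult prim_continuous g tf)
  also have "(LINT x|leb A B. c * deriv \<theta> x) = c * (\<theta> B - \<theta> A)"
    using AB by (simp add: leb_FTC[OF _ tf(1) tf(2)])
  also have "\<dots> = 0" using tf(4)[of A] tf(4)[of B] by simp
  finally show ?thesis using 1 by simp
qed

text \<open>The difference of two plateaus, each divided by the length of its interval, has integral
  0 and so is the derivative of a test function. Hence the averages of \<open>f\<close> over all
  interior intervals agree. Integrability is assumed only away from the endpoints because the
  theorem is applied to the distribution function of a measure whose mass may be infinite near 0 and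
  1.\<close>

theorem du_Bois_Reymond:
  fixes f :: "real \<Rightarrow> real"
  assumes AB: "A < B" and loc: "\<And>c d. A < c \<Longrightarrow> d < B \<Longrightarrow> integrable (leb c d) f"
    and weak: "\<And>\<theta>. test_function A B \<theta> \<Longrightarrow> (LINT x|leb A B. f x * deriv \<theta> x) = 0"
  obtains \<kappa> where "AE x in leb A B. f x = \<kappa>"
proof -
  let ?e = "\<lambda>n. 1 / real (Suc n)"
  have "isCont smooth_step x" for x
    using elem_smooth_continuous[OF smooth_step_smooth, of UNIV] by (simp add: continuous_on_eq_continuous_at)
  \<comment> \<open>A primitive of the step: constant to the left of 0 and of slope one to the right
    of 1. The rule \<open>antideriv\<close> of \<open>elem_smooth\<close> makes it an ingredient of
    test functions.\<close>
  then obtain S where S: "\<And>x. (S has_real_derivative smooth_step x) (at x)"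
    using einterval_antiderivative[of "-\<infinity>" \<infinity> smooth_step]
    by (auto simp: has_real_derivative_iff_has_vector_derivative)
  have S0: "S y = S 0" if "y \<le> 0" for y
  proof (cases "y < 0")
    case True
    then obtain z where "y < z" "z < 0" "S 0 - S y = (0 - y) * smooth_step z"
      using MVT2[of y 0 S smooth_step] S by auto
    then show ?thesis by (simp add: smooth_step_0)
  qed (use that in simp)
  have S1: "S y = S 1 + y - 1" if "y \<ge> 1" for y
  proof (cases "y > 1")
    case True
    then obtain z where "1 < z" "z < y" "S y - S 1 = (y - 1) * smooth_step z"
      using MVT2[of 1 y S smooth_step] S by auto
    then show ?thesis by (simp add: smooth_step_1)
  qed (use that in simp)
  have "elem_smooth S" by (rule elem_smooth.antideriv[OF smooth_step_smooth S])
  define \<Theta> where "\<Theta> c e x = e * S ((x - c) / e)" for c e x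
  have \<Theta>s: "elem_smooth (\<Theta> c e)" for c e
    using elem_smooth.mult[OF elem_smooth.const elem_smooth.affine[OF \<open>elem_smooth S\<close>, of "1 / e" "- c / e"], of e]
    by (simp add: \<Theta>_def[abs_def] diff_divide_distrib)
  have \<Theta>d: "(\<Theta> c e has_real_derivative smooth_step ((x - c) / e)) (at x)" if "e > 0" for c e x
    unfolding \<Theta>_def[abs_def]
    by (rule DERIV_cmult[OF DERIV_chain2[of S, OF S], THEN DERIV_cong])
      (use that in \<open>auto intro!: derivative_eq_intros\<close>)
  have \<Theta>0: "\<Theta> c e x = e * S 0" if "x \<le> c" "e > 0" for c e x
    using that S0[of "(x - c) / e"] by (simp add: \<Theta>_def divide_nonpos_pos)
  have \<Theta>1: "\<Theta> c e x = e * S 1 + x - c - e" if "x \<ge> c + e" "e > 0" for c e x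
  proof -
    have "(x - c) / e \<ge> 1" using that by (simp add: le_divide_eq)
    from S1[OF this] have "\<Theta> c e x = e * S 1 + e * ((x - c) / e) - e"
      by (simp only: \<Theta>_def ring_distribs mult_1_right)
    also have "e * ((x - c) / e) = x - c" using that by simp
    finally show ?thesis by simp
  qed
  have loc': "integrable (leb A B) (\<lambda>x. indicator {c<..<d} x * f x)" if "A < c" "d < B" for c d
    using loc[OF that] leb_sub_eq(2)[of A c d B f] that by simp
  define J where "J c d = (LINT x|leb A B. f x * indicator {c<..d} x)" for c d
  have Jlim: "(\<lambda>n. LINT x|leb A B. f x * plateau c d (?e n) x) \<longlonglongrightarrow> J c d"
    and Jint: "\<forall>\<^sub>F n in sequentially. integrable (leb A B) (\<lambda>x. f x * plateau c d (?e n) x)"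
    if cd: "A < c" "c < d" "d < B" for c d
  proof -
    obtain n0 where n0: "?e n0 < (B - d) / 2"
      using cd reals_Archimedean[of "(B - d) / 2"] by (auto simp: inverse_eq_divide)
    define c' d' where "c' = (A + c) / 2" and "d' = (d + B) / 2"
    have cd': "A < c'" "d' < B" "c' < c" "d < d'" using cd by (auto simp: c'_def d'_def)
    have pl: "f x * plateau c d (?e (n + n0)) x = plateau c d (?e (n + n0)) x * (indicator {c'<..<d'} x * f x)" for x n
    proof (cases "x \<in> {c'<..<d'}")
      case False
      have "?e (n + n0) \<le> ?e n0" by (simp add: field_simps)
      then have "x \<notin> {c..d + ?e (n + n0)}" using False n0 cd' by (auto simp: d'_def)
      then have "plateau c d (?e (n + n0)) x = 0" using cd by (intro plateau_outside) auto
      then show ?thesis by simp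
    qed auto
    note f' = loc'[OF cd'(1,2)]
    have in': "integrable (leb A B) (\<lambda>x. f x * plateau c d (?e (n + n0)) x)" for n
      unfolding pl by (rule integrable_bounded_mult(1)[OF f' _ abs_plateau_le])
        (intro measurable_leb elem_smooth_borel plateau_smooth)
    show "\<forall>\<^sub>F n in sequentially. integrable (leb A B) (\<lambda>x. f x * plateau c d (?e n) x)"
    proof (intro eventually_sequentiallyI[of n0])
      fix n assume "n \<ge> n0"
      then show "integrable (leb A B) (\<lambda>x. f x * plateau c d (?e n) x)" using in'[of "n - n0"] by simp
    qed
    have "(\<lambda>n. LINT x|leb A B. f x * plateau c d (?e (n + n0)) x) \<longlonglongrightarrow> J c d"
      unfolding J_def
    proof (rule integral_dominated_convergence[where w="\<lambda>x. \<bar>indicator {c'<..<d'} x * f x\<bar>"])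
      show "AE x in leb A B. (\<lambda>n. f x * plateau c d (?e (n + n0)) x) \<longlonglongrightarrow> f x * indicator {c<..d} x"
        using cd by (intro AE_I2 tendsto_mult tendsto_const LIMSEQ_ignore_initial_segment[OF plateau_tendsto]) auto
      show "AE x in leb A B. norm (f x * plateau c d (?e (n + n0)) x) \<le> \<bar>indicator {c'<..<d'} x * f x\<bar>" for n
      proof (rule AE_I2)
        fix x
        show "norm (f x * plateau c d (?e (n + n0)) x) \<le> \<bar>indicator {c'<..<d'} x * f x\<bar>"
          unfolding pl real_norm_def abs_mult[of "plateau c d (?e (n + n0)) x"]
          by (intro mult_left_le_one_le abs_ge_zero abs_plateau_le)
      qed
      have "(\<lambda>x. f x * indicator {c<..d} x) = (\<lambda>x. (indicator {c'<..<d'} x * f x) * indicator {c<..d} x)"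
        using cd' by (auto simp: indicator_def fun_eq_iff)
      also have "\<dots> \<in> borel_measurable (leb A B)"
        using f' by (intro borel_measurable_times[OF borel_measurable_integrable[OF f']] measurable_leb) auto
      finally show "(\<lambda>x. f x * indicator {c<..d} x) \<in> borel_measurable (leb A B)" .
    qed (use in' f' in auto)
    then show "(\<lambda>n. LINT x|leb A B. f x * plateau c d (?e n) x) \<longlonglongrightarrow> J c d"
      by (rule LIMSEQ_offset)
  qed
  have ratio: "J c d / (d - c) = J c' d' / (d' - c')"
    if cd: "A < c" "c < d" "d < B" and cd': "A < c'" "c' < d'" "d' < B" for c d c' d'
  proof -
    define D where "D = max d d'"
    have D: "D < B" "d \<le> D" "d' \<le> D" using cd cd' by (auto simp: D_def)
    obtain n0 where n0: "?e n0 < (B - D) / 2"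
      using D reals_Archimedean[of "(B - D) / 2"] by (auto simp: inverse_eq_divide)
    have ev: "\<forall>\<^sub>F n in sequentially. (LINT x|leb A B. f x * plateau c d (?e n) x) / (d - c)
        = (LINT x|leb A B. f x * plateau c' d' (?e n) x) / (d' - c')"
      using Jint[OF cd] Jint[OF cd'] eventually_ge_at_top[of n0]
    proof eventually_elim
      fix n assume i: "integrable (leb A B) (\<lambda>x. f x * plateau c d (?e n) x)"
        "integrable (leb A B) (\<lambda>x. f x * plateau c' d' (?e n) x)" and "n0 \<le> n"
      then have "?e n \<le> ?e n0" by (simp add: field_simps)
      then have en: "?e n < (B - D) / 2" "?e n > 0" using n0 by auto
      define e where "e = ?e n"
      have e: "e < (B - D) / 2" "e > 0" using en by (auto simp: e_def)
      \<comment> \<open>To the left of all intervals both brackets vanish. To the right they are the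
        constants \<open>d - c\<close> and \<open>d' - c'\<close>, so the normalised brackets are
        both 1 and cancel; this gives compact support.\<close>
      define \<theta> where "\<theta> x = (1 / (d - c)) * (\<Theta> c e x - \<Theta> d e x) - (1 / (d' - c')) * (\<Theta> c' e x - \<Theta> d' e x)" for x
      have "elem_smooth \<theta>"
        unfolding \<theta>_def[abs_def]
        by (intro elem_smooth_diff elem_smooth.mult elem_smooth.const \<Theta>s)
      have "test_function A B \<theta>"
      proof (rule test_functionI[OF \<open>elem_smooth \<theta>\<close>])
        show "A < min c c'" using cd cd' by simp
        show "D + e < B" using e D by (auto simp: field_simps)
        fix x assume "x \<notin> {min c c'..D + e}"
        then consider "x < c" "x < c'" "x < d" "x < d'" | "x > c + e" "x > c' + e" "x > d + e" "x > d' + e"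
          using cd cd' D by fastforce
        then show "\<theta> x = 0"
        proof cases
          case 1
          then show ?thesis using e by (simp add: \<theta>_def \<Theta>0)
        next
          case 2
          then show ?thesis using e cd cd' by (simp add: \<theta>_def \<Theta>1 field_simps)
        qed
      qed
      moreover have "deriv \<theta> x = (1 / (d - c)) * plateau c d e x - (1 / (d' - c')) * plateau c' d' e x" for x
        unfolding \<theta>_def[abs_def] plateau_def
        by (intro DERIV_imp_deriv DERIV_diff DERIV_cmult \<Theta>d e)
      ultimately have "0 = (LINT x|leb A B. f x * ((1 / (d - c)) * plateau c d e x - (1 / (d' - c')) * plateau c' d' e x))"
        using weak[of \<theta>] by simp
      also have "\<dots> = (LINT x|leb A B. (1 / (d - c)) * (f x * plateau c d e x) - (1 / (d' - c')) * (f x * plateau c' d' e x))"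
        by (intro Bochner_Integration.integral_cong refl) (simp add: algebra_simps)
      also have "\<dots> = (LINT x|leb A B. f x * plateau c d e x) / (d - c) - (LINT x|leb A B. f x * plateau c' d' e x) / (d' - c')"
        using i unfolding e_def
        by (subst Bochner_Integration.integral_diff[OF integrable_mult_right integrable_mult_right]) auto
      finally show "(LINT x|leb A B. f x * plateau c d (?e n) x) / (d - c)
        = (LINT x|leb A B. f x * plateau c' d' (?e n) x) / (d' - c')" by (simp add: e_def)
    qed
    have l1: "(\<lambda>n. (LINT x|leb A B. f x * plateau c d (?e n) x) / (d - c)) \<longlonglongrightarrow> J c d / (d - c)"
      and l2: "(\<lambda>n. (LINT x|leb A B. f x * plateau c' d' (?e n) x) / (d' - c')) \<longlonglongrightarrow> J c' d' / (d' - c')"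
      using cd cd' by (intro tendsto_divide Jlim tendsto_const; simp)+
    show ?thesis
      by (rule LIMSEQ_unique[OF Lim_transform_eventually[OF l1 ev] l2])
  qed
  \<comment> \<open>The middle third is the reference interval; the average of \<open>f\<close> over
    it is the constant.\<close>
  define c0 d0 where "c0 = (2 * A + B) / 3" and "d0 = (A + 2 * B) / 3"
  have cd0: "A < c0" "c0 < d0" "d0 < B" using AB by (auto simp: c0_def d0_def)
  define \<kappa> where "\<kappa> = J c0 d0 / (d0 - c0)"
  have J: "J c d = \<kappa> * (d - c)" if "A < c" "c < d" "d < B" for c d
    using ratio[OF that cd0] that by (simp add: \<kappa>_def field_simps)
  have AEcd: "AE x in leb c d. f x = \<kappa>" if cd: "A < c" "d < B" for c d
  proof -
    interpret M: finite_measure "leb c d" by simp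
    have "AE x in leb c d. f x - \<kappa> = 0"
    proof (rule prim_eq_0_imp_AE)
      show i: "integrable (leb c d) (\<lambda>x. f x - \<kappa>)" using loc[OF cd] by simp
      have *: "prim c d (\<lambda>x. f x - \<kappa>) t = 0" if t: "c < t" "t < d" for t
      proof -
        have eq: "indicator {c<..<d} x * (indicator {..t} x * f x) = f x * indicator {c<..t} x" for x
          using t by (auto simp: indicator_def)
        have "prim c d f t = J c t"
          unfolding prim_def J_def using cd by (subst leb_sub_eq(1)[of A c d B, symmetric]) (auto simp: eq)
        also have "\<dots> = \<kappa> * (t - c)" using cd t by (intro J) auto
        finally have 1: "prim c d f t = \<kappa> * (t - c)" .
        have "prim c d (\<lambda>_. \<kappa>) t = (LINT x|lborel. \<kappa> * indicator {c<..t} x)"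
          unfolding prim_def leb_integral
          by (intro Bochner_Integration.integral_cong refl) (use t in \<open>auto simp: indicator_def\<close>)
        also have "\<dots> = \<kappa> * (t - c)" using t by simp
        finally show ?thesis using 1 loc[OF cd] by (subst prim_diff) auto
      qed
      show "prim c d (\<lambda>x. f x - \<kappa>) t = 0" for t
      proof (cases "t \<le> c")
        case True
        then show ?thesis by (rule prim_left)
      next
        case tc: False
        show ?thesis
        proof (cases "c < d")
          case True
          have cl: "closure {c<..<d} = {c..d}" using True by simp
          have "prim c d (\<lambda>x. f x - \<kappa>) (min t d) = 0"
            by (rule continuous_constant_on_closure[of "{c<..<d}"])
              (use * cl tc True in \<open>auto intro!: prim_continuous i\<close>)
          then show ?thesis by (cases "t \<le> d") (auto simp: min_def prim_right)
        next
          case False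
          then have "prim c d (\<lambda>x. f x - \<kappa>) t = prim c d (\<lambda>_. 0) t" by (intro prim_cong) auto
          then show ?thesis by (simp add: prim_def)
        qed
      qed
    qed
    then show ?thesis by simp
  qed
  \<comment> \<open>Countably many interior intervals exhaust \<open>{A<..<B}\<close>, so the null
    sets can be united.\<close>
  have "AE x in lborel. \<forall>n. x \<in> {A + ?e n<..<B - ?e n} \<longrightarrow> f x = \<kappa>"
    unfolding AE_all_countable
  proof
    fix n
    have "AE x in leb (A + ?e n) (B - ?e n). f x = \<kappa>" by (intro AEcd) auto
    then show "AE x in lborel. x \<in> {A + ?e n<..<B - ?e n} \<longrightarrow> f x = \<kappa>"
      by (subst (asm) AE_restrict_space_iff) auto
  qed
  then have "AE x in lborel. x \<in> {A<..<B} \<longrightarrow> f x = \<kappa>"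
  proof eventually_elim
    fix x assume *: "\<forall>n. x \<in> {A + ?e n<..<B - ?e n} \<longrightarrow> f x = \<kappa>"
    show "x \<in> {A<..<B} \<longrightarrow> f x = \<kappa>"
    proof
      assume "x \<in> {A<..<B}"
      then obtain n where "?e n < min (x - A) (B - x)"
        using reals_Archimedean[of "min (x - A) (B - x)"] by (auto simp: inverse_eq_divide)
      then show "f x = \<kappa>" using *[rule_format, of n] by auto
    qed
  qed
  then have "AE x in leb A B. f x = \<kappa>" by (subst AE_restrict_space_iff) auto
  then show thesis by (rule that)
qed

section \<open>The chain rule for primitives\<close>

lemma integrable_continuous_mult:
  assumes "integrable (leb A B) w" "continuous_on {A..B} h"
  shows "integrable (leb A B) (\<lambda>r. h r * w r :: real)"
proof -
  obtain C where C: "C \<ge> 0" "\<And>x. x \<in> {A..B} \<Longrightarrow> \<bar>h x\<bar> \<le> C"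
    using continuous_bounded_Icc[OF assms(2)] by metis
  show ?thesis
    by (rule integrable_bounded_mult(1)[OF assms(1), of _ C])
      (use C integrable_continuous_leb[OF assms(2)] in auto)
qed

text \<open>The argument compares increments over a fine partition instead of pointwise derivatives.
  By the mean value theorem each increment of \<open>\<psi> (f t)\<close> is
  \<open>\<psi>' (\<xi> k)\<close> times an integral of \<open>w\<close>. Uniform continuity of
  \<open>f\<close> and of \<open>\<psi>'\<close> on the range of \<open>f\<close> makes
  \<open>\<psi>' (\<xi> k)\<close> differ from \<open>\<psi>' (f r)\<close> by at most
  \<open>e\<close>, so the total error is at most \<open>e\<close> times the L1 norm of
  \<open>w\<close>.\<close>

theorem prim_chain_rule:
  fixes f w \<psi> \<psi>' :: "real \<Rightarrow> real"
  assumes w: "integrable (leb A B) w" and f: "\<And>t. t \<in> {A..B} \<Longrightarrow> f t = c + prim A B w t"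
    and \<psi>: "\<And>y. (\<psi> has_real_derivative \<psi>' y) (at y)" and c\<psi>: "continuous_on UNIV \<psi>'"
    and t: "t \<in> {A..B}"
  shows "\<psi> (f t) = \<psi> c + prim A B (\<lambda>r. \<psi>' (f r) * w r) t"
proof -
  have "continuous_on {A..B} (\<lambda>t. c + prim A B w t)"
    by (intro continuous_on_add continuous_on_const prim_continuous w)
  then have fc: "continuous_on {A..B} f" using f by (subst continuous_on_cong[OF refl f])
  have \<psi>fc: "continuous_on {A..B} (\<lambda>r. \<psi>' (f r))"
    by (rule continuous_on_compose2[OF c\<psi> fc]) auto
  have int: "integrable (leb A B) (\<lambda>r. \<psi>' (f r) * w r)"
    by (rule integrable_continuous_mult[OF w \<psi>fc])
  obtain C where C: "C \<ge> 0" "\<And>x. x \<in> {A..B} \<Longrightarrow> \<bar>f x\<bar> \<le> C"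
    using continuous_bounded_Icc[OF fc] by metis
  define I where "I = (LINT r|leb A B. \<bar>w r\<bar>)"
  have I: "I \<ge> 0" by (simp add: I_def)
  have main: "\<bar>\<psi> (f t) - \<psi> c - prim A B (\<lambda>r. \<psi>' (f r) * w r) t\<bar> \<le> e * I" if e: "e > 0" for e
  proof -
    have "uniformly_continuous_on {-C..C} \<psi>'"
      using c\<psi> by (intro compact_uniformly_continuous) (auto intro: continuous_on_subset)
    then obtain d where d: "d > 0" "\<And>u v. u \<in> {-C..C} \<Longrightarrow> v \<in> {-C..C} \<Longrightarrow> \<bar>u - v\<bar> < d \<Longrightarrow> \<bar>\<psi>' u - \<psi>' v\<bar> < e"
      using e unfolding uniformly_continuous_on_def dist_real_def by (metis abs_minus_commute)
    have "uniformly_continuous_on {A..B} f" using fc by (intro compact_uniformly_continuous) auto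
    moreover have "d / 2 > 0" using d by simp
    ultimately obtain d' where d': "d' > 0" "\<And>u v. u \<in> {A..B} \<Longrightarrow> v \<in> {A..B} \<Longrightarrow> \<bar>u - v\<bar> < d' \<Longrightarrow> \<bar>f u - f v\<bar> < d / 2"
      unfolding uniformly_continuous_on_def dist_real_def by (metis abs_minus_commute)
    obtain n :: nat where n: "n > 0" "(t - A) / real n < d'"
    proof -
      obtain n :: nat where "(t - A) / d' < real n" using reals_Archimedean2 by blast
      then have "(t - A) / real (Suc n) < d'"
        using d' t by (simp add: field_simps)
      then show thesis by (intro that[of "Suc n"]) auto
    qed
    define \<tau> where "\<tau> k = A + real k * ((t - A) / real n)" for k :: nat
    have \<tau>0: "\<tau> 0 = A" and \<tau>n: "\<tau> n = t" using n by (auto simp: \<tau>_def)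
    have \<tau>step: "\<tau> (Suc k) = \<tau> k + (t - A) / real n" for k
      by (simp only: \<tau>_def of_nat_Suc distrib_right mult_1_left ac_simps)
    have \<tau>le: "\<tau> k \<le> \<tau> (Suc k)" for k using t by (simp add: \<tau>step)
    have \<tau>mem: "\<tau> k \<in> {A..B}" if "k \<le> n" for k
    proof -
      have "real k * ((t - A) / real n) \<le> real n * ((t - A) / real n)"
        using that t by (intro mult_right_mono) auto
      then have "\<tau> k \<le> t" using n by (simp add: \<tau>_def)
      moreover have "A \<le> \<tau> k" using t by (simp add: \<tau>_def)
      ultimately show ?thesis using t by auto
    qed
    have "\<exists>\<xi>. \<bar>\<xi> - f (\<tau> k)\<bar> \<le> \<bar>f (\<tau> (Suc k)) - f (\<tau> k)\<bar> \<and> \<bar>\<xi>\<bar> \<le> C \<and>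
        \<psi> (f (\<tau> (Suc k))) - \<psi> (f (\<tau> k)) = \<psi>' \<xi> * (f (\<tau> (Suc k)) - f (\<tau> k))" if "k < n" for k
    proof -
      have Ck: "\<bar>f (\<tau> k)\<bar> \<le> C" "\<bar>f (\<tau> (Suc k))\<bar> \<le> C" using that by (auto intro!: C \<tau>mem)
      consider "f (\<tau> k) < f (\<tau> (Suc k))" | "f (\<tau> k) > f (\<tau> (Suc k))" | "f (\<tau> k) = f (\<tau> (Suc k))" by linarith
      then show ?thesis
      proof cases
        case 1
        from MVT2[OF this, of \<psi> \<psi>'] \<psi> obtain z where "f (\<tau> k) < z" "z < f (\<tau> (Suc k))"
          "\<psi> (f (\<tau> (Suc k))) - \<psi> (f (\<tau> k)) = (f (\<tau> (Suc k)) - f (\<tau> k)) * \<psi>' z" by auto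
        then show ?thesis using Ck by (intro exI[of _ z]) auto
      next
        case 2
        from MVT2[OF this, of \<psi> \<psi>'] \<psi> obtain z where z: "f (\<tau> (Suc k)) < z" "z < f (\<tau> k)"
          "\<psi> (f (\<tau> k)) - \<psi> (f (\<tau> (Suc k))) = (f (\<tau> k) - f (\<tau> (Suc k))) * \<psi>' z" by auto
        then have "\<psi> (f (\<tau> (Suc k))) - \<psi> (f (\<tau> k)) = \<psi>' z * (f (\<tau> (Suc k)) - f (\<tau> k))"
          by (simp add: algebra_simps)
        then show ?thesis using Ck z by (intro exI[of _ z]) auto
      next
        case 3
        then show ?thesis using Ck by (intro exI[of _ "f (\<tau> k)"]) auto
      qed
    qed
    then obtain \<xi> where \<xi>: "\<And>k. k < n \<Longrightarrow> \<bar>\<xi> k - f (\<tau> k)\<bar> \<le> \<bar>f (\<tau> (Suc k)) - f (\<tau> k)\<bar>"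
      "\<And>k. k < n \<Longrightarrow> \<bar>\<xi> k\<bar> \<le> C"
      "\<And>k. k < n \<Longrightarrow> \<psi> (f (\<tau> (Suc k))) - \<psi> (f (\<tau> k)) = \<psi>' (\<xi> k) * (f (\<tau> (Suc k)) - f (\<tau> k))"
      by metis
    \<comment> \<open>The indicator of the subinterval number \<open>k\<close>, kept as a difference
      of half-line indicators so that integrating \<open>J k r * w r\<close> gives an increment of
      \<open>prim\<close>.\<close>
    define J where "J k r = indicator {..\<tau> (Suc k)} r - (indicator {..\<tau> k} r :: real)" for k r
    have J01: "J k r = indicator {\<tau> k<..\<tau> (Suc k)} r" for k r
      using \<tau>le[of k] by (auto simp: J_def indicator_def)
    have Jsum: "(\<Sum>k<n. J k r) = indicator {..t} r - indicator {..A} r" for r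
      unfolding J_def by (subst sum_lessThan_telescope) (simp add: \<tau>0 \<tau>n)
    have J_int: "integrable (leb A B) (\<lambda>r. a * (J k r * w r))" for a k
      unfolding J_def left_diff_distrib by (intro integrable_mult_right Bochner_Integration.integrable_diff prim_integrable w)
    have fdiff: "f (\<tau> (Suc k)) - f (\<tau> k) = (LINT r|leb A B. J k r * w r)" if "k < n" for k
      using f[OF \<tau>mem[of k]] f[OF \<tau>mem[of "Suc k"]] that w
      by (simp add: J_def left_diff_distrib prim_integrable prim_def)
    \<comment> \<open>The error of replacing \<open>\<psi>' (f r)\<close> by the slope chosen for
      the subinterval containing \<open>r\<close>. The subintervals are disjoint, so the sum has at
      most one nonzero term.\<close>
    define E where "E r = (\<Sum>k<n. (\<psi>' (\<xi> k) - \<psi>' (f r)) * J k r)" for r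
    have E: "\<bar>E r\<bar> \<le> e" if "r \<in> {A<..<B}" for r
    proof -
      have "\<bar>E r\<bar> \<le> (\<Sum>k<n. \<bar>(\<psi>' (\<xi> k) - \<psi>' (f r)) * J k r\<bar>)" unfolding E_def by (rule sum_abs)
      also have "\<dots> \<le> (\<Sum>k<n. e * J k r)"
      proof (rule sum_mono)
        fix k assume k: "k \<in> {..<n}"
        show "\<bar>(\<psi>' (\<xi> k) - \<psi>' (f r)) * J k r\<bar> \<le> e * J k r"
        proof (cases "r \<in> {\<tau> k<..\<tau> (Suc k)}")
          case True
          have step: "\<bar>f (\<tau> (Suc k)) - f (\<tau> k)\<bar> < d / 2"
            using k n \<tau>le[of k] by (intro d' \<tau>mem) (auto simp: \<tau>step)
          have "\<bar>f r - f (\<tau> k)\<bar> < d / 2"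
            using True k n that by (intro d' \<tau>mem) (auto simp: \<tau>step)
          moreover have "\<bar>\<xi> k - f (\<tau> k)\<bar> \<le> \<bar>f (\<tau> (Suc k)) - f (\<tau> k)\<bar>" using k by (intro \<xi>) simp
          ultimately have "\<bar>\<xi> k - f r\<bar> < d" using step by linarith
          moreover have "\<bar>f r\<bar> \<le> C" using C(2)[of r] that by auto
          ultimately have "\<bar>\<psi>' (\<xi> k) - \<psi>' (f r)\<bar> < e" using \<xi>(2)[of k] k by (intro d) auto
          then show ?thesis using True by (simp add: J01)
        qed (simp add: J01)
      qed
      also have "\<dots> = e * (indicator {..t} r - indicator {..A} r)" by (simp add: sum_distrib_left[symmetric] Jsum)
      also have "\<dots> \<le> e * 1" using e by (intro mult_left_mono) (auto simp: indicator_def)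
      finally show ?thesis by simp
    qed
    have "\<psi> (f t) - \<psi> c = (\<Sum>k<n. \<psi> (f (\<tau> (Suc k))) - \<psi> (f (\<tau> k)))"
      using t f[of A] by (subst sum_lessThan_telescope) (simp add: \<tau>0 \<tau>n prim_left)
    also have "\<dots> = (\<Sum>k<n. \<psi>' (\<xi> k) * (LINT r|leb A B. J k r * w r))"
      by (intro sum.cong refl) (simp add: \<xi>(3) fdiff)
    also have "\<dots> = (LINT r|leb A B. (\<Sum>k<n. \<psi>' (\<xi> k) * (J k r * w r)))"
      using J_int by (subst Bochner_Integration.integral_sum) auto
    finally have s1: "\<psi> (f t) - \<psi> c = (LINT r|leb A B. (\<Sum>k<n. \<psi>' (\<xi> k) * (J k r * w r)))" .
    have i1: "integrable (leb A B) (\<lambda>r. \<Sum>k<n. \<psi>' (\<xi> k) * (J k r * w r))"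
      by (intro Bochner_Integration.integrable_sum J_int)
    have i2: "integrable (leb A B) (\<lambda>r. indicator {..t} r * (\<psi>' (f r) * w r))"
      by (rule prim_integrable[OF int])
    have diff: "(\<Sum>k<n. \<psi>' (\<xi> k) * (J k r * w r)) - indicator {..t} r * (\<psi>' (f r) * w r) = E r * w r"
      if "r \<in> {A<..<B}" for r
    proof -
      have "E r * w r = (\<Sum>k<n. \<psi>' (\<xi> k) * (J k r * w r)) - \<psi>' (f r) * w r * (\<Sum>k<n. J k r)"
        by (simp add: E_def sum_distrib_right sum_distrib_left sum_subtractf[symmetric] algebra_simps)
      also have "(\<Sum>k<n. J k r) = indicator {..t} r" using that by (simp add: Jsum)
      finally show ?thesis by simp
    qed
    have "\<psi> (f t) - \<psi> c - prim A B (\<lambda>r. \<psi>' (f r) * w r) t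
      = (LINT r|leb A B. (\<Sum>k<n. \<psi>' (\<xi> k) * (J k r * w r)) - indicator {..t} r * (\<psi>' (f r) * w r))"
      unfolding s1 prim_def by (rule Bochner_Integration.integral_diff[OF i1 i2, symmetric])
    also have "\<bar>\<dots>\<bar> \<le> (LINT r|leb A B. e * \<bar>w r\<bar>)"
    proof (rule order_trans[OF integral_abs_bound integral_mono])
      show "\<bar>(\<Sum>k<n. \<psi>' (\<xi> k) * (J k r * w r)) - indicator {..t} r * (\<psi>' (f r) * w r)\<bar> \<le> e * \<bar>w r\<bar>"
        if "r \<in> space (leb A B)" for r
        using that E[of r] by (subst diff) (auto simp: abs_mult intro!: mult_right_mono)
    qed (use i1 i2 w in auto)
    also have "\<dots> = e * I" by (simp add: I_def)
    finally show ?thesis .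
  qed
  have "\<bar>\<psi> (f t) - \<psi> c - prim A B (\<lambda>r. \<psi>' (f r) * w r) t\<bar> \<le> 0"
  proof (rule field_le_epsilon)
    fix e :: real assume "e > 0"
    \<comment> \<open>The denominator \<open>I + 1\<close> avoids a division by 0 when
      \<open>w\<close> vanishes almost everywhere.\<close>
    have "\<bar>\<psi> (f t) - \<psi> c - prim A B (\<lambda>r. \<psi>' (f r) * w r) t\<bar> \<le> e / (I + 1) * I"
      using \<open>e > 0\<close> I by (intro main) auto
    also have "\<dots> \<le> e" using \<open>e > 0\<close> I by (simp add: field_simps)
    finally show "\<bar>\<psi> (f t) - \<psi> c - prim A B (\<lambda>r. \<psi>' (f r) * w r) t\<bar> \<le> 0 + e" by simp
  qed
  then show ?thesis by simp
qed

text \<open>Chain rule for \<open>arctan (n f) / n\<close>, whose derivative tends to the indicator of \<open>f = 0\<close>.\<close>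

theorem prim_deriv_zero_set:
  fixes f w :: "real \<Rightarrow> real"
  assumes w: "integrable (leb A B) w" and f: "\<And>t. t \<in> {A..B} \<Longrightarrow> f t = c + prim A B w t"
  shows "AE t in leb A B. f t = 0 \<longrightarrow> w t = 0"
proof (cases "A < B")
  case False
  then have "space (leb A B) = {}" by simp
  then show ?thesis by (intro AE_I2) simp
next
  case AB: True
  have "continuous_on {A..B} (\<lambda>t. c + prim A B w t)"
    by (intro continuous_on_add continuous_on_const prim_continuous w)
  then have fc: "continuous_on {A..B} f" using f by (subst continuous_on_cong[OF refl f])
  have fm: "f \<in> borel_measurable (leb A B)" using integrable_continuous_leb[OF fc] by simp
  then have im: "(\<lambda>r. indicator {0} (f r) :: real) \<in> borel_measurable (leb A B)"
    by measurable
  define g where "g r = indicator {0} (f r) * w r" for r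
  have gi: "integrable (leb A B) g"
    unfolding g_def by (rule integrable_bounded_mult(1)[OF w im, of 1]) (simp add: indicator_def)
  have p0: "prim A B g t = 0" if t: "t \<in> {A..B}" for t
  proof -
    define \<psi> where "\<psi> n y = arctan (real (Suc n) * y) / real (Suc n)" for n y
    define \<psi>' where "\<psi>' n y = 1 / (1 + (real (Suc n) * y)\<^sup>2)" for n y
    have d: "(\<psi> n has_real_derivative \<psi>' n y) (at y)" for n y
      unfolding \<psi>_def \<psi>'_def
      by (auto intro!: derivative_eq_intros simp: inverse_eq_divide simp del: of_nat_Suc)
    have pos: "1 + (real (Suc n) * y)\<^sup>2 > 0" for n y by (simp add: add_pos_nonneg del: of_nat_Suc)
    have c': "continuous_on UNIV (\<psi>' n)" for n
      unfolding \<psi>'_def using pos by (intro continuous_intros) (metis less_irrefl)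
    have eq: "prim A B (\<lambda>r. \<psi>' n (f r) * w r) t = \<psi> n (f t) - \<psi> n c" for n
      using prim_chain_rule[OF w f d c' t, of n] by simp
    have lim0: "(\<lambda>n. \<psi> n y) \<longlonglongrightarrow> 0" for y
    proof (rule Lim_null_comparison)
      show "\<forall>\<^sub>F n in sequentially. norm (\<psi> n y) \<le> (pi / 2) * inverse (real (Suc n))"
      proof (intro always_eventually allI)
        fix n
        have "\<bar>arctan (real (Suc n) * y)\<bar> \<le> pi / 2"
          using arctan_bounded[of "real (Suc n) * y"] by linarith
        then have "\<bar>arctan (real (Suc n) * y)\<bar> * inverse (real (Suc n)) \<le> (pi / 2) * inverse (real (Suc n))"
          by (intro mult_right_mono) auto
        then show "norm (\<psi> n y) \<le> (pi / 2) * inverse (real (Suc n))"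
          unfolding \<psi>_def divide_inverse abs_mult real_norm_def
          by (simp only: abs_of_nonneg[of "inverse (real (Suc n))"] inverse_nonnegative_iff_nonnegative of_nat_0_le_iff)
      qed
      show "(\<lambda>n. pi / 2 * inverse (real (Suc n))) \<longlonglongrightarrow> 0"
        by (intro tendsto_mult_right_zero LIMSEQ_inverse_real_of_nat)
    qed
    have ptw: "(\<lambda>n. \<psi>' n y) \<longlonglongrightarrow> indicator {0} y" for y
    proof (cases "y = 0")
      case True
      then show ?thesis by (simp add: \<psi>'_def)
    next
      case False
      have "(\<lambda>n. inverse (1 + (real (Suc n) * y)\<^sup>2)) \<longlonglongrightarrow> 0"
      proof (rule tendsto_inverse_0_at_top)
        show "filterlim (\<lambda>n. 1 + (real (Suc n) * y)\<^sup>2) at_top sequentially"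
        proof (rule filterlim_at_top_mono)
          show "filterlim (\<lambda>n. y\<^sup>2 * real n) at_top sequentially"
            using False by (intro filterlim_tendsto_pos_mult_at_top[OF tendsto_const]
              filterlim_real_sequentially) auto
          show "\<forall>\<^sub>F n in sequentially. y\<^sup>2 * real n \<le> 1 + (real (Suc n) * y)\<^sup>2"
          proof (intro always_eventually allI)
            fix n
            have "real n \<le> (real (Suc n))\<^sup>2" by (simp add: power2_eq_square algebra_simps)
            then have "y\<^sup>2 * real n \<le> y\<^sup>2 * (real (Suc n))\<^sup>2" by (intro mult_left_mono) auto
            then show "y\<^sup>2 * real n \<le> 1 + (real (Suc n) * y)\<^sup>2" by (simp add: power_mult_distrib mult.commute)
          qed
        qed
      qed
      then show ?thesis using False by (simp add: \<psi>'_def inverse_eq_divide)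
    qed
    have \<psi>'1: "\<bar>\<psi>' n y\<bar> \<le> 1" for n y using pos[of n y] by (simp add: \<psi>'_def)
    have \<psi>'m: "(\<lambda>r. \<psi>' n (f r)) \<in> borel_measurable (leb A B)" for n
      by (rule measurable_compose[OF fm borel_measurable_continuous_onI[OF c']])
    have "(\<lambda>n. prim A B (\<lambda>r. \<psi>' n (f r) * w r) t) \<longlonglongrightarrow> prim A B g t"
      unfolding prim_def
    proof (rule integral_dominated_convergence[where w="\<lambda>r. \<bar>w r\<bar>"])
      show "AE r in leb A B. (\<lambda>n. indicator {..t} r * (\<psi>' n (f r) * w r)) \<longlonglongrightarrow> indicator {..t} r * g r"
        unfolding g_def by (intro AE_I2 tendsto_mult tendsto_const ptw)
      show "AE r in leb A B. norm (indicator {..t} r * (\<psi>' n (f r) * w r)) \<le> \<bar>w r\<bar>" for n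
      proof (rule AE_I2)
        fix r
        have "\<bar>\<psi>' n (f r) * w r\<bar> \<le> \<bar>w r\<bar>"
          unfolding abs_mult by (intro mult_left_le_one_le \<psi>'1) auto
        then show "norm (indicator {..t} r * (\<psi>' n (f r) * w r)) \<le> \<bar>w r\<bar>"
          using indicator_mult_le[of "{..t}" r "\<psi>' n (f r) * w r"] by simp
      qed
      show "(\<lambda>r. indicator {..t} r * (\<psi>' n (f r) * w r)) \<in> borel_measurable (leb A B)" for n
        using w by (intro borel_measurable_times \<psi>'m measurable_leb[OF borel_measurable_indicator]) auto
      show "(\<lambda>r. indicator {..t} r * g r) \<in> borel_measurable (leb A B)"
        using gi by (intro borel_measurable_times measurable_leb[OF borel_measurable_indicator]) auto
    qed (use w in auto)
    moreover have "(\<lambda>n. prim A B (\<lambda>r. \<psi>' n (f r) * w r) t) \<longlonglongrightarrow> 0 - 0"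
      unfolding eq by (intro tendsto_diff lim0)
    ultimately show ?thesis using LIMSEQ_unique by fastforce
  qed
  have "AE r in leb A B. g r = 0"
  proof (rule prim_eq_0_imp_AE[OF gi])
    fix t
    consider "t \<le> A" | "t \<in> {A..B}" | "B \<le> t" by fastforce
    then show "prim A B g t = 0"
    proof cases
      case 3
      then show ?thesis using p0[of B] AB by (simp add: prim_right)
    qed (use p0 prim_left in auto)
  qed
  then show ?thesis by eventually_elim (auto simp: g_def)
qed

section \<open>Layer-cake formulas and the excess measure\<close>

text \<open>Both a monotone function and the distribution function of a given measure arise, up to a
  constant, as \<open>F s = \<integral> (1[U y s] - 1[U y c]) \<nu>(dy)\<close> with \<open>U y\<close> an up-set for
  every \<open>y\<close>; subtracting the value at \<open>c\<close> makes the integral finite.\<close>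

lemma layer_cake:
  fixes m F :: "real \<Rightarrow> real" and U :: "'a \<Rightarrow> real \<Rightarrow> bool"
  defines "k \<equiv> \<lambda>y s c. of_bool (U y s) - (of_bool (U y c) :: real)"
  assumes \<nu>: "sigma_finite_measure \<nu>"
    and meas: "(\<lambda>(s, y). of_bool (U y s) :: real) \<in> borel_measurable (leb 0 1 \<Otimes>\<^sub>M \<nu>)"
    and up: "\<And>y s s'. y \<in> space \<nu> \<Longrightarrow> U y s \<Longrightarrow> s \<le> s' \<Longrightarrow> U y s'"
    and c: "c \<in> {0<..<1}"
    and int: "\<And>s. s \<in> {0<..<1} \<Longrightarrow> integrable \<nu> (\<lambda>y. k y s c)"
    and F: "\<And>s. s \<in> {0<..<1} \<Longrightarrow> F s = (LINT y|\<nu>. k y s c)"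
    and m: "integrable (leb 0 1) m" "(LINT s|leb 0 1. m s) = 0"
    and Fm: "integrable (leb 0 1) (\<lambda>s. F s * m s)"
  shows "integrable \<nu> (\<lambda>y. LINT s|leb 0 1. of_bool (U y s) * m s)"
    and "(LINT y|\<nu>. LINT s|leb 0 1. of_bool (U y s) * m s) = (LINT s|leb 0 1. F s * m s)"
proof -
  interpret p: pair_sigma_finite "leb 0 1" \<nu> using \<nu> by (simp add: pair_sigma_finite_def)
  have mm: "m \<in> borel_measurable (leb 0 1)" using m by simp
  have cm: "(\<lambda>y. of_bool (U y c) :: real) \<in> borel_measurable \<nu>"
    using measurable_Pair2[OF meas, of c] c by simp
  have km: "(\<lambda>(s, y). k y s c * m s) \<in> borel_measurable (leb 0 1 \<Otimes>\<^sub>M \<nu>)"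
    unfolding k_def case_prod_beta'
    using meas[unfolded case_prod_beta'] measurable_compose[OF measurable_snd cm]
      measurable_compose[OF measurable_fst mm]
    by (intro borel_measurable_times borel_measurable_diff) auto
  \<comment> \<open>For fixed \<open>s\<close> the kernel \<open>k y s c\<close> has one sign for
    all \<open>y\<close>, because every \<open>U y\<close> is an up-set. So its absolute integral is
    \<open>\<bar>F s\<bar>\<close>, and joint integrability reduces to that of
    \<open>F s * m s\<close>.\<close>
  have absk: "(LINT y|\<nu>. \<bar>k y s c\<bar>) = \<bar>F s\<bar>" if s: "s \<in> {0<..<1}" for s
  proof (cases "c \<le> s")
    case True
    then have "\<bar>k y s c\<bar> = k y s c" if "y \<in> space \<nu>" for y using up[OF that] by (auto simp: k_def)
    then have 1: "(LINT y|\<nu>. \<bar>k y s c\<bar>) = F s" by (subst F[OF s]) (auto intro: Bochner_Integration.integral_cong)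
    moreover have "(LINT y|\<nu>. \<bar>k y s c\<bar>) \<ge> 0" by simp
    ultimately show ?thesis by simp
  next
    case False
    then have "\<bar>k y s c\<bar> = - k y s c" if "y \<in> space \<nu>" for y using up[OF that] by (auto simp: k_def)
    then have 1: "(LINT y|\<nu>. \<bar>k y s c\<bar>) = - F s" by (subst F[OF s]) (auto intro: Bochner_Integration.integral_cong
      simp flip: Bochner_Integration.integral_minus)
    moreover have "(LINT y|\<nu>. \<bar>k y s c\<bar>) \<ge> 0" by simp
    ultimately show ?thesis by simp
  qed
  have joint: "integrable (leb 0 1 \<Otimes>\<^sub>M \<nu>) (\<lambda>(s, y). k y s c * m s)"
  proof (rule p.Fubini_integrable[OF km])
    have "(LINT y|\<nu>. norm (k y s c * m s)) = \<bar>F s * m s\<bar>" if "s \<in> {0<..<1}" for s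
      using absk[OF that] by (simp add: abs_mult)
    then have "integrable (leb 0 1) (\<lambda>s. LINT y|\<nu>. norm (k y s c * m s)) \<longleftrightarrow> integrable (leb 0 1) (\<lambda>s. \<bar>F s * m s\<bar>)"
      by (intro Bochner_Integration.integrable_cong refl) auto
    then show "integrable (leb 0 1) (\<lambda>s. LINT y|\<nu>. norm (case (s, y) of (s, y) \<Rightarrow> k y s c * m s))"
      using Fm by simp
    show "AE s in leb 0 1. integrable \<nu> (\<lambda>y. case (s, y) of (s, y) \<Rightarrow> k y s c * m s)"
      using int by (intro AE_I2) auto
  qed
  have mU: "integrable (leb 0 1) (\<lambda>s. of_bool (U y s) * m s)" if "y \<in> space \<nu>" for y
    by (rule integrable_bounded_mult(1)[OF m(1), of _ 1])
      (use measurable_Pair1[OF meas that] in auto)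
  \<comment> \<open>The subtracted value at \<open>c\<close> does not depend on \<open>s\<close> and
    disappears because \<open>m\<close> has mean 0.\<close>
  have inner: "(LINT s|leb 0 1. k y s c * m s) = (LINT s|leb 0 1. of_bool (U y s) * m s)"
    if "y \<in> space \<nu>" for y
    using mU[OF that] m by (simp add: k_def left_diff_distrib)
  have "integrable \<nu> (\<lambda>y. LINT s|leb 0 1. k y s c * m s)"
    using p.integrable_snd[OF joint] by simp
  also have "?this \<longleftrightarrow> integrable \<nu> (\<lambda>y. LINT s|leb 0 1. of_bool (U y s) * m s)"
    by (intro Bochner_Integration.integrable_cong refl inner)
  finally show "integrable \<nu> (\<lambda>y. LINT s|leb 0 1. of_bool (U y s) * m s)" .
  have "(LINT y|\<nu>. LINT s|leb 0 1. of_bool (U y s) * m s) = (LINT y|\<nu>. LINT s|leb 0 1. k y s c * m s)"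
    by (rule Bochner_Integration.integral_cong[OF refl inner[symmetric]])
  also have "\<dots> = (LINT s|leb 0 1. LINT y|\<nu>. k y s c * m s)"
    by (rule p.Fubini_integral[OF joint])
  also have "\<dots> = (LINT s|leb 0 1. F s * m s)"
    by (intro Bochner_Integration.integral_cong refl) (auto simp: F)
  finally show "(LINT y|\<nu>. LINT s|leb 0 1. of_bool (U y s) * m s) = (LINT s|leb 0 1. F s * m s)" .
qed

text \<open>An up-set is a half-line up to its end point \<open>z\<close>, which is null, and
  \<open>m\<close> has mean 0, so the part above \<open>z\<close> is minus the part below.\<close>

lemma upset_integral:
  fixes m :: "real \<Rightarrow> real"
  assumes m: "integrable (leb 0 1) m" "(LINT s|leb 0 1. m s) = 0"
    and P: "\<And>s. s \<in> {0<..<1} \<Longrightarrow> s < z \<Longrightarrow> \<not> P s" "\<And>s. s \<in> {0<..<1} \<Longrightarrow> z < s \<Longrightarrow> P s"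
  shows "(LINT s|leb 0 1. of_bool (P s) * m s) = - prim 0 1 m z"
proof -
  have mm: "m \<in> borel_measurable (leb 0 1)" using m by simp
  have eq: "AE s in leb 0 1. m s - indicator {..z} s * m s = of_bool (P s) * m s"
    using AE_leb_neq[of z 0 1] AE_space[of "leb 0 1"]
  proof eventually_elim
    case (elim s)
    then show ?case using P[of s] by (cases s z rule: linorder_cases) auto
  qed
  have im: "(\<lambda>s. m s - indicator {..z} s * m s) \<in> borel_measurable (leb 0 1)"
    using m prim_integrable[OF m(1)] by (intro borel_measurable_diff) auto
  \<comment> \<open>\<open>P\<close> is determined except at the single point \<open>z\<close>, so
    measurability follows from that of the half-line version after correcting one value.\<close>
  have "(\<lambda>s. of_bool (P s) * m s) \<in> borel_measurable (leb 0 1)"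
  proof -
    have "(\<lambda>s. m s - indicator {..z} s * m s - (if s = z then m z - indicator {..z} z * m z - of_bool (P z) * m z else 0))
      \<in> borel_measurable (leb 0 1)"
      by (intro borel_measurable_diff[OF im] measurable_leb) auto
    also have "?this \<longleftrightarrow> ?thesis"
    proof (intro measurable_cong)
      fix s assume "s \<in> space (leb 0 1)"
      then show "m s - indicator {..z} s * m s - (if s = z then m z - indicator {..z} z * m z - of_bool (P z) * m z else 0)
        = of_bool (P s) * m s"
        using P[of s] by (cases s z rule: linorder_cases) auto
    qed
    finally show ?thesis .
  qed
  then have "(LINT s|leb 0 1. of_bool (P s) * m s) = (LINT s|leb 0 1. m s - indicator {..z} s * m s)"
    using eq im by (intro integral_cong_AE) auto
  also have "\<dots> = - prim 0 1 m z"
    using m prim_integrable[OF m(1)] by (simp add: prim_def)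
  finally show ?thesis .
qed

text \<open>Inserting 0 keeps the set nonempty, so that the supremum is 0 when \<open>g\<close>
  exceeds \<open>y\<close> on the whole interval. The value 1 occurs when \<open>g\<close> never
  exceeds \<open>y\<close>.\<close>

definition gen_inverse :: "(real \<Rightarrow> real) \<Rightarrow> real \<Rightarrow> real" where
  "gen_inverse g y = Sup (insert 0 {s \<in> {0<..<1}. g s \<le> y})"

lemma gen_inverse_bdd: "bdd_above (insert 0 {s \<in> {0<..<1::real}. g s \<le> y})"
  by (rule bdd_aboveI[of _ 1]) auto

lemma gen_inverse_bounds: "0 \<le> gen_inverse g y" "gen_inverse g y \<le> 1"
proof -
  show "0 \<le> gen_inverse g y" unfolding gen_inverse_def by (intro cSup_upper gen_inverse_bdd) simp
  show "gen_inverse g y \<le> 1" unfolding gen_inverse_def by (intro cSup_least) auto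
qed

lemma gen_inverse_less:
  assumes "gen_inverse g y < s" "s \<in> {0<..<1}" shows "y < g s"
proof (rule ccontr)
  assume "\<not> y < g s"
  then have "s \<le> gen_inverse g y" using assms(2) unfolding gen_inverse_def by (intro cSup_upper gen_inverse_bdd) auto
  then show False using assms by simp
qed

lemma less_gen_inverse:
  assumes "s < gen_inverse g y" "s \<in> {0<..<1}" "mono_on {0<..<1} g" shows "g s \<le> y"
proof -
  obtain s' where "s' \<in> insert 0 {s \<in> {0<..<1}. g s \<le> y}" "s < s'"
    using assms(1) less_cSup_iff[OF _ gen_inverse_bdd, of g y s] unfolding gen_inverse_def by auto
  then show ?thesis using assms(2,3) by (auto dest: mono_onD[of _ _ s s'])
qed

lemma gen_inverse_mono: "y \<le> y' \<Longrightarrow> gen_inverse g y \<le> gen_inverse g y'"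
  unfolding gen_inverse_def by (intro cSup_subset_mono gen_inverse_bdd) auto

lemma mono_on_leb_measurable: "mono_on {0<..<1} (g :: real \<Rightarrow> real) \<Longrightarrow> g \<in> borel_measurable (leb 0 1)"
  using borel_measurable_mono_on_fnc[of "{0<..<1}" g]
  by (subst measurable_cong_sets[of _ "restrict_space borel {0<..<1}" borel borel])
    (auto simp: sets_restrict_space)

text \<open>Integration by parts against the Stieltjes measure of \<open>g\<close>, written in the
  height variable. The layer at height \<open>y\<close> is the up-set where \<open>g\<close> exceeds
  \<open>y\<close>; its left end is \<open>gen_inverse g y\<close>, so \<open>m\<close> integrates
  over it to minus its primitive at that point.\<close>

theorem mono_layer_cake:
  fixes g m :: "real \<Rightarrow> real"
  assumes g: "mono_on {0<..<1} g" and m: "integrable (leb 0 1) m" "(LINT s|leb 0 1. m s) = 0"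
    and gm: "integrable (leb 0 1) (\<lambda>s. g s * m s)"
  shows "integrable lborel (\<lambda>y. prim 0 1 m (gen_inverse g y))"
    and "(LINT y|lborel. prim 0 1 m (gen_inverse g y)) = - (LINT s|leb 0 1. g s * m s)"
proof -
  \<comment> \<open>Extended by \<open>False\<close> to the left of the interval and by
    \<open>True\<close> to the right, so that it is an up-set on the whole line; the integrals see
    only \<open>{0<..<1}\<close>.\<close>
  define U where "U y s = ((if s \<le> 0 then False else if 1 \<le> s then True else y < g s))" for y s :: real
  define c :: real where "c = 1 / 2"
  have c: "c \<in> {0<..<1}" by (simp add: c_def)
  have Us: "U y s \<longleftrightarrow> y < g s" if "s \<in> {0<..<1}" for y s using that by (auto simp: U_def)
  have gmm: "g \<in> borel_measurable (leb 0 1)" by (rule mono_on_leb_measurable[OF g])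
  have "(\<lambda>p. of_bool (snd p < g (fst p)) :: real) \<in> borel_measurable (leb 0 1 \<Otimes>\<^sub>M lborel)"
    using measurable_compose[OF measurable_fst gmm, of lborel] by measurable
  also have "?this \<longleftrightarrow> (\<lambda>(s, y). of_bool (U y s) :: real) \<in> borel_measurable (leb 0 1 \<Otimes>\<^sub>M lborel)"
    by (intro measurable_cong) (auto simp: space_pair_measure Us)
  finally have meas: "(\<lambda>(s, y). of_bool (U y s) :: real) \<in> borel_measurable (leb 0 1 \<Otimes>\<^sub>M lborel)" .
  have up: "U y s'" if "y \<in> space lborel" "U y s" "s \<le> s'" for y s s'
    using that mono_onD[OF g, of s s'] by (auto simp: U_def split: if_splits)
  have k: "of_bool (U y s) - of_bool (U y c) = indicator {g c..<g s} y - (indicator {g s..<g c} y :: real)"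
    if "s \<in> {0<..<1}" for y s
    using that c by (auto simp: Us indicator_def)
  have ind: "integrable lborel (indicator {a..<b} :: real \<Rightarrow> real)" for a b :: real
    by (cases "a \<le> b") auto
  have int: "integrable lborel (\<lambda>y. of_bool (U y s) - of_bool (U y c) :: real)" if "s \<in> {0<..<1}" for s
    unfolding k[OF that] by (intro Bochner_Integration.integrable_diff ind)
  have F: "g s - g c = (LINT y|lborel. of_bool (U y s) - of_bool (U y c))" if "s \<in> {0<..<1}" for s
    unfolding k[OF that]
    by (subst Bochner_Integration.integral_diff[OF ind ind], cases "g c \<le> g s") auto
  have i: "integrable (leb 0 1) (\<lambda>s. (g s - g c) * m s)"
    unfolding left_diff_distrib using gm m by (intro Bochner_Integration.integrable_diff integrable_mult_right)
  have inner: "(LINT s|leb 0 1. of_bool (U y s) * m s) = - prim 0 1 m (gen_inverse g y)" for y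
    by (rule upset_integral[OF m])
      (use Us gen_inverse_less[of g y] less_gen_inverse[of _ g y] g in \<open>auto simp: not_less\<close>)
  have sf: "sigma_finite_measure (lborel :: real measure)" ..
  note lc = layer_cake[of lborel U c "\<lambda>s. g s - g c" m, OF sf meas _ c int F m i, unfolded inner]
  have "integrable lborel (\<lambda>y. - prim 0 1 m (gen_inverse g y))"
    by (rule lc(1)) (rule up)
  then show "integrable lborel (\<lambda>y. prim 0 1 m (gen_inverse g y))" by simp
  have "(LINT y|lborel. - prim 0 1 m (gen_inverse g y)) = (LINT s|leb 0 1. (g s - g c) * m s)"
    by (rule lc(2)) (rule up)
  then have "(LINT y|lborel. prim 0 1 m (gen_inverse g y)) = - (LINT s|leb 0 1. (g s - g c) * m s)" by simp
  also have "(LINT s|leb 0 1. (g s - g c) * m s) = (LINT s|leb 0 1. g s * m s)"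
    unfolding left_diff_distrib using gm m by simp
  finally show "(LINT y|lborel. prim 0 1 m (gen_inverse g y)) = - (LINT s|leb 0 1. g s * m s)" .
qed

text \<open>The excess measure of \<open>s + g s\<close> is the image of Lebesgue measure under the generalized
  inverse of \<open>g\<close>; values \<open>0\<close> and \<open>1\<close>, which occur when \<open>g\<close> is bounded, are discarded.\<close>

definition stieltjes :: "(real \<Rightarrow> real) \<Rightarrow> real measure" where
  "stieltjes g = distr (restrict_space lborel {y. gen_inverse g y \<in> {0<..<1}})
     (restrict_space borel {0<..<1}) (gen_inverse g)"

lemma gen_inverse_borel: "gen_inverse g \<in> borel_measurable borel"
  by (intro borel_measurable_mono monoI gen_inverse_mono)

lemma stieltjes_measurable:
  "gen_inverse g \<in> measurable (restrict_space lborel {y. gen_inverse g y \<in> {0<..<1}}) (restrict_space borel {0<..<1})"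
  by (intro measurable_restrict_space2 measurable_restrict_space1)
    (auto simp: space_restrict_space gen_inverse_borel)

lemma stieltjes_set: "{y. gen_inverse g y \<in> {0<..<1}} \<in> sets lborel"
  using measurable_sets[OF gen_inverse_borel, of "{0<..<1}" g] by (simp add: vimage_def)

text \<open>Since \<open>\<theta>\<close> vanishes at 0 and 1, the heights discarded in
  \<open>stieltjes\<close> contribute nothing to the integral over all heights.\<close>

lemma stieltjes_integral:
  assumes "\<theta> \<in> borel_measurable borel" "\<theta> 0 = 0" "\<theta> 1 = (0::real)"
  shows "(LINT s|stieltjes g. \<theta> s) = (LINT y|lborel. \<theta> (gen_inverse g y))"
proof -
  have "(LINT s|stieltjes g. \<theta> s) = (LINT y|restrict_space lborel {y. gen_inverse g y \<in> {0<..<1}}. \<theta> (gen_inverse g y))"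
    unfolding stieltjes_def by (intro integral_distr stieltjes_measurable measurable_restrict_space1 assms)
  also have "\<dots> = (LINT y|lborel. indicator {y. gen_inverse g y \<in> {0<..<1}} y * \<theta> (gen_inverse g y))"
    using stieltjes_set by (subst integral_restrict_space) auto
  also have "\<dots> = (LINT y|lborel. \<theta> (gen_inverse g y))"
  proof (intro Bochner_Integration.integral_cong refl)
    fix y
    consider "gen_inverse g y \<in> {0<..<1}" | "gen_inverse g y = 0" | "gen_inverse g y = 1"
      using gen_inverse_bounds[of g y] by fastforce
    then show "indicator {y. gen_inverse g y \<in> {0<..<1}} y * \<theta> (gen_inverse g y) = \<theta> (gen_inverse g y)"
      by cases (use assms in auto)
  qed
  finally show ?thesis .
qed

lemma compact_in_01:
  assumes "compact K" "K \<subseteq> {0<..<1::real}"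
  obtains a b where "0 < a" "a < b" "b < 1" "K \<subseteq> {a..b}"
proof (cases "K = {}")
  case True
  then show thesis by (intro that[of "1/3" "2/3"]) auto
next
  case False
  from compact_attains_inf[OF assms(1) this] obtain a where "a \<in> K" "\<forall>t\<in>K. a \<le> t" by auto
  moreover from compact_attains_sup[OF assms(1) False] obtain b where "b \<in> K" "\<forall>t\<in>K. t \<le> b" by auto
  ultimately show thesis using assms(2)
    by (intro that[of "a / 2" "(b + 1) / 2"]) (force simp: field_simps)+
qed

text \<open>Heights whose generalized inverse lies in \<open>[a, b]\<close> are confined between the
  values of \<open>g\<close> at a point left of \<open>a\<close> and a point right of
  \<open>b\<close>, which are finite even if \<open>g\<close> is unbounded near 0 or 1.\<close>

lemma stieltjes_compact_finite:
  assumes g: "mono_on {0<..<1} g" and K: "compact K" "K \<subseteq> {0<..<1}"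
  shows "emeasure (stieltjes g) K < \<infinity>"
proof -
  obtain a b where ab: "0 < a" "a < b" "b < 1" "K \<subseteq> {a..b}" using compact_in_01[OF K] .
  have KS: "K \<in> sets (restrict_space borel {0<..<1})"
    using K by (auto simp: sets_restrict_space intro!: image_eqI[of _ _ K] borel_closed compact_imp_closed)
  have "emeasure (stieltjes g) K = emeasure (restrict_space lborel {y. gen_inverse g y \<in> {0<..<1}})
      (gen_inverse g -` K \<inter> space (restrict_space lborel {y. gen_inverse g y \<in> {0<..<1}}))"
    unfolding stieltjes_def by (rule emeasure_distr[OF stieltjes_measurable KS])
  also have "\<dots> = emeasure lborel (gen_inverse g -` K \<inter> space (restrict_space lborel {y. gen_inverse g y \<in> {0<..<1}}))"
    using stieltjes_set by (intro emeasure_restrict_space) (auto simp: space_restrict_space)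
  also have "\<dots> \<le> emeasure lborel {g (a / 2)..g ((1 + b) / 2)}"
  proof (rule emeasure_mono)
    show "gen_inverse g -` K \<inter> space (restrict_space lborel {y. gen_inverse g y \<in> {0<..<1}}) \<subseteq> {g (a / 2)..g ((1 + b) / 2)}"
    proof
      fix y assume "y \<in> gen_inverse g -` K \<inter> space (restrict_space lborel {y. gen_inverse g y \<in> {0<..<1}})"
      then have "a \<le> gen_inverse g y" "gen_inverse g y \<le> b" using ab by auto
      then show "y \<in> {g (a / 2)..g ((1 + b) / 2)}"
        using less_gen_inverse[of "a / 2" g y] gen_inverse_less[of g y "(1 + b) / 2"] g ab
        by (auto simp: field_simps intro!: less_imp_le)
    qed
  qed simp
  also have "\<dots> < \<infinity>" by (simp add: emeasure_lborel_Icc_eq)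
  finally show ?thesis .
qed

section \<open>Test functions and square integrable functions on the unit interval\<close>

lemma integrable_id_mult_leb:
  assumes "integrable (leb 0 1) m" shows "integrable (leb 0 1) (\<lambda>s. s * m s :: real)"
  by (rule integrable_continuous_mult[OF assms]) (intro continuous_intros)

lemma Lp2_iff: "Lp 2 M f \<longleftrightarrow> f \<in> borel_measurable M \<and> integrable M (\<lambda>x. (f x)\<^sup>2)"
  by (simp add: Lp_def)

lemma square_integrable_mult:
  fixes f g :: "'a \<Rightarrow> real"
  assumes "Lp 2 M f" "Lp 2 M g"
  shows "integrable M (\<lambda>x. f x * g x)"
proof (rule Bochner_Integration.integrable_bound[of M "\<lambda>x. (f x)\<^sup>2 + (g x)\<^sup>2"])
  show "AE x in M. norm (f x * g x) \<le> norm ((f x)\<^sup>2 + (g x)\<^sup>2)"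
  proof (rule AE_I2)
    fix x
    have "0 \<le> (\<bar>f x\<bar> - \<bar>g x\<bar>)\<^sup>2" by simp
    also have "\<dots> = (f x)\<^sup>2 + (g x)\<^sup>2 - 2 * \<bar>f x * g x\<bar>" by (simp add: power2_diff abs_mult)
    finally have "2 * \<bar>f x * g x\<bar> \<le> (f x)\<^sup>2 + (g x)\<^sup>2" by simp
    moreover have "(f x)\<^sup>2 + (g x)\<^sup>2 \<ge> 0" by simp
    ultimately show "norm (f x * g x) \<le> norm ((f x)\<^sup>2 + (g x)\<^sup>2)" by simp
  qed
qed (use assms in \<open>auto simp: Lp2_iff\<close>)

lemma (in finite_measure) Lp2_integrable:
  assumes "Lp 2 M f" shows "integrable M f"
  using square_integrable_mult[OF assms, of "\<lambda>_. 1"] by (simp add: Lp2_iff)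

lemmas Lp2_leb_integrable = finite_measure.Lp2_integrable[OF finite_measure_leb]

lemma test_function_prim:
  assumes "test_function 0 1 \<theta>"
  shows "integrable (leb 0 1) (deriv \<theta>)" "(LINT s|leb 0 1. deriv \<theta> s) = 0"
    "s \<in> {0..1} \<Longrightarrow> prim 0 1 (deriv \<theta>) s = \<theta> s"
proof -
  note tf = test_function_facts[OF assms]
  show i: "integrable (leb 0 1) (deriv \<theta>)" by (intro integrable_continuous_leb tf)
  show "(LINT s|leb 0 1. deriv \<theta> s) = 0" by (subst leb_FTC[OF _ tf(1,2)]) (simp_all add: tf(4))
  show "prim 0 1 (deriv \<theta>) s = \<theta> s" if s: "s \<in> {0..1}"
  proof -
    have "prim 0 1 (deriv \<theta>) s = (LINT r|leb 0 1. indicator {0<..<s} r * deriv \<theta> r)"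
      unfolding prim_def
    proof (intro integral_cong_AE borel_measurable_times measurable_leb[OF borel_measurable_indicator]
        borel_measurable_integrable[OF i])
      show "AE r in leb 0 1. indicator {..s} r * deriv \<theta> r = indicator {0<..<s} r * deriv \<theta> r"
        using AE_leb_neq[of s 0 1] AE_space[of "leb 0 1"]
        by eventually_elim (auto simp: indicator_def)
    qed auto
    also have "\<dots> = (LINT r|leb 0 s. deriv \<theta> r)" using s by (intro leb_sub_eq) auto
    also have "\<dots> = \<theta> s - \<theta> 0" using s by (intro leb_FTC tf) auto
    finally show ?thesis by (simp add: tf(4))
  qed
qed

lemma prim_one: "s \<in> {0<..<1} \<Longrightarrow> prim 0 1 (\<lambda>_. 1) s = s"
proof -
  assume s: "s \<in> {0<..<1}"
  have "prim 0 1 (\<lambda>_. 1) s = (LINT r|lborel. indicator {0<..s} r)"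
    unfolding prim_def leb_integral
    by (intro Bochner_Integration.integral_cong refl) (use s in \<open>auto simp: indicator_def\<close>)
  then show ?thesis using s by simp
qed

text \<open>For \<open>m = deriv \<theta>\<close> the primitive is \<open>\<theta>\<close> itself,
  so the layer-cake formula is the required identity for the part \<open>g\<close>, while the part
  \<open>s\<close> produces the Lebesgue integral of \<open>\<theta>\<close>.\<close>

lemma excess_measure_stieltjes:
  assumes g: "mono_on {0<..<1} g" and gi: "Lp 2 (leb 0 1) g"
    and f: "AE s in leb 0 1. f s = s + g s" "f \<in> borel_measurable (leb 0 1)"
  shows "excess_measure f (stieltjes g)"
  unfolding excess_measure_def
proof (intro conjI allI impI)
  show "sets (stieltjes g) = sets (restrict_space borel {0<..<1})" by (simp add: stieltjes_def)
  show "emeasure (stieltjes g) K < \<infinity>" if "compact K" "K \<subseteq> {0<..<1}" for K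
    by (rule stieltjes_compact_finite[OF g that])
  fix \<theta> assume \<theta>: "test_function 0 1 \<theta>"
  note tf = test_function_facts[OF \<theta>] and tp = test_function_prim[OF \<theta>]
  have d2: "Lp 2 (leb 0 1) (deriv \<theta>)"
    unfolding Lp2_iff using tp(1) by (auto intro!: integrable_continuous_leb continuous_on_power tf(2))
  note gm = square_integrable_mult[OF gi d2]
  have "(LINT s|stieltjes g. \<theta> s) = (LINT y|lborel. prim 0 1 (deriv \<theta>) (gen_inverse g y))"
    using tf(6) gen_inverse_bounds by (subst stieltjes_integral) (auto simp: tf(4) tp(3))
  also have "\<dots> = - (LINT s|leb 0 1. g s * deriv \<theta> s)"
    by (rule mono_layer_cake(2)[OF g tp(1,2) gm])
  finally have 1: "(LINT s|stieltjes g. \<theta> s) = - (LINT s|leb 0 1. g s * deriv \<theta> s)" .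
  have one: "integrable (leb 0 1) (\<lambda>_. 1::real)"
    using finite_measure.integrable_const[OF finite_measure_leb] by blast
  have "(LINT s|leb 0 1. (0 + prim 0 1 (\<lambda>_. 1) s) * deriv \<theta> s) = - (LINT s|leb 0 1. 1 * \<theta> s)"
    by (rule prim_weak_deriv[OF _ one \<theta>]) simp
  moreover have "(LINT s|leb 0 1. (0 + prim 0 1 (\<lambda>_. 1) s) * deriv \<theta> s) = (LINT s|leb 0 1. s * deriv \<theta> s)"
    by (intro Bochner_Integration.integral_cong refl) (simp add: prim_one)
  ultimately have 2: "(LINT s|leb 0 1. s * deriv \<theta> s) = - (LINT s|leb 0 1. \<theta> s)" by simp
  have "(LINT s|leb 0 1. f s * deriv \<theta> s) = (LINT s|leb 0 1. s * deriv \<theta> s + g s * deriv \<theta> s)"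
    using f borel_measurable_integrable[OF tp(1)] borel_measurable_integrable[OF gm]
    by (intro integral_cong_AE borel_measurable_times[OF f(2)] borel_measurable_add
        borel_measurable_integrable[OF integrable_id_mult_leb[OF tp(1)]]) (auto simp: ring_distribs)
  also have "\<dots> = (LINT s|leb 0 1. s * deriv \<theta> s) + (LINT s|leb 0 1. g s * deriv \<theta> s)"
    by (rule Bochner_Integration.integral_add[OF integrable_id_mult_leb[OF tp(1)] gm])
  finally show "- (LINT s|leb 0 1. f s * deriv \<theta> s) = (LINT s|leb 0 1. \<theta> s) + (LINT s|stieltjes g. \<theta> s)"
    using 1 2 by simp
qed

lemma Lp2_add: "Lp 2 M f \<Longrightarrow> Lp 2 M g \<Longrightarrow> Lp 2 M (\<lambda>x. f x + g x)"
proof -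
  assume a: "Lp 2 M f" "Lp 2 M g"
  then have "integrable M (\<lambda>x. (f x)\<^sup>2 + 2 * (f x * g x) + (g x)\<^sup>2)"
    by (intro Bochner_Integration.integrable_add integrable_mult_right square_integrable_mult) (auto simp: Lp2_iff)
  with a show "Lp 2 M (\<lambda>x. f x + g x)" by (auto simp: Lp2_iff power2_sum ac_simps)
qed

lemma Lp2_cmult: "Lp 2 M f \<Longrightarrow> Lp 2 M (\<lambda>x. c * f x)"
  by (auto simp: Lp2_iff power_mult_distrib)

lemma Lp2_diff: "Lp 2 M f \<Longrightarrow> Lp 2 M g \<Longrightarrow> Lp 2 M (\<lambda>x. f x - g x)"
  using Lp2_add[OF _ Lp2_cmult[of M g "-1"], of f] by simp

lemma Lp2_uminus: "Lp 2 M f \<Longrightarrow> Lp 2 M (\<lambda>x. - f x)"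
  using Lp2_cmult[of M f "-1"] by simp

lemma Lp2_continuous: "continuous_on {a..b} f \<Longrightarrow> Lp 2 (leb a b) f"
  unfolding Lp2_iff by (auto intro!: integrable_continuous_leb continuous_on_power
      borel_measurable_integrable[OF integrable_continuous_leb])

lemma Lp2_const_leb: "Lp 2 (leb a b) (\<lambda>_. c)" and Lp2_id_leb: "Lp 2 (leb a b) (\<lambda>s. s)"
  by (intro Lp2_continuous continuous_intros)+

lemma Lp2_cong_AE:
  "Lp 2 M f \<Longrightarrow> AE x in M. f x = g x \<Longrightarrow> g \<in> borel_measurable M \<Longrightarrow> Lp 2 M g"
  unfolding Lp2_iff by (auto intro!: integrable_cong_AE_imp[of M "\<lambda>x. (f x)\<^sup>2"])

lemma Lp2_cong: "(\<And>x. x \<in> space M \<Longrightarrow> f x = g x) \<Longrightarrow> Lp 2 M f \<longleftrightarrow> Lp 2 M g"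
  unfolding Lp2_iff by (intro conj_cong measurable_cong Bochner_Integration.integrable_cong) auto

text \<open>Extends the defining identity of the excess measure from test functions to primitives of
  mean-zero L2 functions, the regularity that the multiplier has. The distribution function
  \<open>F\<close> of \<open>\<mu>\<close> satisfies the same identity on test functions, so
  \<open>f s - s - F s\<close> is constant by du Bois-Reymond. Thus \<open>F\<close> is square
  integrable, and the layer-cake formula applies to every \<open>m\<close>.\<close>

lemma excess_measure_integral:
  assumes ex: "excess_measure f \<mu>" and f2: "Lp 2 (leb 0 1) f"
    and m2: "Lp 2 (leb 0 1) m" and m0: "(LINT s|leb 0 1. m s) = 0"
  shows "integrable \<mu> (prim 0 1 m)"
    and "(LINT y|\<mu>. prim 0 1 m y) = - (LINT s|leb 0 1. (f s - s) * m s)"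
proof -
  have sets\<mu>: "sets \<mu> = sets (restrict_space borel {0<..<1::real})"
    and fin: "\<And>K. compact K \<Longrightarrow> K \<subseteq> {0<..<1} \<Longrightarrow> emeasure \<mu> K < \<infinity>"
    and ibp: "\<And>\<theta>. test_function 0 1 \<theta> \<Longrightarrow>
        - (LINT s|leb 0 1. f s * deriv \<theta> s) = (LINT s|leb 0 1. \<theta> s) + (LINT s|\<mu>. \<theta> s)"
    using ex by (auto simp: excess_measure_def)
  have space\<mu>: "space \<mu> = {0<..<1}" using sets_eq_imp_space_eq[OF sets\<mu>] by (simp add: space_restrict_space)
  have in_sets: "A \<in> sets \<mu>" if "A \<in> sets borel" "A \<subseteq> {0<..<1}" for A
    using that by (auto simp: sets\<mu> sets_restrict_space intro!: image_eqI[of _ _ A])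
  have sf: "sigma_finite_measure \<mu>"
  proof (standard, intro exI conjI)
    define J where "J n = {1 / real (n + 2)..1 - 1 / real (n + 2)}" for n :: nat
    have J: "J n \<subseteq> {0<..<1}" "compact (J n)" for n
    proof -
      have "1 / real (n + 2) > 0" by simp
      then show "J n \<subseteq> {0<..<1}" unfolding J_def by (intro subsetI) (simp only: atLeastAtMost_iff greaterThanLessThan_iff, linarith)
      show "compact (J n)" by (simp add: J_def)
    qed
    show "countable (range J)" by simp
    show "range J \<subseteq> sets \<mu>" using J by (intro image_subsetI in_sets) (auto intro!: borel_closed compact_imp_closed)
    show "\<Union> (range J) = space \<mu>" unfolding space\<mu>
    proof (intro equalityI subsetI)
      fix x assume "x \<in> {0<..<1::real}"
      then obtain n where n: "inverse (real (Suc n)) < min x (1 - x)"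
        using reals_Archimedean[of "min x (1 - x)"] by auto
      have "1 / real (n + 2) \<le> inverse (real (Suc n))" by (simp add: field_simps)
      then have "x \<in> J n" using n by (simp only: J_def atLeastAtMost_iff) linarith
      then show "x \<in> \<Union> (range J)" by blast
    qed (use J in blast)
    show "\<forall>a\<in>range J. emeasure \<mu> a \<noteq> \<infinity>"
      using fin[OF J(2,1)] by (auto simp: less_top[symmetric])
  qed
  \<comment> \<open>\<open>\<mu>\<close> may have infinite mass near both endpoints, so its
    distribution function is normalised at an interior point.\<close>
  define c :: real where "c = 1 / 2"
  have c: "c \<in> {0<..<1}" by (simp add: c_def)
  define U where "U y s = (y \<le> s)" for y s :: real
  define k where "k y s = of_bool (U y s) - (of_bool (U y c) :: real)" for y s
  define F where "F s = (LINT y|\<mu>. k y s)" for s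
  have idm: "(\<lambda>y. y) \<in> borel_measurable \<mu>"
    by (subst measurable_cong_sets[OF sets\<mu> refl]) (auto intro: measurable_restrict_space1)
  have idl: "(\<lambda>s. s) \<in> borel_measurable (leb 0 1)" by (rule measurable_leb) simp
  have meas: "(\<lambda>(s, y). of_bool (U y s) :: real) \<in> borel_measurable (leb 0 1 \<Otimes>\<^sub>M \<mu>)"
    unfolding U_def case_prod_beta'
    using measurable_compose[OF measurable_fst idl, of \<mu>] measurable_compose[OF measurable_snd idm, of "leb 0 1"]
    by measurable
  have kdiff_int: "integrable \<mu> (indicator {a<..b} :: real \<Rightarrow> real)" if "a \<in> {0<..<1}" "b \<in> {0<..<1}" for a b
  proof -
    have "emeasure \<mu> {a<..b} \<le> emeasure \<mu> {a..b}" using that by (intro emeasure_mono in_sets) auto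
    also have "\<dots> < \<infinity>" using that by (intro fin) auto
    finally show ?thesis using that by (intro integrable_real_indicator in_sets) auto
  qed
  have k: "k y s = indicator {c<..s} y - (indicator {s<..c} y :: real)" for y s
    by (auto simp: k_def U_def indicator_def)
  have kint: "integrable \<mu> (\<lambda>y. k y s)" if "s \<in> {0<..<1}" for s
    unfolding k using that c by (intro Bochner_Integration.integrable_diff kdiff_int)
  have Fmono: "mono_on {0<..<1} F"
    unfolding F_def by (intro mono_onI integral_mono kint) (auto simp: k_def U_def)
  have Fm: "F \<in> borel_measurable (leb 0 1)" by (rule mono_on_leb_measurable[OF Fmono])
  have inner: "(LINT s|leb 0 1. of_bool (U y s) * m s) = - prim 0 1 m y"
    if "integrable (leb 0 1) m" "(LINT s|leb 0 1. m s) = 0" for m y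
    by (rule upset_integral[OF that]) (auto simp: U_def)
  have layer: "integrable \<mu> (prim 0 1 m)" "(LINT y|\<mu>. prim 0 1 m y) = - (LINT s|leb 0 1. F s * m s)"
    if m: "integrable (leb 0 1) m" "(LINT s|leb 0 1. m s) = 0" and Fm': "integrable (leb 0 1) (\<lambda>s. F s * m s)" for m
  proof -
    have up: "U y s'" if "y \<in> space \<mu>" "U y s" "s \<le> s'" for y s s' using that by (simp add: U_def)
    note lc = layer_cake[of \<mu> U c F m, OF sf meas _ c kint[unfolded k_def] F_def[unfolded k_def] m Fm', unfolded inner[OF m]]
    have "integrable \<mu> (\<lambda>y. - prim 0 1 m y)" by (rule lc(1)) (rule up)
    then show "integrable \<mu> (prim 0 1 m)" by simp
    have "(LINT y|\<mu>. - prim 0 1 m y) = (LINT s|leb 0 1. F s * m s)" by (rule lc(2)) (rule up)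
    then show "(LINT y|\<mu>. prim 0 1 m y) = - (LINT s|leb 0 1. F s * m s)" by simp
  qed
  have Fbound: "\<bar>F s\<bar> \<le> \<bar>F a\<bar> + \<bar>F b\<bar>" if "0 < a" "b < 1" "s \<in> {a..b}" for a b s
    using mono_onD[OF Fmono, of a s] mono_onD[OF Fmono, of s b] that by auto
  \<comment> \<open>Integrability of \<open>F\<close> up to the endpoints is not yet known. A test
    function sees it only on a compact subinterval, where monotonicity bounds it.\<close>
  have Ftest: "integrable (leb 0 1) (\<lambda>s. F s * deriv \<theta> s)" if \<theta>: "test_function 0 1 \<theta>" for \<theta>
  proof -
    note tf = test_function_facts[OF \<theta>]
    obtain a b where ab: "0 < a" "a < b" "b < 1" "closure {x. \<theta> x \<noteq> 0} \<subseteq> {a..b}"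
      using compact_in_01[of "closure {x. \<theta> x \<noteq> 0}"] \<theta> by (auto simp: test_function_def)
    have d0: "deriv \<theta> x = 0" if "x \<notin> {a..b}" for x
    proof -
      have "((\<lambda>_. 0) has_real_derivative 0) (at x)" by simp
      then have "(\<theta> has_real_derivative 0) (at x)"
        by (rule has_field_derivative_transform_within_open[of _ _ _ "- {a..b}"])
          (use that ab closure_subset[of "{x. \<theta> x \<noteq> 0}"] in auto)
      then show ?thesis by (rule DERIV_imp_deriv)
    qed
    obtain C where C: "C \<ge> 0" "\<And>x. x \<in> {0..1} \<Longrightarrow> \<bar>deriv \<theta> x\<bar> \<le> C"
      using continuous_bounded_Icc[OF tf(2)] by metis
    show ?thesis
    proof (rule finite_measure.integrable_const_bound[OF finite_measure_leb, where B="(\<bar>F a\<bar> + \<bar>F b\<bar>) * C"])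
      show "AE s in leb 0 1. norm (F s * deriv \<theta> s) \<le> (\<bar>F a\<bar> + \<bar>F b\<bar>) * C"
      proof (rule AE_I2)
        fix s assume "s \<in> space (leb 0 1)"
        then show "norm (F s * deriv \<theta> s) \<le> (\<bar>F a\<bar> + \<bar>F b\<bar>) * C"
          using d0[of s] Fbound[OF ab(1,3), of s] C by (cases "s \<in> {a..b}") (auto simp: abs_mult intro!: mult_mono)
      qed
      show "(\<lambda>s. F s * deriv \<theta> s) \<in> borel_measurable (leb 0 1)"
        by (intro borel_measurable_times Fm measurable_leb tf(5))
    qed
  qed
  have f1: "integrable (leb 0 1) f" by (rule Lp2_leb_integrable[OF f2])
  have id1: "integrable (leb 0 1) (\<lambda>s. s)" by (rule Lp2_leb_integrable[OF Lp2_id_leb])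
  obtain \<kappa> where \<kappa>: "AE s in leb 0 1. f s - s - F s = \<kappa>"
  proof (rule du_Bois_Reymond[of 0 1 "\<lambda>s. f s - s - F s"])
    fix a b :: real assume ab: "0 < a" "b < 1"
    have sub: "integrable (leb a b) h" if hi: "integrable (leb 0 1) h" for h :: "real \<Rightarrow> real"
      using integrable_bounded_mult(1)[OF hi measurable_leb[OF borel_measurable_indicator], of "{a<..<b}" 1]
        leb_sub_eq(2)[of 0 a b 1 h] ab by simp
    have "integrable (leb 0 1) (\<lambda>s. indicator {a<..<b} s * F s)"
    proof (rule finite_measure.integrable_const_bound[OF finite_measure_leb, where B="\<bar>F a\<bar> + \<bar>F b\<bar>"])
      show "AE s in leb 0 1. norm (indicator {a<..<b} s * F s) \<le> \<bar>F a\<bar> + \<bar>F b\<bar>"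
        using Fbound[OF ab] by (auto simp: indicator_def intro!: AE_I2)
    qed (intro borel_measurable_times Fm measurable_leb borel_measurable_indicator, simp)
    then have Fi: "integrable (leb a b) F" using leb_sub_eq(2)[of 0 a b 1 F] ab by simp
    show "integrable (leb a b) (\<lambda>s. f s - s - F s)"
      by (intro Bochner_Integration.integrable_diff[OF Bochner_Integration.integrable_diff Fi] sub f1 id1)
  next
    fix \<theta> assume \<theta>: "test_function 0 1 \<theta>"
    note tf = test_function_facts[OF \<theta>] and tp = test_function_prim[OF \<theta>]
    have d2: "Lp 2 (leb 0 1) (deriv \<theta>)" by (intro Lp2_continuous tf)
    have "(LINT s|\<mu>. \<theta> s) = (LINT s|\<mu>. prim 0 1 (deriv \<theta>) s)"
      by (intro Bochner_Integration.integral_cong refl) (simp add: tp(3) space\<mu>)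
    also have "\<dots> = - (LINT s|leb 0 1. F s * deriv \<theta> s)" by (rule layer(2)[OF tp(1,2) Ftest[OF \<theta>]])
    finally have 1: "(LINT s|\<mu>. \<theta> s) = - (LINT s|leb 0 1. F s * deriv \<theta> s)" .
    have one: "integrable (leb 0 1) (\<lambda>_. 1::real)" by (rule Lp2_leb_integrable[OF Lp2_const_leb])
    have "(LINT s|leb 0 1. (0 + prim 0 1 (\<lambda>_. 1) s) * deriv \<theta> s) = - (LINT s|leb 0 1. 1 * \<theta> s)"
      by (rule prim_weak_deriv[OF _ one \<theta>]) simp
    moreover have "(LINT s|leb 0 1. (0 + prim 0 1 (\<lambda>_. 1) s) * deriv \<theta> s) = (LINT s|leb 0 1. s * deriv \<theta> s)"
      by (intro Bochner_Integration.integral_cong refl) (simp add: prim_one)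
    ultimately have 2: "(LINT s|leb 0 1. s * deriv \<theta> s) = - (LINT s|leb 0 1. \<theta> s)" by simp
    have i: "integrable (leb 0 1) (\<lambda>s. f s * deriv \<theta> s)" by (rule square_integrable_mult[OF f2 d2])
    have "(LINT s|leb 0 1. (f s - s - F s) * deriv \<theta> s)
      = (LINT s|leb 0 1. f s * deriv \<theta> s) - (LINT s|leb 0 1. s * deriv \<theta> s) - (LINT s|leb 0 1. F s * deriv \<theta> s)"
      unfolding left_diff_distrib
      using i integrable_id_mult_leb[OF tp(1)] Ftest[OF \<theta>] by simp
    also have "\<dots> = 0" using ibp[OF \<theta>] 1 2 by simp
    finally show "(LINT s|leb 0 1. (f s - s - F s) * deriv \<theta> s) = 0" .
  qed auto
  have mi: "integrable (leb 0 1) m" by (rule Lp2_leb_integrable[OF m2])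
  have fid: "Lp 2 (leb 0 1) (\<lambda>s. f s - s)" by (intro Lp2_diff f2 Lp2_id_leb)
  have Feq: "AE s in leb 0 1. (f s - s) * m s - \<kappa> * m s = F s * m s"
    using \<kappa> by eventually_elim (auto simp: algebra_simps)
  have mm: "(\<lambda>s. F s * m s) \<in> borel_measurable (leb 0 1)"
    using mi by (intro borel_measurable_times Fm) auto
  have gi: "integrable (leb 0 1) (\<lambda>s. (f s - s) * m s - \<kappa> * m s)"
    by (intro Bochner_Integration.integrable_diff square_integrable_mult[OF fid m2] integrable_mult_right mi)
  \<comment> \<open>Only now, with \<open>F\<close> identified with \<open>f s - s\<close> up to a
    constant, does square integrability of \<open>f\<close> make \<open>F s * m s\<close> integrable
    for general \<open>m\<close>.\<close>
  have Fmi: "integrable (leb 0 1) (\<lambda>s. F s * m s)"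
    by (rule integrable_cong_AE_imp[OF gi mm]) (use Feq in \<open>auto elim: AE_mp\<close>)
  show "integrable \<mu> (prim 0 1 m)" by (rule layer(1)[OF mi m0 Fmi])
  have "(LINT y|\<mu>. prim 0 1 m y) = - (LINT s|leb 0 1. F s * m s)" by (rule layer(2)[OF mi m0 Fmi])
  also have "(LINT s|leb 0 1. F s * m s) = (LINT s|leb 0 1. (f s - s) * m s - \<kappa> * m s)"
    using Feq gi mm by (intro integral_cong_AE) (auto elim: AE_mp)
  also have "\<dots> = (LINT s|leb 0 1. (f s - s) * m s)"
    using square_integrable_mult[OF fid m2] mi m0 by simp
  finally show "(LINT y|\<mu>. prim 0 1 m y) = - (LINT s|leb 0 1. (f s - s) * m s)" .
qed

text \<open>Derivatives of the nonnegative functions in \<open>H\<^sup>1\<^sub>0(0,1)\<close>. In terms of these, \<open>\<partial>\<^sub>s X \<ge> 1\<close>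
  says that \<open>\<integral> (X - s) m ds \<le> 0\<close> for all of them, and \<open>\<Lambda> (1 - \<partial>\<^sub>s X) = 0\<close> that equality holds for
  \<open>m = \<partial>\<^sub>s \<Lambda>\<close>.\<close>

definition admissible :: "(real \<Rightarrow> real) \<Rightarrow> bool" where
  "admissible m \<longleftrightarrow> Lp 2 (leb 0 1) m \<and> (LINT s|leb 0 1. m s) = 0 \<and> (\<forall>s\<in>{0..1}. prim 0 1 m s \<ge> 0)"

text \<open>By the layer-cake formula the integral is minus an integral of values of the primitive
  of \<open>m\<close>, all of them nonnegative.\<close>

lemma mono_admissible_le_0:
  assumes g: "mono_on {0<..<1} g" "Lp 2 (leb 0 1) g" and m: "admissible m"
  shows "(LINT s|leb 0 1. g s * m s) \<le> 0"
proof -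
  have "0 \<le> (LINT y|lborel. prim 0 1 m (gen_inverse g y))"
    using m gen_inverse_bounds by (intro Bochner_Integration.integral_nonneg) (auto simp: admissible_def)
  also have "\<dots> = - (LINT s|leb 0 1. g s * m s)"
    using m g by (intro mono_layer_cake square_integrable_mult) (auto simp: admissible_def Lp2_leb_integrable)
  finally show ?thesis by simp
qed

text \<open>Moves the constraint from measures to integrals against admissible functions. The sign
  is that of the integral of \<open>prim 0 1 m\<close> against \<open>\<mu>\<close>; a null density
  means that this primitive vanishes \<open>\<mu>\<close>-almost everywhere, which gives
  equality.\<close>

lemma excess_measure_admissible:
  assumes ex: "excess_measure f \<mu>" "Lp 2 (leb 0 1) f" and m: "admissible m"
  shows "(LINT s|leb 0 1. (f s - s) * m s) \<le> 0"
    and "density \<mu> (\<lambda>s. ennreal (\<Lambda> s)) = null_measure \<mu> \<Longrightarrow> (\<And>s. s \<in> {0..1} \<Longrightarrow> \<Lambda> s = prim 0 1 m s) \<Longrightarrow>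
      (LINT s|leb 0 1. (f s - s) * m s) = 0"
proof -
  have space\<mu>: "space \<mu> = {0<..<1}"
    using ex(1) sets_eq_imp_space_eq[of \<mu> "restrict_space borel {0<..<1}"]
    by (simp add: space_restrict_space excess_measure_def)
  have m': "Lp 2 (leb 0 1) m" "(LINT s|leb 0 1. m s) = 0" "\<And>s. s \<in> {0..1} \<Longrightarrow> prim 0 1 m s \<ge> 0"
    using m by (auto simp: admissible_def)
  note em = excess_measure_integral[OF ex m'(1,2)]
  have "0 \<le> (LINT y|\<mu>. prim 0 1 m y)"
    by (rule integral_nonneg_AE, rule AE_I2) (auto simp: space\<mu> intro!: m')
  then show "(LINT s|leb 0 1. (f s - s) * m s) \<le> 0" using em(2) by simp
  assume null: "density \<mu> (\<lambda>s. ennreal (\<Lambda> s)) = null_measure \<mu>" and \<Lambda>: "\<And>s. s \<in> {0..1} \<Longrightarrow> \<Lambda> s = prim 0 1 m s"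
  have pm: "(\<lambda>s. ennreal (prim 0 1 m s)) \<in> borel_measurable \<mu>" using em(1) by simp
  then have \<Lambda>m: "(\<lambda>s. ennreal (\<Lambda> s)) \<in> borel_measurable \<mu>"
    by (rule measurable_cong[THEN iffD1, rotated]) (auto simp: \<Lambda> space\<mu>)
  have "(\<integral>\<^sup>+ s. ennreal (\<Lambda> s) \<partial>\<mu>) = emeasure (density \<mu> (\<lambda>s. ennreal (\<Lambda> s))) (space \<mu>)"
    by (subst emeasure_density[OF \<Lambda>m]) (auto intro!: nn_integral_cong)
  also have "\<dots> = 0" by (simp add: null)
  finally have "AE s in \<mu>. ennreal (\<Lambda> s) = 0" using \<Lambda>m by (simp add: nn_integral_0_iff_AE)
  then have "AE s in \<mu>. prim 0 1 m s = 0"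
    using AE_space by eventually_elim (use m'(3) in \<open>auto simp: \<Lambda> space\<mu> ennreal_eq_0_iff intro!: antisym\<close>)
  then have "(LINT y|\<mu>. prim 0 1 m y) = 0" by (rule integral_eq_zero_AE)
  then show "(LINT s|leb 0 1. (f s - s) * m s) = 0" using em(2) by simp
qed

text \<open>The converse direction: \<open>mono_admissible_le_0\<close> and \<open>ge\<close> force
  equality, and a nonnegative function with integral 0 vanishes at almost every height.\<close>

lemma stieltjes_density_null:
  assumes g: "mono_on {0<..<1} g" "Lp 2 (leb 0 1) g" and m: "admissible m"
    and ge: "(LINT s|leb 0 1. g s * m s) \<ge> 0"
  shows "density (stieltjes g) (\<lambda>s. ennreal (prim 0 1 m s)) = null_measure (stieltjes g)"
proof -
  have mi: "integrable (leb 0 1) m" using m by (auto simp: admissible_def Lp2_leb_integrable)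
  note lc = mono_layer_cake[OF g(1) mi _ square_integrable_mult[OF g(2)]]
  have nn: "AE y in lborel. 0 \<le> prim 0 1 m (gen_inverse g y)"
    using m gen_inverse_bounds by (auto simp: admissible_def)
  have "(LINT y|lborel. prim 0 1 m (gen_inverse g y)) = 0"
    using lc(2) m ge mono_admissible_le_0[OF g m] by (auto simp: admissible_def)
  then have ae: "AE y in lborel. prim 0 1 m (gen_inverse g y) = 0"
    using lc(1) m nn by (subst (asm) integral_nonneg_eq_0_iff_AE) (auto simp: admissible_def)
  have pm: "prim 0 1 m \<in> borel_measurable borel"
    by (intro borel_measurable_continuous_onI prim_continuous mi)
  then have pm': "prim 0 1 m \<in> borel_measurable (restrict_space borel {0<..<1})"
    by (rule measurable_restrict_space1)
  have "AE s in stieltjes g. prim 0 1 m s = 0"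
    unfolding stieltjes_def
  proof (subst AE_distr_iff[OF stieltjes_measurable])
    show "{x \<in> space (restrict_space borel {0<..<1}). prim 0 1 m x = 0} \<in> sets (restrict_space borel {0<..<1})"
      using pm' by measurable
    show "AE y in restrict_space lborel {y. gen_inverse g y \<in> {0<..<1}}. prim 0 1 m (gen_inverse g y) = 0"
      using ae stieltjes_set by (subst AE_restrict_space_iff) (auto elim: AE_mp)
  qed
  moreover have "prim 0 1 m \<in> borel_measurable (stieltjes g)" using pm' by (simp add: stieltjes_def)
  ultimately have "density (stieltjes g) (\<lambda>s. ennreal (prim 0 1 m s)) = density (stieltjes g) (\<lambda>_. 0)"
    by (intro density_cong) (auto elim: AE_mp)
  then show ?thesis by (simp add: null_measure_eq_density)
qed

section \<open>Monotone representatives\<close>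

lemma AE_leb_dense:
  assumes "AE s in leb A B. P s" "A \<le> a" "a < b" "b \<le> B"
  obtains s where "a < s" "s < b" "P s"
proof -
  have "\<not> (\<forall>s\<in>{a<..<b}. \<not> P s)"
  proof
    assume *: "\<forall>s\<in>{a<..<b}. \<not> P s"
    have "AE s in lborel. s \<in> {A<..<B} \<longrightarrow> P s" using assms(1) by (subst (asm) AE_restrict_space_iff) auto
    then have "AE s in lborel. s \<notin> {a<..<b}" by eventually_elim (use * assms in force)
    then have "emeasure lborel {a<..<b} = 0" by (subst (asm) AE_iff_measurable[of "{a<..<b}"]) auto
    then show False using assms by simp
  qed
  then show thesis using that by auto
qed

text \<open>Almost everywhere limits of monotone functions are ordered only on a set
  \<open>S\<close> of full measure, whereas the Stieltjes construction is applied to functions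
  monotone at every point. The supremum over the points of \<open>S\<close> to the left is such a
  function; points of \<open>S\<close> further to the right bound it.\<close>

lemma AE_mono_extend:
  fixes h :: "real \<Rightarrow> real"
  assumes S: "AE s in leb 0 1. s \<in> S" and h: "\<And>s s'. s \<in> S \<Longrightarrow> s' \<in> S \<Longrightarrow> s \<in> {0<..<1} \<Longrightarrow> s' \<in> {0<..<1} \<Longrightarrow> s < s' \<Longrightarrow> h s \<le> h s'"
  obtains g where "mono_on {0<..<1} g" "AE s in leb 0 1. g s = h s"
proof
  define A where "A s = {r. r \<in> S \<and> 0 < r \<and> r \<le> s}" for s :: real
  define g where "g s = Sup (h ` A s)" for s
  have ne: "A s \<noteq> {}" if s: "s \<in> {0<..<1}" for s
  proof -
    obtain r where "0 < r" "r < s" "r \<in> S" by (rule AE_leb_dense[OF S, of 0 s]) (use s in auto)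
    then show ?thesis by (auto simp: A_def intro!: exI[of _ r])
  qed
  have bdd: "bdd_above (h ` A s)" if s: "s \<in> {0<..<1}" for s
  proof -
    obtain s' where "s < s'" "s' < 1" "s' \<in> S" 
      by (rule AE_leb_dense[OF S, of s 1]) (use s in auto)
    then show ?thesis using s by (intro bdd_aboveI[of _ "h s'"]) (auto simp: A_def intro!: h)
  qed
  show "mono_on {0<..<1} g"
    unfolding g_def by (intro mono_onI cSup_subset_mono bdd) (use ne in \<open>auto simp: A_def\<close>)
  show "AE s in leb 0 1. g s = h s"
    using S AE_space[of "leb 0 1"]
  proof eventually_elim
    fix s assume s: "s \<in> S" "s \<in> space (leb 0 1)"
    have "Sup (h ` A s) = h s"
    proof (intro cSup_eq_maximum)
      show "h s \<in> h ` A s" using s by (auto simp: A_def)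
      fix x assume "x \<in> h ` A s"
      then obtain r where r: "x = h r" "r \<in> S" "0 < r" "r \<le> s" by (auto simp: A_def)
      show "x \<le> h s"
      proof (cases "r = s")
        case False
        then have "h r \<le> h s" using r s by (intro h) auto
        then show ?thesis using r by simp
      qed (use r in simp)
    qed
    then show "g s = h s" by (simp add: g_def)
  qed
qed

section \<open>Square integrable functions\<close>

lemma Lp_norm_2: "Lp_norm 2 M f = sqrt (LINT x|M. (f x)\<^sup>2)"
  by (simp add: Lp_norm_def powr_half_sqrt)

lemma square_integral_nonneg: "0 \<le> (LINT x|M. (f x)\<^sup>2 :: real)" by simp

lemma sq_add_le: "((a::real) + b)\<^sup>2 \<le> 2 * a\<^sup>2 + 2 * b\<^sup>2"
  using sum_squares_ge_zero[of "a - b" 0] by (simp add: power2_eq_square algebra_simps)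

lemma square_integral_add_le:
  assumes "Lp 2 M f" "Lp 2 M g"
  shows "(LINT x|M. (f x + g x)\<^sup>2) \<le> 2 * (LINT x|M. (f x)\<^sup>2) + 2 * (LINT x|M. (g x)\<^sup>2)"
proof -
  have "(LINT x|M. (f x + g x)\<^sup>2) \<le> (LINT x|M. 2 * (f x)\<^sup>2 + 2 * (g x)\<^sup>2)"
    using assms Lp2_add[OF assms] by (intro integral_mono sq_add_le) (auto simp: Lp2_iff)
  also have "\<dots> = 2 * (LINT x|M. (f x)\<^sup>2) + 2 * (LINT x|M. (g x)\<^sup>2)"
    using assms by (simp add: Lp2_iff)
  finally show ?thesis .
qed

text \<open>Cauchy-Schwarz, from the nonnegativity in \<open>t\<close> of the quadratic polynomial
  obtained by integrating the square of \<open>t * f x + g x\<close>.\<close>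

lemma integral_mult_le_sqrt:
  assumes f: "Lp 2 M f" and g: "Lp 2 M g"
  shows "\<bar>LINT x|M. f x * g x\<bar> \<le> sqrt (LINT x|M. (f x)\<^sup>2) * sqrt (LINT x|M. (g x)\<^sup>2)"
proof -
  define a where "a = (LINT x|M. (f x)\<^sup>2)"
  define b where "b = (LINT x|M. (g x)\<^sup>2)"
  define c where "c = (LINT x|M. f x * g x)"
  have ab: "a \<ge> 0" "b \<ge> 0" by (auto simp: a_def b_def)
  have quad: "0 \<le> a * t\<^sup>2 + 2 * c * t + b" for t
  proof -
    have "0 \<le> (LINT x|M. (t * f x + g x)\<^sup>2)" by simp
    also have "\<dots> = (LINT x|M. t\<^sup>2 * (f x)\<^sup>2 + (2 * t) * (f x * g x) + (g x)\<^sup>2)"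
      by (intro Bochner_Integration.integral_cong refl) (simp add: power2_eq_square algebra_simps)
    also have "\<dots> = t\<^sup>2 * a + 2 * t * c + b"
      using f g square_integrable_mult[OF f g] by (simp add: Lp2_iff a_def b_def c_def)
    finally show ?thesis by (simp add: algebra_simps)
  qed
  have "c\<^sup>2 \<le> a * b"
  proof (cases "a = 0")
    case True
    have "c = 0"
    proof (rule ccontr)
      assume "c \<noteq> 0"
      \<comment> \<open>For \<open>a = 0\<close> the polynomial is affine, and this choice of
        \<open>t\<close> would make its value -1.\<close>
      then have "2 * c * (- (b + 1) / (2 * c)) = - (b + 1)" by simp
      then show False using quad[of "- (b + 1) / (2 * c)"] True by simp
    qed
    then show ?thesis using True by simp
  next
    case False
    then have "a > 0" using ab by simp
    have "a * (- c / a)\<^sup>2 = c\<^sup>2 / a" "2 * c * (- c / a) = - 2 * (c\<^sup>2 / a)"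
      using \<open>a > 0\<close> by (simp_all add: power2_eq_square)
    then have "c\<^sup>2 / a \<le> b" using quad[of "- c / a"] by linarith
    then show ?thesis using \<open>a > 0\<close> by (simp add: pos_divide_le_eq mult.commute)
  qed
  then have "sqrt (c\<^sup>2) \<le> sqrt (a * b)" by (rule real_sqrt_le_mono)
  then show ?thesis by (simp add: real_sqrt_mult a_def b_def c_def)
qed

lemma Lp2_abs: "Lp 2 M f \<Longrightarrow> Lp 2 M (\<lambda>x. \<bar>f x\<bar>)"
  by (auto simp: Lp2_iff)

lemma measure_leb_le_1: "measure (leb 0 1) (space (leb 0 1)) = 1"
  using measure_leb[of 0 1] by simp

lemma (in finite_measure) integral_abs_le_sqrt:
  assumes "Lp 2 M f"
  shows "(LINT x|M. \<bar>f x\<bar>) \<le> sqrt (measure M (space M)) * sqrt (LINT x|M. (f x)\<^sup>2)"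
  using integral_mult_le_sqrt[OF _ Lp2_abs[OF assms], of "\<lambda>_. 1"] by (simp add: Lp2_iff)

lemma integral_abs_le_sqrt_01:
  assumes "Lp 2 (leb 0 1) f"
  shows "(LINT x|leb 0 1. \<bar>f x\<bar>) \<le> sqrt (LINT x|leb 0 1. (f x)\<^sup>2)"
  using finite_measure.integral_abs_le_sqrt[OF finite_measure_leb assms, unfolded measure_leb_le_1] by simp

text \<open>Carries bounds on differences of two members of a sequence to the difference from the
  limit when convergence is known only almost everywhere along a subsequence.\<close>

lemma square_integral_Fatou:
  fixes h :: "nat \<Rightarrow> 'a \<Rightarrow> real"
  assumes h: "\<And>k. Lp 2 M (h k)" and lim: "AE x in M. (\<lambda>k. h k x) \<longlonglongrightarrow> l x" and l: "l \<in> borel_measurable M"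
    and bd: "\<forall>\<^sub>F k in sequentially. (LINT x|M. (h k x)\<^sup>2) \<le> e" and e: "e \<ge> 0"
  shows "Lp 2 M l" "(LINT x|M. (l x)\<^sup>2) \<le> e"
proof -
  have hm: "h k \<in> borel_measurable M" "integrable M (\<lambda>x. (h k x)\<^sup>2)" for k
    using h[of k] by (auto simp: Lp2_iff)
  have "(\<integral>\<^sup>+ x. ennreal ((l x)\<^sup>2) \<partial>M) = (\<integral>\<^sup>+ x. liminf (\<lambda>k. ennreal ((h k x)\<^sup>2)) \<partial>M)"
  proof (rule nn_integral_cong_AE, use lim in eventually_elim)
    fix x assume "(\<lambda>k. h k x) \<longlonglongrightarrow> l x"
    then have "(\<lambda>k. ennreal ((h k x)\<^sup>2)) \<longlonglongrightarrow> ennreal ((l x)\<^sup>2)"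
      by (intro tendsto_ennrealI tendsto_power)
    then show "ennreal ((l x)\<^sup>2) = liminf (\<lambda>k. ennreal ((h k x)\<^sup>2))"
      using lim_imp_Liminf[OF trivial_limit_sequentially, of "\<lambda>k. ennreal ((h k x)\<^sup>2)"] by metis
  qed
  also have "\<dots> \<le> liminf (\<lambda>k. \<integral>\<^sup>+ x. ennreal ((h k x)\<^sup>2) \<partial>M)"
    using hm by (intro nn_integral_liminf) simp
  also have "\<dots> \<le> liminf (\<lambda>k. ennreal e)"
  proof (rule Liminf_mono, use bd in eventually_elim)
    fix k assume "(LINT x|M. (h k x)\<^sup>2) \<le> e"
    then show "(\<integral>\<^sup>+ x. ennreal ((h k x)\<^sup>2) \<partial>M) \<le> ennreal e"
      using hm by (subst nn_integral_eq_integral) (auto intro: ennreal_leI)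
  qed
  also have "\<dots> = ennreal e" by (simp add: Liminf_const)
  finally have *: "(\<integral>\<^sup>+ x. ennreal ((l x)\<^sup>2) \<partial>M) \<le> ennreal e" .
  have lm: "(\<lambda>x. (l x)\<^sup>2) \<in> borel_measurable M" using l by simp
  have i: "integrable M (\<lambda>x. (l x)\<^sup>2)"
    by (rule integrableI_bounded[OF lm]) (use * in \<open>auto simp: le_less_trans\<close>)
  then show "Lp 2 M l" using l by (simp add: Lp2_iff)
  show "(LINT x|M. (l x)\<^sup>2) \<le> e"
    using * i e by (subst (asm) nn_integral_eq_integral) (auto simp: ennreal_le_iff)
qed

lemma AE_summable_L1:
  fixes f :: "nat \<Rightarrow> 'a \<Rightarrow> real"
  assumes f: "\<And>k. integrable M (f k)" and le: "\<And>k. (LINT x|M. \<bar>f k x\<bar>) \<le> (1 / 2) ^ k"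
  shows "AE x in M. summable (\<lambda>k. f k x)"
proof -
  have "(\<integral>\<^sup>+ x. (\<Sum>k. ennreal \<bar>f k x\<bar>) \<partial>M) = (\<Sum>k. \<integral>\<^sup>+ x. ennreal \<bar>f k x\<bar> \<partial>M)"
    using f by (intro nn_integral_suminf) auto
  also have "\<dots> \<le> (\<Sum>k. ennreal ((1 / 2) ^ k))"
  proof (intro suminf_le)
    show "(\<integral>\<^sup>+ x. ennreal \<bar>f k x\<bar> \<partial>M) \<le> ennreal ((1 / 2) ^ k)" for k
      using f le by (subst nn_integral_eq_integral) (auto intro!: ennreal_leI)
  qed auto
  also have "\<dots> = ennreal (\<Sum>k. (1 / 2) ^ k)"
    by (intro suminf_ennreal2) (auto intro: summable_geometric)
  also have "\<dots> < \<infinity>" by simp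
  finally have "AE x in M. (\<Sum>k. ennreal \<bar>f k x\<bar>) \<noteq> \<infinity>"
    using f by (intro nn_integral_PInf_AE) auto
  then show ?thesis
  proof eventually_elim
    fix x assume "(\<Sum>k. ennreal \<bar>f k x\<bar>) \<noteq> \<infinity>"
    then have "summable (\<lambda>k. \<bar>f k x\<bar>)" by (intro summable_suminf_not_top) auto
    then show "summable (\<lambda>k. f k x)" by (rule summable_rabs_cancel)
  qed
qed

lemma AE_convergent_L1:
  fixes f :: "nat \<Rightarrow> 'a \<Rightarrow> real"
  assumes f: "\<And>k. integrable M (f k)" and le: "\<And>k. (LINT x|M. \<bar>f (Suc k) x - f k x\<bar>) \<le> (1 / 2) ^ k"
  shows "AE x in M. convergent (\<lambda>k. f k x)"
proof -
  have "AE x in M. summable (\<lambda>k. f (Suc k) x - f k x)" using f le by (intro AE_summable_L1) auto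
  then show ?thesis
  proof eventually_elim
    fix x assume "summable (\<lambda>k. f (Suc k) x - f k x)"
    then have "convergent (\<lambda>n. \<Sum>k<n. f (Suc k) x - f k x)" by (simp add: summable_iff_convergent)
    then have "convergent (\<lambda>n. f n x - f 0 x)" 
      by (simp only: sum_lessThan_telescope[of "\<lambda>k. f k x"])
    then have "convergent (\<lambda>n. (f n x - f 0 x) + f 0 x)" by (intro convergent_add convergent_const)
    then show "convergent (\<lambda>k. f k x)" by simp
  qed
qed

lemma AE_subseq_L1:
  fixes f :: "nat \<Rightarrow> 'a \<Rightarrow> real"
  assumes f: "\<And>k. integrable M (f k)" and lim: "(\<lambda>k. LINT x|M. \<bar>f k x\<bar>) \<longlonglongrightarrow> 0"
  obtains r :: "nat \<Rightarrow> nat" where "strict_mono r" "AE x in M. (\<lambda>k. f (r k) x) \<longlonglongrightarrow> 0"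
proof -
  have ex: "\<exists>n>m. (LINT x|M. \<bar>f n x\<bar>) \<le> (1 / 2) ^ k" for m k
  proof -
    have "\<forall>\<^sub>F n in sequentially. (LINT x|M. \<bar>f n x\<bar>) < (1 / 2) ^ k"
      using lim by (rule order_tendstoD) simp
    from eventually_conj[OF this eventually_gt_at_top[of m]]
    show ?thesis by (auto simp: eventually_sequentially intro: less_imp_le)
  qed
  have "\<exists>r. \<forall>k. (LINT x|M. \<bar>f (r k) x\<bar>) \<le> (1 / 2) ^ k \<and> r k < r (Suc k)"
    by (rule dependent_nat_choice) (use ex in blast)+
  then obtain r where r: "\<And>k. (LINT x|M. \<bar>f (r k) x\<bar>) \<le> (1 / 2) ^ k" "\<And>k. r k < r (Suc k)" by blast
  have "AE x in M. summable (\<lambda>k. f (r k) x)" by (rule AE_summable_L1) (use f r in auto)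
  then have "AE x in M. (\<lambda>k. f (r k) x) \<longlonglongrightarrow> 0" by eventually_elim (rule summable_LIMSEQ_zero)
  then show thesis using r by (intro that[of r]) (auto simp: strict_mono_Suc_iff)
qed

text \<open>On a finite measure space an L2 Cauchy sequence is Cauchy in L1, hence has an almost
  everywhere convergent subsequence; Fatou's lemma leads back to L2 and to the full
  sequence.\<close>

lemma (in finite_measure) Lp2_complete:
  fixes f :: "nat \<Rightarrow> 'a \<Rightarrow> real"
  assumes f: "\<And>n. Lp 2 M (f n)"
    and cauchy: "\<And>e. e > 0 \<Longrightarrow> \<exists>n0. \<forall>i\<ge>n0. \<forall>j\<ge>n0. (LINT x|M. (f i x - f j x)\<^sup>2) < e"
  obtains l where "Lp 2 M l" "(\<lambda>n. LINT x|M. (f n x - l x)\<^sup>2) \<longlonglongrightarrow> 0"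
proof -
  \<comment> \<open>The summand 1 keeps \<open>C\<close> positive when the space is null and makes
    the last estimate below strict.\<close>
  define C where "C = sqrt (measure M (space M)) + 1"
  have C: "C > 0" by (simp add: C_def add_nonneg_pos)
  have L1: "\<exists>N. \<forall>i\<ge>N. \<forall>j\<ge>N. (LINT x|M. norm (f i x - f j x)) < e" if e: "e > 0" for e
  proof -
    obtain N where N: "\<And>i j. i \<ge> N \<Longrightarrow> j \<ge> N \<Longrightarrow> (LINT x|M. (f i x - f j x)\<^sup>2) < (e / C)\<^sup>2"
      using cauchy[of "(e / C)\<^sup>2"] e C by auto
    have "(LINT x|M. norm (f i x - f j x)) < e" if ij: "i \<ge> N" "j \<ge> N" for i j
    proof -
      have "(LINT x|M. \<bar>f i x - f j x\<bar>) \<le> sqrt (measure M (space M)) * sqrt (LINT x|M. (f i x - f j x)\<^sup>2)"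
        by (intro integral_abs_le_sqrt Lp2_diff f)
      also have "\<dots> \<le> sqrt (measure M (space M)) * sqrt ((e / C)\<^sup>2)"
        using N[OF ij] by (intro mult_left_mono real_sqrt_le_mono) auto
      also have "\<dots> = sqrt (measure M (space M)) * (e / C)" using e C by simp
      also have "\<dots> < C * (e / C)" using e C by (intro mult_strict_right_mono) (auto simp: C_def)
      finally show ?thesis using C by simp
    qed
    then show ?thesis by blast
  qed
  obtain r where r: "strict_mono r" and ae: "AE x in M. Cauchy (\<lambda>k. f (r k) x)"
    by (rule cauchy_L1_AE_cauchy_subseq[of M f]) (use Lp2_integrable f L1 in auto)
  define l where "l x = lim (\<lambda>k. f (r k) x)" for x
  have lm: "l \<in> borel_measurable M"
    unfolding l_def using f by (intro borel_measurable_lim_metric) (auto simp: Lp2_iff)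
  have ptw: "AE x in M. (\<lambda>k. f (r k) x) \<longlonglongrightarrow> l x"
    using ae by eventually_elim (auto simp: l_def Cauchy_convergent_iff convergent_LIMSEQ_iff)
  have main: "Lp 2 M (\<lambda>x. f i x - l x) \<and> (LINT x|M. (f i x - l x)\<^sup>2) \<le> e"
    if e: "e > 0" and i: "i \<ge> n0" and n0: "\<And>i j. i \<ge> n0 \<Longrightarrow> j \<ge> n0 \<Longrightarrow> (LINT x|M. (f i x - f j x)\<^sup>2) < e" for e i n0
  proof -
    have 1: "AE x in M. (\<lambda>k. f i x - f (r k) x) \<longlonglongrightarrow> f i x - l x"
      using ptw by eventually_elim (intro tendsto_intros)
    have 2: "\<forall>\<^sub>F k in sequentially. (LINT x|M. (f i x - f (r k) x)\<^sup>2) \<le> e"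
      using eventually_ge_at_top[of n0]
    proof eventually_elim
      fix k assume "k \<ge> n0"
      then have "r k \<ge> n0" using seq_suble[OF r, of k] by simp
      then show "(LINT x|M. (f i x - f (r k) x)\<^sup>2) \<le> e" using n0[OF i] by (simp add: less_imp_le)
    qed
    have 3: "(\<lambda>x. f i x - l x) \<in> borel_measurable M" using f[of i] lm by (auto simp: Lp2_iff)
    show ?thesis
      using square_integral_Fatou[OF Lp2_diff[OF f f] 1 3 2] e by auto
  qed
  have "Lp 2 M l"
  proof -
    obtain n0 where "\<And>i j. i \<ge> n0 \<Longrightarrow> j \<ge> n0 \<Longrightarrow> (LINT x|M. (f i x - f j x)\<^sup>2) < 1"
      using cauchy[of 1] by auto
    then have "Lp 2 M (\<lambda>x. f n0 x - l x)" using main[of 1 n0 n0] by auto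
    from Lp2_diff[OF f[of n0] this] show ?thesis by simp
  qed
  moreover have "(\<lambda>n. LINT x|M. (f n x - l x)\<^sup>2) \<longlonglongrightarrow> 0"
  proof (rule LIMSEQ_I)
    fix e :: real assume e: "e > 0"
    then obtain n0 where n0: "\<And>i j. i \<ge> n0 \<Longrightarrow> j \<ge> n0 \<Longrightarrow> (LINT x|M. (f i x - f j x)\<^sup>2) < e / 2"
      using cauchy[of "e / 2"] by auto
    show "\<exists>no. \<forall>n\<ge>no. norm ((LINT x|M. (f n x - l x)\<^sup>2) - 0) < e"
    proof (intro exI[of _ n0] allI impI)
      fix n assume "n \<ge> n0"
      then have "(LINT x|M. (f n x - l x)\<^sup>2) \<le> e / 2" using main[of "e / 2" n0 n] n0 e by auto
      then show "norm ((LINT x|M. (f n x - l x)\<^sup>2) - 0) < e" using e by simp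
    qed
  qed
  ultimately show thesis by (rule that)
qed

text \<open>Finitely supported convex weights on indices at least \<open>n\<close>. A combination
  with such weights depends only on the tail of a sequence, so limits and one-sided bounds of the
  tail pass to it; \<open>K\<close> makes it a finite sum.\<close>

definition tail_weights :: "nat \<Rightarrow> nat \<Rightarrow> (nat \<Rightarrow> real) \<Rightarrow> bool" where
  "tail_weights n K c \<longleftrightarrow> (\<forall>k. 0 \<le> c k) \<and> (\<forall>k. c k \<noteq> 0 \<longrightarrow> n \<le> k \<and> k < K) \<and> (\<Sum>k<K. c k) = 1"

lemma tail_weights_extend:
  assumes "tail_weights n K c" "K \<le> K'"
  shows "(\<Sum>k<K'. c k * u k) = (\<Sum>k<K. c k * (u k :: real))"
  using assms by (intro sum.mono_neutral_right) (auto simp: tail_weights_def)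

lemma tail_weights_mono: "tail_weights n K c \<Longrightarrow> m \<le> n \<Longrightarrow> tail_weights m K c"
  unfolding tail_weights_def by force

lemma tail_weights_mid:
  assumes "tail_weights n K c" "tail_weights n K' c'"
  shows "tail_weights n (max K K') (\<lambda>k. (c k + c' k) / 2)"
proof -
  have "(\<Sum>k<max K K'. (c k + c' k) / 2) = ((\<Sum>k<max K K'. c k * 1) + (\<Sum>k<max K K'. c' k * 1)) / 2"
    by (simp add: sum.distrib sum_divide_distrib[symmetric])
  also have "\<dots> = 1"
    using tail_weights_extend[OF assms(1), of "max K K'" "\<lambda>_. 1"] tail_weights_extend[OF assms(2), of "max K K'" "\<lambda>_. 1"] assms
    by (simp add: tail_weights_def)
  finally have sum: "(\<Sum>k<max K K'. (c k + c' k) / 2) = 1" .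
  have "n \<le> k \<and> k < max K K'" if "(c k + c' k) / 2 \<noteq> 0" for k
  proof -
    from that have "c k \<noteq> 0 \<or> c' k \<noteq> 0" by auto
    then show ?thesis using assms unfolding tail_weights_def by (meson less_max_iff_disj)
  qed
  with sum assms show ?thesis unfolding tail_weights_def by simp
qed

lemma Lp2_sum: "(\<And>k. k \<in> I \<Longrightarrow> Lp 2 M (u k)) \<Longrightarrow> finite I \<Longrightarrow> Lp 2 M (\<lambda>x. \<Sum>k\<in>I. c k * u k x)"
proof (induction I rule: infinite_finite_induct)
  case empty
  then show ?case by (simp add: Lp2_iff)
next
  case (insert i I)
  then show ?case by (simp add: Lp2_add Lp2_cmult)
qed simp

text \<open>The combinations are chosen with almost minimal norm among the convex combinations of a tail;
  the parallelogram law makes such a choice Cauchy.\<close>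

theorem Mazur_Cauchy:
  fixes u :: "nat \<Rightarrow> 'a \<Rightarrow> real"
  assumes u: "\<And>k. Lp 2 M (u k)" and B: "\<And>k. (LINT x|M. (u k x)\<^sup>2) \<le> B"
  obtains c K where "\<And>n. tail_weights n (K n) (c n)"
    "\<And>e. e > 0 \<Longrightarrow> \<exists>n0. \<forall>i\<ge>n0. \<forall>j\<ge>n0.
       (LINT x|M. ((\<Sum>k<K i. c i k * u k x) - (\<Sum>k<K j. c j k * u k x))\<^sup>2) < e"
proof -
  define w where "w K c x = (\<Sum>k<K. c k * u k x)" for K :: nat and c x
  define q where "q K c = (LINT x|M. (w K c x)\<^sup>2)" for K c
  have wL: "Lp 2 M (w K c)" for K c unfolding w_def by (rule Lp2_sum) (use u in auto)
  define S where "S n = {q K c |K c. tail_weights n K c}" for n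
  define I where "I n = Inf (S n)" for n
  have S_mem: "q (Suc n) (\<lambda>k. of_bool (k = n)) \<in> S n" for n
  proof -
    have "tail_weights n (Suc n) (\<lambda>k. of_bool (k = n))" by (auto simp: tail_weights_def)
    then show ?thesis unfolding S_def by blast
  qed
  have qn: "q (Suc n) (\<lambda>k. of_bool (k = n)) \<le> B" for n
    using B[of n] by (simp add: q_def w_def)
  have bdd: "bdd_below (S n)" for n
    by (rule bdd_belowI[of _ 0]) (auto simp: S_def q_def)
  have I_le: "I n \<le> q K c" if "tail_weights n K c" for n K c
    unfolding I_def using that by (intro cInf_lower bdd) (auto simp: S_def)
  have I_B: "I n \<le> B" for n
    using cInf_lower[OF S_mem bdd, of n] qn[of n] by (simp add: I_def)
  \<comment> \<open>Later tails admit fewer combinations, so their infima increase; being bounded by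
    \<open>B\<close>, they converge.\<close>
  have "incseq I"
  proof (rule incseq_SucI)
    fix n
    show "I n \<le> I (Suc n)"
      unfolding I_def[of "Suc n"]
    proof (rule cInf_greatest)
      show "S (Suc n) \<noteq> {}" using S_mem by blast
      show "I n \<le> y" if "y \<in> S (Suc n)" for y
        using that tail_weights_mono[of "Suc n" _ _ n] by (auto simp: S_def intro: I_le)
    qed
  qed
  then obtain I' where I': "I \<longlonglongrightarrow> I'" "\<And>n. I n \<le> I'"
    using incseq_convergent[of I B] I_B by blast
  have "\<exists>K c. tail_weights n K c \<and> q K c < I n + 1 / real (Suc n)" for n
  proof -
    have "Inf (S n) < I n + 1 / real (Suc n)" by (simp add: I_def)
    then show ?thesis using cInf_lessD[of "S n"] S_mem[of n] unfolding S_def by blast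
  qed
  then obtain K c where c: "\<And>n. tail_weights n (K n) (c n)" "\<And>n. q (K n) (c n) < I n + 1 / real (Suc n)"
    by metis
  \<comment> \<open>The midpoint of two almost minimal combinations is again a combination of the
    tail at \<open>j\<close>, so its squared norm is at least \<open>I j\<close>. The parallelogram
    law then bounds the distance of the two.\<close>
  have par: "(LINT x|M. (w (K i) (c i) x - w (K j) (c j) x)\<^sup>2) \<le> 2 * (I' - I j) + 4 / real (Suc j)"
    if ij: "j \<le> i" for i j
  proof -
    let ?c = "\<lambda>k. (c i k + c j k) / 2" and ?K = "max (K i) (K j)"
    have tw: "tail_weights j ?K ?c"
      by (intro tail_weights_mid c tail_weights_mono[OF c(1)[of i]] ij)
    have mid: "w ?K ?c x = (w (K i) (c i) x + w (K j) (c j) x) / 2" for x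
      unfolding w_def tail_weights_extend[OF c(1)[of i], of ?K "\<lambda>k. u k x", symmetric, simplified]
        tail_weights_extend[OF c(1)[of j], of ?K "\<lambda>k. u k x", symmetric, simplified]
      by (simp add: sum.distrib[symmetric] sum_divide_distrib add_divide_distrib ring_distribs)
    have "(LINT x|M. (w (K i) (c i) x - w (K j) (c j) x)\<^sup>2)
       = (LINT x|M. 2 * (w (K i) (c i) x)\<^sup>2 + 2 * (w (K j) (c j) x)\<^sup>2 - 4 * (w ?K ?c x)\<^sup>2)"
      unfolding mid by (intro Bochner_Integration.integral_cong refl) (simp add: power2_eq_square field_simps)
    also have "\<dots> = 2 * q (K i) (c i) + 2 * q (K j) (c j) - 4 * q ?K ?c"
      using wL by (simp add: q_def Lp2_iff)
    also have "\<dots> \<le> 2 * (I i + 1 / real (Suc i)) + 2 * (I j + 1 / real (Suc j)) - 4 * I j"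
      using c(2)[of i] c(2)[of j] I_le[OF tw] by (intro diff_mono add_mono mult_left_mono) auto
    also have "\<dots> \<le> 2 * (I' + 1 / real (Suc j)) + 2 * (I j + 1 / real (Suc j)) - 4 * I j"
    proof -
      have "1 / real (Suc i) \<le> 1 / real (Suc j)" using ij by (simp add: field_simps)
      then show ?thesis using I'(2)[of i] by (intro diff_mono add_mono mult_left_mono) auto
    qed
    also have "\<dots> = 2 * (I' - I j) + 4 / real (Suc j)" by (simp add: algebra_simps)
    finally show ?thesis .
  qed
  have lim: "(\<lambda>j. 2 * (I' - I j) + 4 / real (Suc j)) \<longlonglongrightarrow> 2 * (I' - I') + 0"
    by (intro tendsto_intros I' real_tendsto_divide_at_top[of _ 4] filterlim_compose[OF filterlim_real_sequentially filterlim_Suc])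
  show thesis
  proof (rule that[OF c(1)])
    fix e :: real assume "e > 0"
    from order_tendstoD(2)[OF lim, of e] this
    obtain n0 where n0: "\<And>j. j \<ge> n0 \<Longrightarrow> 2 * (I' - I j) + 4 / real (Suc j) < e"
      by (auto simp: eventually_sequentially)
    show "\<exists>n0. \<forall>i\<ge>n0. \<forall>j\<ge>n0. (LINT x|M. ((\<Sum>k<K i. c i k * u k x) - (\<Sum>k<K j. c j k * u k x))\<^sup>2) < e"
    proof (intro exI[of _ n0] allI impI)
      fix i j assume ij: "i \<ge> n0" "j \<ge> n0"
      have "(LINT x|M. (w (K i) (c i) x - w (K j) (c j) x)\<^sup>2) < e"
      proof (cases "j \<le> i")
        case True
        then show ?thesis using par[OF True] n0[OF ij(2)] by linarith
      next
        case False
        then have "(LINT x|M. (w (K j) (c j) x - w (K i) (c i) x)\<^sup>2) < e"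
          using par[of i j] n0[OF ij(1)] by linarith
        then show ?thesis by (simp add: power2_commute)
      qed
      then show "(LINT x|M. ((\<Sum>k<K i. c i k * u k x) - (\<Sum>k<K j. c j k * u k x))\<^sup>2) < e"
        by (simp add: w_def)
    qed
  qed
qed

section \<open>Energy estimates\<close>

lemma prim_FTC:
  assumes "a \<le> t" "t \<le> b" "\<And>x. (F has_real_derivative f x) (at x)" "continuous_on UNIV f"
  shows "prim a b f t = F t - F a"
proof -
  have c: "continuous_on S f" for S using assms(4) by (rule continuous_on_subset) simp
  have i: "integrable (leb a b) f" by (intro integrable_continuous_leb c)
  have "prim a b f t = (LINT r|leb a b. indicator {a<..<t} r * f r)"
    unfolding prim_def
  proof (intro integral_cong_AE borel_measurable_times measurable_leb[OF borel_measurable_indicator]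
      borel_measurable_integrable[OF i])
    show "AE r in leb a b. indicator {..t} r * f r = indicator {a<..<t} r * f r"
      using AE_leb_neq[of t a b] AE_space[of "leb a b"]
      by eventually_elim (auto simp: indicator_def)
  qed auto
  also have "\<dots> = (LINT r|leb a t. f r)" using assms by (intro leb_sub_eq) auto
  also have "\<dots> = F t - F a" using assms by (intro leb_FTC c) auto
  finally show ?thesis .
qed

lemma prim_mono_AE:
  assumes "integrable (leb a b) f" "integrable (leb a b) g" "AE r in leb a b. f r \<le> g r"
  shows "prim a b f t \<le> prim a b g t"
  unfolding prim_def
  by (intro integral_mono_AE prim_integrable assms)
    (use assms(3) in \<open>eventually_elim, auto simp: indicator_def\<close>)

text \<open>Proved by bounding the supremum of \<open>exp (- 2 K t) u t\<close> by \<open>A\<close> plus half of itself.\<close>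

lemma Gronwall:
  fixes u :: "real \<Rightarrow> real"
  assumes K: "K > 0" and A: "A \<ge> 0" and ui: "integrable (leb 0 T) u"
    and u: "\<And>t. t \<in> {0..T} \<Longrightarrow> 0 \<le> u t \<and> u t \<le> B"
    and ineq: "\<And>t. t \<in> {0..T} \<Longrightarrow> u t \<le> A + K * prim 0 T u t"
    and t: "t \<in> {0..T}"
  shows "u t \<le> 2 * A * exp (2 * K * t)"
proof -
  define v where "v t = exp (- (2 * K * t)) * u t" for t
  define S where "S = Sup (v ` {0..T})"
  have v_le: "v t \<le> B" "0 \<le> v t" if "t \<in> {0..T}" for t
  proof -
    have "exp (- (2 * K * t)) * u t \<le> 1 * u t" using that u[OF that] K by (intro mult_right_mono) auto
    then show "v t \<le> B" using u[OF that] by (simp add: v_def)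
    show "0 \<le> v t" using u[OF that] by (simp add: v_def)
  qed
  have bdd: "bdd_above (v ` {0..T})" by (rule bdd_aboveI[of _ B]) (auto intro: v_le)
  have vS: "v t \<le> S" if "t \<in> {0..T}" for t unfolding S_def using that by (intro cSup_upper bdd) auto
  have S0: "S \<ge> 0" using vS[OF t] v_le(2)[OF t] by linarith
  have uS: "u t \<le> S * exp (2 * K * t)" if "t \<in> {0..T}" for t
  proof -
    have "u t = v t * exp (2 * K * t)" by (simp add: v_def exp_minus)
    also have "\<dots> \<le> S * exp (2 * K * t)" using vS[OF that] by (intro mult_right_mono) auto
    finally show ?thesis .
  qed
  have step: "v t \<le> A + S / 2" if t: "t \<in> {0..T}" for t
  proof -
    have c: "continuous_on X (\<lambda>\<tau>. S * exp (2 * K * \<tau>))" for X by (intro continuous_intros)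
    have "prim 0 T u t \<le> prim 0 T (\<lambda>\<tau>. S * exp (2 * K * \<tau>)) t"
      using uS by (intro prim_mono_AE ui integrable_continuous_leb c AE_I2) auto
    \<comment> \<open>The rate \<open>2 * K\<close> of the weight turns the factor \<open>K\<close>
      of the inequality into \<open>K / (2 * K) = 1 / 2\<close>.\<close>
    also have "\<dots> = S / (2 * K) * exp (2 * K * t) - S / (2 * K) * exp (2 * K * 0)"
      using t K by (intro prim_FTC c) (auto intro!: derivative_eq_intros)
    also have "\<dots> \<le> S / (2 * K) * exp (2 * K * t)" using S0 K by simp
    finally have "K * prim 0 T u t \<le> K * (S / (2 * K) * exp (2 * K * t))"
      using K by (intro mult_left_mono) auto
    also have "\<dots> = S / 2 * exp (2 * K * t)" using K by simp
    finally have "u t \<le> A + S / 2 * exp (2 * K * t)" using ineq[OF t] by linarith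
    then have "v t \<le> exp (- (2 * K * t)) * (A + S / 2 * exp (2 * K * t))"
      unfolding v_def by (intro mult_left_mono) auto
    also have "\<dots> = exp (- (2 * K * t)) * A + S / 2" by (simp add: exp_minus field_simps)
    also have "\<dots> \<le> 1 * A + S / 2" using A K t by (intro add_right_mono mult_right_mono) auto
    finally show ?thesis by simp
  qed
  have "S \<le> A + S / 2"
    unfolding S_def[of] using step t by (subst S_def[symmetric], intro cSup_least) (auto simp: S_def)
  then have "S \<le> 2 * A" by simp
  then have "S * exp (2 * K * t) \<le> 2 * A * exp (2 * K * t)" by (intro mult_right_mono) auto
  then show ?thesis using uS[OF t] by linarith
qed

lemma prim_time_measurable:
  assumes "(\<lambda>(t, s). W t s) \<in> borel_measurable (leb2 T)"
  shows "(\<lambda>(t, s). prim 0 T (\<lambda>r. W r s) t) \<in> borel_measurable (leb2 T)"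
proof -
  have id: "(\<lambda>r. r) \<in> borel_measurable (leb 0 T)" by (rule measurable_leb) simp
  have m1: "(\<lambda>p. fst (fst p)) \<in> borel_measurable (leb2 T \<Otimes>\<^sub>M leb 0 T)"
    "(\<lambda>p. snd p) \<in> borel_measurable (leb2 T \<Otimes>\<^sub>M leb 0 T)"
    using measurable_compose[OF measurable_compose[OF measurable_fst measurable_fst] id]
      measurable_compose[OF measurable_snd id] by auto
  have m2: "(\<lambda>p. (snd p, snd (fst p))) \<in> measurable (leb2 T \<Otimes>\<^sub>M leb 0 T) (leb2 T)"
    by measurable
  have "(\<lambda>p. (if snd p \<le> fst (fst p) then 1 else 0) * W (snd p) (snd (fst p))) \<in> borel_measurable (leb2 T \<Otimes>\<^sub>M leb 0 T)"
    using m1 measurable_compose[OF m2 assms] by (simp add: case_prod_beta')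
  also have "(\<lambda>p. (if snd p \<le> fst (fst p) then 1 else 0) * W (snd p) (snd (fst p)))
     = (\<lambda>(p, r). indicator {..fst p} r * W r (snd p))"
    by (auto simp: fun_eq_iff indicator_def)
  finally have "(\<lambda>(p, r). indicator {..fst p} r * W r (snd p)) \<in> borel_measurable (leb2 T \<Otimes>\<^sub>M leb 0 T)" .
  from sigma_finite_measure.borel_measurable_lebesgue_integral[OF sigma_finite_leb this]
  show ?thesis by (simp add: prim_def case_prod_beta')
qed

lemma prim_space_measurable:
  assumes "(\<lambda>(t, s). L t s) \<in> borel_measurable (leb2 T)"
  shows "(\<lambda>(t, s). prim 0 1 (L t) s) \<in> borel_measurable (leb2 T)"
proof -
  have id: "(\<lambda>r. r) \<in> borel_measurable (leb 0 1)" by (rule measurable_leb) simp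
  have m1: "(\<lambda>p. snd (fst p)) \<in> borel_measurable (leb2 T \<Otimes>\<^sub>M leb 0 1)"
    "(\<lambda>p. snd p) \<in> borel_measurable (leb2 T \<Otimes>\<^sub>M leb 0 1)"
    using measurable_compose[OF measurable_compose[OF measurable_fst measurable_snd] id]
      measurable_compose[OF measurable_snd id] by auto
  have m2: "(\<lambda>p. (fst (fst p), snd p)) \<in> measurable (leb2 T \<Otimes>\<^sub>M leb 0 1) (leb2 T)"
    by measurable
  have "(\<lambda>p. (if snd p \<le> snd (fst p) then 1 else 0) * L (fst (fst p)) (snd p)) \<in> borel_measurable (leb2 T \<Otimes>\<^sub>M leb 0 1)"
    using m1 measurable_compose[OF m2 assms] by (simp add: case_prod_beta')
  also have "(\<lambda>p. (if snd p \<le> snd (fst p) then 1 else 0) * L (fst (fst p)) (snd p))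
     = (\<lambda>(p, r). indicator {..snd p} r * L (fst p) r)"
    by (auto simp: fun_eq_iff indicator_def)
  finally have "(\<lambda>(p, r). indicator {..snd p} r * L (fst p) r) \<in> borel_measurable (leb2 T \<Otimes>\<^sub>M leb 0 1)" .
  from sigma_finite_measure.borel_measurable_lebesgue_integral[OF sigma_finite_leb this]
  show ?thesis by (simp add: prim_def case_prod_beta')
qed

lemma Lp2_leb2_integrable: "Lp 2 (leb2 T) f \<Longrightarrow> integrable (leb2 T) f"
  by (rule finite_measure.Lp2_integrable[OF finite_measure_leb2])

lemma fst_measurable_leb2: "f \<in> borel_measurable (leb 0 T) \<Longrightarrow> (\<lambda>(t, s). f t) \<in> borel_measurable (leb2 T)"
  and snd_measurable_leb2: "g \<in> borel_measurable (leb 0 1) \<Longrightarrow> (\<lambda>(t, s). g s) \<in> borel_measurable (leb2 T)"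
  unfolding case_prod_beta' by (rule measurable_compose[OF measurable_fst], simp, rule measurable_compose[OF measurable_snd], simp)

text \<open>Restricted to equations between jointly measurable functions, because exchanging the two
  quantifiers requires a measurable exceptional set.\<close>

lemma AE_leb2_swap:
  assumes m: "(\<lambda>(t, s). D t s :: real) \<in> borel_measurable (leb2 T)" "(\<lambda>(t, s). E t s) \<in> borel_measurable (leb2 T)"
  shows "(AE t in leb 0 T. AE s in leb 0 1. D t s = E t s) \<longleftrightarrow> (AE s in leb 0 1. AE t in leb 0 T. D t s = E t s)"
    and "(AE t in leb 0 T. AE s in leb 0 1. D t s = E t s) \<longleftrightarrow> (AE (t, s) in leb2 T. D t s = E t s)"
proof -
  have S: "{x \<in> space (leb2 T). D (fst x) (snd x) = E (fst x) (snd x)} \<in> sets (leb2 T)"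
    using m unfolding case_prod_beta' by measurable
  show "(AE t in leb 0 T. AE s in leb 0 1. D t s = E t s) \<longleftrightarrow> (AE s in leb 0 1. AE t in leb 0 T. D t s = E t s)"
    by (rule pair_leb.AE_commute[OF S])
  have "(AE x in leb2 T. D (fst x) (snd x) = E (fst x) (snd x)) \<longleftrightarrow> (AE t in leb 0 T. AE s in leb 0 1. D t s = E t s)"
  proof
    assume "AE x in leb2 T. D (fst x) (snd x) = E (fst x) (snd x)"
    from pair_leb.AE_pair[OF this]
    show "AE t in leb 0 T. AE s in leb 0 1. D t s = E t s" by simp
  next
    assume "AE t in leb 0 T. AE s in leb 0 1. D t s = E t s"
    then show "AE x in leb2 T. D (fst x) (snd x) = E (fst x) (snd x)"
      using S by (intro pair_leb.AE_pair_measure) auto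
  qed
  then show "(AE t in leb 0 T. AE s in leb 0 1. D t s = E t s) \<longleftrightarrow> (AE (t, s) in leb2 T. D t s = E t s)"
    by (simp add: case_prod_beta')
qed

text \<open>The chain rule for the square at fixed \<open>s\<close>, integrated over
  \<open>s\<close>. In \<open>ev\<close> the exceptional set depends on the time; Fubini turns this
  into agreement at almost all times with \<open>E\<close>, which for almost every \<open>s\<close>
  is a primitive in time.\<close>

theorem energy_identity:
  fixes D W :: "real \<Rightarrow> real \<Rightarrow> real"
  assumes W: "Lp 2 (leb2 T) (\<lambda>(t, s). W t s)" and D: "Lp 2 (leb2 T) (\<lambda>(t, s). D t s)"
    and Dt: "\<And>t. t \<in> {0..T} \<Longrightarrow> Lp 2 (leb 0 1) (D t)"
    and ev: "\<And>t. t \<in> {0..T} \<Longrightarrow> AE s in leb 0 1. D t s = D 0 s + prim 0 T (\<lambda>\<tau>. W \<tau> s) t"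
    and t: "t \<in> {0..T}"
  shows "(LINT s|leb 0 1. (D t s)\<^sup>2)
    = (LINT s|leb 0 1. (D 0 s)\<^sup>2) + 2 * prim 0 T (\<lambda>\<tau>. LINT s|leb 0 1. D \<tau> s * W \<tau> s) t"
    and "integrable (leb 0 T) (\<lambda>\<tau>. LINT s|leb 0 1. D \<tau> s * W \<tau> s)"
proof -
  have zero: "0 \<in> {0..T}" using t by auto
  define E where "E \<tau> s = D 0 s + prim 0 T (\<lambda>r. W r s) \<tau>" for \<tau> s
  have Wm: "(\<lambda>(t, s). W t s) \<in> borel_measurable (leb2 T)" and Dm: "(\<lambda>(t, s). D t s) \<in> borel_measurable (leb2 T)"
    using W D by (auto simp: Lp2_iff)
  have W1: "AE s in leb 0 1. integrable (leb 0 T) (\<lambda>\<tau>. W \<tau> s)"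
    by (rule pair_leb.AE_integrable_snd[OF Lp2_leb2_integrable[OF W]])
  have "(\<lambda>p. (case p of (t, s) \<Rightarrow> D 0 s) + (case p of (t, s) \<Rightarrow> prim 0 T (\<lambda>r. W r s) t)) \<in> borel_measurable (leb2 T)"
    using Dt[OF zero] by (intro borel_measurable_add prim_time_measurable Wm snd_measurable_leb2) (auto simp: Lp2_iff)
  then have Em: "(\<lambda>(t, s). E t s) \<in> borel_measurable (leb2 T)"
    by (simp add: E_def case_prod_beta')
  have "AE \<tau> in leb 0 T. AE s in leb 0 1. D \<tau> s = E \<tau> s"
    unfolding E_def by (rule AE_I2, rule ev) auto
  then have DE: "AE s in leb 0 1. AE \<tau> in leb 0 T. D \<tau> s = E \<tau> s"
    by (simp add: AE_leb2_swap(1)[OF Dm Em])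
  have "integrable (leb2 T) (\<lambda>p. (case p of (t, s) \<Rightarrow> D t s) * (case p of (t, s) \<Rightarrow> W t s))"
    by (rule square_integrable_mult[OF D W])
  then have DW: "integrable (leb2 T) (\<lambda>(t, s). D t s * W t s)" by (simp add: case_prod_beta')
  then show I1: "integrable (leb 0 T) (\<lambda>\<tau>. LINT s|leb 0 1. D \<tau> s * W \<tau> s)"
    by (rule pair_leb.integrable_fst)
  have DWs: "AE s in leb 0 1. integrable (leb 0 T) (\<lambda>\<tau>. D \<tau> s * W \<tau> s)"
    by (rule pair_leb.AE_integrable_snd[OF DW])
  have "integrable (leb2 T) (\<lambda>p. indicator {..t} (fst p) * (case p of (t, s) \<Rightarrow> D t s * W t s))"
    using fst_measurable_leb2[OF measurable_leb[OF borel_measurable_indicator], of "{..t}" T]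
    by (intro integrable_bounded_mult(1)[OF DW, of _ 1]) (auto simp: case_prod_beta')
  then have iDW: "integrable (leb2 T) (\<lambda>(\<tau>, s). indicator {..t} \<tau> * (D \<tau> s * W \<tau> s))"
    by (simp add: case_prod_beta')
  have Dsq: "integrable (leb 0 1) (\<lambda>s. (D 0 s)\<^sup>2)" using Dt[OF zero] by (simp add: Lp2_iff)
  have pint: "integrable (leb 0 1) (\<lambda>s. prim 0 T (\<lambda>\<tau>. D \<tau> s * W \<tau> s) t)"
    unfolding prim_def by (rule pair_leb.integrable_snd[OF iDW])
  \<comment> \<open>Under the time integral agreement at almost all times suffices; at the end time
    \<open>t\<close> itself the instance of \<open>ev\<close> for this \<open>t\<close> is
    used.\<close>
  have ae: "AE s in leb 0 1. (D t s)\<^sup>2 = (D 0 s)\<^sup>2 + 2 * prim 0 T (\<lambda>\<tau>. D \<tau> s * W \<tau> s) t"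
    using W1 DE ev[OF t] DWs
  proof eventually_elim
    fix s assume W1: "integrable (leb 0 T) (\<lambda>\<tau>. W \<tau> s)" and DE: "AE \<tau> in leb 0 T. D \<tau> s = E \<tau> s"
      and Dts: "D t s = D 0 s + prim 0 T (\<lambda>\<tau>. W \<tau> s) t" and DWi: "integrable (leb 0 T) (\<lambda>\<tau>. D \<tau> s * W \<tau> s)"
    have "continuous_on {0..T} (\<lambda>\<tau>. 2 * E \<tau> s)" unfolding E_def
      by (intro continuous_on_add continuous_on_mult continuous_on_const prim_continuous W1)
    from integrable_continuous_mult[OF W1 this]
    have EWm: "(\<lambda>\<tau>. 2 * E \<tau> s * W \<tau> s) \<in> borel_measurable (leb 0 T)" by simp
    have "(D t s)\<^sup>2 = (E t s)\<^sup>2" by (simp add: Dts E_def)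
    also have "\<dots> = (D 0 s)\<^sup>2 + prim 0 T (\<lambda>\<tau>. 2 * E \<tau> s * W \<tau> s) t"
      by (rule prim_chain_rule[OF W1, of "\<lambda>\<tau>. E \<tau> s" "D 0 s" power2 "\<lambda>y. 2 * y"])
        (use t in \<open>auto simp: E_def intro!: derivative_eq_intros continuous_intros\<close>)
    also have "prim 0 T (\<lambda>\<tau>. 2 * E \<tau> s * W \<tau> s) t = prim 0 T (\<lambda>\<tau>. 2 * (D \<tau> s * W \<tau> s)) t"
      using DWi EWm DE by (intro prim_cong_AE) (auto elim: AE_mp)
    also have "\<dots> = 2 * prim 0 T (\<lambda>\<tau>. D \<tau> s * W \<tau> s) t" by (rule prim_cmult)
    finally show "(D t s)\<^sup>2 = (D 0 s)\<^sup>2 + 2 * prim 0 T (\<lambda>\<tau>. D \<tau> s * W \<tau> s) t" .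
  qed
  have "(LINT s|leb 0 1. (D t s)\<^sup>2) = (LINT s|leb 0 1. (D 0 s)\<^sup>2 + 2 * prim 0 T (\<lambda>\<tau>. D \<tau> s * W \<tau> s) t)"
    using ae Dsq pint Dt[OF t] by (intro integral_cong_AE) (auto simp: Lp2_iff)
  also have "\<dots> = (LINT s|leb 0 1. (D 0 s)\<^sup>2) + 2 * (LINT s|leb 0 1. prim 0 T (\<lambda>\<tau>. D \<tau> s * W \<tau> s) t)"
    using Dsq pint by simp
  also have "(LINT s|leb 0 1. prim 0 T (\<lambda>\<tau>. D \<tau> s * W \<tau> s) t)
     = (LINT \<tau>|leb 0 T. LINT s|leb 0 1. indicator {..t} \<tau> * (D \<tau> s * W \<tau> s))"
    unfolding prim_def by (rule pair_leb.Fubini_integral[OF iDW])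
  also have "\<dots> = prim 0 T (\<lambda>\<tau>. LINT s|leb 0 1. D \<tau> s * W \<tau> s) t"
    unfolding prim_def by simp
  finally show "(LINT s|leb 0 1. (D t s)\<^sup>2)
    = (LINT s|leb 0 1. (D 0 s)\<^sup>2) + 2 * prim 0 T (\<lambda>\<tau>. LINT s|leb 0 1. D \<tau> s * W \<tau> s) t" .
qed

section \<open>Approximate solutions\<close>

text \<open>The Lagrangian system up to an error \<open>h\<close>; \<open>L\<close> stands for \<open>\<partial>\<^sub>s \<Lambda>\<close>. Solutions of the limit system
  have \<open>h = 0\<close>, interpolated \<open>N\<close>-particle solutions have \<open>h = 1 / N\<close>.\<close>

definition approx_solution ::
    "real \<Rightarrow> (real \<Rightarrow> real) \<Rightarrow> real \<Rightarrow> (real \<Rightarrow> real \<Rightarrow> real) \<Rightarrow> (real \<Rightarrow> real \<Rightarrow> real) \<Rightarrow> bool" where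
  "approx_solution T d\<phi> h X L \<longleftrightarrow>
     Lp 2 (leb2 T) (\<lambda>(t, s). X t s) \<and> Lp 2 (leb2 T) (\<lambda>(t, s). L t s) \<and>
     (\<forall>t\<in>{0..T}. Lp 2 (leb 0 1) (X t)) \<and>
     (\<forall>t\<in>{0..T}. AE s in leb 0 1. X t s = X 0 s + prim 0 T (\<lambda>\<tau>. - d\<phi> (X \<tau> s) - L \<tau> s) t) \<and>
     (AE t in leb 0 T. admissible (L t) \<and>
        - h * (LINT s|leb 0 1. \<bar>L t s\<bar>) \<le> (LINT s|leb 0 1. (X t s - s) * L t s) \<and>
        (\<forall>m. admissible m \<longrightarrow> (LINT s|leb 0 1. (X t s - s) * m s) \<le> h * (LINT s|leb 0 1. \<bar>m s\<bar>)))"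

lemma Lp2_Lipschitz_compose:
  assumes f: "Lp 2 M f" "finite_measure M" and d: "\<And>x y. \<bar>d x - d y\<bar> \<le> K * \<bar>x - y\<bar>" "d \<in> borel_measurable borel"
  shows "Lp 2 M (\<lambda>x. d (f x))" "(LINT x|M. (d (f x))\<^sup>2) \<le> 2 * (d 0)\<^sup>2 * measure M (space M) + 2 * K\<^sup>2 * (LINT x|M. (f x)\<^sup>2)"
proof -
  interpret finite_measure M by fact
  have le: "(d y)\<^sup>2 \<le> 2 * (d 0)\<^sup>2 + 2 * K\<^sup>2 * y\<^sup>2" for y
  proof -
    have "(d y - d 0)\<^sup>2 \<le> (K * \<bar>y\<bar>)\<^sup>2" using d(1)[of y 0] by (intro abs_le_square_iff[THEN iffD1]) auto
    then show ?thesis using sq_add_le[of "d 0" "d y - d 0"] by (simp add: power_mult_distrib)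
  qed
  have i: "integrable M (\<lambda>x. 2 * (d 0)\<^sup>2 + 2 * K\<^sup>2 * (f x)\<^sup>2)" using f by (simp add: Lp2_iff)
  have m: "(\<lambda>x. d (f x)) \<in> borel_measurable M" using f d by (auto simp: Lp2_iff)
  have "integrable M (\<lambda>x. (d (f x))\<^sup>2)"
    by (rule Bochner_Integration.integrable_bound[OF i]) (use m le in \<open>auto intro!: AE_I2 order_trans[OF le]\<close>)
  with m show "Lp 2 M (\<lambda>x. d (f x))" by (simp add: Lp2_iff)
  have "(LINT x|M. (d (f x))\<^sup>2) \<le> (LINT x|M. 2 * (d 0)\<^sup>2 + 2 * K\<^sup>2 * (f x)\<^sup>2)"
    by (intro integral_mono i le) fact
  also have "\<dots> = 2 * (d 0)\<^sup>2 * measure M (space M) + 2 * K\<^sup>2 * (LINT x|M. (f x)\<^sup>2)"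
    using f by (simp add: Lp2_iff)
  finally show "(LINT x|M. (d (f x))\<^sup>2) \<le> 2 * (d 0)\<^sup>2 * measure M (space M) + 2 * K\<^sup>2 * (LINT x|M. (f x)\<^sup>2)" .
qed

lemma Lp2_leb2_AE: "Lp 2 (leb2 T) (\<lambda>(t, s). L t s) \<Longrightarrow> AE t in leb 0 T. Lp 2 (leb 0 1) (L t)"
proof -
  assume L: "Lp 2 (leb2 T) (\<lambda>(t, s). L t s)"
  have "AE t in leb 0 T. integrable (leb 0 1) (\<lambda>s. (L t s)\<^sup>2)"
    by (rule pair_leb.AE_integrable_fst) (use L in \<open>simp add: Lp2_iff case_prod_beta'\<close>)
  with AE_space show "AE t in leb 0 T. Lp 2 (leb 0 1) (L t)"
    by eventually_elim (use measurable_Pair2[of "\<lambda>(t, s). L t s"] L in \<open>auto simp: Lp2_iff\<close>)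
qed

lemma Lp2_leb2_square_integral:
  assumes "Lp 2 (leb2 T) (\<lambda>(t, s). L t s)"
  shows "integrable (leb 0 T) (\<lambda>t. LINT s|leb 0 1. (L t s)\<^sup>2)"
    "(LINT t|leb 0 T. LINT s|leb 0 1. (L t s)\<^sup>2) = (LINT p|leb2 T. (case p of (t, s) \<Rightarrow> L t s)\<^sup>2)"
    "integrable (leb 0 T) (\<lambda>t. LINT s|leb 0 1. \<bar>L t s\<bar>)"
    "(LINT t|leb 0 T. LINT s|leb 0 1. \<bar>L t s\<bar>) = (LINT p|leb2 T. \<bar>case p of (t, s) \<Rightarrow> L t s\<bar>)"
proof -
  have 1: "integrable (leb2 T) (\<lambda>(t, s). (L t s)\<^sup>2)" using assms by (simp add: Lp2_iff case_prod_beta')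
  have 2: "integrable (leb2 T) (\<lambda>(t, s). \<bar>L t s\<bar>)"
    using integrable_abs[OF Lp2_leb2_integrable[OF assms]] by (simp add: case_prod_beta')
  show "integrable (leb 0 T) (\<lambda>t. LINT s|leb 0 1. (L t s)\<^sup>2)" by (rule pair_leb.integrable_fst[OF 1])
  show "integrable (leb 0 T) (\<lambda>t. LINT s|leb 0 1. \<bar>L t s\<bar>)" by (rule pair_leb.integrable_fst[OF 2])
  show "(LINT t|leb 0 T. LINT s|leb 0 1. (L t s)\<^sup>2) = (LINT p|leb2 T. (case p of (t, s) \<Rightarrow> L t s)\<^sup>2)"
    using pair_leb.integral_fst[OF 1] by (simp add: case_prod_beta')
  show "(LINT t|leb 0 T. LINT s|leb 0 1. \<bar>L t s\<bar>) = (LINT p|leb2 T. \<bar>case p of (t, s) \<Rightarrow> L t s\<bar>)"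
    using pair_leb.integral_fst[OF 2] by (simp add: case_prod_beta')
qed

text \<open>In the time derivative of the squared distance the force contributes at most
  \<open>K\<close> times that distance. The products of positions and multiplier derivatives split
  into two diagonal terms, controlled by complementarity, and two cross terms, controlled by the
  constraint of one solution tested with the multiplier of the other. Together these cost at most
  \<open>(h + h') * g t\<close>, and Gronwall's inequality concludes.\<close>

theorem approx_solution_compare:
  assumes K: "K > 0" and d\<phi>: "\<And>x y. \<bar>d\<phi> x - d\<phi> y\<bar> \<le> K * \<bar>x - y\<bar>" "d\<phi> \<in> borel_measurable borel"
    and S: "approx_solution T d\<phi> h X L" "approx_solution T d\<phi> h' X' L'" and h: "h \<ge> 0" "h' \<ge> 0"
    and t: "t \<in> {0..T}"
  defines "G \<equiv> (LINT t|leb 0 T. LINT s|leb 0 1. \<bar>L t s\<bar>) + (LINT t|leb 0 T. LINT s|leb 0 1. \<bar>L' t s\<bar>)"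
  shows "(LINT s|leb 0 1. (X t s - X' t s)\<^sup>2)
    \<le> 2 * ((LINT s|leb 0 1. (X 0 s - X' 0 s)\<^sup>2) + 2 * (h + h') * G) * exp (4 * K * T)"
proof -
  have X: "Lp 2 (leb2 T) (\<lambda>(t, s). X t s)" "Lp 2 (leb2 T) (\<lambda>(t, s). L t s)" "\<And>t. t \<in> {0..T} \<Longrightarrow> Lp 2 (leb 0 1) (X t)"
    and Xe: "\<And>t. t \<in> {0..T} \<Longrightarrow> AE s in leb 0 1. X t s = X 0 s + prim 0 T (\<lambda>\<tau>. - d\<phi> (X \<tau> s) - L \<tau> s) t"
    and Xc: "AE t in leb 0 T. admissible (L t) \<and>
        - h * (LINT s|leb 0 1. \<bar>L t s\<bar>) \<le> (LINT s|leb 0 1. (X t s - s) * L t s) \<and>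
        (\<forall>m. admissible m \<longrightarrow> (LINT s|leb 0 1. (X t s - s) * m s) \<le> h * (LINT s|leb 0 1. \<bar>m s\<bar>))"
    using S(1) by (auto simp: approx_solution_def)
  have X': "Lp 2 (leb2 T) (\<lambda>(t, s). X' t s)" "Lp 2 (leb2 T) (\<lambda>(t, s). L' t s)" "\<And>t. t \<in> {0..T} \<Longrightarrow> Lp 2 (leb 0 1) (X' t)"
    and Xe': "\<And>t. t \<in> {0..T} \<Longrightarrow> AE s in leb 0 1. X' t s = X' 0 s + prim 0 T (\<lambda>\<tau>. - d\<phi> (X' \<tau> s) - L' \<tau> s) t"
    and Xc': "AE t in leb 0 T. admissible (L' t) \<and>
        - h' * (LINT s|leb 0 1. \<bar>L' t s\<bar>) \<le> (LINT s|leb 0 1. (X' t s - s) * L' t s) \<and>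
        (\<forall>m. admissible m \<longrightarrow> (LINT s|leb 0 1. (X' t s - s) * m s) \<le> h' * (LINT s|leb 0 1. \<bar>m s\<bar>))"
    using S(2) by (auto simp: approx_solution_def)
  define V where "V t s = - d\<phi> (X t s) - L t s" for t s
  define V' where "V' t s = - d\<phi> (X' t s) - L' t s" for t s
  define D where "D t s = X t s - X' t s" for t s
  define W where "W t s = V t s - V' t s" for t s
  define g where "g t = (LINT s|leb 0 1. \<bar>L t s\<bar>) + (LINT s|leb 0 1. \<bar>L' t s\<bar>)" for t
  define u where "u t = (LINT s|leb 0 1. (D t s)\<^sup>2)" for t
  have V2: "Lp 2 (leb2 T) (\<lambda>(t, s). V t s)" "Lp 2 (leb2 T) (\<lambda>(t, s). V' t s)"
    using Lp2_diff[OF Lp2_uminus[OF Lp2_Lipschitz_compose(1)[OF X(1) finite_measure_leb2 d\<phi>]] X(2)]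
      Lp2_diff[OF Lp2_uminus[OF Lp2_Lipschitz_compose(1)[OF X'(1) finite_measure_leb2 d\<phi>]] X'(2)]
    by (simp_all add: V_def V'_def case_prod_beta')
  have W2: "Lp 2 (leb2 T) (\<lambda>(t, s). W t s)" using Lp2_diff[OF V2] by (simp add: W_def case_prod_beta')
  have D2: "Lp 2 (leb2 T) (\<lambda>(t, s). D t s)" using Lp2_diff[OF X(1) X'(1)] by (simp add: D_def case_prod_beta')
  have Dt: "Lp 2 (leb 0 1) (D t)" if "t \<in> {0..T}" for t
    using Lp2_diff[OF X(3) X'(3)] that by (simp add: D_def[abs_def])
  have V1: "AE s in leb 0 1. integrable (leb 0 T) (\<lambda>\<tau>. V \<tau> s)" "AE s in leb 0 1. integrable (leb 0 T) (\<lambda>\<tau>. V' \<tau> s)"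
    by (intro pair_leb.AE_integrable_snd Lp2_leb2_integrable V2)+
  have ev: "AE s in leb 0 1. D t s = D 0 s + prim 0 T (\<lambda>\<tau>. W \<tau> s) t" if "t \<in> {0..T}" for t
    using Xe[OF that, folded V_def] Xe'[OF that, folded V'_def] V1
    by eventually_elim (simp add: D_def W_def prim_diff)
  note en = energy_identity[OF W2 D2 Dt ev, folded u_def]
  have gi: "integrable (leb 0 T) g"
    unfolding g_def using Lp2_leb2_square_integral(3)[OF X(2)] Lp2_leb2_square_integral(3)[OF X'(2)] by simp
  have ui: "integrable (leb 0 T) u" unfolding u_def by (rule Lp2_leb2_square_integral(1)[OF D2])
  have diss: "AE t in leb 0 T. (LINT s|leb 0 1. D t s * W t s) \<le> K * u t + (h + h') * g t"
    using Xc Xc' AE_space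
  proof eventually_elim
    fix t
    assume t: "t \<in> space (leb 0 T)"
      and c: "admissible (L t) \<and>
        - h * (LINT s|leb 0 1. \<bar>L t s\<bar>) \<le> (LINT s|leb 0 1. (X t s - s) * L t s) \<and>
        (\<forall>m. admissible m \<longrightarrow> (LINT s|leb 0 1. (X t s - s) * m s) \<le> h * (LINT s|leb 0 1. \<bar>m s\<bar>))"
      and c': "admissible (L' t) \<and>
        - h' * (LINT s|leb 0 1. \<bar>L' t s\<bar>) \<le> (LINT s|leb 0 1. (X' t s - s) * L' t s) \<and>
        (\<forall>m. admissible m \<longrightarrow> (LINT s|leb 0 1. (X' t s - s) * m s) \<le> h' * (LINT s|leb 0 1. \<bar>m s\<bar>))"
    have tT: "t \<in> {0..T}" using t by auto
    note Xt = X(3)[OF tT] and Xt' = X'(3)[OF tT]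
    have Lt: "Lp 2 (leb 0 1) (L t)" and Lt': "Lp 2 (leb 0 1) (L' t)" using c c' by (auto simp: admissible_def)
    have a: "Lp 2 (leb 0 1) (\<lambda>s. d\<phi> (X t s))" and a': "Lp 2 (leb 0 1) (\<lambda>s. d\<phi> (X' t s))"
      by (intro Lp2_Lipschitz_compose(1)[OF _ finite_measure_leb d\<phi>] Xt Xt')+
    have Xs: "Lp 2 (leb 0 1) (\<lambda>s. X t s - s)" "Lp 2 (leb 0 1) (\<lambda>s. X' t s - s)"
      by (intro Lp2_diff Xt Xt' Lp2_id_leb)+
    have i1: "integrable (leb 0 1) (\<lambda>s. - (D t s * (d\<phi> (X t s) - d\<phi> (X' t s))))"
      by (intro Bochner_Integration.integrable_minus square_integrable_mult Lp2_diff Dt[OF tT] a a')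
    note i2 = square_integrable_mult[OF Xs(1) Lt] square_integrable_mult[OF Xs(1) Lt']
      square_integrable_mult[OF Xs(2) Lt] square_integrable_mult[OF Xs(2) Lt']
    \<comment> \<open>Writing \<open>D\<close> as the difference of \<open>X t s - s\<close> and
      \<open>X' t s - s\<close> brings in the quantities that the constraints control.\<close>
    have "(LINT s|leb 0 1. D t s * W t s) = (LINT s|leb 0 1. - (D t s * (d\<phi> (X t s) - d\<phi> (X' t s)))
        - (X t s - s) * L t s + (X t s - s) * L' t s + (X' t s - s) * L t s - (X' t s - s) * L' t s)"
      by (intro Bochner_Integration.integral_cong refl) (simp add: D_def W_def V_def V'_def algebra_simps)
    also have "\<dots> = (LINT s|leb 0 1. - (D t s * (d\<phi> (X t s) - d\<phi> (X' t s))))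
        - (LINT s|leb 0 1. (X t s - s) * L t s) + (LINT s|leb 0 1. (X t s - s) * L' t s)
        + (LINT s|leb 0 1. (X' t s - s) * L t s) - (LINT s|leb 0 1. (X' t s - s) * L' t s)"
      by (simp only: Bochner_Integration.integral_add Bochner_Integration.integral_diff
          Bochner_Integration.integrable_add Bochner_Integration.integrable_diff i1 i2)
    also have "(LINT s|leb 0 1. - (D t s * (d\<phi> (X t s) - d\<phi> (X' t s)))) \<le> (LINT s|leb 0 1. K * (D t s)\<^sup>2)"
    proof (rule integral_mono[OF i1])
      show "integrable (leb 0 1) (\<lambda>s. K * (D t s)\<^sup>2)" using Dt[OF tT] by (simp add: Lp2_iff)
      fix s
      have "- (D t s * (d\<phi> (X t s) - d\<phi> (X' t s))) \<le> \<bar>D t s\<bar> * \<bar>d\<phi> (X t s) - d\<phi> (X' t s)\<bar>"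
        by (simp add: abs_mult[symmetric])
      also have "\<dots> \<le> \<bar>D t s\<bar> * (K * \<bar>D t s\<bar>)"
        unfolding D_def by (intro mult_left_mono d\<phi>) auto
      also have "\<dots> = K * (D t s)\<^sup>2" by (simp add: power2_eq_square mult.left_commute)
      finally show "- (D t s * (d\<phi> (X t s) - d\<phi> (X' t s))) \<le> K * (D t s)\<^sup>2" .
    qed
    also have "(LINT s|leb 0 1. K * (D t s)\<^sup>2) = K * u t" by (simp add: u_def)
    finally have "(LINT s|leb 0 1. D t s * W t s) \<le> K * u t - (LINT s|leb 0 1. (X t s - s) * L t s)
        + (LINT s|leb 0 1. (X t s - s) * L' t s)
        + (LINT s|leb 0 1. (X' t s - s) * L t s) - (LINT s|leb 0 1. (X' t s - s) * L' t s)" by simp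
    moreover have "(LINT s|leb 0 1. (X t s - s) * L' t s) \<le> h * (LINT s|leb 0 1. \<bar>L' t s\<bar>)"
      "(LINT s|leb 0 1. (X' t s - s) * L t s) \<le> h' * (LINT s|leb 0 1. \<bar>L t s\<bar>)" using c c' by auto
    moreover have "(h + h') * g t = h * (LINT s|leb 0 1. \<bar>L t s\<bar>) + h * (LINT s|leb 0 1. \<bar>L' t s\<bar>)
        + h' * (LINT s|leb 0 1. \<bar>L t s\<bar>) + h' * (LINT s|leb 0 1. \<bar>L' t s\<bar>)"
      by (simp add: g_def distrib_left distrib_right)
    ultimately show "(LINT s|leb 0 1. D t s * W t s) \<le> K * u t + (h + h') * g t"
      using c[THEN conjunct2, THEN conjunct1] c'[THEN conjunct2, THEN conjunct1] by linarith
  qed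
  have int: "integrable (leb 0 T) (\<lambda>\<tau>. LINT s|leb 0 1. D \<tau> s * W \<tau> s)" by (rule en(2)[OF _ _ t]) auto
  have gn: "g t \<ge> 0" for t by (simp add: g_def)
  have Geq: "G = (LINT t|leb 0 T. g t)"
    unfolding G_def g_def using Lp2_leb2_square_integral(3)[OF X(2)] Lp2_leb2_square_integral(3)[OF X'(2)] by simp
  \<comment> \<open>The factor 2 of the energy identity makes the rate \<open>2 * K\<close>;
    \<open>Gronwall\<close> doubles it once more, whence \<open>exp (4 * K * T)\<close>.\<close>
  have main: "u t \<le> (u 0 + 2 * (h + h') * G) + (2 * K) * prim 0 T u t" if t: "t \<in> {0..T}" for t
  proof -
    have ut: "u t = u 0 + 2 * prim 0 T (\<lambda>\<tau>. LINT s|leb 0 1. D \<tau> s * W \<tau> s) t"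
      by (rule en(1)[OF _ _ t]) auto
    have "prim 0 T (\<lambda>\<tau>. LINT s|leb 0 1. D \<tau> s * W \<tau> s) t \<le> prim 0 T (\<lambda>\<tau>. K * u \<tau> + (h + h') * g \<tau>) t"
      by (intro prim_mono_AE int diss) (use ui gi in auto)
    also have "\<dots> = K * prim 0 T u t + (h + h') * prim 0 T g t"
      using ui gi by (simp add: prim_add prim_cmult)
    also have "\<dots> \<le> K * prim 0 T u t + (h + h') * G"
      using prim_bound[OF gi, of t] gn h by (intro add_left_mono mult_left_mono) (auto simp: Geq)
    finally have "2 * prim 0 T (\<lambda>\<tau>. LINT s|leb 0 1. D \<tau> s * W \<tau> s) t \<le> 2 * (K * prim 0 T u t + (h + h') * G)"
      by simp
    then show ?thesis unfolding ut by (simp add: algebra_simps)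
  qed
  have G0: "G \<ge> 0" unfolding Geq by (intro Bochner_Integration.integral_nonneg gn)
  have "u t \<le> 2 * (u 0 + 2 * (h + h') * G) * exp (2 * (2 * K) * t)"
  proof (rule Gronwall[OF _ _ ui _ main t])
    show "0 \<le> u t \<and> u t \<le> u 0 + 2 * (LINT \<tau>|leb 0 T. \<bar>LINT s|leb 0 1. D \<tau> s * W \<tau> s\<bar>)" if t: "t \<in> {0..T}" for t
    proof
      have "u t = u 0 + 2 * prim 0 T (\<lambda>\<tau>. LINT s|leb 0 1. D \<tau> s * W \<tau> s) t"
        by (rule en(1)[OF _ _ t]) auto
      then show "u t \<le> u 0 + 2 * (LINT \<tau>|leb 0 T. \<bar>LINT s|leb 0 1. D \<tau> s * W \<tau> s\<bar>)"
        using prim_bound[OF int, of t] by linarith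
    qed (simp add: u_def)
    have "u 0 \<ge> 0" by (simp add: u_def)
    then show "0 \<le> u 0 + 2 * (h + h') * G" using h G0 by (intro add_nonneg_nonneg mult_nonneg_nonneg) auto
  qed (use K in auto)
  also have "\<dots> \<le> 2 * (u 0 + 2 * (h + h') * G) * exp (4 * K * T)"
  proof (rule mult_left_mono)
    have "u 0 \<ge> 0" by (simp add: u_def)
    then show "0 \<le> 2 * (u 0 + 2 * (h + h') * G)" using h G0 by (intro add_nonneg_nonneg mult_nonneg_nonneg) auto
    show "exp (2 * (2 * K) * t) \<le> exp (4 * K * T)" using t K by simp
  qed
  finally show ?thesis by (simp add: u_def D_def)
qed

section \<open>Lagrangian solutions\<close>

lemma Lp_norm_2_tendsto_iff:
  "((\<lambda>\<tau>. Lp_norm 2 M (f \<tau>)) \<longlongrightarrow> 0) F \<longleftrightarrow> ((\<lambda>\<tau>. LINT x|M. (f \<tau> x)\<^sup>2) \<longlongrightarrow> 0) F"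
proof
  assume "((\<lambda>\<tau>. Lp_norm 2 M (f \<tau>)) \<longlongrightarrow> 0) F"
  from tendsto_power[OF this, of 2] show "((\<lambda>\<tau>. LINT x|M. (f \<tau> x)\<^sup>2) \<longlongrightarrow> 0) F"
    by (simp add: Lp_norm_2)
next
  assume "((\<lambda>\<tau>. LINT x|M. (f \<tau> x)\<^sup>2) \<longlongrightarrow> 0) F"
  from tendsto_real_sqrt[OF this] show "((\<lambda>\<tau>. Lp_norm 2 M (f \<tau>)) \<longlongrightarrow> 0) F"
    by (simp add: Lp_norm_2)
qed

lemma leb2_case_mult:
  assumes "integrable (leb2 T) (\<lambda>(t, s). Y t s)" "g \<in> borel_measurable (leb2 T)"
    "\<And>t s. t \<in> {0<..<T} \<Longrightarrow> s \<in> {0<..<1} \<Longrightarrow> \<bar>g (t, s)\<bar> \<le> (C::real)"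
  shows "integrable (leb2 T) (\<lambda>(t, s). g (t, s) * Y t s)"
proof -
  have "integrable (leb2 T) (\<lambda>p. g p * (case p of (t, s) \<Rightarrow> Y t s))"
    using assms by (intro integrable_bounded_mult(1)[of _ _ _ C]) (auto simp: space_pair_measure)
  then show ?thesis by (simp add: case_prod_beta')
qed

lemma leb2_indicator_mult:
  assumes "integrable (leb2 T) (\<lambda>(t, s). Y t s)"
  shows "integrable (leb2 T) (\<lambda>(\<tau>, s). indicator {..t} \<tau> * Y \<tau> s :: real)"
proof -
  have "(\<lambda>(\<tau>, s). indicator {..t} \<tau> :: real) \<in> borel_measurable (leb2 T)"
    by (intro fst_measurable_leb2 measurable_leb) simp
  from leb2_case_mult[OF assms this, of 1] show ?thesis by simp
qed

text \<open>The exceptional set in \<open>H1L2_deriv\<close> depends on the test function, so the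
  identity cannot simply be read at a fixed \<open>s\<close>. Integrating over a measurable set
  \<open>A\<close> of \<open>s\<close> first gives a continuous scalar function of time with an
  integrable weak derivative, to which the scalar theorem applies. Equality of the integrals over
  every \<open>A\<close> then gives the claim at each single time.\<close>

lemma H1L2_continuous_prim:
  assumes T: "T > 0" and Y: "H1L2_deriv T Y V" and C: "C_Lp 2 T Y" and t: "t \<in> {0..T}"
  shows "AE s in leb 0 1. Y t s = Y 0 s + prim 0 T (\<lambda>\<tau>. V \<tau> s) t"
proof -
  have Y2: "Lp 2 (leb2 T) (\<lambda>(t, s). Y t s)" and V2: "Lp 2 (leb2 T) (\<lambda>(t, s). V t s)"
    and weak: "\<And>\<theta>. test_function 0 T \<theta> \<Longrightarrow> AE s in leb 0 1.
           (LINT t|leb 0 T. Y t s * deriv \<theta> t) = - (LINT t|leb 0 T. V t s * \<theta> t)"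
    using Y by (auto simp: H1L2_deriv_def)
  have Yt: "Lp 2 (leb 0 1) (Y t)" if "t \<in> {0..T}" for t using C that by (auto simp: C_Lp_def)
  have Yc: "((\<lambda>\<tau>. LINT s|leb 0 1. (Y \<tau> s - Y t s)\<^sup>2) \<longlongrightarrow> 0) (at t within {0..T})" if "t \<in> {0..T}" for t
    using C that by (auto simp: C_Lp_def Lp_norm_2_tendsto_iff)
  note Y1 = Lp2_leb2_integrable[OF Y2] and V1 = Lp2_leb2_integrable[OF V2]
  have zero: "0 \<in> {0..T}" using T by simp
  have indm: "indicator A \<in> borel_measurable (leb 0 1)" if "A \<in> sets (leb 0 1)" for A using that by simp
  have key: "(LINT s|leb 0 1. indicator A s * Y t s) = (LINT s|leb 0 1. indicator A s * Y 0 s)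
      + (LINT s|leb 0 1. indicator A s * prim 0 T (\<lambda>\<tau>. V \<tau> s) t)"
    if A: "A \<in> sets (leb 0 1)" for A
  proof -
    define f where "f t = (LINT s|leb 0 1. indicator A s * Y t s)" for t
    define g where "g t = (LINT s|leb 0 1. indicator A s * V t s)" for t
    have fi: "integrable (leb 0 1) (\<lambda>s. indicator A s * Y t s)" if "t \<in> {0..T}" for t
      by (rule integrable_bounded_mult(1)[OF Lp2_leb_integrable[OF Yt[OF that]] indm[OF A], of 1]) simp
    have gm: "integrable (leb2 T) (\<lambda>(t, s). indicator A s * V t s)"
      using leb2_case_mult[OF V1 snd_measurable_leb2[OF indm[OF A]], of 1] by simp
    have gi: "integrable (leb 0 T) g" unfolding g_def by (rule pair_leb.integrable_fst[OF gm])
    have fc: "continuous_on {0..T} f"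
      unfolding continuous_on_def
    proof
      fix t assume t: "t \<in> {0..T}"
      have lim: "((\<lambda>\<tau>. sqrt (LINT s|leb 0 1. (Y \<tau> s - Y t s)\<^sup>2)) \<longlongrightarrow> 0) (at t within {0..T})"
        using tendsto_real_sqrt[OF Yc[OF t]] by simp
      have "((\<lambda>\<tau>. f \<tau> - f t) \<longlongrightarrow> 0) (at t within {0..T})"
      proof (rule Lim_null_comparison[OF _ lim])
        show "\<forall>\<^sub>F \<tau> in at t within {0..T}. norm (f \<tau> - f t) \<le> sqrt (LINT s|leb 0 1. (Y \<tau> s - Y t s)\<^sup>2)"
          unfolding eventually_at_filter
        proof (intro always_eventually allI impI)
          fix \<tau> assume \<tau>: "\<tau> \<in> {0..T}"
          have d2: "Lp 2 (leb 0 1) (\<lambda>s. Y \<tau> s - Y t s)" by (intro Lp2_diff Yt t \<tau>)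
          have "f \<tau> - f t = (LINT s|leb 0 1. indicator A s * Y \<tau> s - indicator A s * Y t s)"
            using fi[OF t] fi[OF \<tau>] by (simp add: f_def)
          also have "\<bar>\<dots>\<bar> \<le> (LINT s|leb 0 1. \<bar>Y \<tau> s - Y t s\<bar>)"
          proof (rule order_trans[OF integral_abs_bound integral_mono])
            show "integrable (leb 0 1) (\<lambda>s. \<bar>indicator A s * Y \<tau> s - indicator A s * Y t s\<bar>)"
              using fi[OF t] fi[OF \<tau>] by auto
            show "integrable (leb 0 1) (\<lambda>s. \<bar>Y \<tau> s - Y t s\<bar>)" using Lp2_leb_integrable[OF d2] by simp
          qed (auto simp: indicator_def)
          also have "\<dots> \<le> sqrt (LINT s|leb 0 1. (Y \<tau> s - Y t s)\<^sup>2)" by (rule integral_abs_le_sqrt_01[OF d2])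
          finally show "norm (f \<tau> - f t) \<le> sqrt (LINT s|leb 0 1. (Y \<tau> s - Y t s)\<^sup>2)" by simp
        qed
      qed
      then show "(f \<longlongrightarrow> f t) (at t within {0..T})" by (rule LIM_zero_cancel)
    qed
    have wk: "(LINT t|leb 0 T. f t * deriv \<theta> t) = - (LINT t|leb 0 T. g t * \<theta> t)" if \<theta>: "test_function 0 T \<theta>" for \<theta>
    proof -
      note tf = test_function_facts[OF \<theta>]
      obtain C1 where C1: "\<And>x. x \<in> {0..T} \<Longrightarrow> \<bar>deriv \<theta> x\<bar> \<le> C1"
        using continuous_bounded_Icc[OF tf(2)] by metis
      obtain C2 where C2: "\<And>x. x \<in> {0..T} \<Longrightarrow> \<bar>\<theta> x\<bar> \<le> C2"
        using continuous_bounded_Icc[OF tf(3)] by metis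
      have m1: "(\<lambda>p. indicator A (snd p) * deriv \<theta> (fst p)) \<in> borel_measurable (leb2 T)"
        "(\<lambda>p. indicator A (snd p) * \<theta> (fst p)) \<in> borel_measurable (leb2 T)"
        using snd_measurable_leb2[OF indm[OF A]] fst_measurable_leb2[OF measurable_leb[OF tf(5)]]
          fst_measurable_leb2[OF measurable_leb[OF tf(6)]]
        by (auto simp: case_prod_beta' intro!: borel_measurable_times)
      have "integrable (leb2 T) (\<lambda>(t, s). (indicator A (snd (t, s)) * deriv \<theta> (fst (t, s))) * Y t s)"
        using C1 by (intro leb2_case_mult[OF Y1 m1(1), of C1])
          (auto simp: abs_mult indicator_def intro!: order_trans[OF abs_ge_zero C1])
      then have i1: "integrable (leb2 T) (\<lambda>(t, s). indicator A s * Y t s * deriv \<theta> t)"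
        by (simp add: case_prod_beta' mult_ac)
      have "integrable (leb2 T) (\<lambda>(t, s). (indicator A (snd (t, s)) * \<theta> (fst (t, s))) * V t s)"
        using C2 by (intro leb2_case_mult[OF V1 m1(2), of C2])
          (auto simp: abs_mult indicator_def intro!: order_trans[OF abs_ge_zero C2])
      then have i2: "integrable (leb2 T) (\<lambda>(t, s). indicator A s * V t s * \<theta> t)"
        by (simp add: case_prod_beta' mult_ac)
      have "(LINT t|leb 0 T. f t * deriv \<theta> t) = (LINT t|leb 0 T. LINT s|leb 0 1. indicator A s * Y t s * deriv \<theta> t)"
        by (simp add: f_def)
      also have "\<dots> = (LINT s|leb 0 1. LINT t|leb 0 T. indicator A s * Y t s * deriv \<theta> t)"
        by (rule pair_leb.Fubini_integral[OF i1, symmetric])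
      also have "\<dots> = (LINT s|leb 0 1. - (LINT t|leb 0 T. indicator A s * V t s * \<theta> t))"
      proof (rule integral_cong_AE)
        show "(\<lambda>s. LINT t|leb 0 T. indicator A s * Y t s * deriv \<theta> t) \<in> borel_measurable (leb 0 1)"
          using pair_leb.integrable_snd[OF i1] by simp
        show "(\<lambda>s. - (LINT t|leb 0 T. indicator A s * V t s * \<theta> t)) \<in> borel_measurable (leb 0 1)"
          using pair_leb.integrable_snd[OF i2] by simp
        show "AE s in leb 0 1. (LINT t|leb 0 T. indicator A s * Y t s * deriv \<theta> t) = - (LINT t|leb 0 T. indicator A s * V t s * \<theta> t)"
          using weak[OF \<theta>] by eventually_elim (simp add: mult.assoc)
      qed
      also have "\<dots> = - (LINT s|leb 0 1. LINT t|leb 0 T. indicator A s * V t s * \<theta> t)" by simp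
      also have "(LINT s|leb 0 1. LINT t|leb 0 T. indicator A s * V t s * \<theta> t)
          = (LINT t|leb 0 T. LINT s|leb 0 1. indicator A s * V t s * \<theta> t)"
        by (rule pair_leb.Fubini_integral[OF i2])
      also have "\<dots> = (LINT t|leb 0 T. g t * \<theta> t)" by (simp add: g_def)
      finally show ?thesis .
    qed
    have "f t = f 0 + prim 0 T g t" by (rule continuous_weak_deriv_prim[OF T fc gi wk t])
    also have "prim 0 T g t = (LINT \<tau>|leb 0 T. LINT s|leb 0 1. indicator {..t} \<tau> * (indicator A s * V \<tau> s))"
      by (simp add: prim_def g_def)
    also have "\<dots> = (LINT s|leb 0 1. LINT \<tau>|leb 0 T. indicator {..t} \<tau> * (indicator A s * V \<tau> s))"
    proof (rule pair_leb.Fubini_integral[symmetric])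
      show "integrable (leb2 T) (\<lambda>(\<tau>, s). indicator {..t} \<tau> * (indicator A s * V \<tau> s))"
        by (rule leb2_indicator_mult[OF gm])
    qed
    also have "\<dots> = (LINT s|leb 0 1. indicator A s * prim 0 T (\<lambda>\<tau>. V \<tau> s) t)"
      by (simp add: prim_def mult.left_commute)
    finally show ?thesis by (simp add: f_def)
  qed
  have pint: "integrable (leb 0 1) (\<lambda>s. prim 0 T (\<lambda>\<tau>. V \<tau> s) t)"
  proof -
    have "integrable (leb2 T) (\<lambda>(\<tau>, s). indicator {..t} \<tau> * V \<tau> s)"
      by (rule leb2_indicator_mult[OF V1])
    from pair_leb.integrable_snd[OF this] show ?thesis by (simp add: prim_def)
  qed
  note Yti = Lp2_leb_integrable[OF Yt[OF t]] and Y0i = Lp2_leb_integrable[OF Yt[OF zero]]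
  show ?thesis
  proof (rule density_unique_real[OF Yti Bochner_Integration.integrable_add[OF Y0i pint]])
    fix A assume A: "A \<in> sets (leb 0 1)"
    have "integrable (leb 0 1) (\<lambda>s. indicator A s * Y 0 s)" "integrable (leb 0 1) (\<lambda>s. indicator A s * prim 0 T (\<lambda>\<tau>. V \<tau> s) t)"
      by (rule integrable_bounded_mult(1)[OF _ indm[OF A], of _ 1]; use Y0i pint in auto)+
    then show "set_lebesgue_integral (leb 0 1) A (Y t)
      = set_lebesgue_integral (leb 0 1) A (\<lambda>s. Y 0 s + prim 0 T (\<lambda>\<tau>. V \<tau> s) t)"
      using key[OF A] by (simp add: set_lebesgue_integral_def distrib_left)
  qed
qed

text \<open>Turns the measure formulation into the integral conditions with error 0. The boundary
  values make \<open>L t\<close> a mean-zero function with primitive \<open>M t\<close>, and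
  \<open>excess_measure_admissible\<close> supplies constraint and complementarity.\<close>

lemma lagrangian_approx_solution:
  assumes T: "T > 0" and d\<phi>: "\<And>x y. \<bar>d\<phi> x - d\<phi> y\<bar> \<le> K * \<bar>x - y\<bar>" "d\<phi> \<in> borel_measurable borel"
    and S: "lagrangian_solution T d\<phi> X0 Y M"
  obtains L where "approx_solution T d\<phi> 0 Y L" "AE t in leb 0 T. \<forall>s\<in>{0..1}. M t s = prim 0 1 (L t) s"
    "AE s in leb 0 1. Y 0 s = X0 s"
proof -
  from S obtain V L where Y: "H1L2_deriv T Y V" and M: "L2H1_deriv T M L"
    and eq: "AE (t, s) in leb2 T. V t s = - d\<phi> (Y t s) - L t s" and C: "C_Lp 2 T Y"
    and init: "AE s in leb 0 1. Y 0 s = X0 s"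
    and con: "AE t in leb 0 T.
        continuous_on {0..1} (M t) \<and> M t 0 = 0 \<and> M t 1 = 0 \<and> (\<forall>s\<in>{0..1}. M t s \<ge> 0) \<and>
        (\<exists>\<mu>. excess_measure (Y t) \<mu> \<and> density \<mu> (\<lambda>s. ennreal (M t s)) = null_measure \<mu>)"
    unfolding lagrangian_solution_def by blast
  have Y2: "Lp 2 (leb2 T) (\<lambda>(t, s). Y t s)" and V2: "Lp 2 (leb2 T) (\<lambda>(t, s). V t s)"
    using Y by (auto simp: H1L2_deriv_def)
  have L2: "Lp 2 (leb2 T) (\<lambda>(t, s). L t s)" and H1: "AE t in leb 0 T. H1_deriv 0 1 (M t) (L t)"
    using M by (auto simp: L2H1_deriv_def)
  have Yt: "Lp 2 (leb 0 1) (Y t)" if "t \<in> {0..T}" for t using C that by (auto simp: C_Lp_def)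
  have W2: "Lp 2 (leb2 T) (\<lambda>(t, s). - d\<phi> (Y t s) - L t s)"
    using Lp2_diff[OF Lp2_uminus[OF Lp2_Lipschitz_compose(1)[OF Y2 finite_measure_leb2 d\<phi>]] L2]
    by (simp add: case_prod_beta')
  have Vm: "(\<lambda>(t, s). V t s) \<in> borel_measurable (leb2 T)" "(\<lambda>(t, s). - d\<phi> (Y t s) - L t s) \<in> borel_measurable (leb2 T)"
    using V2 W2 by (auto simp: Lp2_iff)
  have swap: "AE s in leb 0 1. AE t in leb 0 T. V t s = - d\<phi> (Y t s) - L t s"
    using eq by (simp add: AE_leb2_swap(1)[OF Vm, symmetric] AE_leb2_swap(2)[OF Vm])
  have evo: "AE s in leb 0 1. Y t s = Y 0 s + prim 0 T (\<lambda>\<tau>. - d\<phi> (Y \<tau> s) - L \<tau> s) t" if t: "t \<in> {0..T}" for t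
    using H1L2_continuous_prim[OF T Y C t] swap AE_space
  proof eventually_elim
    fix s assume s: "s \<in> space (leb 0 1)" and e: "AE t in leb 0 T. V t s = - d\<phi> (Y t s) - L t s"
      and Y: "Y t s = Y 0 s + prim 0 T (\<lambda>\<tau>. V \<tau> s) t"
    have "prim 0 T (\<lambda>\<tau>. V \<tau> s) t = prim 0 T (\<lambda>\<tau>. - d\<phi> (Y \<tau> s) - L \<tau> s) t"
      using measurable_Pair1[OF Vm(1) s] measurable_Pair1[OF Vm(2) s] by (intro prim_cong_AE e) auto
    then show "Y t s = Y 0 s + prim 0 T (\<lambda>\<tau>. - d\<phi> (Y \<tau> s) - L \<tau> s) t" using Y by simp
  qed
  have rep: "AE t in leb 0 T. admissible (L t) \<and> (\<forall>s\<in>{0..1}. M t s = prim 0 1 (L t) s)"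
    using con H1
  proof eventually_elim
    fix t assume H: "H1_deriv 0 1 (M t) (L t)"
      and c: "continuous_on {0..1} (M t) \<and> M t 0 = 0 \<and> M t 1 = 0 \<and> (\<forall>s\<in>{0..1}. M t s \<ge> 0) \<and>
        (\<exists>\<mu>. excess_measure (Y t) \<mu> \<and> density \<mu> (\<lambda>s. ennreal (M t s)) = null_measure \<mu>)"
    have Lt: "Lp 2 (leb 0 1) (L t)" using H by (simp add: H1_deriv_def)
    have eq: "M t s = prim 0 1 (L t) s" if "s \<in> {0..1}" for s
      using H1_deriv_continuous_prim[OF _ _ H that Lp2_leb_integrable[OF Lt]] c by simp
    have "(LINT s|leb 0 1. L t s) = 0" using eq[of 1] c by (simp add: prim_right)
    then show "admissible (L t) \<and> (\<forall>s\<in>{0..1}. M t s = prim 0 1 (L t) s)"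
      using Lt eq c by (auto simp: admissible_def)
  qed
  have "AE t in leb 0 T. admissible (L t) \<and>
        - 0 * (LINT s|leb 0 1. \<bar>L t s\<bar>) \<le> (LINT s|leb 0 1. (Y t s - s) * L t s) \<and>
        (\<forall>m. admissible m \<longrightarrow> (LINT s|leb 0 1. (Y t s - s) * m s) \<le> 0 * (LINT s|leb 0 1. \<bar>m s\<bar>))"
    using con rep AE_space
  proof eventually_elim
    fix t assume t: "t \<in> space (leb 0 T)" and r: "admissible (L t) \<and> (\<forall>s\<in>{0..1}. M t s = prim 0 1 (L t) s)"
      and c: "continuous_on {0..1} (M t) \<and> M t 0 = 0 \<and> M t 1 = 0 \<and> (\<forall>s\<in>{0..1}. M t s \<ge> 0) \<and>
        (\<exists>\<mu>. excess_measure (Y t) \<mu> \<and> density \<mu> (\<lambda>s. ennreal (M t s)) = null_measure \<mu>)"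
    from c obtain \<mu> where \<mu>: "excess_measure (Y t) \<mu>" "density \<mu> (\<lambda>s. ennreal (M t s)) = null_measure \<mu>" by blast
    have Ytt: "Lp 2 (leb 0 1) (Y t)" using t by (intro Yt) auto
    show "admissible (L t) \<and>
        - 0 * (LINT s|leb 0 1. \<bar>L t s\<bar>) \<le> (LINT s|leb 0 1. (Y t s - s) * L t s) \<and>
        (\<forall>m. admissible m \<longrightarrow> (LINT s|leb 0 1. (Y t s - s) * m s) \<le> 0 * (LINT s|leb 0 1. \<bar>m s\<bar>))"
      using r excess_measure_admissible(1)[OF \<mu>(1) Ytt] excess_measure_admissible(2)[OF \<mu>(1) Ytt _ \<mu>(2)] by simp
  qed
  then have "approx_solution T d\<phi> 0 Y L"
    unfolding approx_solution_def using Y2 L2 Yt evo by blast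
  moreover have "AE t in leb 0 T. \<forall>s\<in>{0..1}. M t s = prim 0 1 (L t) s"
    using rep by eventually_elim simp
  ultimately show thesis using init by (intro that)
qed

lemma square_integral_eq_0:
  assumes "Lp 2 M f" "(LINT x|M. (f x)\<^sup>2) = 0"
  shows "AE x in M. f x = 0"
  using assms by (subst (asm) integral_nonneg_eq_0_iff_AE) (auto simp: Lp2_iff)

text \<open>Comparison with both errors 0 and equal initial data identifies the positions. The two
  evolution equations then force the time primitives of the difference of the multiplier derivatives
  to vanish; so these derivatives agree, and the multipliers are their space primitives.\<close>

theorem lagrangian_solution_unique:
  assumes T: "T > 0" and K: "K > 0" and d\<phi>: "\<And>x y. \<bar>d\<phi> x - d\<phi> y\<bar> \<le> K * \<bar>x - y\<bar>" "d\<phi> \<in> borel_measurable borel"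
    and S: "lagrangian_solution T d\<phi> X0 Y M" "lagrangian_solution T d\<phi> X0 X \<Lambda>"
  shows "t \<in> {0..T} \<Longrightarrow> AE s in leb 0 1. Y t s = X t s"
    and "AE t in leb 0 T. \<forall>s\<in>{0..1}. M t s = \<Lambda> t s"
proof -
  obtain L where Y: "approx_solution T d\<phi> 0 Y L" "AE t in leb 0 T. \<forall>s\<in>{0..1}. M t s = prim 0 1 (L t) s"
    "AE s in leb 0 1. Y 0 s = X0 s" by (rule lagrangian_approx_solution[OF T d\<phi> S(1)])
  obtain L' where X: "approx_solution T d\<phi> 0 X L'" "AE t in leb 0 T. \<forall>s\<in>{0..1}. \<Lambda> t s = prim 0 1 (L' t) s"
    "AE s in leb 0 1. X 0 s = X0 s" by (rule lagrangian_approx_solution[OF T d\<phi> S(2)])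
  have Y2: "Lp 2 (leb2 T) (\<lambda>(t, s). Y t s)" "Lp 2 (leb2 T) (\<lambda>(t, s). L t s)" "\<And>t. t \<in> {0..T} \<Longrightarrow> Lp 2 (leb 0 1) (Y t)"
    and Ye: "\<And>t. t \<in> {0..T} \<Longrightarrow> AE s in leb 0 1. Y t s = Y 0 s + prim 0 T (\<lambda>\<tau>. - d\<phi> (Y \<tau> s) - L \<tau> s) t"
    using Y(1) by (auto simp: approx_solution_def)
  have X2: "Lp 2 (leb2 T) (\<lambda>(t, s). X t s)" "Lp 2 (leb2 T) (\<lambda>(t, s). L' t s)" "\<And>t. t \<in> {0..T} \<Longrightarrow> Lp 2 (leb 0 1) (X t)"
    and Xe: "\<And>t. t \<in> {0..T} \<Longrightarrow> AE s in leb 0 1. X t s = X 0 s + prim 0 T (\<lambda>\<tau>. - d\<phi> (X \<tau> s) - L' \<tau> s) t"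
    using X(1) by (auto simp: approx_solution_def)
  have "(LINT s|leb 0 1. (Y 0 s - X 0 s)\<^sup>2) = 0"
    by (rule integral_eq_zero_AE) (use Y(3) X(3) in \<open>eventually_elim, simp\<close>)
  then have le: "(LINT s|leb 0 1. (Y t s - X t s)\<^sup>2) \<le> 0" if "t \<in> {0..T}" for t
    using approx_solution_compare[OF K d\<phi> Y(1) X(1) _ _ that] by simp
  have eq: "AE s in leb 0 1. Y t s = X t s" if t: "t \<in> {0..T}" for t
  proof -
    have "(LINT s|leb 0 1. (Y t s - X t s)\<^sup>2) = 0"
      using le[OF t] square_integral_nonneg[of "leb 0 1" "\<lambda>s. Y t s - X t s"] by linarith
    from square_integral_eq_0[OF Lp2_diff[OF Y2(3)[OF t] X2(3)[OF t]] this] show ?thesis by simp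
  qed
  then show "t \<in> {0..T} \<Longrightarrow> AE s in leb 0 1. Y t s = X t s" .
  have Ym: "(\<lambda>(t, s). Y t s) \<in> borel_measurable (leb2 T)" "(\<lambda>(t, s). X t s) \<in> borel_measurable (leb2 T)"
    and Lm: "(\<lambda>(t, s). L t s) \<in> borel_measurable (leb2 T)" "(\<lambda>(t, s). L' t s) \<in> borel_measurable (leb2 T)"
    using Y2 X2 by (auto simp: Lp2_iff)
  have "AE t in leb 0 T. AE s in leb 0 1. Y t s = X t s"
    by (rule AE_I2, rule eq) auto
  then have YX: "AE s in leb 0 1. AE t in leb 0 T. Y t s = X t s" by (simp add: AE_leb2_swap(1)[OF Ym])
  have Wm: "(\<lambda>(t, s). - d\<phi> (X t s) - L t s) \<in> borel_measurable (leb2 T)" "(\<lambda>(t, s). - d\<phi> (X t s) - L' t s) \<in> borel_measurable (leb2 T)"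
      "(\<lambda>(t, s). - d\<phi> (Y t s) - L t s) \<in> borel_measurable (leb2 T)"
    using measurable_compose[OF Ym(1) d\<phi>(2)] measurable_compose[OF Ym(2) d\<phi>(2)] Lm unfolding case_prod_beta'
    by (auto intro!: borel_measurable_diff borel_measurable_uminus)
  have Wi: "AE s in leb 0 1. integrable (leb 0 T) (\<lambda>\<tau>. - d\<phi> (X \<tau> s) - L' \<tau> s)"
    "AE s in leb 0 1. integrable (leb 0 T) (\<lambda>\<tau>. - d\<phi> (X \<tau> s) - L \<tau> s)"
  proof -
    note a = Lp2_uminus[OF Lp2_Lipschitz_compose(1)[OF X2(1) finite_measure_leb2 d\<phi>]]
    show "AE s in leb 0 1. integrable (leb 0 T) (\<lambda>\<tau>. - d\<phi> (X \<tau> s) - L' \<tau> s)"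
      using Lp2_leb2_integrable[OF Lp2_diff[OF a X2(2)]] by (intro pair_leb.AE_integrable_snd) (simp add: case_prod_beta')
    show "AE s in leb 0 1. integrable (leb 0 T) (\<lambda>\<tau>. - d\<phi> (X \<tau> s) - L \<tau> s)"
      using Lp2_leb2_integrable[OF Lp2_diff[OF a Y2(2)]] by (intro pair_leb.AE_integrable_snd) (simp add: case_prod_beta')
  qed
  have Li: "AE s in leb 0 1. integrable (leb 0 T) (\<lambda>\<tau>. L' \<tau> s - L \<tau> s)"
    using Lp2_leb2_integrable[OF Lp2_diff[OF X2(2) Y2(2)]] by (intro pair_leb.AE_integrable_snd) (simp add: case_prod_beta')
  have pt: "AE s in leb 0 1. prim 0 T (\<lambda>\<tau>. L' \<tau> s - L \<tau> s) t = 0" if t: "t \<in> {0..T}" for t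
  proof -
    have z: "0 \<in> {0..T}" using T by simp
    show ?thesis
      using Ye[OF t] Xe[OF t] eq[OF t] eq[OF z] Wi YX AE_space
    proof eventually_elim
      case (elim s)
      have "prim 0 T (\<lambda>\<tau>. - d\<phi> (Y \<tau> s) - L \<tau> s) t = prim 0 T (\<lambda>\<tau>. - d\<phi> (X \<tau> s) - L \<tau> s) t"
        using measurable_Pair1[OF Wm(1), of s] measurable_Pair1[OF Wm(3), of s] elim
        by (intro prim_cong_AE) (auto elim: AE_mp)
      then have "prim 0 T (\<lambda>\<tau>. - d\<phi> (X \<tau> s) - L \<tau> s) t - prim 0 T (\<lambda>\<tau>. - d\<phi> (X \<tau> s) - L' \<tau> s) t = 0"
        using elim by simp
      then show ?case using elim by (subst (asm) prim_diff[symmetric]) auto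
    qed
  qed
  \<comment> \<open>Each time has its own null set of \<open>s\<close>. Rational times leave a
    single one, and continuity of \<open>prim\<close> in time restores the others.\<close>
  have "AE s in leb 0 1. \<forall>q\<in>\<rat>. prim 0 T (\<lambda>\<tau>. L' \<tau> s - L \<tau> s) q = 0"
  proof (subst AE_ball_countable[OF countable_rat], intro ballI)
    fix q :: real
    consider "q \<le> 0" | "q \<in> {0..T}" | "q \<ge> T" by fastforce
    then show "AE s in leb 0 1. prim 0 T (\<lambda>\<tau>. L' \<tau> s - L \<tau> s) q = 0"
    proof cases
      case 3
      have "T \<in> {0..T}" using T by simp
      from pt[OF this] show ?thesis using 3 by (simp add: prim_right)
    qed (use pt in \<open>auto simp: prim_left\<close>)
  qed
  then have "AE s in leb 0 1. AE t in leb 0 T. L' t s = L t s"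
    using Li
  proof eventually_elim
    fix s assume i: "integrable (leb 0 T) (\<lambda>\<tau>. L' \<tau> s - L \<tau> s)" and z: "\<forall>q\<in>\<rat>. prim 0 T (\<lambda>\<tau>. L' \<tau> s - L \<tau> s) q = 0"
    have "prim 0 T (\<lambda>\<tau>. L' \<tau> s - L \<tau> s) q = 0" for q
      by (rule continuous_constant_on_closure[of \<rat>]) (use z in \<open>auto simp: Rats_closure_real intro!: prim_continuous i\<close>)
    from prim_eq_0_imp_AE[OF i this] show "AE t in leb 0 T. L' t s = L t s" by simp
  qed
  then have "AE t in leb 0 T. AE s in leb 0 1. L' t s = L t s" by (simp add: AE_leb2_swap(1)[OF Lm(2,1)])
  then show "AE t in leb 0 T. \<forall>s\<in>{0..1}. M t s = \<Lambda> t s"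
    using Y(2) X(2) AE_space
  proof eventually_elim
    fix t assume t: "t \<in> space (leb 0 T)" and e: "AE s in leb 0 1. L' t s = L t s"
      and r: "\<forall>s\<in>{0..1}. M t s = prim 0 1 (L t) s" "\<forall>s\<in>{0..1}. \<Lambda> t s = prim 0 1 (L' t) s"
    have "prim 0 1 (L' t) s = prim 0 1 (L t) s" for s
      using measurable_Pair2[OF Lm(1) t] measurable_Pair2[OF Lm(2) t] by (intro prim_cong_AE e) auto
    then show "\<forall>s\<in>{0..1}. M t s = \<Lambda> t s" using r by simp
  qed
qed

section \<open>Step functions on the cells\<close>

text \<open>At \<open>s = 0\<close> the index is 1 by the convention in \<open>cell\<close>,
  although 0 does not belong to the half-open cell; hence the assumption
  \<open>s > 0\<close>.\<close>

lemma cell_iff: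
  assumes "i \<ge> 1" "N \<ge> 1" "s > 0"
  shows "cell N s = i \<longleftrightarrow> s \<in> {(real i - 1) / real N<..real i / real N}"
proof
  assume c: "cell N s = i"
  have pos: "real N * s > 0" using assms by simp
  then have "nat \<lceil>real N * s\<rceil> \<ge> 1" by (simp add: le_nat_iff)
  then have "\<lceil>real N * s\<rceil> = int i" using c by (simp add: cell_def)
  then have "real i - 1 < real N * s" "real N * s \<le> real i" by linarith+
  then show "s \<in> {(real i - 1) / real N<..real i / real N}" using assms by (auto simp: field_simps)
qed (use cell_eq assms in blast)

lemma cell_range:
  assumes "N \<ge> 1" "s \<in> {0<..<1}" shows "cell N s \<in> {1..N}"
proof -
  have "real N * s \<le> real N * 1" using assms by (intro mult_left_mono) auto
  then have "\<lceil>real N * s\<rceil> \<le> int N" by (simp add: ceiling_le_iff)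
  then show ?thesis using assms by (auto simp: cell_def)
qed

lemma cell_bounds:
  assumes "N \<ge> 1" "s \<in> {0<..<1}"
  shows "s \<le> real (cell N s) / real N" "real (cell N s) / real N - 1 / real N < s"
  using cell_iff[of "cell N s" N s] cell_range[OF assms] assms by (auto simp: diff_divide_distrib)

lemma cell_mono: "s \<le> s' \<Longrightarrow> cell N s \<le> cell N s'"
  unfolding cell_def by (intro max.mono nat_mono ceiling_mono mult_left_mono) auto

lemma cell_indicator:
  assumes "i \<in> {1..N}" "s \<in> {0<..<1}"
  shows "indicator {..real i / real N} s - indicator {..(real i - 1) / real N} s = (of_bool (cell N s = i) :: real)"
proof -
  have "(real i - 1) / real N \<le> real i / real N" by (simp add: divide_right_mono)
  then show ?thesis using cell_iff[of i N s] assms by (auto simp: indicator_def)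
qed

lemma cell_sum:
  fixes y :: "nat \<Rightarrow> real"
  assumes "N \<ge> 1" "s \<in> {0<..<1}"
  shows "y (cell N s) = (\<Sum>i=1..N. y i * of_bool (cell N s = i))"
  using cell_range[OF assms] by (subst sum.remove[of _ "cell N s"]) auto

lemma cell_measurable: "N \<ge> 1 \<Longrightarrow> (\<lambda>s. y (cell N s) :: real) \<in> borel_measurable (leb 0 1)"
proof -
  assume N: "N \<ge> 1"
  have "(\<lambda>s. \<Sum>i=1..N. y i * (indicator {..real i / real N} s - indicator {..(real i - 1) / real N} s)) \<in> borel_measurable (leb 0 1)"
    by (intro borel_measurable_sum borel_measurable_times borel_measurable_diff measurable_leb) auto
  also have "?this \<longleftrightarrow> ?thesis"
    by (intro measurable_cong) (simp add: cell_sum[OF N] cell_indicator del: sum_of_bool_eq sum_mult_of_bool_eq)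
  finally show ?thesis .
qed

lemma Lp2_cell: "N \<ge> 1 \<Longrightarrow> Lp 2 (leb 0 1) (\<lambda>s. y (cell N s))"
proof -
  assume N: "N \<ge> 1"
  note m = cell_measurable[OF N, of y]
  have "integrable (leb 0 1) (\<lambda>s. (y (cell N s))\<^sup>2)"
  proof (rule finite_measure.integrable_const_bound[OF finite_measure_leb, where B="\<Sum>i=1..N. (y i)\<^sup>2"])
    show "AE s in leb 0 1. norm ((y (cell N s))\<^sup>2) \<le> (\<Sum>i=1..N. (y i)\<^sup>2)"
    proof (rule AE_I2)
      fix s assume "s \<in> space (leb 0 1)"
      then have "cell N s \<in> {1..N}" by (intro cell_range[OF N]) simp
      then have "(y (cell N s))\<^sup>2 \<le> (\<Sum>i=1..N. (y i)\<^sup>2)" by (intro member_le_sum) auto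
      then show "norm ((y (cell N s))\<^sup>2) \<le> (\<Sum>i=1..N. (y i)\<^sup>2)" by simp
    qed
  qed (use m in simp)
  with m show ?thesis by (simp add: Lp2_iff)
qed

lemma cell_integral_mult:
  fixes y :: "nat \<Rightarrow> real"
  assumes N: "N \<ge> 1" and m: "integrable (leb 0 1) m"
  shows "(LINT s|leb 0 1. y (cell N s) * m s) = (\<Sum>i=1..N. y i * (prim 0 1 m (real i / real N) - prim 0 1 m ((real i - 1) / real N)))"
proof -
  have i: "integrable (leb 0 1) (\<lambda>s. y i * (indicator {..real i / real N} s * m s - indicator {..(real i - 1) / real N} s * m s))" for i
    by (intro integrable_mult_right Bochner_Integration.integrable_diff prim_integrable m)
  have "(LINT s|leb 0 1. y (cell N s) * m s)
    = (LINT s|leb 0 1. (\<Sum>i=1..N. y i * (indicator {..real i / real N} s * m s - indicator {..(real i - 1) / real N} s * m s)))"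
  proof (intro Bochner_Integration.integral_cong refl)
    fix s assume "s \<in> space (leb 0 1)"
    then have s: "s \<in> {0<..<1}" by simp
    have "(\<Sum>i=1..N. y i * (indicator {..real i / real N} s * m s - indicator {..(real i - 1) / real N} s * m s))
       = (\<Sum>i=1..N. (y i * of_bool (cell N s = i)) * m s)"
      unfolding left_diff_distrib[symmetric] by (intro sum.cong refl) (simp add: cell_indicator[OF _ s])
    also have "\<dots> = y (cell N s) * m s" by (simp only: sum_distrib_right[symmetric] cell_sum[OF N s, symmetric])
    finally show "y (cell N s) * m s = (\<Sum>i=1..N. y i * (indicator {..real i / real N} s * m s - indicator {..(real i - 1) / real N} s * m s))" by simp
  qed
  also have "\<dots> = (\<Sum>i=1..N. LINT s|leb 0 1. y i * (indicator {..real i / real N} s * m s - indicator {..(real i - 1) / real N} s * m s))"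
    by (rule Bochner_Integration.integral_sum) (rule i)
  also have "\<dots> = (\<Sum>i=1..N. y i * (prim 0 1 m (real i / real N) - prim 0 1 m ((real i - 1) / real N)))"
    using m by (simp add: prim_def prim_integrable)
  finally show ?thesis .
qed

lemma prim_one_min: "0 \<le> t \<Longrightarrow> prim 0 1 (\<lambda>_. 1) t = min t 1"
  using prim_one[of t] by (cases "t = 0"; cases "t < 1") (auto simp: prim_left prim_right measure_leb_le_1[simplified])

lemma cell_integral:
  assumes N: "N \<ge> 1"
  shows "(LINT s|leb 0 1. y (cell N s)) = (\<Sum>i=1..N. y i) / real N"
proof -
  have one: "integrable (leb 0 1) (\<lambda>_. 1::real)" by (rule Lp2_leb_integrable[OF Lp2_const_leb])
  have "(LINT s|leb 0 1. y (cell N s)) = (\<Sum>i=1..N. y i * (prim 0 1 (\<lambda>_. 1) (real i / real N) - prim 0 1 (\<lambda>_. 1) ((real i - 1) / real N)))"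
    using cell_integral_mult[OF N one, of y] by simp
  also have "\<dots> = (\<Sum>i=1..N. y i * (1 / real N))"
  proof (intro sum.cong refl)
    fix i assume "i \<in> {1..N}"
    then have "prim 0 1 (\<lambda>_. 1) (real i / real N) = real i / real N"
      "prim 0 1 (\<lambda>_. 1) ((real i - 1) / real N) = (real i - 1) / real N"
      by (auto simp: prim_one_min min_def field_simps)
    then show "y i * (prim 0 1 (\<lambda>_. 1) (real i / real N) - prim 0 1 (\<lambda>_. 1) ((real i - 1) / real N)) = y i * (1 / real N)"
      by (simp add: diff_divide_distrib)
  qed
  also have "\<dots> = (\<Sum>i=1..N. y i) / real N" by (simp add: sum_divide_distrib)
  finally show ?thesis .
qed

lemma sum_by_parts:
  fixes a b :: "nat \<Rightarrow> real"
  assumes "N \<ge> 1"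
  shows "(\<Sum>i=1..N. a i * (b i - b (i - 1))) = a N * b N - a 1 * b 0 - (\<Sum>i=1..<N. b i * (a (i + 1) - a i))"
  using assms
proof (induction N rule: nat_induct_at_least)
  case base
  then show ?case by (simp add: right_diff_distrib)
next
  case (Suc n)
  have "(\<Sum>i=1..<Suc n. b i * (a (i + 1) - a i)) = (\<Sum>i=1..<n. b i * (a (i + 1) - a i)) + b n * (a (Suc n) - a n)"
    using Suc.hyps by simp
  moreover have "(\<Sum>i=1..Suc n. a i * (b i - b (i - 1))) = (\<Sum>i=1..n. a i * (b i - b (i - 1))) + a (Suc n) * (b (Suc n) - b n)"
    by simp
  ultimately show ?case
    unfolding Suc.IH by (simp add: algebra_simps)
qed

text \<open>The slopes of a piecewise linear function integrate back to it: complete cells before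
  \<open>s\<close> telescope, and the cell of \<open>s\<close> contributes a partial increment. This
  identifies \<open>interp_lin\<close> with a space primitive when the multiplier at index 0
  vanishes.\<close>

lemma prim_cell:
  fixes \<Lambda> :: "nat \<Rightarrow> real"
  assumes N: "N \<ge> 1" and s: "s \<in> {0..1}"
  defines "i \<equiv> cell N s"
  shows "prim 0 1 (\<lambda>r. real N * (\<Lambda> (cell N r) - \<Lambda> (cell N r - 1))) s
    = real N * (\<Lambda> i - \<Lambda> (i - 1)) * (s - (real i - 1) / real N) + \<Lambda> (i - 1) - \<Lambda> 0"
proof (cases "s = 0")
  case True
  then show ?thesis by (simp add: i_def cell_def prim_left)
next
  case False
  have i: "i \<ge> 1" "i \<le> N" "(real i - 1) / real N < s" "s \<le> real i / real N"
  proof -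
    show 1: "i \<ge> 1" by (simp add: i_def cell_def)
    show "(real i - 1) / real N < s" "s \<le> real i / real N"
      using cell_iff[of i N s] 1 N False s by (auto simp: i_def)
    then have "(real i - 1) / real N < 1" using s by simp
    then have "real i - 1 < real N" using N by (simp add: pos_divide_less_eq)
    then show "i \<le> N" by linarith
  qed
  define y where "y j = real N * (\<Lambda> j - \<Lambda> (j - 1))" for j
  have pint: "integrable (leb 0 1) (indicator {..s} :: real \<Rightarrow> real)"
    using prim_integrable[OF Lp2_leb_integrable[OF Lp2_const_leb[of 0 1 1]], of s] by simp
  \<comment> \<open>The cut-off at \<open>s\<close> takes the place of the weight in
    \<open>cell_integral_mult\<close>, so cell \<open>j\<close> contributes its length to the left
    of \<open>s\<close>.\<close>
  have "prim 0 1 (\<lambda>r. y (cell N r)) s = (LINT r|leb 0 1. y (cell N r) * indicator {..s} r)"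
    by (simp add: prim_def mult.commute)
  also have "\<dots> = (\<Sum>j=1..N. y j * (prim 0 1 (indicator {..s}) (real j / real N) - prim 0 1 (indicator {..s}) ((real j - 1) / real N)))"
    by (rule cell_integral_mult[OF N pint])
  also have "\<dots> = (\<Sum>j=1..N. y j * (min s (real j / real N) - min s ((real j - 1) / real N)))"
  proof (intro sum.cong refl)
    fix j assume j: "j \<in> {1..N}"
    have p: "prim 0 1 (indicator {..s}) r = min s r" if "0 \<le> r" "r \<le> 1" for r
    proof -
      have "prim 0 1 (indicator {..s}) r = prim 0 1 (\<lambda>_. 1) (min s r)"
        unfolding prim_def by (intro Bochner_Integration.integral_cong refl) (auto simp: indicator_def)
      then show ?thesis using that s by (simp add: prim_one_min)
    qed
    show "y j * (prim 0 1 (indicator {..s}) (real j / real N) - prim 0 1 (indicator {..s}) ((real j - 1) / real N))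
      = y j * (min s (real j / real N) - min s ((real j - 1) / real N))"
      using j by (subst (1 2) p) (auto simp: field_simps)
  qed
  also have "{1..N} = {1..<i} \<union> {i} \<union> {i<..N}" using i by auto
  also have "(\<Sum>j\<in>\<dots>. y j * (min s (real j / real N) - min s ((real j - 1) / real N)))
     = (\<Sum>j=1..<i. y j * (min s (real j / real N) - min s ((real j - 1) / real N)))
      + y i * (min s (real i / real N) - min s ((real i - 1) / real N))
      + (\<Sum>j\<in>{i<..N}. y j * (min s (real j / real N) - min s ((real j - 1) / real N)))"
    by (subst sum.union_disjoint; (subst sum.union_disjoint)?) auto
  also have "(\<Sum>j\<in>{i<..N}. y j * (min s (real j / real N) - min s ((real j - 1) / real N))) = 0"
  proof (intro sum.neutral ballI)
    fix j assume j: "j \<in> {i<..N}"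
    have "real i / real N \<le> (real j - 1) / real N" "(real j - 1) / real N \<le> real j / real N"
      using j by (auto intro!: divide_right_mono)
    then show "y j * (min s (real j / real N) - min s ((real j - 1) / real N)) = 0"
      using i by simp
  qed
  also have "(\<Sum>j=1..<i. y j * (min s (real j / real N) - min s ((real j - 1) / real N))) = (\<Sum>j=1..<i. \<Lambda> j - \<Lambda> (j - 1))"
  proof (intro sum.cong refl)
    fix j assume j: "j \<in> {1..<i}"
    have "real j / real N \<le> (real i - 1) / real N" "(real j - 1) / real N \<le> real j / real N"
      using j by (auto intro!: divide_right_mono)
    then have "min s (real j / real N) - min s ((real j - 1) / real N) = 1 / real N"
      using i by (simp add: diff_divide_distrib)
    then show "y j * (min s (real j / real N) - min s ((real j - 1) / real N)) = \<Lambda> j - \<Lambda> (j - 1)"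
      using N by (simp add: y_def)
  qed
  also have "(\<Sum>j=1..<i. \<Lambda> j - \<Lambda> (j - 1)) = \<Lambda> (i - 1) - \<Lambda> 0"
    using i(1) by (induction i rule: nat_induct_at_least) (simp_all add: not_less_eq_eq)
  also have "y i * (min s (real i / real N) - min s ((real i - 1) / real N)) = y i * (s - (real i - 1) / real N)"
    using i by simp
  finally show ?thesis by (simp add: y_def)
qed

text \<open>On the unit interval a primitive is bounded by the L1 norm, hence by the L2 norm, of its
  derivative. So L2 convergence of the derivatives is all that has to be shown for strong
  convergence in \<open>L\<^sup>2(0,T;H\<^sup>1(0,1))\<close>.\<close>

lemma L2H1_deriv_prim:
  assumes L: "Lp 2 (leb2 T) (\<lambda>(t, s). L t s)"
  shows "L2H1_deriv T (\<lambda>t s. prim 0 1 (L t) s) L"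
    and "(LINT p|leb2 T. (case p of (t, s) \<Rightarrow> prim 0 1 (L t) s)\<^sup>2) \<le> (LINT p|leb2 T. (case p of (t, s) \<Rightarrow> L t s)\<^sup>2)"
proof -
  have Lm: "(\<lambda>(t, s). L t s) \<in> borel_measurable (leb2 T)" using L by (simp add: Lp2_iff)
  have pm: "(\<lambda>(t, s). prim 0 1 (L t) s) \<in> borel_measurable (leb2 T)" by (rule prim_space_measurable[OF Lm])
  note q = Lp2_leb2_square_integral(1,2)[OF L]
  define Q where "Q t = (LINT s|leb 0 1. (L t s)\<^sup>2)" for t
  have Qi: "integrable (leb 0 T) Q" using q unfolding Q_def by simp
  have ae: "AE t in leb 0 T. Lp 2 (leb 0 1) (L t)" by (rule Lp2_leb2_AE[OF L])
  have le: "(prim 0 1 (L t) s)\<^sup>2 \<le> Q t" if "Lp 2 (leb 0 1) (L t)" for t s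
  proof -
    have "\<bar>prim 0 1 (L t) s\<bar> \<le> sqrt (Q t)"
      using prim_bound[OF Lp2_leb_integrable[OF that], of s] integral_abs_le_sqrt_01[OF that] by (simp add: Q_def)
    then have "\<bar>prim 0 1 (L t) s\<bar>\<^sup>2 \<le> (sqrt (Q t))\<^sup>2" by (intro power_mono) auto
    then show ?thesis by (simp add: Q_def)
  qed
  have Lp_prim: "Lp 2 (leb 0 1) (prim 0 1 (L t))" if "Lp 2 (leb 0 1) (L t)" for t
    by (intro Lp2_continuous prim_continuous Lp2_leb_integrable that)
  have inner: "(LINT s|leb 0 1. (prim 0 1 (L t) s)\<^sup>2) \<le> Q t" if L: "Lp 2 (leb 0 1) (L t)" for t
  proof -
    have "(LINT s|leb 0 1. (prim 0 1 (L t) s)\<^sup>2) \<le> (LINT s|leb 0 1. Q t)"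
      using Lp_prim[OF L] Lp2_leb_integrable[OF Lp2_const_leb[of 0 1 "Q t"]] by (intro integral_mono le L) (auto simp: Lp2_iff)
    then show ?thesis using measure_leb_le_1 by simp
  qed
  have m1: "(\<lambda>t. LINT s|leb 0 1. norm (case (t, s) of (t, s) \<Rightarrow> (prim 0 1 (L t) s)\<^sup>2)) \<in> borel_measurable (leb 0 T)"
  proof -
    have "(\<lambda>(t, s). (prim 0 1 (L t) s)\<^sup>2) \<in> borel_measurable (leb2 T)"
      using pm by (simp add: case_prod_beta')
    from sigma_finite_measure.borel_measurable_lebesgue_integral[OF sigma_finite_leb this]
    show ?thesis by simp
  qed
  have i: "integrable (leb2 T) (\<lambda>(t, s). (prim 0 1 (L t) s)\<^sup>2)"
  proof (rule pair_leb.Fubini_integrable)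
    show "(\<lambda>(t, s). (prim 0 1 (L t) s)\<^sup>2) \<in> borel_measurable (leb2 T)" using pm by (simp add: case_prod_beta')
    show "AE t in leb 0 T. integrable (leb 0 1) (\<lambda>s. case (t, s) of (t, s) \<Rightarrow> (prim 0 1 (L t) s)\<^sup>2)"
      using ae by eventually_elim (use Lp_prim in \<open>simp add: Lp2_iff\<close>)
    show "integrable (leb 0 T) (\<lambda>t. LINT s|leb 0 1. norm (case (t, s) of (t, s) \<Rightarrow> (prim 0 1 (L t) s)\<^sup>2))"
      by (rule Bochner_Integration.integrable_bound[OF Qi m1])
        (use ae in \<open>eventually_elim, simp add: inner order_trans[OF inner abs_ge_self]\<close>)
  qed
  have P2: "Lp 2 (leb2 T) (\<lambda>(t, s). prim 0 1 (L t) s)"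
    using pm i by (simp add: Lp2_iff case_prod_beta')
  show "L2H1_deriv T (\<lambda>t s. prim 0 1 (L t) s) L"
    unfolding L2H1_deriv_def
  proof (intro conjI P2 L)
    show "AE t in leb 0 T. H1_deriv 0 1 (\<lambda>s. prim 0 1 (L t) s) (L t)"
      using ae
    proof eventually_elim
      fix t assume Lt: "Lp 2 (leb 0 1) (L t)"
      show "H1_deriv 0 1 (\<lambda>s. prim 0 1 (L t) s) (L t)"
        unfolding H1_deriv_def
      proof (intro conjI allI impI Lp_prim Lt)
        fix \<theta> assume "test_function 0 1 \<theta>"
        from prim_weak_deriv[OF _ Lp2_leb_integrable[OF Lt] this, of 0]
        show "(LINT s|leb 0 1. prim 0 1 (L t) s * deriv \<theta> s) = - (LINT s|leb 0 1. L t s * \<theta> s)" by simp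
      qed
    qed
  qed
  note q' = Lp2_leb2_square_integral(1,2)[OF P2]
  have "(LINT t|leb 0 T. LINT s|leb 0 1. (prim 0 1 (L t) s)\<^sup>2) \<le> (LINT t|leb 0 T. Q t)"
    by (intro integral_mono_AE q' Qi) (use ae inner in \<open>auto elim: AE_mp\<close>)
  then show "(LINT p|leb2 T. (case p of (t, s) \<Rightarrow> prim 0 1 (L t) s)\<^sup>2) \<le> (LINT p|leb2 T. (case p of (t, s) \<Rightarrow> L t s)\<^sup>2)"
    using q' q by (simp add: Q_def)
qed

lemma L2H1_deriv_cong_AE:
  assumes u: "L2H1_deriv T u v" and w: "(\<lambda>(t, s). w t s) \<in> borel_measurable (leb2 T)"
    and eq: "AE t in leb 0 T. \<forall>s\<in>{0<..<1}. w t s = u t s"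
  shows "L2H1_deriv T w v"
proof -
  have um: "(\<lambda>(t, s). u t s) \<in> borel_measurable (leb2 T)" using u by (simp add: L2H1_deriv_def Lp2_iff)
  have "AE t in leb 0 T. AE s in leb 0 1. u t s = w t s"
    using eq by eventually_elim (auto intro!: AE_I2)
  then have "AE (t, s) in leb2 T. u t s = w t s" by (simp add: AE_leb2_swap(2)[OF um w])
  then have ae: "AE p in leb2 T. (case p of (t, s) \<Rightarrow> u t s) = (case p of (t, s) \<Rightarrow> w t s)"
    by (simp add: case_prod_beta')
  have "Lp 2 (leb2 T) (\<lambda>(t, s). u t s)" using u by (simp add: L2H1_deriv_def)
  from Lp2_cong_AE[OF this ae w] have "Lp 2 (leb2 T) (\<lambda>(t, s). w t s)" .
  moreover have "AE t in leb 0 T. H1_deriv 0 1 (w t) (v t)"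
  proof -
    have "AE t in leb 0 T. H1_deriv 0 1 (u t) (v t)" using u by (simp add: L2H1_deriv_def)
    then show ?thesis using eq
    proof eventually_elim
      fix t assume H: "H1_deriv 0 1 (u t) (v t)" and e: "\<forall>s\<in>{0<..<1}. w t s = u t s"
      have "Lp 2 (leb 0 1) (w t) \<longleftrightarrow> Lp 2 (leb 0 1) (u t)" by (intro Lp2_cong) (simp add: e)
      moreover have "(LINT s|leb 0 1. w t s * deriv \<theta> s) = (LINT s|leb 0 1. u t s * deriv \<theta> s)" for \<theta>
        by (intro Bochner_Integration.integral_cong refl) (simp add: e)
      ultimately show "H1_deriv 0 1 (w t) (v t)" using H by (simp add: H1_deriv_def)
    qed
  qed
  ultimately show ?thesis using u by (simp add: L2H1_deriv_def)
qed

section \<open>The particle system as an approximate solution\<close>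

lemma gap_mono:
  fixes y :: "nat \<Rightarrow> real"
  assumes gap: "\<And>i. i \<in> {1..<N} \<Longrightarrow> y (i + 1) - y i \<ge> 1 / real N" and ij: "1 \<le> i" "i \<le> j" "j \<le> N"
  shows "y i - real i / real N \<le> y j - real j / real N"
  using ij(2,3)
proof (induction j rule: dec_induct)
  case (step n)
  have "y (n + 1) - y n \<ge> 1 / real N" using step ij(1) by (intro gap) auto
  then have "y n - real n / real N \<le> y (Suc n) - real (Suc n) / real N"
    by (simp add: add_divide_distrib)
  then show ?case using step by simp
qed simp

context
  fixes N :: nat and y l :: "nat \<Rightarrow> real"
  assumes N: "N \<ge> 1" and gap: "\<And>i. i \<in> {1..<N} \<Longrightarrow> y (i + 1) - y i \<ge> 1 / real N"
begin

text \<open>\<open>y (cell N s) - s\<close> decreases inside each cell; replacing \<open>s\<close>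
  by the right end of its cell repairs this at a cost of at most \<open>1 / N\<close>.\<close>

lemma cell_excess_mono: "mono_on {0<..<1} (\<lambda>s. y (cell N s) - real (cell N s) / real N)"
proof (rule mono_onI)
  fix r s :: real assume rs: "r \<in> {0<..<1}" "s \<in> {0<..<1}" "r \<le> s"
  show "y (cell N r) - real (cell N r) / real N \<le> y (cell N s) - real (cell N s) / real N"
    using cell_range[OF N rs(1)] cell_range[OF N rs(2)] cell_mono[OF rs(3)] by (intro gap_mono gap) auto
qed

lemma Lp2_cell_diff: "Lp 2 (leb 0 1) (\<lambda>s. real (cell N s) / real N - s)"
  by (intro Lp2_diff Lp2_cell[OF N, of "\<lambda>i. real i / real N"] Lp2_id_leb)

lemma cell_diff_integral:
  assumes m: "Lp 2 (leb 0 1) m"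
  shows "\<bar>LINT s|leb 0 1. (real (cell N s) / real N - s) * m s\<bar> \<le> 1 / real N * (LINT s|leb 0 1. \<bar>m s\<bar>)"
proof -
  have "\<bar>LINT s|leb 0 1. (real (cell N s) / real N - s) * m s\<bar> \<le> (LINT s|leb 0 1. 1 / real N * \<bar>m s\<bar>)"
  proof (rule order_trans[OF integral_abs_bound integral_mono])
    show "integrable (leb 0 1) (\<lambda>s. \<bar>(real (cell N s) / real N - s) * m s\<bar>)"
      by (intro integrable_abs square_integrable_mult Lp2_cell_diff m)
    show "integrable (leb 0 1) (\<lambda>s. 1 / real N * \<bar>m s\<bar>)"
      by (intro integrable_mult_right integrable_abs Lp2_leb_integrable m)
    fix s assume "s \<in> space (leb 0 1)"
    then have s: "s \<in> {0<..<1}" by simp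
    have "\<bar>real (cell N s) / real N - s\<bar> \<le> 1 / real N"
      using cell_bounds[OF N s] by (simp add: abs_le_iff)
    then show "\<bar>(real (cell N s) / real N - s) * m s\<bar> \<le> 1 / real N * \<bar>m s\<bar>"
      unfolding abs_mult by (rule mult_right_mono) simp
  qed
  then show ?thesis by simp
qed

lemma cell_split_integral:
  assumes m: "Lp 2 (leb 0 1) m"
  shows "(LINT s|leb 0 1. (y (cell N s) - s) * m s)
    = (LINT s|leb 0 1. (y (cell N s) - real (cell N s) / real N) * m s)
      + (LINT s|leb 0 1. (real (cell N s) / real N - s) * m s)"
proof -
  have "(LINT s|leb 0 1. (y (cell N s) - s) * m s)
    = (LINT s|leb 0 1. (y (cell N s) - real (cell N s) / real N) * m s + (real (cell N s) / real N - s) * m s)"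
    by (intro Bochner_Integration.integral_cong refl) (simp add: algebra_simps)
  also have "\<dots> = (LINT s|leb 0 1. (y (cell N s) - real (cell N s) / real N) * m s)
      + (LINT s|leb 0 1. (real (cell N s) / real N - s) * m s)"
    by (intro Bochner_Integration.integral_add square_integrable_mult Lp2_cell_diff m
        Lp2_cell[OF N, of "\<lambda>i. y i - real i / real N"])
  finally show ?thesis .
qed

lemma cell_constraint:
  assumes m: "admissible m"
  shows "(LINT s|leb 0 1. (y (cell N s) - s) * m s) \<le> 1 / real N * (LINT s|leb 0 1. \<bar>m s\<bar>)"
proof -
  have m2: "Lp 2 (leb 0 1) m" using m by (simp add: admissible_def)
  have "(LINT s|leb 0 1. (y (cell N s) - real (cell N s) / real N) * m s) \<le> 0"
    by (rule mono_admissible_le_0[OF cell_excess_mono Lp2_cell[OF N, of "\<lambda>i. y i - real i / real N"] m])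
  then show ?thesis using cell_split_integral[OF m2] cell_diff_integral[OF m2] by linarith
qed

context
  assumes l: "\<And>i. i \<in> {1..<N} \<Longrightarrow> l i \<ge> 0" and compl: "\<And>i. i \<in> {1..<N} \<Longrightarrow> l i * (y (i + 1) - y i - 1 / real N) = 0"
    and l0: "l 0 = 0" "l N = 0"
begin

text \<open>Summation by parts, whose boundary terms vanish with \<open>l 0\<close> and
  \<open>l N\<close>. It is used with \<open>a = 1\<close> for the mean, with the excess positions
  for complementarity, and with the velocities for orthogonality.\<close>

lemma multiplier_integral:
  "(LINT s|leb 0 1. a (cell N s) * (real N * (l (cell N s) - l (cell N s - 1)))) = - (\<Sum>i=1..<N. l i * (a (i + 1) - a i))"
proof -
  have "(LINT s|leb 0 1. a (cell N s) * (real N * (l (cell N s) - l (cell N s - 1))))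
      = (\<Sum>i=1..N. a i * (real N * (l i - l (i - 1)))) / real N"
    by (rule cell_integral[OF N, of "\<lambda>i. a i * (real N * (l i - l (i - 1)))"])
  also have "(\<Sum>i=1..N. a i * (real N * (l i - l (i - 1)))) = real N * (\<Sum>i=1..N. a i * (l i - l (i - 1)))"
    unfolding sum_distrib_left by (intro sum.cong refl) (rule mult.left_commute)
  also have "\<dots> / real N = (\<Sum>i=1..N. a i * (l i - l (i - 1)))" using N by simp
  also have "\<dots> = - (\<Sum>i=1..<N. l i * (a (i + 1) - a i))"
    by (subst sum_by_parts[OF N]) (simp add: l0)
  finally show ?thesis .
qed

lemma multiplier_nonneg: "i \<le> N \<Longrightarrow> l i \<ge> 0"
  using l[of i] l0 by (cases "i = 0"; cases "i = N") auto

lemma multiplier_prim_nonneg: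
  assumes s: "s \<in> {0..1}"
  shows "prim 0 1 (\<lambda>r. real N * (l (cell N r) - l (cell N r - 1))) s \<ge> 0"
proof -
  define i where "i = cell N s"
  \<comment> \<open>The relative position of \<open>s\<close> in its cell; the primitive is the
    convex combination of the two neighbouring multipliers with this weight.\<close>
  define \<theta> where "\<theta> = real N * (s - (real i - 1) / real N)"
  have i: "i \<ge> 1" by (simp add: i_def cell_def)
  have \<theta>: "0 \<le> \<theta>" "\<theta> \<le> 1" "i \<le> N"
  proof -
    have "real N * s \<le> real N * 1" using s by (intro mult_left_mono) auto
    then have "\<lceil>real N * s\<rceil> \<le> int N" by (simp add: ceiling_le_iff)
    then have "nat \<lceil>real N * s\<rceil> \<le> N" by linarith
    with N show "i \<le> N" unfolding i_def cell_def by (rule max.boundedI)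
    have "0 \<le> \<theta> \<and> \<theta> \<le> 1"
    proof (cases "s = 0")
      case True
      then show ?thesis by (simp add: \<theta>_def i_def cell_def)
    next
      case False
      then have "s \<in> {(real i - 1) / real N<..real i / real N}"
        using cell_iff[OF i N, of s] s by (simp add: i_def)
      then have "real i - 1 < real N * s" "real N * s \<le> real i" using N by (auto simp: field_simps)
      moreover have "real N * ((real i - 1) / real N) = real i - 1" using N by simp
      then have "\<theta> = real N * s - (real i - 1)" by (simp only: \<theta>_def right_diff_distrib)
      ultimately show ?thesis by simp
    qed
    then show "0 \<le> \<theta>" "\<theta> \<le> 1" by auto
  qed
  have "prim 0 1 (\<lambda>r. real N * (l (cell N r) - l (cell N r - 1))) s = \<theta> * l i + (1 - \<theta>) * l (i - 1)"
    unfolding prim_cell[OF N s, folded i_def] by (simp add: \<theta>_def l0 algebra_simps)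
  also have "\<dots> \<ge> 0" using \<theta> multiplier_nonneg[of i] multiplier_nonneg[of "i - 1"]
    by (intro add_nonneg_nonneg mult_nonneg_nonneg) auto
  finally show ?thesis .
qed

lemma Lp2_multiplier: "Lp 2 (leb 0 1) (\<lambda>r. real N * (l (cell N r) - l (cell N r - 1)))"
  by (rule Lp2_cell[OF N, of "\<lambda>i. real N * (l i - l (i - 1))"])

lemma multiplier_admissible: "admissible (\<lambda>r. real N * (l (cell N r) - l (cell N r - 1)))"
  unfolding admissible_def
  using Lp2_multiplier multiplier_prim_nonneg multiplier_integral[of "\<lambda>_. 1"] by simp

lemma multiplier_complementarity:
  defines "L \<equiv> \<lambda>r. real N * (l (cell N r) - l (cell N r - 1))"
  shows "- (1 / real N) * (LINT s|leb 0 1. \<bar>L s\<bar>) \<le> (LINT s|leb 0 1. (y (cell N s) - s) * L s)"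
proof -
  have "(LINT s|leb 0 1. (y (cell N s) - real (cell N s) / real N) * L s)
      = - (\<Sum>i=1..<N. l i * (y (i + 1) - real (i + 1) / real N - (y i - real i / real N)))"
    unfolding L_def by (rule multiplier_integral)
  \<comment> \<open>Subtracting \<open>i / N\<close> turns the difference of neighbours into the
    excess of the gap over \<open>1 / N\<close>, the factor in the complementarity
    condition.\<close>
  also have "(\<Sum>i=1..<N. l i * (y (i + 1) - real (i + 1) / real N - (y i - real i / real N))) = 0"
  proof (intro sum.neutral ballI)
    fix i assume "i \<in> {1..<N}"
    from compl[OF this] show "l i * (y (i + 1) - real (i + 1) / real N - (y i - real i / real N)) = 0"
      by (simp add: add_divide_distrib algebra_simps)
  qed
  finally have "(LINT s|leb 0 1. (y (cell N s) - real (cell N s) / real N) * L s) = 0" by simp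
  moreover have L2: "Lp 2 (leb 0 1) L" unfolding L_def by (rule Lp2_multiplier)
  ultimately show ?thesis using cell_split_integral[OF L2] cell_diff_integral[OF L2] by linarith
qed

end

end

text \<open>The particle system bounds the gaps at almost every time only; continuity extends this
  to every time, as the monotonicity of the limit at each \<open>t\<close> requires.\<close>

lemma continuous_AE_nonneg:
  fixes f :: "real \<Rightarrow> real"
  assumes T: "T > 0" and f: "continuous_on {0..T} f" and ae: "AE t in leb 0 T. f t \<ge> 0" and t: "t \<in> {0..T}"
  shows "f t \<ge> 0"
proof (rule ccontr)
  assume neg: "\<not> f t \<ge> 0"
  then obtain d where d: "d > 0" "\<And>r. r \<in> {0..T} \<Longrightarrow> dist r t < d \<Longrightarrow> dist (f r) (f t) < - f t"
    using f t unfolding continuous_on_iff by (meson neg_0_less_iff_less not_le)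
  have ab: "max 0 (t - d) < min T (t + d)" using T d t by auto
  obtain r where r: "max 0 (t - d) < r" "r < min T (t + d)" "f r \<ge> 0"
    by (rule AE_leb_dense[OF ae _ ab]) auto
  have "dist (f r) (f t) < - f t" using r by (intro d) (auto simp: dist_real_def)
  then show False using r by (simp add: dist_real_def)
qed

lemma fst_integrable_leb2:
  assumes "integrable (leb 0 T) f" shows "integrable (leb2 T) (\<lambda>(t, s). f t :: real)"
proof (rule pair_leb.Fubini_integrable)
  show "(\<lambda>(t, s). f t) \<in> borel_measurable (leb2 T)" using assms by (intro fst_measurable_leb2) simp
  have c: "integrable (leb 0 1) (\<lambda>_. f t)" for t by (rule Lp2_leb_integrable[OF Lp2_const_leb])
  then show "AE t in leb 0 T. integrable (leb 0 1) (\<lambda>s. case (t, s) of (t, s) \<Rightarrow> f t)" by simp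
  show "integrable (leb 0 T) (\<lambda>t. LINT s|leb 0 1. norm (case (t, s) of (t, s) \<Rightarrow> f t))"
    using assms measure_leb_le_1 by simp
qed

lemma cell_leb2_measurable:
  assumes N: "N \<ge> 1" and y: "\<And>i. i \<in> {1..N} \<Longrightarrow> y i \<in> borel_measurable (leb 0 T)"
  shows "(\<lambda>(t, s). y (cell N s) t :: real) \<in> borel_measurable (leb2 T)"
proof -
  have "(\<lambda>p. \<Sum>i=1..N. y i (fst p) * of_bool (cell N (snd p) = i)) \<in> borel_measurable (leb2 T)"
  proof (intro borel_measurable_sum borel_measurable_times)
    fix i assume "i \<in> {1..N}"
    then show "(\<lambda>p. y i (fst p)) \<in> borel_measurable (leb2 T)"
      using fst_measurable_leb2[OF y] by (simp add: case_prod_beta')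
    show "(\<lambda>p. of_bool (cell N (snd p) = i) :: real) \<in> borel_measurable (leb2 T)"
      using snd_measurable_leb2[OF cell_measurable[OF N, of "\<lambda>j. of_bool (j = i)"]] by (simp add: case_prod_beta')
  qed
  also have "?this \<longleftrightarrow> (\<lambda>p. y (cell N (snd p)) (fst p)) \<in> borel_measurable (leb2 T)"
  proof (intro measurable_cong)
    fix p assume "p \<in> space (leb2 T)"
    then have "snd p \<in> {0<..<1}" by (auto simp: space_pair_measure)
    from cell_sum[OF N this, of "\<lambda>i. y i (fst p)"]
    show "(\<Sum>i=1..N. y i (fst p) * of_bool (cell N (snd p) = i)) = y (cell N (snd p)) (fst p)" by (rule sym)
  qed
  finally show ?thesis by (simp add: case_prod_beta')
qed

lemma cell_leb2_Lp2:
  assumes N: "N \<ge> 1" and y: "\<And>i. i \<in> {1..N} \<Longrightarrow> Lp 2 (leb 0 T) (y i)"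
  shows "Lp 2 (leb2 T) (\<lambda>(t, s). y (cell N s) t)"
proof -
  have m: "(\<lambda>(t, s). y (cell N s) t) \<in> borel_measurable (leb2 T)"
    using y by (intro cell_leb2_measurable[OF N]) (auto simp: Lp2_iff)
  have i: "integrable (leb2 T) (\<lambda>p. \<Sum>i=1..N. (case p of (t, s) \<Rightarrow> (y i t)\<^sup>2))"
    using y by (intro Bochner_Integration.integrable_sum fst_integrable_leb2) (auto simp: Lp2_iff)
  have "integrable (leb2 T) (\<lambda>p. (case p of (t, s) \<Rightarrow> y (cell N s) t)\<^sup>2)"
  proof (rule Bochner_Integration.integrable_bound[OF i])
    show "AE p in leb2 T. norm ((case p of (t, s) \<Rightarrow> y (cell N s) t)\<^sup>2) \<le> norm (\<Sum>i=1..N. (case p of (t, s) \<Rightarrow> (y i t)\<^sup>2))"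
    proof (rule AE_I2)
      fix p assume "p \<in> space (leb2 T)"
      then obtain t s where p: "p = (t, s)" "s \<in> {0<..<1}" by (cases p) (auto simp: space_pair_measure)
      have "(y (cell N s) t)\<^sup>2 \<le> (\<Sum>i=1..N. (y i t)\<^sup>2)"
        by (rule member_le_sum[OF cell_range[OF N p(2)]]) auto
      then show "norm ((case p of (t, s) \<Rightarrow> y (cell N s) t)\<^sup>2) \<le> norm (\<Sum>i=1..N. (case p of (t, s) \<Rightarrow> (y i t)\<^sup>2))"
        by (simp add: p)
    qed
  qed (use m in simp)
  with m show ?thesis by (simp add: Lp2_iff)
qed

text \<open>Pythagoras for \<open>- a = V + L\<close>. The bound on \<open>L\<close> is the
  multiplier estimate, the bound on \<open>V\<close> controls the growth of the positions.\<close>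

lemma orthogonal_bound:
  assumes a: "Lp 2 M a" and L: "Lp 2 M L" and V: "\<And>x. x \<in> space M \<Longrightarrow> V x = - a x - L x"
    and orth: "(LINT x|M. V x * L x) = 0"
  shows "(LINT x|M. (L x)\<^sup>2) \<le> (LINT x|M. (a x)\<^sup>2)" "(LINT x|M. (V x)\<^sup>2) \<le> (LINT x|M. (a x)\<^sup>2)"
proof -
  have "Lp 2 M (\<lambda>x. - a x - L x)" by (intro Lp2_diff Lp2_uminus a L)
  moreover have "Lp 2 M V \<longleftrightarrow> Lp 2 M (\<lambda>x. - a x - L x)" by (rule Lp2_cong[OF V])
  ultimately have V2: "Lp 2 M V" by simp
  have "(LINT x|M. (a x)\<^sup>2) = (LINT x|M. (V x)\<^sup>2 + (L x)\<^sup>2 + 2 * (V x * L x))"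
  proof (intro Bochner_Integration.integral_cong refl)
    fix x assume "x \<in> space M"
    then have "a x = - V x - L x" using V by simp
    then show "(a x)\<^sup>2 = (V x)\<^sup>2 + (L x)\<^sup>2 + 2 * (V x * L x)"
      by (simp only: power2_eq_square) (simp add: algebra_simps)
  qed
  also have "\<dots> = (LINT x|M. (V x)\<^sup>2) + (LINT x|M. (L x)\<^sup>2) + 2 * (LINT x|M. V x * L x)"
    using V2 L square_integrable_mult[OF V2 L] by (simp add: Lp2_iff)
  finally have "(LINT x|M. (a x)\<^sup>2) = (LINT x|M. (V x)\<^sup>2) + (LINT x|M. (L x)\<^sup>2)" using orth by simp
  then show "(LINT x|M. (L x)\<^sup>2) \<le> (LINT x|M. (a x)\<^sup>2)" "(LINT x|M. (V x)\<^sup>2) \<le> (LINT x|M. (a x)\<^sup>2)"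
    using square_integral_nonneg[of M V] square_integral_nonneg[of M L] by linarith+
qed

definition multiplier_deriv :: "nat \<Rightarrow> (nat \<Rightarrow> real \<Rightarrow> real) \<Rightarrow> real \<Rightarrow> real \<Rightarrow> real" where
  "multiplier_deriv N \<Lambda> t s = real N * (\<Lambda> (cell N s) t - \<Lambda> (cell N s - 1) t)"

lemma interp_const_C_Lp:
  assumes N: "N \<ge> 1" and p: "p > 0" and x: "\<And>i. i \<in> {1..N} \<Longrightarrow> continuous_on {0..T} (x i)"
  shows "C_Lp p T (interp_const N x)"
  unfolding C_Lp_def
proof (intro ballI conjI)
  fix t assume t: "t \<in> {0..T}"
  have "integrable (leb 0 1) (\<lambda>s. \<bar>x (cell N s) t\<bar> powr p)"
    by (rule Lp2_leb_integrable[OF Lp2_cell[OF N, of "\<lambda>i. \<bar>x i t\<bar> powr p"]])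
  then show "Lp p (leb 0 1) (interp_const N x t)"
    using cell_measurable[OF N, of "\<lambda>i. x i t"] by (simp add: Lp_def interp_const_def[abs_def])
  have eq: "Lp_norm p (leb 0 1) (\<lambda>s. interp_const N x \<tau> s - interp_const N x t s)
      = ((\<Sum>i=1..N. \<bar>x i \<tau> - x i t\<bar> powr p) / real N) powr (1 / p)" for \<tau>
    unfolding Lp_norm_def interp_const_def by (subst cell_integral[OF N, of "\<lambda>i. \<bar>x i \<tau> - x i t\<bar> powr p"]) simp
  show "((\<lambda>\<tau>. Lp_norm p (leb 0 1) (\<lambda>s. interp_const N x \<tau> s - interp_const N x t s)) \<longlongrightarrow> 0) (at t within {0..T})"
    unfolding eq
  proof (rule tendsto_zero_powrI)
    have "((\<lambda>\<tau>. (\<Sum>i=1..N. \<bar>x i \<tau> - x i t\<bar> powr p) / real N) \<longlongrightarrow> (\<Sum>i=1..N. 0) / real N) (at t within {0..T})"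
    proof (intro tendsto_divide tendsto_sum tendsto_const)
      fix i assume "i \<in> {1..N}"
      from x[OF this] t have "(x i \<longlongrightarrow> x i t) (at t within {0..T})" by (simp add: continuous_on_def)
      then have "((\<lambda>\<tau>. \<bar>x i \<tau> - x i t\<bar>) \<longlongrightarrow> 0) (at t within {0..T})"
        by (intro tendsto_rabs_zero LIM_zero)
      then show "((\<lambda>\<tau>. \<bar>x i \<tau> - x i t\<bar> powr p) \<longlongrightarrow> 0) (at t within {0..T})"
        by (rule tendsto_zero_powrI) (use p in auto)
    qed (use N in simp)
    then show "((\<lambda>\<tau>. (\<Sum>i=1..N. \<bar>x i \<tau> - x i t\<bar> powr p) / real N) \<longlongrightarrow> 0) (at t within {0..T})" by simp
    show "((\<lambda>\<tau>. 1 / p) \<longlongrightarrow> 1 / p) (at t within {0..T})" by (rule tendsto_const)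
    show "\<forall>\<^sub>F \<tau> in at t within {0..T}. 0 \<le> (\<Sum>i=1..N. \<bar>x i \<tau> - x i t\<bar> powr p) / real N"
      by (intro always_eventually allI divide_nonneg_nonneg sum_nonneg) auto
  qed (use p in simp)
qed

text \<open>Collects what the limit argument uses about the particle system. Its core is the second
  claim: velocity and multiplier derivative are orthogonal in space at almost every time.\<close>

theorem particle_solution_facts:
  assumes T: "T > 0" and d\<phi>: "\<And>x y. \<bar>d\<phi> x - d\<phi> y\<bar> \<le> K * \<bar>x - y\<bar>" "d\<phi> \<in> borel_measurable borel"
    and N: "N \<ge> 1" and sol: "particle_solution T d\<phi> N x0 x \<Lambda>"
  defines "X \<equiv> interp_const N x" and "L \<equiv> multiplier_deriv N \<Lambda>"
  shows "approx_solution T d\<phi> (1 / real N) X L"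
    and "AE t in leb 0 T. (LINT s|leb 0 1. (L t s)\<^sup>2) \<le> (LINT s|leb 0 1. (d\<phi> (X t s))\<^sup>2) \<and>
       (LINT s|leb 0 1. (- d\<phi> (X t s) - L t s)\<^sup>2) \<le> (LINT s|leb 0 1. (d\<phi> (X t s))\<^sup>2)"
    and "AE t in leb 0 T. \<forall>s\<in>{0..1}. interp_lin N \<Lambda> t s = prim 0 1 (L t) s"
    and "p > 0 \<Longrightarrow> C_Lp p T X"
    and "t \<in> {0..T} \<Longrightarrow> mono_on {0<..<1} (\<lambda>s. X t s - real (cell N s) / real N)"
    and "L2H1_deriv T (interp_lin N \<Lambda>) L"
    and "i \<in> {1..N} \<Longrightarrow> x i 0 = x0 i"
proof -
  from sol obtain v where x: "\<And>i. i \<in> {1..N} \<Longrightarrow> continuous_on {0..T} (x i)" "\<And>i. i \<in> {1..N} \<Longrightarrow> x i 0 = x0 i"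
    and l: "\<And>i. i \<in> {0..N} \<Longrightarrow> Lp 2 (leb 0 T) (\<Lambda> i)" and H: "\<And>i. i \<in> {1..N} \<Longrightarrow> H1_deriv 0 T (x i) (v i)"
    and sys: "AE t in leb 0 T.
           (\<forall>i\<in>{1..N}. v i t = - d\<phi> (x i t) - real N * (\<Lambda> i t - \<Lambda> (i - 1) t)) \<and>
           (\<forall>i\<in>{1..<N}. x (i + 1) t - x i t \<ge> 1 / real N \<and> \<Lambda> i t \<ge> 0 \<and>
              \<Lambda> i t * (x (i + 1) t - x i t - 1 / real N) = 0) \<and>
           \<Lambda> 0 t = 0 \<and> \<Lambda> N t = 0"
    unfolding particle_solution_def by blast
  show "i \<in> {1..N} \<Longrightarrow> x i 0 = x0 i" by (rule x)
  show CLp: "p > 0 \<Longrightarrow> C_Lp p T X" unfolding X_def by (rule interp_const_C_Lp[OF N _ x(1)])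
  have v2: "Lp 2 (leb 0 T) (v i)" and v1: "integrable (leb 0 T) (v i)" if "i \<in> {1..N}" for i
    using H[OF that] by (auto simp: H1_deriv_def Lp2_leb_integrable)
  have xi: "x i t = x i 0 + prim 0 T (v i) t" if "i \<in> {1..N}" "t \<in> {0..T}" for i t
    by (rule H1_deriv_continuous_prim[OF T x(1) H _ v1]) (use that in auto)
  have gap: "x (i + 1) t - x i t \<ge> 1 / real N" if i: "i \<in> {1..<N}" and t: "t \<in> {0..T}" for i t
  proof -
    have "x (i + 1) t - x i t - 1 / real N \<ge> 0"
    proof (rule continuous_AE_nonneg[OF T _ _ t])
      show "continuous_on {0..T} (\<lambda>t. x (i + 1) t - x i t - 1 / real N)"
        using i by (intro continuous_on_diff continuous_on_const x) auto
      show "AE t in leb 0 T. x (i + 1) t - x i t - 1 / real N \<ge> 0"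
        using sys by eventually_elim (use i in auto)
    qed
    then show ?thesis by simp
  qed
  show "t \<in> {0..T} \<Longrightarrow> mono_on {0<..<1} (\<lambda>s. X t s - real (cell N s) / real N)"
    unfolding X_def interp_const_def using cell_excess_mono[OF N, of "\<lambda>i. x i t"] gap by blast
  have x2: "Lp 2 (leb 0 T) (x i)" if "i \<in> {1..N}" for i using that by (intro Lp2_continuous x)
  have l2: "Lp 2 (leb 0 T) (\<lambda>t. real N * (\<Lambda> i t - \<Lambda> (i - 1) t))" if "i \<in> {1..N}" for i
    using that by (intro Lp2_cmult Lp2_diff l) auto
  have X2: "Lp 2 (leb2 T) (\<lambda>(t, s). X t s)"
    unfolding X_def interp_const_def by (rule cell_leb2_Lp2[OF N x2])
  have L2: "Lp 2 (leb2 T) (\<lambda>(t, s). L t s)"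
    unfolding L_def multiplier_deriv_def by (rule cell_leb2_Lp2[OF N l2])
  have Xt: "Lp 2 (leb 0 1) (X t)" for t
    unfolding X_def interp_const_def[abs_def] by (rule Lp2_cell[OF N, of "\<lambda>i. x i t"])
  have zero: "0 \<in> {0..T}" using T by simp
  have evo: "AE s in leb 0 1. X t s = X 0 s + prim 0 T (\<lambda>\<tau>. - d\<phi> (X \<tau> s) - L \<tau> s) t" if t: "t \<in> {0..T}" for t
  proof (rule AE_I2)
    fix s assume "s \<in> space (leb 0 1)"
    then have "s \<in> {0<..<1}" by simp
    from cell_range[OF N this] have i: "cell N s \<in> {1..N}" .
    let ?i = "cell N s"
    have "prim 0 T (v ?i) t = prim 0 T (\<lambda>\<tau>. - d\<phi> (x ?i \<tau>) - real N * (\<Lambda> ?i \<tau> - \<Lambda> (?i - 1) \<tau>)) t"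
    proof (rule prim_cong_AE)
      show "AE \<tau> in leb 0 T. v ?i \<tau> = - d\<phi> (x ?i \<tau>) - real N * (\<Lambda> ?i \<tau> - \<Lambda> (?i - 1) \<tau>)"
        using sys by eventually_elim (use i in blast)
      show "v ?i \<in> borel_measurable (leb 0 T)" using v1[OF i] by simp
      show "(\<lambda>\<tau>. - d\<phi> (x ?i \<tau>) - real N * (\<Lambda> ?i \<tau> - \<Lambda> (?i - 1) \<tau>)) \<in> borel_measurable (leb 0 T)"
        using l2[OF i] measurable_compose[OF _ d\<phi>(2), of "x ?i" "leb 0 T"] x2[OF i]
        by (intro borel_measurable_diff borel_measurable_uminus) (auto simp: Lp2_iff)
    qed
    then show "X t s = X 0 s + prim 0 T (\<lambda>\<tau>. - d\<phi> (X \<tau> s) - L \<tau> s) t"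
      using xi[OF i t] by (simp add: X_def L_def interp_const_def multiplier_deriv_def)
  qed
  have con: "AE t in leb 0 T. admissible (L t) \<and>
        - (1 / real N) * (LINT s|leb 0 1. \<bar>L t s\<bar>) \<le> (LINT s|leb 0 1. (X t s - s) * L t s) \<and>
        (\<forall>m. admissible m \<longrightarrow> (LINT s|leb 0 1. (X t s - s) * m s) \<le> 1 / real N * (LINT s|leb 0 1. \<bar>m s\<bar>))"
    using sys
  proof eventually_elim
    case (elim t)
    have Leq: "L t = (\<lambda>s. real N * (\<Lambda> (cell N s) t - \<Lambda> (cell N s - 1) t))"
      by (simp add: L_def multiplier_deriv_def[abs_def])
    have c: "\<And>i. i \<in> {1..<N} \<Longrightarrow> x (i + 1) t - x i t \<ge> 1 / real N" "\<And>i. i \<in> {1..<N} \<Longrightarrow> \<Lambda> i t \<ge> 0"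
      "\<And>i. i \<in> {1..<N} \<Longrightarrow> \<Lambda> i t * (x (i + 1) t - x i t - 1 / real N) = 0" "\<Lambda> 0 t = 0" "\<Lambda> N t = 0"
      using elim by auto
    show ?case
      using multiplier_admissible[OF N, of "\<lambda>i. x i t" "\<lambda>i. \<Lambda> i t", OF c]
        multiplier_complementarity[OF N, of "\<lambda>i. x i t" "\<lambda>i. \<Lambda> i t", OF c]
        cell_constraint[OF N, of "\<lambda>i. x i t", OF c(1)]
      unfolding Leq X_def interp_const_def by blast
  qed
  show "approx_solution T d\<phi> (1 / real N) X L"
    unfolding approx_solution_def using X2 L2 Xt evo con by blast
  \<comment> \<open>Two neighbours at minimal distance have equal velocities at almost every such
    time, because the derivative of the gap vanishes almost everywhere on its zero set.\<close>
  have stick: "AE t in leb 0 T. \<forall>i\<in>{1..<N}. x (i + 1) t - x i t - 1 / real N = 0 \<longrightarrow> v (i + 1) t - v i t = 0"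
  proof (rule AE_finite_allI)
    fix i assume i: "i \<in> {1..<N}"
    then have i': "i \<in> {1..N}" "i + 1 \<in> {1..N}" by auto
    show "AE t in leb 0 T. x (i + 1) t - x i t - 1 / real N = 0 \<longrightarrow> v (i + 1) t - v i t = 0"
    proof (rule prim_deriv_zero_set)
      show "integrable (leb 0 T) (\<lambda>t. v (i + 1) t - v i t)" using v1 i' by simp
      show "x (i + 1) t - x i t - 1 / real N = (x (i + 1) 0 - x i 0 - 1 / real N) + prim 0 T (\<lambda>t. v (i + 1) t - v i t) t"
        if t: "t \<in> {0..T}" for t
        using xi[OF i'(1) t] xi[OF i'(2) t] v1[OF i'(1)] v1[OF i'(2)] by (simp add: prim_diff)
    qed
  qed simp
  show "AE t in leb 0 T. (LINT s|leb 0 1. (L t s)\<^sup>2) \<le> (LINT s|leb 0 1. (d\<phi> (X t s))\<^sup>2) \<and>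
       (LINT s|leb 0 1. (- d\<phi> (X t s) - L t s)\<^sup>2) \<le> (LINT s|leb 0 1. (d\<phi> (X t s))\<^sup>2)"
    using sys stick con
  proof eventually_elim
    case (elim t)
    have c: "\<And>i. i \<in> {1..<N} \<Longrightarrow> x (i + 1) t - x i t \<ge> 1 / real N" "\<And>i. i \<in> {1..<N} \<Longrightarrow> \<Lambda> i t \<ge> 0"
      "\<And>i. i \<in> {1..<N} \<Longrightarrow> \<Lambda> i t * (x (i + 1) t - x i t - 1 / real N) = 0" "\<Lambda> 0 t = 0" "\<Lambda> N t = 0"
      using elim by auto
    have V: "- d\<phi> (X t s) - L t s = v (cell N s) t" if "s \<in> {0<..<1}" for s
      using elim cell_range[OF N that] by (auto simp: X_def L_def interp_const_def multiplier_deriv_def)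
    have "(LINT s|leb 0 1. (- d\<phi> (X t s) - L t s) * L t s) = (LINT s|leb 0 1. v (cell N s) t * (real N * (\<Lambda> (cell N s) t - \<Lambda> (cell N s - 1) t)))"
      by (intro Bochner_Integration.integral_cong refl) (simp add: V, simp add: L_def multiplier_deriv_def)
    also have "\<dots> = - (\<Sum>i=1..<N. \<Lambda> i t * (v (i + 1) t - v i t))"
      by (rule multiplier_integral[OF N, of "\<lambda>i. x i t" "\<lambda>i. \<Lambda> i t" "\<lambda>i. v i t", OF c])
    \<comment> \<open>Either the multiplier is 0 or the gap is closed, and in the latter case
      \<open>stick\<close> makes the relative velocity 0.\<close>
    also have "(\<Sum>i=1..<N. \<Lambda> i t * (v (i + 1) t - v i t)) = 0"
    proof (intro sum.neutral ballI)
      fix i assume i: "i \<in> {1..<N}"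
      have "x (i + 1) t - x i t - 1 / real N = 0 \<longrightarrow> v (i + 1) t - v i t = 0" using elim(2) i by blast
      then show "\<Lambda> i t * (v (i + 1) t - v i t) = 0" using c(3)[OF i] by (metis mult_eq_0_iff)
    qed
    finally have orth: "(LINT s|leb 0 1. (- d\<phi> (X t s) - L t s) * L t s) = 0" by simp
    have a: "Lp 2 (leb 0 1) (\<lambda>s. d\<phi> (X t s))" by (rule Lp2_Lipschitz_compose(1)[OF Xt finite_measure_leb d\<phi>])
    have Lt: "Lp 2 (leb 0 1) (L t)" using elim by (simp add: admissible_def)
    show ?case using orthogonal_bound[OF a Lt _ orth] by blast
  qed
  show lin: "AE t in leb 0 T. \<forall>s\<in>{0..1}. interp_lin N \<Lambda> t s = prim 0 1 (L t) s"
    using sys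
  proof eventually_elim
    case (elim t)
    show ?case
    proof
      fix s :: real assume s: "s \<in> {0..1}"
      from prim_cell[OF N s, of "\<lambda>i. \<Lambda> i t"] elim
      show "interp_lin N \<Lambda> t s = prim 0 1 (L t) s"
        by (simp add: interp_lin_def L_def multiplier_deriv_def[abs_def] Let_def)
    qed
  qed
  show "L2H1_deriv T (interp_lin N \<Lambda>) L"
  proof (rule L2H1_deriv_cong_AE[OF L2H1_deriv_prim(1)[OF L2]])
    have "(\<lambda>p. (case p of (t, s) \<Rightarrow> L t s) * (snd p - (real (cell N (snd p)) - 1) / real N) + (case p of (t, s) \<Rightarrow> \<Lambda> (cell N s - 1) t)) \<in> borel_measurable (leb2 T)"
    proof (intro borel_measurable_add borel_measurable_times)
      show "(\<lambda>(t, s). L t s) \<in> borel_measurable (leb2 T)" using L2 by (simp add: Lp2_iff)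
      show "(\<lambda>(t, s). \<Lambda> (cell N s - 1) t) \<in> borel_measurable (leb2 T)"
        using l by (intro cell_leb2_measurable[OF N, of "\<lambda>i. \<Lambda> (i - 1)"]) (auto simp: Lp2_iff)
      have "(\<lambda>s. s - (real (cell N s) - 1) / real N) \<in> borel_measurable (leb 0 1)"
        by (intro borel_measurable_diff cell_measurable[OF N, of "\<lambda>i. (real i - 1) / real N"] measurable_leb) simp
      from snd_measurable_leb2[OF this] show "(\<lambda>p. snd p - (real (cell N (snd p)) - 1) / real N) \<in> borel_measurable (leb2 T)"
        by (simp add: case_prod_beta')
    qed
    then show "(\<lambda>(t, s). interp_lin N \<Lambda> t s) \<in> borel_measurable (leb2 T)"
      by (simp add: case_prod_beta' interp_lin_def Let_def L_def multiplier_deriv_def)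
    show "AE t in leb 0 T. \<forall>s\<in>{0<..<1}. interp_lin N \<Lambda> t s = prim 0 1 (L t) s"
      using lin by eventually_elim auto
  qed
qed

section \<open>Passage to the limit\<close>

text \<open>The way back from the integral conditions to the measure formulation. A monotone
  function equal to \<open>X t s - s\<close> almost everywhere yields the excess measure, and the
  complementarity inequality makes its product with the multiplier vanish.\<close>

lemma lagrangian_solutionI:
  assumes T: "T > 0" and d\<phi>: "\<And>x y. \<bar>d\<phi> x - d\<phi> y\<bar> \<le> K * \<bar>x - y\<bar>" "d\<phi> \<in> borel_measurable borel"
    and S: "approx_solution T d\<phi> 0 X L" and C: "C_Lp 2 T X" and init: "AE s in leb 0 1. X 0 s = X0 s"
    and mono: "\<And>t. t \<in> {0..T} \<Longrightarrow> \<exists>g. mono_on {0<..<1} g \<and> (AE s in leb 0 1. X t s = s + g s)"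
  shows "lagrangian_solution T d\<phi> X0 X (\<lambda>t s. prim 0 1 (L t) s)"
proof -
  have X2: "Lp 2 (leb2 T) (\<lambda>(t, s). X t s)" and L2: "Lp 2 (leb2 T) (\<lambda>(t, s). L t s)"
    and Xt: "\<And>t. t \<in> {0..T} \<Longrightarrow> Lp 2 (leb 0 1) (X t)"
    and ev: "\<And>t. t \<in> {0..T} \<Longrightarrow> AE s in leb 0 1. X t s = X 0 s + prim 0 T (\<lambda>\<tau>. - d\<phi> (X \<tau> s) - L \<tau> s) t"
    and con: "AE t in leb 0 T. admissible (L t) \<and>
        - 0 * (LINT s|leb 0 1. \<bar>L t s\<bar>) \<le> (LINT s|leb 0 1. (X t s - s) * L t s) \<and>
        (\<forall>m. admissible m \<longrightarrow> (LINT s|leb 0 1. (X t s - s) * m s) \<le> 0 * (LINT s|leb 0 1. \<bar>m s\<bar>))"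
    using S by (auto simp: approx_solution_def)
  define V where "V t s = - d\<phi> (X t s) - L t s" for t s
  have V2: "Lp 2 (leb2 T) (\<lambda>(t, s). V t s)"
    using Lp2_diff[OF Lp2_uminus[OF Lp2_Lipschitz_compose(1)[OF X2 finite_measure_leb2 d\<phi>]] L2]
    by (simp add: V_def case_prod_beta')
  have zero: "0 \<in> {0..T}" using T by simp
  have m: "(\<lambda>(t, s). X t s) \<in> borel_measurable (leb2 T)" using X2 by (simp add: Lp2_iff)
  have "(\<lambda>p. (case p of (t, s) \<Rightarrow> X 0 s) + (case p of (t, s) \<Rightarrow> prim 0 T (\<lambda>r. V r s) t)) \<in> borel_measurable (leb2 T)"
    using Xt[OF zero] V2 by (intro borel_measurable_add prim_time_measurable snd_measurable_leb2) (auto simp: Lp2_iff)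
  then have Em: "(\<lambda>(t, s). X 0 s + prim 0 T (\<lambda>\<tau>. V \<tau> s) t) \<in> borel_measurable (leb2 T)"
    by (simp add: case_prod_beta')
  have "AE t in leb 0 T. AE s in leb 0 1. X t s = X 0 s + prim 0 T (\<lambda>\<tau>. V \<tau> s) t"
    unfolding V_def by (rule AE_I2, rule ev) auto
  \<comment> \<open>The weak time derivative is tested at fixed \<open>s\<close>, so the evolution
    must hold for almost all times off one null set of \<open>s\<close>.\<close>
  then have swap: "AE s in leb 0 1. AE t in leb 0 T. X t s = X 0 s + prim 0 T (\<lambda>\<tau>. V \<tau> s) t"
    by (simp add: AE_leb2_swap(1)[OF m Em])
  have Vi: "AE s in leb 0 1. integrable (leb 0 T) (\<lambda>\<tau>. V \<tau> s)"
    by (rule pair_leb.AE_integrable_snd[OF Lp2_leb2_integrable[OF V2]])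
  have H1: "H1L2_deriv T X V"
    unfolding H1L2_deriv_def
  proof (intro conjI X2 V2 allI impI)
    fix \<theta> assume \<theta>: "test_function 0 T \<theta>"
    show "AE s in leb 0 1. (LINT t|leb 0 T. X t s * deriv \<theta> t) = - (LINT t|leb 0 T. V t s * \<theta> t)"
      using swap Vi AE_space
    proof eventually_elim
      fix s assume s: "s \<in> space (leb 0 1)" and i: "integrable (leb 0 T) (\<lambda>\<tau>. V \<tau> s)"
        and eq: "AE t in leb 0 T. X t s = X 0 s + prim 0 T (\<lambda>\<tau>. V \<tau> s) t"
      have "(LINT t|leb 0 T. X t s * deriv \<theta> t) = (LINT t|leb 0 T. (X 0 s + prim 0 T (\<lambda>\<tau>. V \<tau> s) t) * deriv \<theta> t)"
        using measurable_Pair1[OF m s] measurable_Pair1[OF Em s] eq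
        by (intro integral_cong_AE borel_measurable_times measurable_leb[OF test_function_facts(5)[OF \<theta>]]) auto
      also have "\<dots> = - (LINT t|leb 0 T. V t s * \<theta> t)" by (rule prim_weak_deriv[OF T i \<theta>])
      finally show "(LINT t|leb 0 T. X t s * deriv \<theta> t) = - (LINT t|leb 0 T. V t s * \<theta> t)" .
    qed
  qed
  have "AE t in leb 0 T.
        continuous_on {0..1} (prim 0 1 (L t)) \<and> prim 0 1 (L t) 0 = 0 \<and> prim 0 1 (L t) 1 = 0 \<and>
        (\<forall>s\<in>{0..1}. prim 0 1 (L t) s \<ge> 0) \<and>
        (\<exists>\<mu>. excess_measure (X t) \<mu> \<and> density \<mu> (\<lambda>s. ennreal (prim 0 1 (L t) s)) = null_measure \<mu>)"
    using con AE_space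
  proof eventually_elim
    case (elim t)
    then have a: "admissible (L t)" and t: "t \<in> {0..T}" by auto
    have Lt: "integrable (leb 0 1) (L t)" using a by (simp add: admissible_def Lp2_leb_integrable)
    obtain g where g: "mono_on {0<..<1} g" "AE s in leb 0 1. X t s = s + g s" using mono[OF t] by blast
    have gL: "Lp 2 (leb 0 1) g"
    proof (rule Lp2_cong_AE)
      show "Lp 2 (leb 0 1) (\<lambda>s. X t s - s)" by (intro Lp2_diff Xt[OF t] Lp2_id_leb)
      show "AE s in leb 0 1. X t s - s = g s" using g(2) by eventually_elim simp
      show "g \<in> borel_measurable (leb 0 1)" by (rule mono_on_leb_measurable[OF g(1)])
    qed
    have Xm: "X t \<in> borel_measurable (leb 0 1)" using Xt[OF t] by (simp add: Lp2_iff)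
    have Lt2: "Lp 2 (leb 0 1) (L t)" using a by (simp add: admissible_def)
    have "(LINT s|leb 0 1. g s * L t s) = (LINT s|leb 0 1. (X t s - s) * L t s)"
    proof (rule integral_cong_AE)
      show "(\<lambda>s. g s * L t s) \<in> borel_measurable (leb 0 1)" using square_integrable_mult[OF gL Lt2] by simp
      show "(\<lambda>s. (X t s - s) * L t s) \<in> borel_measurable (leb 0 1)"
        using square_integrable_mult[OF Lp2_diff[OF Xt[OF t] Lp2_id_leb] Lt2] by simp
      show "AE s in leb 0 1. g s * L t s = (X t s - s) * L t s" using g(2) by eventually_elim simp
    qed
    then have ge: "(LINT s|leb 0 1. g s * L t s) \<ge> 0" using elim by simp
    have "excess_measure (X t) (stieltjes g)" by (rule excess_measure_stieltjes[OF g(1) gL g(2) Xm])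
    moreover have "density (stieltjes g) (\<lambda>s. ennreal (prim 0 1 (L t) s)) = null_measure (stieltjes g)"
      by (rule stieltjes_density_null[OF g(1) gL a ge])
    ultimately show ?case
      using a prim_continuous[OF Lt] by (auto simp: admissible_def prim_left prim_right)
  qed
  moreover have "AE (t, s) in leb2 T. V t s = - d\<phi> (X t s) - L t s" by (simp add: V_def)
  ultimately show ?thesis
    unfolding lagrangian_solution_def using H1 L2H1_deriv_prim(1)[OF L2] C init by blast
qed

section \<open>Linear structure of \<open>L\<^sup>2(0,T;H\<^sup>1(0,1))\<close> and its
  functionals\<close>

lemma H1_deriv_add:
  assumes "H1_deriv a b f f'" "H1_deriv a b g g'"
  shows "H1_deriv a b (\<lambda>s. f s + g s) (\<lambda>s. f' s + g' s)"
  unfolding H1_deriv_def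
proof (intro conjI allI impI)
  show "Lp 2 (leb a b) (\<lambda>s. f s + g s)" "Lp 2 (leb a b) (\<lambda>s. f' s + g' s)"
    using assms by (auto simp: H1_deriv_def intro!: Lp2_add)
  fix \<theta> assume \<theta>: "test_function a b \<theta>"
  have t2: "Lp 2 (leb a b) \<theta>" "Lp 2 (leb a b) (deriv \<theta>)"
    by (intro Lp2_continuous test_function_facts[OF \<theta>])+
  have "Lp 2 (leb a b) f" "Lp 2 (leb a b) g" "Lp 2 (leb a b) f'" "Lp 2 (leb a b) g'"
    using assms by (auto simp: H1_deriv_def)
  note i = this[THEN square_integrable_mult[OF _ t2(1)]] this[THEN square_integrable_mult[OF _ t2(2)]]
  show "(LINT s|leb a b. (f s + g s) * deriv \<theta> s) = - (LINT s|leb a b. (f' s + g' s) * \<theta> s)"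
    using assms \<theta> i by (simp add: distrib_right H1_deriv_def)
qed

lemma H1_deriv_cmult: "H1_deriv a b f f' \<Longrightarrow> H1_deriv a b (\<lambda>s. c * f s) (\<lambda>s. c * f' s)"
  by (auto simp: H1_deriv_def Lp2_cmult mult.assoc)

lemma L2H1_deriv_add:
  assumes "L2H1_deriv T u u'" "L2H1_deriv T w w'"
  shows "L2H1_deriv T (\<lambda>t s. u t s + w t s) (\<lambda>t s. u' t s + w' t s)"
proof -
  have "AE t in leb 0 T. H1_deriv 0 1 (u t) (u' t)" "AE t in leb 0 T. H1_deriv 0 1 (w t) (w' t)"
    using assms by (auto simp: L2H1_deriv_def)
  then have "AE t in leb 0 T. H1_deriv 0 1 (\<lambda>s. u t s + w t s) (\<lambda>s. u' t s + w' t s)"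
    by eventually_elim (rule H1_deriv_add)
  then show ?thesis
    using assms Lp2_add[of "leb2 T" "\<lambda>(t, s). u t s" "\<lambda>(t, s). w t s"] Lp2_add[of "leb2 T" "\<lambda>(t, s). u' t s" "\<lambda>(t, s). w' t s"]
    by (simp add: L2H1_deriv_def case_prod_beta')
qed

lemma L2H1_deriv_cmult:
  assumes "L2H1_deriv T u u'"
  shows "L2H1_deriv T (\<lambda>t s. c * u t s) (\<lambda>t s. c * u' t s)"
proof -
  have "AE t in leb 0 T. H1_deriv 0 1 (u t) (u' t)" using assms by (auto simp: L2H1_deriv_def)
  then have "AE t in leb 0 T. H1_deriv 0 1 (\<lambda>s. c * u t s) (\<lambda>s. c * u' t s)"
    by eventually_elim (rule H1_deriv_cmult)
  then show ?thesis
    using assms Lp2_cmult[of "leb2 T" "\<lambda>(t, s). u t s" c] Lp2_cmult[of "leb2 T" "\<lambda>(t, s). u' t s" c]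
    by (simp add: L2H1_deriv_def case_prod_beta')
qed

lemma L2H1_deriv_zero: "L2H1_deriv T (\<lambda>t s. 0) (\<lambda>t s. 0)"
  by (simp add: L2H1_deriv_def H1_deriv_def Lp2_iff)

lemma L2H1_deriv_sum:
  fixes n :: nat
  assumes "\<And>k. k < n \<Longrightarrow> L2H1_deriv T (u k) (u' k)"
  shows "L2H1_deriv T (\<lambda>t s. \<Sum>k<n. c k * u k t s) (\<lambda>t s. \<Sum>k<n. c k * u' k t s)"
  using assms
proof (induction n)
  case 0
  then show ?case by (simp add: L2H1_deriv_zero)
next
  case (Suc n)
  then show ?case by (simp add: L2H1_deriv_add L2H1_deriv_cmult)
qed

lemma L2H1_dual_sum:
  fixes n :: nat
  assumes F: "L2H1_dual T F" and u: "\<And>k. k < n \<Longrightarrow> L2H1 T (u k)"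
  shows "F (\<lambda>t s. \<Sum>k<n. c k * u k t s) = (\<Sum>k<n. c k * F (u k))"
  using u
proof (induction n)
  case 0
  \<comment> \<open>Homogeneity with the factor 0 gives the value at the empty combination.\<close>
  have "F (\<lambda>t s. 0 * 0) = 0 * F (\<lambda>t s. 0)"
    using F L2H1_deriv_zero unfolding L2H1_dual_def L2H1_def by blast
  then show ?case by simp
next
  case (Suc n)
  obtain u' where u': "\<And>k. k < Suc n \<Longrightarrow> L2H1_deriv T (u k) (u' k)"
    using Suc.prems unfolding L2H1_def by metis
  have 1: "L2H1 T (\<lambda>t s. \<Sum>k<n. c k * u k t s)"
    unfolding L2H1_def using L2H1_deriv_sum[of n T u u' c] u' by auto
  have 2: "L2H1 T (\<lambda>t s. c n * u n t s)"
    unfolding L2H1_def using L2H1_deriv_cmult[of T "u n" "u' n" "c n"] u' by blast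
  have "F (\<lambda>t s. (\<Sum>k<n. c k * u k t s) + c n * u n t s) = F (\<lambda>t s. \<Sum>k<n. c k * u k t s) + F (\<lambda>t s. c n * u n t s)"
    using F 1 2 unfolding L2H1_dual_def by blast
  also have "F (\<lambda>t s. c n * u n t s) = c n * F (u n)"
    using F Suc.prems[of n] unfolding L2H1_dual_def by blast
  finally show ?case using Suc by simp
qed

lemma L2H1_dual_tendsto:
  assumes F: "L2H1_dual T F" and u: "\<And>n. L2H1_deriv T (u n) (u' n)" and w: "L2H1_deriv T w w'"
    and lim: "(\<lambda>n. LINT p|leb2 T. (case p of (t, s) \<Rightarrow> u n t s - w t s)\<^sup>2) \<longlonglongrightarrow> 0"
      "(\<lambda>n. LINT p|leb2 T. (case p of (t, s) \<Rightarrow> u' n t s - w' t s)\<^sup>2) \<longlonglongrightarrow> 0"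
  shows "(\<lambda>n. F (u n)) \<longlonglongrightarrow> F w"
proof -
  from F obtain C where C: "\<And>u v. L2H1_deriv T u v \<Longrightarrow>
        \<bar>F u\<bar> \<le> C * sqrt ((Lp_norm 2 (leb2 T) (\<lambda>(t, s). u t s))\<^sup>2 + (Lp_norm 2 (leb2 T) (\<lambda>(t, s). v t s))\<^sup>2)"
    unfolding L2H1_dual_def by blast
  let ?q = "\<lambda>n. (LINT p|leb2 T. (case p of (t, s) \<Rightarrow> u n t s - w t s)\<^sup>2) + (LINT p|leb2 T. (case p of (t, s) \<Rightarrow> u' n t s - w' t s)\<^sup>2)"
  have le: "norm (F (u n) - F w) \<le> C * sqrt (?q n)" for n
  proof -
    have d: "L2H1_deriv T (\<lambda>t s. u n t s + (-1) * w t s) (\<lambda>t s. u' n t s + (-1) * w' t s)"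
      by (intro L2H1_deriv_add L2H1_deriv_cmult u w)
    have m: "L2H1 T (\<lambda>t s. (-1) * w t s)" unfolding L2H1_def using L2H1_deriv_cmult[OF w, of "-1"] by blast
    have "L2H1 T (u n)" "L2H1 T w" unfolding L2H1_def using u w by blast+
    with F m have "F (\<lambda>t s. u n t s + (-1) * w t s) = F (u n) + F (\<lambda>t s. (-1) * w t s)"
      "F (\<lambda>t s. (-1) * w t s) = (-1) * F w"
      unfolding L2H1_dual_def by blast+
    then have "F (u n) - F w = F (\<lambda>t s. u n t s + (-1) * w t s)" by simp
    then show ?thesis using C[OF d] by (simp add: Lp_norm_2)
  qed
  have "(\<lambda>n. C * sqrt (?q n)) \<longlonglongrightarrow> C * sqrt (0 + 0)"
    by (intro tendsto_mult tendsto_const tendsto_real_sqrt tendsto_add lim)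
  then have "(\<lambda>n. C * sqrt (?q n)) \<longlonglongrightarrow> 0" by simp
  then have "(\<lambda>n. F (u n) - F w) \<longlonglongrightarrow> 0"
    by (rule Lim_null_comparison[OF always_eventually, rotated]) (use le in blast)
  then show ?thesis by (rule LIM_zero_cancel)
qed

section \<open>Limits along convex combinations\<close>

lemma tail_weights_sum_ge:
  assumes c: "tail_weights n K c" and a: "\<And>k. n \<le> k \<Longrightarrow> (b::real) \<le> a k"
  shows "b \<le> (\<Sum>k<K. c k * a k)"
proof -
  have "b = (\<Sum>k<K. c k * b)" using c by (simp add: tail_weights_def sum_distrib_right[symmetric])
  also have "\<dots> \<le> (\<Sum>k<K. c k * a k)"
  proof (rule sum_mono)
    fix k
    show "c k * b \<le> c k * a k"
      using c a[of k] by (cases "c k = 0") (auto simp: tail_weights_def intro!: mult_left_mono)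
  qed
  finally show ?thesis .
qed

lemma tail_weights_sum_le:
  assumes "tail_weights n K c" "\<And>k. n \<le> k \<Longrightarrow> a k \<le> (b::real)"
  shows "(\<Sum>k<K. c k * a k) \<le> b"
  using tail_weights_sum_ge[OF assms(1), of "-b" "\<lambda>k. - a k"] assms(2) by (simp add: sum_negf)

lemma tail_weights_L1:
  assumes c: "tail_weights n K c" and Y: "\<And>k. integrable M (Y k)" and Z: "integrable M Z"
    and le: "\<And>k. n \<le> k \<Longrightarrow> (LINT x|M. \<bar>Y k x - Z x\<bar>) \<le> (e::real)"
  shows "(LINT x|M. \<bar>(\<Sum>k<K. c k * Y k x) - Z x\<bar>) \<le> e"
proof -
  have cn: "c k \<ge> 0" for k using c by (simp add: tail_weights_def)
  have i: "integrable M (\<lambda>x. \<bar>Y k x - Z x\<bar>)" for k using Y[of k] Z by auto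
  have "(LINT x|M. \<bar>(\<Sum>k<K. c k * Y k x) - Z x\<bar>) \<le> (LINT x|M. (\<Sum>k<K. c k * \<bar>Y k x - Z x\<bar>))"
  proof (rule integral_mono)
    show "integrable M (\<lambda>x. \<bar>(\<Sum>k<K. c k * Y k x) - Z x\<bar>)"
      using Y Z by (intro integrable_abs Bochner_Integration.integrable_diff Bochner_Integration.integrable_sum) auto
    show "integrable M (\<lambda>x. \<Sum>k<K. c k * \<bar>Y k x - Z x\<bar>)"
      using i by (intro Bochner_Integration.integrable_sum) auto
    fix x
    have "(\<Sum>k<K. c k * Y k x) - Z x = (\<Sum>k<K. c k * (Y k x - Z x))"
      using c by (simp add: right_diff_distrib sum_subtractf sum_distrib_right[symmetric] tail_weights_def)
    also have "\<bar>\<dots>\<bar> \<le> (\<Sum>k<K. \<bar>c k * (Y k x - Z x)\<bar>)" by (rule sum_abs)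
    also have "\<dots> = (\<Sum>k<K. c k * \<bar>Y k x - Z x\<bar>)" using cn by (simp add: abs_mult)
    finally show "\<bar>(\<Sum>k<K. c k * Y k x) - Z x\<bar> \<le> (\<Sum>k<K. c k * \<bar>Y k x - Z x\<bar>)" .
  qed
  also have "\<dots> = (\<Sum>k<K. c k * (LINT x|M. \<bar>Y k x - Z x\<bar>))"
    using i by simp
  also have "\<dots> \<le> e" by (rule tail_weights_sum_le[OF c le])
  finally show ?thesis .
qed

lemma prim_time_L1:
  assumes f: "integrable (leb2 T) (\<lambda>(t, s). f t s)"
  shows "integrable (leb 0 1) (\<lambda>s. prim 0 T (\<lambda>\<tau>. f \<tau> s) t)"
    and "(LINT s|leb 0 1. \<bar>prim 0 T (\<lambda>\<tau>. f \<tau> s) t\<bar>) \<le> (LINT p|leb2 T. \<bar>case p of (t, s) \<Rightarrow> f t s\<bar>)"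
proof -
  show i: "integrable (leb 0 1) (\<lambda>s. prim 0 T (\<lambda>\<tau>. f \<tau> s) t)"
    using pair_leb.integrable_snd[OF leb2_indicator_mult[OF f, of t]] by (simp add: prim_def)
  have f': "integrable (leb2 T) (\<lambda>(t, s). \<bar>f t s\<bar>)" using integrable_abs[OF f] by (simp add: case_prod_beta')
  have "(LINT s|leb 0 1. \<bar>prim 0 T (\<lambda>\<tau>. f \<tau> s) t\<bar>) \<le> (LINT s|leb 0 1. LINT \<tau>|leb 0 T. \<bar>f \<tau> s\<bar>)"
  proof (rule integral_mono_AE)
    show "integrable (leb 0 1) (\<lambda>s. \<bar>prim 0 T (\<lambda>\<tau>. f \<tau> s) t\<bar>)" using i by simp
    show "integrable (leb 0 1) (\<lambda>s. LINT \<tau>|leb 0 T. \<bar>f \<tau> s\<bar>)" by (rule pair_leb.integrable_snd[OF f'])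
    show "AE s in leb 0 1. \<bar>prim 0 T (\<lambda>\<tau>. f \<tau> s) t\<bar> \<le> (LINT \<tau>|leb 0 T. \<bar>f \<tau> s\<bar>)"
      using pair_leb.AE_integrable_snd[OF f] by eventually_elim (rule prim_bound)
  qed
  also have "\<dots> = (LINT p|leb2 T. \<bar>case p of (t, s) \<Rightarrow> f t s\<bar>)"
    using pair_leb.integral_snd[OF f'] by (simp add: case_prod_beta')
  finally show "(LINT s|leb 0 1. \<bar>prim 0 T (\<lambda>\<tau>. f \<tau> s) t\<bar>) \<le> (LINT p|leb2 T. \<bar>case p of (t, s) \<Rightarrow> f t s\<bar>)" .
qed

text \<open>Convergence of the initial data is taken in L2, the distance in which the comparison
  estimate works, and the potential enters only through a Lipschitz force. The final theorem derives
  the former from the energy and width bounds, the latter from the bounded second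
  derivative.\<close>

locale particle_limit =
  fixes T K :: real and d\<phi> X0 :: "real \<Rightarrow> real"
    and x0 :: "nat \<Rightarrow> nat \<Rightarrow> real" and x \<Lambda> :: "nat \<Rightarrow> nat \<Rightarrow> real \<Rightarrow> real"
  assumes T: "T > 0" and K: "K > 0"
    and Lip: "\<And>x y. \<bar>d\<phi> x - d\<phi> y\<bar> \<le> K * \<bar>x - y\<bar>" and d\<phi>m: "d\<phi> \<in> borel_measurable borel"
    and sol: "\<And>N. N \<ge> 1 \<Longrightarrow> particle_solution T d\<phi> N (x0 N) (x N) (\<Lambda> N)"
    and X0: "Lp 2 (leb 0 1) X0"
    and init: "(\<lambda>N. LINT s|leb 0 1. (interp_const N (x N) 0 s - X0 s)\<^sup>2) \<longlonglongrightarrow> 0"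
begin

definition X :: "nat \<Rightarrow> real \<Rightarrow> real \<Rightarrow> real" where "X N = interp_const N (x N)"
definition L :: "nat \<Rightarrow> real \<Rightarrow> real \<Rightarrow> real" where "L N = multiplier_deriv N (\<Lambda> N)"

lemmas facts = particle_solution_facts[OF T Lip d\<phi>m _ sol, folded X_def L_def]

lemma zero_mem: "0 \<in> {0..T}" using T by simp

lemma XL:
  assumes "N \<ge> 1"
  shows "Lp 2 (leb2 T) (\<lambda>(t, s). X N t s)" "Lp 2 (leb2 T) (\<lambda>(t, s). L N t s)"
    "t \<in> {0..T} \<Longrightarrow> Lp 2 (leb 0 1) (X N t)"
    "t \<in> {0..T} \<Longrightarrow> AE s in leb 0 1. X N t s = X N 0 s + prim 0 T (\<lambda>\<tau>. - d\<phi> (X N \<tau> s) - L N \<tau> s) t"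
    "AE t in leb 0 T. admissible (L N t) \<and>
        - (1 / real N) * (LINT s|leb 0 1. \<bar>L N t s\<bar>) \<le> (LINT s|leb 0 1. (X N t s - s) * L N t s) \<and>
        (\<forall>m. admissible m \<longrightarrow> (LINT s|leb 0 1. (X N t s - s) * m s) \<le> 1 / real N * (LINT s|leb 0 1. \<bar>m s\<bar>))"
  using facts(1)[OF assms assms] by (auto simp: approx_solution_def)

section \<open>Bounds uniform in the number of particles\<close>

lemma initial_bound: obtains B where "\<And>N. N \<ge> 1 \<Longrightarrow> (LINT s|leb 0 1. (X N 0 s)\<^sup>2) \<le> B"
proof -
  obtain C where C: "\<And>N. norm (LINT s|leb 0 1. (X N 0 s - X0 s)\<^sup>2) \<le> C"
    using convergent_imp_Bseq[OF convergentI[OF init]] unfolding Bseq_def X_def by blast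
  show thesis
  proof (rule that)
    fix N :: nat assume N: "N \<ge> 1"
    have "(LINT s|leb 0 1. (X N 0 s)\<^sup>2) = (LINT s|leb 0 1. ((X N 0 s - X0 s) + X0 s)\<^sup>2)" by simp
    also have "\<dots> \<le> 2 * (LINT s|leb 0 1. (X N 0 s - X0 s)\<^sup>2) + 2 * (LINT s|leb 0 1. (X0 s)\<^sup>2)"
      by (intro square_integral_add_le Lp2_diff XL(3)[OF N zero_mem] X0)
    also have "\<dots> \<le> 2 * C + 2 * (LINT s|leb 0 1. (X0 s)\<^sup>2)" using C[of N] by simp
    finally show "(LINT s|leb 0 1. (X N 0 s)\<^sup>2) \<le> 2 * C + 2 * (LINT s|leb 0 1. (X0 s)\<^sup>2)" .
  qed
qed

text \<open>The evolution is tested with the positions themselves. Orthogonality bounds the norm of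
  the velocity by that of \<open>d\<phi> (X N)\<close>, which grows linearly in \<open>X N\<close>,
  so Gronwall's inequality closes the estimate before any bound on the multipliers is known.\<close>

lemma uniform_bound: obtains B where "\<And>N t. N \<ge> 1 \<Longrightarrow> t \<in> {0..T} \<Longrightarrow> (LINT s|leb 0 1. (X N t s)\<^sup>2) \<le> B"
proof -
  obtain B0 where B0: "\<And>N. N \<ge> 1 \<Longrightarrow> (LINT s|leb 0 1. (X N 0 s)\<^sup>2) \<le> B0" using initial_bound by blast
  \<comment> \<open>The 1 comes from \<open>2 * X * V \<le> X\<^sup>2 + V\<^sup>2\<close>;
    \<open>2 * K\<^sup>2\<close> and \<open>d\<close> come from squaring the linear growth of
    \<open>d\<phi>\<close>.\<close>
  define \<kappa> where "\<kappa> = 1 + 2 * K\<^sup>2"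
  define d where "d = 2 * (d\<phi> 0)\<^sup>2"
  have \<kappa>: "\<kappa> > 0" and d: "d \<ge> 0" by (auto simp: \<kappa>_def d_def add_pos_nonneg)
  have B00: "B0 \<ge> 0" using B0[of 1] square_integral_nonneg[of "leb 0 1" "X 1 0"] by linarith
  show thesis
  proof (rule that)
    fix N :: nat and t assume N: "N \<ge> 1" and t: "t \<in> {0..T}"
    note XL = XL[OF N]
    define V where "V t s = - d\<phi> (X N t s) - L N t s" for t s
    define u where "u t = (LINT s|leb 0 1. (X N t s)\<^sup>2)" for t
    define e where "e \<tau> = (LINT s|leb 0 1. X N \<tau> s * V \<tau> s)" for \<tau>
    have V2: "Lp 2 (leb2 T) (\<lambda>(t, s). V t s)"
      using Lp2_diff[OF Lp2_uminus[OF Lp2_Lipschitz_compose(1)[OF XL(1) finite_measure_leb2 Lip d\<phi>m]] XL(2)]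
      by (simp add: V_def case_prod_beta')
    note en = energy_identity[OF V2 XL(1) XL(3) XL(4)[folded V_def], folded u_def e_def]
    have ei: "integrable (leb 0 T) e" by (rule en(2)[OF _ _ t]) auto
    have ui: "integrable (leb 0 T) u" unfolding u_def by (rule Lp2_leb2_square_integral(1)[OF XL(1)])
    have ineq: "AE \<tau> in leb 0 T. 2 * e \<tau> \<le> d + \<kappa> * u \<tau>"
      using facts(2)[OF N N] XL(5) AE_space
    proof eventually_elim
      case (elim \<tau>)
      then have \<tau>: "\<tau> \<in> {0..T}" by auto
      have L2: "Lp 2 (leb 0 1) (L N \<tau>)" using elim by (simp add: admissible_def)
      note a2 = Lp2_Lipschitz_compose[OF XL(3)[OF \<tau>] finite_measure_leb Lip d\<phi>m]
      have V2: "Lp 2 (leb 0 1) (V \<tau>)" unfolding V_def by (intro Lp2_diff Lp2_uminus a2 L2)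
      have i: "integrable (leb 0 1) (\<lambda>s. (X N \<tau> s)\<^sup>2)" "integrable (leb 0 1) (\<lambda>s. (V \<tau> s)\<^sup>2)"
        using XL(3)[OF \<tau>] V2 by (auto simp: Lp2_iff)
      have "2 * e \<tau> = (LINT s|leb 0 1. 2 * (X N \<tau> s * V \<tau> s))" by (simp add: e_def)
      also have "\<dots> \<le> (LINT s|leb 0 1. (X N \<tau> s)\<^sup>2 + (V \<tau> s)\<^sup>2)"
        using square_integrable_mult[OF XL(3)[OF \<tau>] V2] i
        by (intro integral_mono integrable_mult_right Bochner_Integration.integrable_add)
          (auto simp: sum_squares_bound[of "X N \<tau> _" "V \<tau> _", simplified mult.assoc])
      also have "\<dots> = u \<tau> + (LINT s|leb 0 1. (V \<tau> s)\<^sup>2)" using i by (simp add: u_def)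
      also have "(LINT s|leb 0 1. (V \<tau> s)\<^sup>2) \<le> (LINT s|leb 0 1. (d\<phi> (X N \<tau> s))\<^sup>2)"
        using elim by (simp add: V_def)
      also have "\<dots> \<le> d + 2 * K\<^sup>2 * u \<tau>" using a2(2) by (simp add: d_def u_def measure_leb)
      finally show ?case by (simp add: \<kappa>_def algebra_simps)
    qed
    have ut: "u t = u 0 + 2 * prim 0 T e t" if "t \<in> {0..T}" for t
      by (rule en(1)[OF _ _ that]) auto
    have ci: "integrable (leb 0 T) (\<lambda>_. c :: real)" for c by (rule Lp2_leb_integrable[OF Lp2_const_leb])
    have main: "u t \<le> (B0 + d * T) + \<kappa> * prim 0 T u t" if t: "t \<in> {0..T}" for t
    proof -
      have "2 * prim 0 T e t = prim 0 T (\<lambda>\<tau>. 2 * e \<tau>) t" by (simp add: prim_cmult)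
      also have "\<dots> \<le> prim 0 T (\<lambda>\<tau>. d + \<kappa> * u \<tau>) t"
        using ei ui ci by (intro prim_mono_AE ineq) auto
      also have "\<dots> = prim 0 T (\<lambda>\<tau>. d) t + \<kappa> * prim 0 T u t" using ui ci by (simp add: prim_add prim_cmult)
      also have "prim 0 T (\<lambda>\<tau>. d) t \<le> d * T"
        using prim_bound[OF ci[of d], of t] d T measure_leb[of 0 T] by (simp add: mult.commute)
      finally have "2 * prim 0 T e t \<le> d * T + \<kappa> * prim 0 T u t" by simp
      moreover have "u 0 \<le> B0" using B0[OF N] by (simp add: u_def)
      ultimately show ?thesis using ut[OF t] by linarith
    qed
    have "u t \<le> 2 * (B0 + d * T) * exp (2 * \<kappa> * t)"
    proof (rule Gronwall[OF \<kappa> _ ui _ main t])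
      show "0 \<le> B0 + d * T" using B00 d T by simp
      show "0 \<le> u t \<and> u t \<le> B0 + 2 * (LINT \<tau>|leb 0 T. \<bar>e \<tau>\<bar>)" if "t \<in> {0..T}" for t
      proof
        show "0 \<le> u t" by (simp add: u_def)
        have "u 0 \<le> B0" using B0[OF N] by (simp add: u_def)
        then show "u t \<le> B0 + 2 * (LINT \<tau>|leb 0 T. \<bar>e \<tau>\<bar>)"
          using ut[OF that] prim_bound[OF ei, of t] by linarith
      qed
    qed
    also have "\<dots> \<le> 2 * (B0 + d * T) * exp (2 * \<kappa> * T)"
      using B00 d T t \<kappa> by (intro mult_left_mono) auto
    finally show "(LINT s|leb 0 1. (X N t s)\<^sup>2) \<le> 2 * (B0 + d * T) * exp (2 * \<kappa> * T)"
      by (simp add: u_def)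
  qed
qed

text \<open>The other half of the orthogonality estimate, now with the positions under control; the
  bound depends neither on \<open>N\<close> nor on the time.\<close>

lemma multiplier_bound:
  obtains B where "B \<ge> 0" "\<And>N. N \<ge> 1 \<Longrightarrow> AE t in leb 0 T. (LINT s|leb 0 1. (L N t s)\<^sup>2) \<le> B"
proof -
  obtain B where B: "\<And>N t. N \<ge> 1 \<Longrightarrow> t \<in> {0..T} \<Longrightarrow> (LINT s|leb 0 1. (X N t s)\<^sup>2) \<le> B" using uniform_bound by blast
  have B0: "B \<ge> 0" using B[of 1 0] zero_mem square_integral_nonneg[of "leb 0 1" "X 1 0"] by linarith
  show thesis
  proof (rule that)
    show "0 \<le> 2 * (d\<phi> 0)\<^sup>2 + 2 * K\<^sup>2 * B" using B0 by simp
    fix N :: nat assume N: "N \<ge> 1"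
    show "AE t in leb 0 T. (LINT s|leb 0 1. (L N t s)\<^sup>2) \<le> 2 * (d\<phi> 0)\<^sup>2 + 2 * K\<^sup>2 * B"
      using facts(2)[OF N N] AE_space
    proof eventually_elim
      case (elim t)
      then have t: "t \<in> {0..T}" by auto
      have "(LINT s|leb 0 1. (L N t s)\<^sup>2) \<le> (LINT s|leb 0 1. (d\<phi> (X N t s))\<^sup>2)" using elim by simp
      also have "\<dots> \<le> 2 * (d\<phi> 0)\<^sup>2 + 2 * K\<^sup>2 * (LINT s|leb 0 1. (X N t s)\<^sup>2)"
        using Lp2_Lipschitz_compose(2)[OF XL(3)[OF N t] finite_measure_leb Lip d\<phi>m]
        by (simp add: measure_leb)
      also have "\<dots> \<le> 2 * (d\<phi> 0)\<^sup>2 + 2 * K\<^sup>2 * B" using B[OF N t] by (intro add_left_mono mult_left_mono) auto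
      finally show ?case .
    qed
  qed
qed

lemma const_integral: "(LINT t|leb 0 T. c) = T * (c :: real)"
  using measure_leb[of 0 T] T by simp

lemma integrable_const_T: "integrable (leb 0 T) (\<lambda>_. c :: real)"
  by (rule Lp2_leb_integrable[OF Lp2_const_leb])

text \<open>Two particle systems are approximate solutions with errors \<open>1 / N\<close> and
  \<open>1 / M\<close>. The comparison bounds their distance by the initial distance plus these
  errors times the L1 norms of the multiplier derivatives, which \<open>multiplier_bound\<close>
  controls.\<close>

lemma uniformly_Cauchy:
  assumes e: "e > 0"
  obtains n where "n \<ge> 1" "\<And>N M t. N \<ge> n \<Longrightarrow> M \<ge> n \<Longrightarrow> t \<in> {0..T} \<Longrightarrow> (LINT s|leb 0 1. (X N t s - X M t s)\<^sup>2) < e"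
proof -
  obtain B where B: "B \<ge> 0" "\<And>N. N \<ge> 1 \<Longrightarrow> AE t in leb 0 T. (LINT s|leb 0 1. (L N t s)\<^sup>2) \<le> B"
    using multiplier_bound by blast
  define G where "G = T * sqrt B"
  have G: "(LINT t|leb 0 T. LINT s|leb 0 1. \<bar>L N t s\<bar>) \<le> G" if N: "N \<ge> 1" for N
  proof -
    have "(LINT t|leb 0 T. LINT s|leb 0 1. \<bar>L N t s\<bar>) \<le> (LINT t|leb 0 T. sqrt B)"
    proof (rule integral_mono_AE)
      show "AE t in leb 0 T. (LINT s|leb 0 1. \<bar>L N t s\<bar>) \<le> sqrt B"
        using B(2)[OF N] Lp2_leb2_AE[OF XL(2)[OF N]]
      proof eventually_elim
        case (elim t)
        from integral_abs_le_sqrt_01[OF elim(2)] real_sqrt_le_mono[OF elim(1)]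
        show ?case by linarith
      qed
    qed (use Lp2_leb2_square_integral(3)[OF XL(2)[OF N]] integrable_const_T in auto)
    then show ?thesis unfolding const_integral G_def .
  qed
  have G0: "G \<ge> 0" using T B by (simp add: G_def)
  define q where "q N = (LINT s|leb 0 1. (X N 0 s - X0 s)\<^sup>2)" for N
  \<comment> \<open>The comparison bound is linear in the errors and the initial squared distance;
    passing through \<open>X0\<close> at time 0 splits it into one contribution per system.\<close>
  define a where "a N = 2 * (2 * q N + 4 * G * (1 / real N)) * exp (4 * K * T)" for N
  have le: "(LINT s|leb 0 1. (X N t s - X M t s)\<^sup>2) \<le> a N + a M" if N: "N \<ge> 1" and M: "M \<ge> 1" and t: "t \<in> {0..T}" for N M t
  proof -
    have "(LINT s|leb 0 1. (X N 0 s - X M 0 s)\<^sup>2) = (LINT s|leb 0 1. ((X N 0 s - X0 s) + (-1) * (X M 0 s - X0 s))\<^sup>2)"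
      by (intro Bochner_Integration.integral_cong refl) simp
    also have "\<dots> \<le> 2 * q N + 2 * (LINT s|leb 0 1. ((-1) * (X M 0 s - X0 s))\<^sup>2)"
      unfolding q_def by (intro square_integral_add_le Lp2_cmult Lp2_diff XL(3)[OF N zero_mem] XL(3)[OF M zero_mem] X0)
    also have "(LINT s|leb 0 1. ((-1) * (X M 0 s - X0 s))\<^sup>2) = q M"
      unfolding q_def by (simp add: power2_commute)
    finally have i: "(LINT s|leb 0 1. (X N 0 s - X M 0 s)\<^sup>2) \<le> 2 * q N + 2 * q M" .
    have "(LINT s|leb 0 1. (X N t s - X M t s)\<^sup>2)
      \<le> 2 * ((LINT s|leb 0 1. (X N 0 s - X M 0 s)\<^sup>2) + 2 * (1 / real N + 1 / real M) *
          ((LINT t|leb 0 T. LINT s|leb 0 1. \<bar>L N t s\<bar>) + (LINT t|leb 0 T. LINT s|leb 0 1. \<bar>L M t s\<bar>))) * exp (4 * K * T)"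
      by (rule approx_solution_compare[OF K Lip d\<phi>m facts(1)[OF N N] facts(1)[OF M M] _ _ t]) auto
    also have "\<dots> \<le> 2 * ((2 * q N + 2 * q M) + 2 * (1 / real N + 1 / real M) * (G + G)) * exp (4 * K * T)"
      using i G[OF N] G[OF M] by (intro mult_right_mono mult_left_mono add_mono) auto
    also have "\<dots> = a N + a M" by (simp add: a_def algebra_simps)
    finally show ?thesis .
  qed
  have q: "q \<longlonglongrightarrow> 0" using init by (simp add: q_def[abs_def] X_def)
  have "a \<longlonglongrightarrow> 2 * (2 * 0 + 4 * G * 0) * exp (4 * K * T)"
    unfolding a_def by (intro tendsto_intros q lim_1_over_n)
  then have "\<forall>\<^sub>F N in sequentially. a N < e / 2" using e by (intro order_tendstoD) auto
  then obtain n where n: "\<And>N. N \<ge> n \<Longrightarrow> a N < e / 2" by (auto simp: eventually_sequentially)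
  show thesis
  proof (rule that[of "max n 1"])
    fix N M t assume NM: "N \<ge> max n 1" "M \<ge> max n 1" "t \<in> {0..T}"
    then show "(LINT s|leb 0 1. (X N t s - X M t s)\<^sup>2) < e" using le[of N M t] n[of N] n[of M] by auto
  qed simp
qed

text \<open>Convergence fixes \<open>Z t\<close> only up to a null set of \<open>s\<close> that may
  vary with \<open>t\<close>, so joint measurability does not follow from the other two conditions
  and is recorded separately.\<close>

definition is_limit :: "(real \<Rightarrow> real \<Rightarrow> real) \<Rightarrow> bool" where
  "is_limit Z \<longleftrightarrow> (\<lambda>(t, s). Z t s) \<in> borel_measurable (leb2 T) \<and> (\<forall>t\<in>{0..T}. Lp 2 (leb 0 1) (Z t)) \<and>
     (\<forall>e>0. \<exists>n\<ge>1. \<forall>N\<ge>n. \<forall>t\<in>{0..T}. (LINT s|leb 0 1. (X N t s - Z t s)\<^sup>2) \<le> e)"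

text \<open>A single subsequence converges almost everywhere in \<open>s\<close> for every \<open>t\<close>, so the limit can be
  taken pointwise and is jointly measurable.\<close>

lemma limit_exists: obtains Z where "is_limit Z"
proof -
  \<comment> \<open>The squared rate makes the L1 distance of consecutive terms at most
    \<open>(1 / 2) ^ k\<close>, hence summable, at every \<open>t\<close> at once.\<close>
  have "\<exists>r. \<forall>k. ((r k \<ge> 1) \<and> (\<forall>N\<ge>r k. \<forall>M\<ge>r k. \<forall>t\<in>{0..T}. (LINT s|leb 0 1. (X N t s - X M t s)\<^sup>2) < ((1 / 2) ^ k)\<^sup>2)) \<and> r k < r (Suc k)"
  proof (rule dependent_nat_choice)
    obtain n where "n \<ge> 1" "\<And>N M t. N \<ge> n \<Longrightarrow> M \<ge> n \<Longrightarrow> t \<in> {0..T} \<Longrightarrow> (LINT s|leb 0 1. (X N t s - X M t s)\<^sup>2) < ((1 / 2) ^ 0)\<^sup>2"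
      by (rule uniformly_Cauchy[of "((1 / 2) ^ 0)\<^sup>2"]) auto
    then show "\<exists>n. n \<ge> 1 \<and> (\<forall>N\<ge>n. \<forall>M\<ge>n. \<forall>t\<in>{0..T}. (LINT s|leb 0 1. (X N t s - X M t s)\<^sup>2) < ((1 / 2) ^ 0)\<^sup>2)" by blast
    fix r k
    have "((1 / 2 :: real) ^ Suc k)\<^sup>2 > 0" by simp
    then obtain n where n: "n \<ge> 1" "\<And>N M t. N \<ge> n \<Longrightarrow> M \<ge> n \<Longrightarrow> t \<in> {0..T} \<Longrightarrow> (LINT s|leb 0 1. (X N t s - X M t s)\<^sup>2) < ((1 / 2) ^ Suc k)\<^sup>2"
      by (rule uniformly_Cauchy) blast
    then show "\<exists>n. (n \<ge> 1 \<and> (\<forall>N\<ge>n. \<forall>M\<ge>n. \<forall>t\<in>{0..T}. (LINT s|leb 0 1. (X N t s - X M t s)\<^sup>2) < ((1 / 2) ^ Suc k)\<^sup>2)) \<and> r < n"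
      by (intro exI[of _ "max n (Suc r)"]) auto
  qed
  then obtain r where r1: "\<And>k. r k \<ge> (1::nat)" and rinc: "\<And>k. r k < r (Suc k)"
    and r: "\<And>k N M t. N \<ge> r k \<Longrightarrow> M \<ge> r k \<Longrightarrow> t \<in> {0..T} \<Longrightarrow> (LINT s|leb 0 1. (X N t s - X M t s)\<^sup>2) < ((1 / 2) ^ k)\<^sup>2"
    by blast
  define Z where "Z t s = lim (\<lambda>k. X (r k) t s)" for t s
  have Xm: "X (r k) t \<in> borel_measurable (leb 0 1)" if "t \<in> {0..T}" for k t
    using XL(3)[OF r1 that] by (simp add: Lp2_iff)
  have Zt: "Z t \<in> borel_measurable (leb 0 1)" if "t \<in> {0..T}" for t
    unfolding Z_def using Xm[OF that] by (intro borel_measurable_lim_metric)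
  have "(\<lambda>p. lim (\<lambda>k. case p of (t, s) \<Rightarrow> X (r k) t s)) \<in> borel_measurable (leb2 T)"
    using XL(1)[OF r1] by (intro borel_measurable_lim_metric) (simp add: Lp2_iff)
  then have Zm: "(\<lambda>(t, s). Z t s) \<in> borel_measurable (leb2 T)" by (simp add: Z_def case_prod_beta')
  have ptw: "AE s in leb 0 1. (\<lambda>k. X (r k) t s) \<longlonglongrightarrow> Z t s" if t: "t \<in> {0..T}" for t
  proof -
    have "AE s in leb 0 1. convergent (\<lambda>k. X (r k) t s)"
    proof (rule AE_convergent_L1)
      show "integrable (leb 0 1) (X (r k) t)" for k by (rule Lp2_leb_integrable[OF XL(3)[OF r1 t]])
      show "(LINT s|leb 0 1. \<bar>X (r (Suc k)) t s - X (r k) t s\<bar>) \<le> (1 / 2) ^ k" for k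
      proof -
        have "(LINT s|leb 0 1. \<bar>X (r (Suc k)) t s - X (r k) t s\<bar>) \<le> sqrt (LINT s|leb 0 1. (X (r (Suc k)) t s - X (r k) t s)\<^sup>2)"
          by (intro integral_abs_le_sqrt_01 Lp2_diff XL(3)[OF r1 t])
        also have "\<dots> \<le> sqrt (((1 / 2) ^ k)\<^sup>2)"
          using rinc[of k] t r[of k "r (Suc k)" "r k" t] by (intro real_sqrt_le_mono) auto
        finally show ?thesis by simp
      qed
    qed
    then show ?thesis by eventually_elim (simp add: Z_def convergent_LIMSEQ_iff)
  qed
  have fat: "Lp 2 (leb 0 1) (\<lambda>s. X N t s - Z t s) \<and> (LINT s|leb 0 1. (X N t s - Z t s)\<^sup>2) \<le> e"
    if e: "e > 0" and n: "n \<ge> 1" "N \<ge> n" and t: "t \<in> {0..T}"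
      and c: "\<And>N M t. N \<ge> n \<Longrightarrow> M \<ge> n \<Longrightarrow> t \<in> {0..T} \<Longrightarrow> (LINT s|leb 0 1. (X N t s - X M t s)\<^sup>2) < e" for e n N t
  proof -
    have N1: "N \<ge> 1" using n by simp
    have 1: "Lp 2 (leb 0 1) (\<lambda>s. X N t s - X (r k) t s)" for k by (intro Lp2_diff XL(3)[OF N1 t] XL(3)[OF r1 t])
    have 2: "AE s in leb 0 1. (\<lambda>k. X N t s - X (r k) t s) \<longlonglongrightarrow> X N t s - Z t s"
      using ptw[OF t] by eventually_elim (intro tendsto_intros)
    have 3: "(\<lambda>s. X N t s - Z t s) \<in> borel_measurable (leb 0 1)"
      using XL(3)[OF N1 t] Zt[OF t] by (auto simp: Lp2_iff)
    have 4: "\<forall>\<^sub>F k in sequentially. (LINT s|leb 0 1. (X N t s - X (r k) t s)\<^sup>2) \<le> e"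
      using eventually_ge_at_top[of n]
    proof eventually_elim
      case (elim k)
      have "k \<le> r k" using seq_suble[of r k] rinc by (simp add: strict_mono_Suc_iff)
      then show ?case using c[of N "r k" t] elim n t by simp
    qed
    show ?thesis using square_integral_Fatou[OF 1 2 3 4] e by simp
  qed
  have "is_limit Z"
    unfolding is_limit_def
  proof (intro conjI ballI allI impI Zm)
    fix t assume t: "t \<in> {0..T}"
    obtain n where n: "n \<ge> 1" "\<And>N M t. N \<ge> n \<Longrightarrow> M \<ge> n \<Longrightarrow> t \<in> {0..T} \<Longrightarrow> (LINT s|leb 0 1. (X N t s - X M t s)\<^sup>2) < 1"
      by (rule uniformly_Cauchy[of 1]) auto
    have "Lp 2 (leb 0 1) (\<lambda>s. X n t s - Z t s)" using fat[OF _ n(1) order_refl t n(2)] by simp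
    from Lp2_diff[OF XL(3)[OF n(1) t] this] show "Lp 2 (leb 0 1) (Z t)" by simp
  next
    fix e :: real assume e: "e > 0"
    obtain n where n: "n \<ge> 1" "\<And>N M t. N \<ge> n \<Longrightarrow> M \<ge> n \<Longrightarrow> t \<in> {0..T} \<Longrightarrow> (LINT s|leb 0 1. (X N t s - X M t s)\<^sup>2) < e"
      by (rule uniformly_Cauchy[OF e]) auto
    then show "\<exists>n\<ge>1. \<forall>N\<ge>n. \<forall>t\<in>{0..T}. (LINT s|leb 0 1. (X N t s - Z t s)\<^sup>2) \<le> e"
      using fat[OF e n(1) _ _ n(2)] by blast
  qed
  then show thesis by (rule that)
qed

section \<open>Regularity and monotonicity of the limit\<close>

context
  fixes Z assumes Z: "is_limit Z"
begin

lemma Z_facts: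
  "(\<lambda>(t, s). Z t s) \<in> borel_measurable (leb2 T)" "t \<in> {0..T} \<Longrightarrow> Lp 2 (leb 0 1) (Z t)"
  using Z by (auto simp: is_limit_def)

lemma Z_conv:
  assumes "e > 0"
  obtains n where "n \<ge> 1" "\<And>N t. N \<ge> n \<Longrightarrow> t \<in> {0..T} \<Longrightarrow> (LINT s|leb 0 1. (X N t s - Z t s)\<^sup>2) \<le> e"
  using Z assms unfolding is_limit_def by blast

lemma Z_tendsto: "t \<in> {0..T} \<Longrightarrow> (\<lambda>N. LINT s|leb 0 1. (X N t s - Z t s)\<^sup>2) \<longlonglongrightarrow> 0"
proof (rule LIMSEQ_I)
  fix e :: real assume t: "t \<in> {0..T}" and e: "e > 0"
  obtain n where n: "n \<ge> 1" "\<And>N t. N \<ge> n \<Longrightarrow> t \<in> {0..T} \<Longrightarrow> (LINT s|leb 0 1. (X N t s - Z t s)\<^sup>2) \<le> e / 2"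
    by (rule Z_conv[of "e / 2"]) (use e in auto)
  have "norm ((LINT s|leb 0 1. (X N t s - Z t s)\<^sup>2) - 0) < e" if "N \<ge> n" for N
    using n(2)[OF that t] e by simp
  then show "\<exists>no. \<forall>N\<ge>no. norm ((LINT s|leb 0 1. (X N t s - Z t s)\<^sup>2) - 0) < e" by blast
qed

lemma Z_initial: "AE s in leb 0 1. Z 0 s = X0 s"
proof -
  have le: "(LINT s|leb 0 1. (Z 0 s - X0 s)\<^sup>2) \<le> 2 * (LINT s|leb 0 1. (X N 0 s - X0 s)\<^sup>2) + 2 * (LINT s|leb 0 1. (X N 0 s - Z 0 s)\<^sup>2)" if N: "N \<ge> 1" for N
  proof -
    have "(LINT s|leb 0 1. (Z 0 s - X0 s)\<^sup>2) = (LINT s|leb 0 1. ((X N 0 s - X0 s) + (-1) * (X N 0 s - Z 0 s))\<^sup>2)"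
      by (intro Bochner_Integration.integral_cong refl) simp
    also have "\<dots> \<le> 2 * (LINT s|leb 0 1. (X N 0 s - X0 s)\<^sup>2) + 2 * (LINT s|leb 0 1. ((-1) * (X N 0 s - Z 0 s))\<^sup>2)"
      by (intro square_integral_add_le Lp2_cmult Lp2_diff XL(3)[OF N zero_mem] X0 Z_facts zero_mem)
    also have "(LINT s|leb 0 1. ((-1) * (X N 0 s - Z 0 s))\<^sup>2) = (LINT s|leb 0 1. (X N 0 s - Z 0 s)\<^sup>2)"
      by (simp add: power2_commute)
    finally show ?thesis .
  qed
  have "(\<lambda>N. 2 * (LINT s|leb 0 1. (X N 0 s - X0 s)\<^sup>2) + 2 * (LINT s|leb 0 1. (X N 0 s - Z 0 s)\<^sup>2)) \<longlonglongrightarrow> 2 * 0 + 2 * 0"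
    using init by (intro tendsto_intros Z_tendsto zero_mem) (simp add: X_def)
  then have "(LINT s|leb 0 1. (Z 0 s - X0 s)\<^sup>2) \<le> 2 * 0 + 2 * 0"
    by (rule LIMSEQ_le_const) (use le in blast)
  then have "(LINT s|leb 0 1. (Z 0 s - X0 s)\<^sup>2) = 0"
    using square_integral_nonneg[of "leb 0 1" "\<lambda>s. Z 0 s - X0 s"] by linarith
  from square_integral_eq_0[OF Lp2_diff[OF Z_facts(2)[OF zero_mem] X0] this] show ?thesis by simp
qed

lemma Z_Lp2: "Lp 2 (leb2 T) (\<lambda>(t, s). Z t s)"
proof -
  obtain B where B: "\<And>N t. N \<ge> 1 \<Longrightarrow> t \<in> {0..T} \<Longrightarrow> (LINT s|leb 0 1. (X N t s)\<^sup>2) \<le> B" using uniform_bound by blast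
  obtain n where n: "n \<ge> 1" "\<And>N t. N \<ge> n \<Longrightarrow> t \<in> {0..T} \<Longrightarrow> (LINT s|leb 0 1. (X N t s - Z t s)\<^sup>2) \<le> 1"
    by (rule Z_conv[of 1]) auto
  have bd: "(LINT s|leb 0 1. (Z t s)\<^sup>2) \<le> 2 * B + 2" if t: "t \<in> {0..T}" for t
  proof -
    have "(LINT s|leb 0 1. (Z t s)\<^sup>2) = (LINT s|leb 0 1. (X n t s + (-1) * (X n t s - Z t s))\<^sup>2)"
      by (intro Bochner_Integration.integral_cong refl) simp
    also have "\<dots> \<le> 2 * (LINT s|leb 0 1. (X n t s)\<^sup>2) + 2 * (LINT s|leb 0 1. ((-1) * (X n t s - Z t s))\<^sup>2)"
      by (intro square_integral_add_le Lp2_cmult Lp2_diff XL(3)[OF n(1) t] Z_facts t)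
    also have "(LINT s|leb 0 1. ((-1) * (X n t s - Z t s))\<^sup>2) = (LINT s|leb 0 1. (X n t s - Z t s)\<^sup>2)"
      by (simp add: power2_commute)
    finally show ?thesis using B[OF n(1) t] n(2)[OF order_refl t] by linarith
  qed
  have m2: "(\<lambda>(t, s). (Z t s)\<^sup>2) \<in> borel_measurable (leb2 T)" using Z_facts(1) by (simp add: case_prod_beta')
  have "integrable (leb2 T) (\<lambda>(t, s). (Z t s)\<^sup>2)"
  proof (rule pair_leb.Fubini_integrable[OF m2])
    show "AE t in leb 0 T. integrable (leb 0 1) (\<lambda>s. case (t, s) of (t, s) \<Rightarrow> (Z t s)\<^sup>2)"
    proof (rule AE_I2)
      fix t assume "t \<in> space (leb 0 T)"
      then have "t \<in> {0..T}" by auto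
      from Z_facts(2)[OF this] show "integrable (leb 0 1) (\<lambda>s. case (t, s) of (t, s) \<Rightarrow> (Z t s)\<^sup>2)" by (simp add: Lp2_iff)
    qed
    show "integrable (leb 0 T) (\<lambda>t. LINT s|leb 0 1. norm (case (t, s) of (t, s) \<Rightarrow> (Z t s)\<^sup>2))"
    proof (rule finite_measure.integrable_const_bound[OF finite_measure_leb, where B="2 * B + 2"])
      show "AE t in leb 0 T. norm (LINT s|leb 0 1. norm (case (t, s) of (t, s) \<Rightarrow> (Z t s)\<^sup>2)) \<le> 2 * B + 2"
      proof (rule AE_I2)
        fix t assume "t \<in> space (leb 0 T)"
        then have "t \<in> {0..T}" by auto
        from bd[OF this] show "norm (LINT s|leb 0 1. norm (case (t, s) of (t, s) \<Rightarrow> (Z t s)\<^sup>2)) \<le> 2 * B + 2" by simp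
      qed
      from sigma_finite_measure.borel_measurable_lebesgue_integral[OF sigma_finite_leb m2]
      show "(\<lambda>t. LINT s|leb 0 1. norm (case (t, s) of (t, s) \<Rightarrow> (Z t s)\<^sup>2)) \<in> borel_measurable (leb 0 T)" by simp
    qed
  qed
  then show ?thesis using Z_facts(1) by (simp add: Lp2_iff case_prod_beta')
qed

lemma Z_C_Lp: "C_Lp 2 T Z"
  unfolding C_Lp_def Lp_norm_2_tendsto_iff
proof (intro ballI conjI Z_facts(2))
  fix t assume t: "t \<in> {0..T}"
  show "((\<lambda>\<tau>. LINT s|leb 0 1. (Z \<tau> s - Z t s)\<^sup>2) \<longlongrightarrow> 0) (at t within {0..T})"
  proof (rule tendstoI)
    fix e :: real assume e: "e > 0"
    \<comment> \<open>The three differences below carry the factors 2, 4 and 4, so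
      \<open>e / 8\<close> for the first and \<open>e / 16\<close> for the other two add up to less
      than \<open>e\<close>.\<close>
    obtain n where n: "n \<ge> 1" "\<And>N t. N \<ge> n \<Longrightarrow> t \<in> {0..T} \<Longrightarrow> (LINT s|leb 0 1. (X N t s - Z t s)\<^sup>2) \<le> e / 16"
      by (rule Z_conv[of "e / 16"]) (use e in auto)
    have "((\<lambda>\<tau>. LINT s|leb 0 1. (X n \<tau> s - X n t s)\<^sup>2) \<longlongrightarrow> 0) (at t within {0..T})"
      using facts(4)[OF n(1) n(1), of 2] t by (simp add: C_Lp_def Lp_norm_2_tendsto_iff)
    then have "\<forall>\<^sub>F \<tau> in at t within {0..T}. (LINT s|leb 0 1. (X n \<tau> s - X n t s)\<^sup>2) < e / 8"
      using e by (intro order_tendstoD) auto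
    moreover have "\<forall>\<^sub>F \<tau> in at t within {0..T}. \<tau> \<in> {0..T}" by (simp add: eventually_at_filter)
    ultimately show "\<forall>\<^sub>F \<tau> in at t within {0..T}. dist (LINT s|leb 0 1. (Z \<tau> s - Z t s)\<^sup>2) 0 < e"
    proof eventually_elim
      fix \<tau> assume c: "(LINT s|leb 0 1. (X n \<tau> s - X n t s)\<^sup>2) < e / 8" and \<tau>: "\<tau> \<in> {0..T}"
      note d = Lp2_diff[OF XL(3)[OF n(1) \<tau>] Z_facts(2)[OF \<tau>]] Lp2_diff[OF XL(3)[OF n(1) t] Z_facts(2)[OF t]]
        Lp2_diff[OF XL(3)[OF n(1) \<tau>] XL(3)[OF n(1) t]]
      have "(LINT s|leb 0 1. (Z \<tau> s - Z t s)\<^sup>2)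
        = (LINT s|leb 0 1. ((X n \<tau> s - X n t s) + ((X n t s - Z t s) + (-1) * (X n \<tau> s - Z \<tau> s)))\<^sup>2)"
        by (intro Bochner_Integration.integral_cong refl) simp
      also have "\<dots> \<le> 2 * (LINT s|leb 0 1. (X n \<tau> s - X n t s)\<^sup>2)
          + 2 * (LINT s|leb 0 1. ((X n t s - Z t s) + (-1) * (X n \<tau> s - Z \<tau> s))\<^sup>2)"
        by (intro square_integral_add_le Lp2_add Lp2_cmult d)
      finally have 1: "(LINT s|leb 0 1. (Z \<tau> s - Z t s)\<^sup>2) \<le> 2 * (LINT s|leb 0 1. (X n \<tau> s - X n t s)\<^sup>2)
          + 2 * (LINT s|leb 0 1. ((X n t s - Z t s) + (-1) * (X n \<tau> s - Z \<tau> s))\<^sup>2)" .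
      have 2: "(LINT s|leb 0 1. ((X n t s - Z t s) + (-1) * (X n \<tau> s - Z \<tau> s))\<^sup>2)
          \<le> 2 * (LINT s|leb 0 1. (X n t s - Z t s)\<^sup>2) + 2 * (LINT s|leb 0 1. ((-1) * (X n \<tau> s - Z \<tau> s))\<^sup>2)"
        by (intro square_integral_add_le Lp2_cmult d)
      have 3: "(LINT s|leb 0 1. ((-1) * (X n \<tau> s - Z \<tau> s))\<^sup>2) = (LINT s|leb 0 1. (X n \<tau> s - Z \<tau> s)\<^sup>2)"
        by (simp add: power2_commute)
      have "(LINT s|leb 0 1. (Z \<tau> s - Z t s)\<^sup>2) < e"
        using 1 2 c n(2)[OF order_refl t] n(2)[OF order_refl \<tau>] e unfolding 3 by linarith
      then show "dist (LINT s|leb 0 1. (Z \<tau> s - Z t s)\<^sup>2) 0 < e" by (simp add: dist_real_def)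
    qed
  qed
qed

text \<open>Along a subsequence converging almost everywhere in \<open>s\<close>, the monotone
  functions \<open>X N t s - real (cell N s) / real N\<close> tend to \<open>Z t s - s\<close>,
  since a point differs from the right end of its cell by at most \<open>1 / N\<close>. The order
  survives on the set of convergence, and \<open>AE_mono_extend\<close> extends it.\<close>

lemma Z_mono:
  assumes t: "t \<in> {0..T}"
  shows "\<exists>g. mono_on {0<..<1} g \<and> (AE s in leb 0 1. Z t s = s + g s)"
proof -
  have d2: "Lp 2 (leb 0 1) (\<lambda>s. X (Suc k) t s - Z t s)" for k by (intro Lp2_diff XL(3)[OF _ t] Z_facts t) simp
  have lim0: "(\<lambda>k. LINT s|leb 0 1. \<bar>X (Suc k) t s - Z t s\<bar>) \<longlonglongrightarrow> 0"
  proof (rule Lim_null_comparison)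
    have "(\<lambda>k. sqrt (LINT s|leb 0 1. (X (Suc k) t s - Z t s)\<^sup>2)) \<longlonglongrightarrow> sqrt 0"
      by (rule tendsto_real_sqrt[OF LIMSEQ_Suc[OF Z_tendsto[OF t]]])
    then show "(\<lambda>k. sqrt (LINT s|leb 0 1. (X (Suc k) t s - Z t s)\<^sup>2)) \<longlonglongrightarrow> 0" by simp
    show "\<forall>\<^sub>F k in sequentially. norm (LINT s|leb 0 1. \<bar>X (Suc k) t s - Z t s\<bar>) \<le> sqrt (LINT s|leb 0 1. (X (Suc k) t s - Z t s)\<^sup>2)"
      using integral_abs_le_sqrt_01[OF d2] by (simp add: abs_of_nonneg[OF Bochner_Integration.integral_nonneg])
  qed
  obtain r :: "nat \<Rightarrow> nat" where r: "strict_mono r" "AE s in leb 0 1. (\<lambda>k. X (Suc (r k)) t s - Z t s) \<longlonglongrightarrow> 0"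
    using AE_subseq_L1[OF Lp2_leb_integrable[OF d2] lim0] by blast
  define S where "S = {s. (\<lambda>k. X (Suc (r k)) t s - Z t s) \<longlonglongrightarrow> 0}"
  have cellc: "(\<lambda>k. real (cell (Suc (r k)) s) / real (Suc (r k))) \<longlonglongrightarrow> s" if s: "s \<in> {0<..<1}" for s
  proof -
    have "(\<lambda>k. real (cell (Suc (r k)) s) / real (Suc (r k)) - s) \<longlonglongrightarrow> 0"
    proof (rule Lim_null_comparison)
      show "\<forall>\<^sub>F k in sequentially. norm (real (cell (Suc (r k)) s) / real (Suc (r k)) - s) \<le> inverse (real (Suc (r k)))"
      proof (intro always_eventually allI)
        fix k
        show "norm (real (cell (Suc (r k)) s) / real (Suc (r k)) - s) \<le> inverse (real (Suc (r k)))"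
          using cell_bounds[OF _ s, of "Suc (r k)"] unfolding inverse_eq_divide real_norm_def by (simp only: abs_le_iff) linarith
      qed
      show "(\<lambda>k. inverse (real (Suc (r k)))) \<longlonglongrightarrow> 0"
        using LIMSEQ_subseq_LIMSEQ[OF LIMSEQ_inverse_real_of_nat r(1)] by (simp add: o_def)
    qed
    then show ?thesis by (rule LIM_zero_cancel)
  qed
  obtain g where g: "mono_on {0<..<1} g" "AE s in leb 0 1. g s = Z t s - s"
  proof (rule AE_mono_extend[of S "\<lambda>s. Z t s - s"])
    show "AE s in leb 0 1. s \<in> S" using r(2) by (simp add: S_def)
    fix s s' assume ss: "s \<in> S" "s' \<in> S" "s \<in> {0<..<1}" "s' \<in> {0<..<1::real}" "s < s'"
    have lim: "(\<lambda>k. X (Suc (r k)) t s - real (cell (Suc (r k)) s) / real (Suc (r k))) \<longlonglongrightarrow> Z t s - s"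
      if "s \<in> S" "s \<in> {0<..<1}" for s
      using that unfolding S_def by (intro tendsto_diff[OF LIM_zero_cancel cellc]) auto
    show "Z t s - s \<le> Z t s' - s'"
    proof (rule LIMSEQ_le[OF lim lim])
      show "\<exists>N. \<forall>k\<ge>N. X (Suc (r k)) t s - real (cell (Suc (r k)) s) / real (Suc (r k))
         \<le> X (Suc (r k)) t s' - real (cell (Suc (r k)) s') / real (Suc (r k))"
        using mono_onD[OF facts(5)[OF _ _ t], of "Suc (r _)" s s'] ss by auto
    qed (use ss in auto)
  qed
  have "AE s in leb 0 1. Z t s = s + g s" using g(2) by eventually_elim simp
  with g(1) show ?thesis by blast
qed

end

end

lemma square_integral_weak_tendsto:
  assumes w: "\<And>n. Lp 2 M (w n)" and l: "Lp 2 M l" and f: "Lp 2 M f"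
    and lim: "(\<lambda>n. LINT x|M. (w n x - l x)\<^sup>2) \<longlonglongrightarrow> 0"
  shows "(\<lambda>n. LINT x|M. f x * w n x) \<longlonglongrightarrow> (LINT x|M. f x * l x)"
proof -
  have "(\<lambda>n. (LINT x|M. f x * w n x) - (LINT x|M. f x * l x)) \<longlonglongrightarrow> 0"
  proof (rule Lim_null_comparison)
    show "\<forall>\<^sub>F n in sequentially. norm ((LINT x|M. f x * w n x) - (LINT x|M. f x * l x))
      \<le> sqrt (LINT x|M. (f x)\<^sup>2) * sqrt (LINT x|M. (w n x - l x)\<^sup>2)"
    proof (intro always_eventually allI)
      fix n
      have "(LINT x|M. f x * w n x) - (LINT x|M. f x * l x) = (LINT x|M. f x * (w n x - l x))"
        using square_integrable_mult[OF f w[of n]] square_integrable_mult[OF f l] by (simp add: right_diff_distrib)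
      then show "norm ((LINT x|M. f x * w n x) - (LINT x|M. f x * l x))
        \<le> sqrt (LINT x|M. (f x)\<^sup>2) * sqrt (LINT x|M. (w n x - l x)\<^sup>2)"
        using integral_mult_le_sqrt[OF f Lp2_diff[OF w[of n] l]] by simp
    qed
    have "(\<lambda>n. sqrt (LINT x|M. (f x)\<^sup>2) * sqrt (LINT x|M. (w n x - l x)\<^sup>2)) \<longlonglongrightarrow> sqrt (LINT x|M. (f x)\<^sup>2) * sqrt 0"
      by (intro tendsto_intros lim)
    then show "(\<lambda>n. sqrt (LINT x|M. (f x)\<^sup>2) * sqrt (LINT x|M. (w n x - l x)\<^sup>2)) \<longlonglongrightarrow> 0" by simp
  qed
  then show ?thesis by (rule LIM_zero_cancel)
qed

text \<open>The L1 distance to \<open>Z\<close> is convex, and the combination at stage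
  \<open>n\<close> involves only indices \<open>\<rho> k\<close> with
  \<open>n \<le> k < \<rho> k\<close>.\<close>

lemma tail_weights_tendsto:
  fixes Y :: "nat \<Rightarrow> 'a \<Rightarrow> real" and \<rho> :: "nat \<Rightarrow> nat"
  assumes c: "\<And>n. tail_weights n (M n) (c n)" and \<rho>: "\<And>k. k < \<rho> k"
    and Y: "\<And>k. integrable A (Y (\<rho> k))" and Z: "integrable A Z"
    and lim: "(\<lambda>N. LINT x|A. \<bar>Y N x - Z x\<bar>) \<longlonglongrightarrow> 0"
  shows "(\<lambda>n. LINT x|A. \<bar>(\<Sum>k<M n. c n k * Y (\<rho> k) x) - Z x\<bar>) \<longlonglongrightarrow> 0"
proof (rule LIMSEQ_I)
  fix e :: real assume e: "e > 0"
  then have "\<forall>\<^sub>F N in sequentially. (LINT x|A. \<bar>Y N x - Z x\<bar>) < e / 2" using lim by (intro order_tendstoD) auto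
  then obtain n0 where n0: "\<And>N. N \<ge> n0 \<Longrightarrow> (LINT x|A. \<bar>Y N x - Z x\<bar>) < e / 2" by (auto simp: eventually_sequentially)
  have "norm ((LINT x|A. \<bar>(\<Sum>k<M n. c n k * Y (\<rho> k) x) - Z x\<bar>) - 0) < e" if n: "n \<ge> n0" for n
  proof -
    have "(LINT x|A. \<bar>(\<Sum>k<M n. c n k * Y (\<rho> k) x) - Z x\<bar>) \<le> e / 2"
    proof (rule tail_weights_L1[OF c[of n] Y Z])
      fix k assume "n \<le> k"
      then have "\<rho> k \<ge> n0" using \<rho>[of k] n by simp
      then show "(LINT x|A. \<bar>Y (\<rho> k) x - Z x\<bar>) \<le> e / 2" using n0[of "\<rho> k"] by simp
    qed
    then show ?thesis using e by simp
  qed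
  then show "\<exists>no. \<forall>n\<ge>no. norm ((LINT x|A. \<bar>(\<Sum>k<M n. c n k * Y (\<rho> k) x) - Z x\<bar>) - 0) < e" by blast
qed

lemma prim_sum:
  assumes "\<And>k. k < n \<Longrightarrow> integrable (leb a b) (f k)"
  shows "prim a b (\<lambda>r. \<Sum>k<n. c k * f k r) t = (\<Sum>k<(n::nat). c k * prim a b (f k) t)"
  using assms
proof (induction n)
  case 0
  then show ?case by (simp add: prim_def)
next
  case (Suc n)
  then have "integrable (leb a b) (\<lambda>r. \<Sum>k<n. c k * f k r)" "integrable (leb a b) (\<lambda>r. c n * f n r)"
    by (auto intro!: Bochner_Integration.integrable_sum)
  then show ?case using Suc by (simp add: prim_add prim_cmult)
qed

section \<open>Evolution equation and multiplier of the limit\<close>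

context particle_limit
begin

context
  fixes Z assumes Z: "is_limit Z"
begin

text \<open>Strong convergence of the multiplier derivatives is out of reach, but their time
  integrals do converge in L1: the evolution equation expresses them through the positions, which
  converge uniformly in time, and through the Lipschitz force.\<close>

lemma limit_evolution:
  assumes t: "t \<in> {0..T}"
  defines "Y \<equiv> \<lambda>s. Z 0 s - Z t s + prim 0 T (\<lambda>\<tau>. - d\<phi> (Z \<tau> s)) t"
  shows "integrable (leb 0 1) Y"
    and "(\<lambda>N. LINT s|leb 0 1. \<bar>prim 0 T (\<lambda>\<tau>. L N \<tau> s) t - Y s\<bar>) \<longlonglongrightarrow> 0"
proof -
  have aZ: "Lp 2 (leb2 T) (\<lambda>(t, s). - d\<phi> (Z t s))"
    using Lp2_uminus[OF Lp2_Lipschitz_compose(1)[OF Z_Lp2[OF Z] finite_measure_leb2 Lip d\<phi>m]] by (simp add: case_prod_beta')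
  have aX: "Lp 2 (leb2 T) (\<lambda>(t, s). - d\<phi> (X N t s))" if N: "N \<ge> 1" for N
    using Lp2_uminus[OF Lp2_Lipschitz_compose(1)[OF XL(1)[OF N] finite_measure_leb2 Lip d\<phi>m]] by (simp add: case_prod_beta')
  have Zi: "integrable (leb 0 1) (Z t)" if "t \<in> {0..T}" for t by (rule Lp2_leb_integrable[OF Z_facts(2)[OF Z that]])
  have pZ: "integrable (leb 0 1) (\<lambda>s. prim 0 T (\<lambda>\<tau>. - d\<phi> (Z \<tau> s)) t)"
    by (rule prim_time_L1(1)[OF Lp2_leb2_integrable[OF aZ]])
  show Yi: "integrable (leb 0 1) Y"
    unfolding Y_def using Zi[OF zero_mem] Zi[OF t] pZ by simp
  \<comment> \<open>The 2 counts the position errors at the times 0 and \<open>t\<close>;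
    \<open>K * T\<close> is the error of the force accumulated over the time interval.\<close>
  have le: "(LINT s|leb 0 1. \<bar>prim 0 T (\<lambda>\<tau>. L N \<tau> s) t - Y s\<bar>) \<le> (2 + K * T) * sqrt e"
    if e: "e > 0" and N: "N \<ge> 1" and b: "\<And>t. t \<in> {0..T} \<Longrightarrow> (LINT s|leb 0 1. (X N t s - Z t s)\<^sup>2) \<le> e" for e N
  proof -
    note XL = XL[OF N]
    have d1: "(LINT s|leb 0 1. \<bar>X N t s - Z t s\<bar>) \<le> sqrt e" if "t \<in> {0..T}" for t
      using integral_abs_le_sqrt_01[OF Lp2_diff[OF XL(3)[OF that] Z_facts(2)[OF Z that]]] real_sqrt_le_mono[OF b[OF that]]
      by linarith
    have D2: "Lp 2 (leb2 T) (\<lambda>(t, s). X N t s - Z t s)"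
      using Lp2_diff[OF XL(1) Z_Lp2[OF Z]] by (simp add: case_prod_beta')
    have A2: "Lp 2 (leb2 T) (\<lambda>(t, s). - d\<phi> (X N t s) - (- d\<phi> (Z t s)))"
      using Lp2_diff[OF aX[OF N] aZ] by (simp add: case_prod_beta')
    have dd: "(LINT p|leb2 T. \<bar>case p of (t, s) \<Rightarrow> - d\<phi> (X N t s) - (- d\<phi> (Z t s))\<bar>) \<le> K * (T * sqrt e)"
    proof -
      have "(LINT p|leb2 T. \<bar>case p of (t, s) \<Rightarrow> - d\<phi> (X N t s) - (- d\<phi> (Z t s))\<bar>)
          \<le> (LINT p|leb2 T. K * \<bar>case p of (t, s) \<Rightarrow> X N t s - Z t s\<bar>)"
      proof (rule integral_mono)
        show "integrable (leb2 T) (\<lambda>p. \<bar>case p of (t, s) \<Rightarrow> - d\<phi> (X N t s) - (- d\<phi> (Z t s))\<bar>)"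
          by (rule integrable_abs[OF Lp2_leb2_integrable[OF A2]])
        show "integrable (leb2 T) (\<lambda>p. K * \<bar>case p of (t, s) \<Rightarrow> X N t s - Z t s\<bar>)"
          by (intro integrable_mult_right integrable_abs Lp2_leb2_integrable D2)
        show "\<bar>case p of (t, s) \<Rightarrow> - d\<phi> (X N t s) - (- d\<phi> (Z t s))\<bar> \<le> K * \<bar>case p of (t, s) \<Rightarrow> X N t s - Z t s\<bar>" for p
          using Lip[of "X N (fst p) (snd p)" "Z (fst p) (snd p)"] by (simp add: case_prod_beta' abs_minus_commute)
      qed
      also have "\<dots> = K * (LINT t|leb 0 T. LINT s|leb 0 1. \<bar>X N t s - Z t s\<bar>)"
        using Lp2_leb2_square_integral(4)[OF D2] by simp
      also have "(LINT t|leb 0 T. LINT s|leb 0 1. \<bar>X N t s - Z t s\<bar>) \<le> (LINT t|leb 0 T. sqrt e)"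
        by (rule integral_mono) (use Lp2_leb2_square_integral(3)[OF D2] integrable_const_T d1 in auto)
      finally show ?thesis using K unfolding const_integral by (simp add: mult_left_mono)
    qed
    have pp: "integrable (leb 0 1) (\<lambda>s. prim 0 T (\<lambda>\<tau>. - d\<phi> (X N \<tau> s) - (- d\<phi> (Z \<tau> s))) t)"
      "(LINT s|leb 0 1. \<bar>prim 0 T (\<lambda>\<tau>. - d\<phi> (X N \<tau> s) - (- d\<phi> (Z \<tau> s))) t\<bar>) \<le> K * (T * sqrt e)"
      using prim_time_L1[OF Lp2_leb2_integrable[OF A2], of t] dd by auto
    have ae: "AE s in leb 0 1. prim 0 T (\<lambda>\<tau>. L N \<tau> s) t - Y s
      = (X N 0 s - Z 0 s) - (X N t s - Z t s) + prim 0 T (\<lambda>\<tau>. - d\<phi> (X N \<tau> s) - (- d\<phi> (Z \<tau> s))) t"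
      using XL(4)[OF t] pair_leb.AE_integrable_snd[OF Lp2_leb2_integrable[OF aX[OF N]]]
        pair_leb.AE_integrable_snd[OF Lp2_leb2_integrable[OF aZ]] pair_leb.AE_integrable_snd[OF Lp2_leb2_integrable[OF XL(2)]]
    proof eventually_elim
      case (elim s)
      then show ?case unfolding Y_def by (simp only: prim_diff)
    qed
    have Li: "integrable (leb 0 1) (\<lambda>s. prim 0 T (\<lambda>\<tau>. L N \<tau> s) t)"
      by (rule prim_time_L1(1)[OF Lp2_leb2_integrable[OF XL(2)]])
    have ti: "integrable (leb 0 1) (\<lambda>s. \<bar>X N t s - Z t s\<bar>)" if "t \<in> {0..T}" for t
      by (intro integrable_abs Lp2_leb_integrable Lp2_diff XL(3) Z_facts(2)[OF Z] that)
    have "(LINT s|leb 0 1. \<bar>prim 0 T (\<lambda>\<tau>. L N \<tau> s) t - Y s\<bar>)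
      \<le> (LINT s|leb 0 1. \<bar>X N 0 s - Z 0 s\<bar> + \<bar>X N t s - Z t s\<bar> + \<bar>prim 0 T (\<lambda>\<tau>. - d\<phi> (X N \<tau> s) - (- d\<phi> (Z \<tau> s))) t\<bar>)"
    proof (rule integral_mono_AE)
      show "AE s in leb 0 1. \<bar>prim 0 T (\<lambda>\<tau>. L N \<tau> s) t - Y s\<bar>
        \<le> \<bar>X N 0 s - Z 0 s\<bar> + \<bar>X N t s - Z t s\<bar> + \<bar>prim 0 T (\<lambda>\<tau>. - d\<phi> (X N \<tau> s) - (- d\<phi> (Z \<tau> s))) t\<bar>"
        using ae by eventually_elim linarith
    qed (use Li Yi ti[OF zero_mem] ti[OF t] pp(1) in auto)
    also have "\<dots> = (LINT s|leb 0 1. \<bar>X N 0 s - Z 0 s\<bar>) + (LINT s|leb 0 1. \<bar>X N t s - Z t s\<bar>)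
        + (LINT s|leb 0 1. \<bar>prim 0 T (\<lambda>\<tau>. - d\<phi> (X N \<tau> s) - (- d\<phi> (Z \<tau> s))) t\<bar>)"
      using ti[OF zero_mem] ti[OF t] integrable_abs[OF pp(1)] by simp
    also have "\<dots> \<le> sqrt e + sqrt e + K * (T * sqrt e)"
      by (intro add_mono d1 zero_mem t pp)
    finally show ?thesis by (simp add: algebra_simps)
  qed
  show "(\<lambda>N. LINT s|leb 0 1. \<bar>prim 0 T (\<lambda>\<tau>. L N \<tau> s) t - Y s\<bar>) \<longlonglongrightarrow> 0"
  proof (rule LIMSEQ_I)
    fix r :: real assume r: "r > 0"
    define \<kappa> where "\<kappa> = 2 + K * T"
    define e where "e = (r / (2 * \<kappa>))\<^sup>2"
    have KT: "\<kappa> > 0" unfolding \<kappa>_def using K T by (intro add_pos_pos mult_pos_pos) auto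
    have e: "e > 0" using r KT by (simp add: e_def)
    have "sqrt e = r / (2 * \<kappa>)" using r KT by (simp add: e_def)
    then have "(2 + K * T) * sqrt e = r / 2" using KT unfolding \<kappa>_def[symmetric] by simp
    then have small: "(2 + K * T) * sqrt e < r" using r by simp
    obtain n where n: "n \<ge> 1" "\<And>N t. N \<ge> n \<Longrightarrow> t \<in> {0..T} \<Longrightarrow> (LINT s|leb 0 1. (X N t s - Z t s)\<^sup>2) \<le> e"
      by (rule Z_conv[OF Z e]) auto
    show "\<exists>no. \<forall>N\<ge>no. norm ((LINT s|leb 0 1. \<bar>prim 0 T (\<lambda>\<tau>. L N \<tau> s) t - Y s\<bar>) - 0) < r"
    proof (intro exI[of _ n] allI impI)
      fix N assume "N \<ge> n"
      then have "(LINT s|leb 0 1. \<bar>prim 0 T (\<lambda>\<tau>. L N \<tau> s) t - Y s\<bar>) \<le> (2 + K * T) * sqrt e"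
        using n by (intro le e) auto
      then show "norm ((LINT s|leb 0 1. \<bar>prim 0 T (\<lambda>\<tau>. L N \<tau> s) t - Y s\<bar>) - 0) < r"
        using small by simp
    qed
  qed
qed

text \<open>Once the positions are replaced by their limit, every condition on the multiplier
  derivative is linear in it, so it passes to convex combinations and to their strong limit. The
  evolution passes through the time integrals, sign and complementarity at almost every time.
  Allowing an arbitrary selection \<open>\<rho>\<close> prepares the subsequence argument for weak
  convergence.\<close>

theorem limit_multiplier:
  assumes \<rho>: "\<And>k. k < \<rho> k"
  obtains c M L' where "\<And>n. tail_weights n (M n) (c n)" "approx_solution T d\<phi> 0 Z L'"
    "(\<lambda>n. LINT p|leb2 T. (case p of (t, s) \<Rightarrow> (\<Sum>k<M n. c n k * L (\<rho> k) t s) - L' t s)\<^sup>2) \<longlonglongrightarrow> 0"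
proof -
  have \<rho>1: "\<rho> k \<ge> 1" for k using \<rho>[of k] by simp
  obtain B where B: "B \<ge> 0" "\<And>N. N \<ge> 1 \<Longrightarrow> AE t in leb 0 T. (LINT s|leb 0 1. (L N t s)\<^sup>2) \<le> B"
    using multiplier_bound by blast
  define u where "u k p = (case p of (t, s) \<Rightarrow> L (\<rho> k) t s)" for k p
  have u2: "Lp 2 (leb2 T) (u k)" for k using XL(2)[OF \<rho>1] by (simp add: u_def[abs_def])
  have uB: "(LINT p|leb2 T. (u k p)\<^sup>2) \<le> T * B" for k
  proof -
    note q = Lp2_leb2_square_integral(1,2)[OF XL(2)[OF \<rho>1[of k]]]
    have "(LINT t|leb 0 T. LINT s|leb 0 1. (L (\<rho> k) t s)\<^sup>2) \<le> (LINT t|leb 0 T. B)"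
      by (rule integral_mono_AE) (use q integrable_const_T B(2)[OF \<rho>1] in auto)
    then show ?thesis unfolding const_integral using q(2) by (simp add: u_def)
  qed
  obtain c M where c: "\<And>n. tail_weights n (M n) (c n)"
    and cau: "\<And>e. e > 0 \<Longrightarrow> \<exists>n0. \<forall>i\<ge>n0. \<forall>j\<ge>n0.
       (LINT p|leb2 T. ((\<Sum>k<M i. c i k * u k p) - (\<Sum>k<M j. c j k * u k p))\<^sup>2) < e"
  proof (rule Mazur_Cauchy[of "leb2 T" u "T * B", OF u2 uB], goal_cases)
    case (1 c M)
    show ?case by (rule that[OF 1(2)], rule 1(3))
  qed
  have s2: "Lp 2 (leb2 T) (\<lambda>p. \<Sum>k<M n. c n k * u k p)" for n by (rule Lp2_sum[OF u2]) simp
  obtain l where l: "Lp 2 (leb2 T) l" "(\<lambda>n. LINT p|leb2 T. ((\<Sum>k<M n. c n k * u k p) - l p)\<^sup>2) \<longlonglongrightarrow> 0"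
    by (rule finite_measure.Lp2_complete[OF finite_measure_leb2, of T "\<lambda>n p. \<Sum>k<M n. c n k * u k p", OF s2 cau])
  define L' where "L' t s = l (t, s)" for t s
  define w where "w n t s = (\<Sum>k<M n. c n k * L (\<rho> k) t s)" for n t s
  have L'2: "Lp 2 (leb2 T) (\<lambda>(t, s). L' t s)" using l(1) by (simp add: L'_def)
  have w2: "Lp 2 (leb2 T) (\<lambda>(t, s). w n t s)" for n
    using s2[of n] by (simp add: w_def u_def case_prod_beta')
  have lim: "(\<lambda>n. LINT p|leb2 T. (case p of (t, s) \<Rightarrow> w n t s - L' t s)\<^sup>2) \<longlonglongrightarrow> 0"
    using l(2) by (simp add: w_def u_def L'_def case_prod_beta')
  have wL2: "Lp 2 (leb2 T) (\<lambda>(t, s). w n t s - L' t s)" for n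
    using Lp2_diff[OF w2 L'2] by (simp add: case_prod_beta')
  have evo: "AE s in leb 0 1. Z t s = Z 0 s + prim 0 T (\<lambda>\<tau>. - d\<phi> (Z \<tau> s) - L' \<tau> s) t" if t: "t \<in> {0..T}" for t
  proof -
    define Y where "Y s = Z 0 s - Z t s + prim 0 T (\<lambda>\<tau>. - d\<phi> (Z \<tau> s)) t" for s
    note Y = limit_evolution[OF t, folded Y_def]
    have Li: "integrable (leb 0 1) (\<lambda>s. prim 0 T (\<lambda>\<tau>. L (\<rho> k) \<tau> s) t)" for k
      by (rule prim_time_L1(1)[OF Lp2_leb2_integrable[OF XL(2)[OF \<rho>1]]])
    have l1: "(\<lambda>n. LINT s|leb 0 1. \<bar>(\<Sum>k<M n. c n k * prim 0 T (\<lambda>\<tau>. L (\<rho> k) \<tau> s) t) - Y s\<bar>) \<longlonglongrightarrow> 0"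
      by (rule tail_weights_tendsto[OF c \<rho>, of "leb 0 1" "\<lambda>N s. prim 0 T (\<lambda>\<tau>. L N \<tau> s) t"]) (rule Li Y)+
    define C where "C = sqrt (measure (leb2 T) (space (leb2 T)))"
    have l2: "(\<lambda>n. C * sqrt (LINT p|leb2 T. (case p of (t, s) \<Rightarrow> w n t s - L' t s)\<^sup>2)) \<longlonglongrightarrow> C * sqrt 0"
      by (intro tendsto_intros lim)
    have allk: "AE s in leb 0 1. \<forall>k. integrable (leb 0 T) (\<lambda>\<tau>. L (\<rho> k) \<tau> s)"
      unfolding AE_all_countable
      by (intro allI pair_leb.AE_integrable_snd Lp2_leb2_integrable XL(2) \<rho>1)
    have L's: "AE s in leb 0 1. integrable (leb 0 T) (\<lambda>\<tau>. L' \<tau> s)"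
      by (rule pair_leb.AE_integrable_snd[OF Lp2_leb2_integrable[OF L'2]])
    have L'i: "integrable (leb 0 1) (\<lambda>s. prim 0 T (\<lambda>\<tau>. L' \<tau> s) t)"
      by (rule prim_time_L1(1)[OF Lp2_leb2_integrable[OF L'2]])
    have le: "(LINT s|leb 0 1. \<bar>Y s - prim 0 T (\<lambda>\<tau>. L' \<tau> s) t\<bar>)
      \<le> (LINT s|leb 0 1. \<bar>(\<Sum>k<M n. c n k * prim 0 T (\<lambda>\<tau>. L (\<rho> k) \<tau> s) t) - Y s\<bar>)
        + C * sqrt (LINT p|leb2 T. (case p of (t, s) \<Rightarrow> w n t s - L' t s)\<^sup>2)" for n
    proof -
      note pw = prim_time_L1[OF Lp2_leb2_integrable[OF wL2[of n]], of t]
      have i1: "integrable (leb 0 1) (\<lambda>s. \<bar>(\<Sum>k<M n. c n k * prim 0 T (\<lambda>\<tau>. L (\<rho> k) \<tau> s) t) - Y s\<bar>)"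
        using Li Y(1) by (intro integrable_abs Bochner_Integration.integrable_diff Bochner_Integration.integrable_sum) auto
      have "(LINT s|leb 0 1. \<bar>Y s - prim 0 T (\<lambda>\<tau>. L' \<tau> s) t\<bar>)
        \<le> (LINT s|leb 0 1. \<bar>(\<Sum>k<M n. c n k * prim 0 T (\<lambda>\<tau>. L (\<rho> k) \<tau> s) t) - Y s\<bar>
            + \<bar>prim 0 T (\<lambda>\<tau>. w n \<tau> s - L' \<tau> s) t\<bar>)"
      proof (rule integral_mono_AE)
        show "AE s in leb 0 1. \<bar>Y s - prim 0 T (\<lambda>\<tau>. L' \<tau> s) t\<bar>
          \<le> \<bar>(\<Sum>k<M n. c n k * prim 0 T (\<lambda>\<tau>. L (\<rho> k) \<tau> s) t) - Y s\<bar> + \<bar>prim 0 T (\<lambda>\<tau>. w n \<tau> s - L' \<tau> s) t\<bar>"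
          using allk L's
        proof eventually_elim
          case (elim s)
          have "integrable (leb 0 T) (\<lambda>\<tau>. w n \<tau> s)"
            unfolding w_def using elim by (intro Bochner_Integration.integrable_sum) auto
          then have "prim 0 T (\<lambda>\<tau>. w n \<tau> s - L' \<tau> s) t = prim 0 T (\<lambda>\<tau>. w n \<tau> s) t - prim 0 T (\<lambda>\<tau>. L' \<tau> s) t"
            using elim by (simp add: prim_diff)
          also have "prim 0 T (\<lambda>\<tau>. w n \<tau> s) t = (\<Sum>k<M n. c n k * prim 0 T (\<lambda>\<tau>. L (\<rho> k) \<tau> s) t)"
            unfolding w_def using elim by (intro prim_sum) auto
          finally show ?case by linarith
        qed
      qed (use i1 pw(1) Y(1) L'i in auto)
      also have "\<dots> = (LINT s|leb 0 1. \<bar>(\<Sum>k<M n. c n k * prim 0 T (\<lambda>\<tau>. L (\<rho> k) \<tau> s) t) - Y s\<bar>)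
          + (LINT s|leb 0 1. \<bar>prim 0 T (\<lambda>\<tau>. w n \<tau> s - L' \<tau> s) t\<bar>)"
        by (rule Bochner_Integration.integral_add[OF i1 integrable_abs[OF pw(1)]])
      also have "\<dots> \<le> (LINT s|leb 0 1. \<bar>(\<Sum>k<M n. c n k * prim 0 T (\<lambda>\<tau>. L (\<rho> k) \<tau> s) t) - Y s\<bar>)
          + C * sqrt (LINT p|leb2 T. (case p of (t, s) \<Rightarrow> w n t s - L' t s)\<^sup>2)"
        using pw(2) finite_measure.integral_abs_le_sqrt[OF finite_measure_leb2 wL2[of n]] by (intro add_left_mono) (simp add: C_def)
      finally show ?thesis .
    qed
    have "(LINT s|leb 0 1. \<bar>Y s - prim 0 T (\<lambda>\<tau>. L' \<tau> s) t\<bar>) \<le> 0 + C * sqrt 0"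
      by (rule LIMSEQ_le_const[OF tendsto_add[OF l1 l2]]) (use le in blast)
    then have "(LINT s|leb 0 1. \<bar>Y s - prim 0 T (\<lambda>\<tau>. L' \<tau> s) t\<bar>) = 0"
      by (intro antisym) auto
    then have "AE s in leb 0 1. \<bar>Y s - prim 0 T (\<lambda>\<tau>. L' \<tau> s) t\<bar> = 0"
      using Y(1) L'i by (subst (asm) integral_nonneg_eq_0_iff_AE) auto
    moreover have "AE s in leb 0 1. integrable (leb 0 T) (\<lambda>\<tau>. - d\<phi> (Z \<tau> s))"
      using Lp2_leb2_integrable[OF Lp2_uminus[OF Lp2_Lipschitz_compose(1)[OF Z_Lp2[OF Z] finite_measure_leb2 Lip d\<phi>m]]]
      by (intro pair_leb.AE_integrable_snd) (simp add: case_prod_beta')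
    ultimately show ?thesis
      using L's
    proof eventually_elim
      case (elim s)
      from prim_diff[OF elim(2,3), of t] elim(1) show ?case by (simp add: Y_def)
    qed
  qed
  \<comment> \<open>Convergence in space and time yields convergence in space at a fixed time only
    along a further subsequence \<open>\<sigma>\<close>, common to almost all times.\<close>
  define q where "q n t = (LINT s|leb 0 1. (w n t s - L' t s)\<^sup>2)" for n t
  have qi: "integrable (leb 0 T) (q n)" for n unfolding q_def by (rule Lp2_leb2_square_integral(1)[OF wL2])
  have "(\<lambda>n. LINT t|leb 0 T. \<bar>q n t\<bar>) \<longlonglongrightarrow> 0"
    using lim Lp2_leb2_square_integral(2)[OF wL2] by (simp add: q_def)
  then obtain \<sigma> :: "nat \<Rightarrow> nat" where \<sigma>: "strict_mono \<sigma>" "AE t in leb 0 T. (\<lambda>j. q (\<sigma> j) t) \<longlonglongrightarrow> 0"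
    by (rule AE_subseq_L1[where f = q, OF qi])
  have allN: "AE t in leb 0 T. \<forall>N. N \<ge> 1 \<longrightarrow> (LINT s|leb 0 1. (L N t s)\<^sup>2) \<le> B \<and> admissible (L N t) \<and>
        - (1 / real N) * (LINT s|leb 0 1. \<bar>L N t s\<bar>) \<le> (LINT s|leb 0 1. (X N t s - s) * L N t s) \<and>
        (\<forall>m. admissible m \<longrightarrow> (LINT s|leb 0 1. (X N t s - s) * m s) \<le> 1 / real N * (LINT s|leb 0 1. \<bar>m s\<bar>))"
    unfolding AE_all_countable
  proof (intro allI)
    fix N :: nat
    show "AE t in leb 0 T. N \<ge> 1 \<longrightarrow> (LINT s|leb 0 1. (L N t s)\<^sup>2) \<le> B \<and> admissible (L N t) \<and>
        - (1 / real N) * (LINT s|leb 0 1. \<bar>L N t s\<bar>) \<le> (LINT s|leb 0 1. (X N t s - s) * L N t s) \<and>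
        (\<forall>m. admissible m \<longrightarrow> (LINT s|leb 0 1. (X N t s - s) * m s) \<le> 1 / real N * (LINT s|leb 0 1. \<bar>m s\<bar>))"
    proof (cases "N \<ge> 1")
      case True
      show ?thesis using B(2)[OF True] XL(5)[OF True] by eventually_elim simp
    qed simp
  qed
  have con: "AE t in leb 0 T. admissible (L' t) \<and>
        - 0 * (LINT s|leb 0 1. \<bar>L' t s\<bar>) \<le> (LINT s|leb 0 1. (Z t s - s) * L' t s) \<and>
        (\<forall>m. admissible m \<longrightarrow> (LINT s|leb 0 1. (Z t s - s) * m s) \<le> 0 * (LINT s|leb 0 1. \<bar>m s\<bar>))"
    using allN \<sigma>(2) Lp2_leb2_AE[OF L'2] AE_space
  proof eventually_elim
    case (elim t)
    then have t: "t \<in> {0..T}" and L't: "Lp 2 (leb 0 1) (L' t)" by auto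
    have qlim: "(\<lambda>j. LINT s|leb 0 1. (w (\<sigma> j) t s - L' t s)\<^sup>2) \<longlonglongrightarrow> 0" using elim by (simp add: q_def)
    have LN: "Lp 2 (leb 0 1) (L N t)" "admissible (L N t)" "(LINT s|leb 0 1. (L N t s)\<^sup>2) \<le> B"
      "- (1 / real N) * (LINT s|leb 0 1. \<bar>L N t s\<bar>) \<le> (LINT s|leb 0 1. (X N t s - s) * L N t s)"
      "\<And>m. admissible m \<Longrightarrow> (LINT s|leb 0 1. (X N t s - s) * m s) \<le> 1 / real N * (LINT s|leb 0 1. \<bar>m s\<bar>)"
      if "N \<ge> 1" for N
      using elim(1) that by (auto simp: admissible_def)
    have wt: "Lp 2 (leb 0 1) (w n t)" for n
      unfolding w_def using LN(1)[OF \<rho>1] by (intro Lp2_sum) auto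
    have wconv: "(\<lambda>j. LINT s|leb 0 1. f s * w (\<sigma> j) t s) \<longlonglongrightarrow> (LINT s|leb 0 1. f s * L' t s)" if "Lp 2 (leb 0 1) f" for f
      by (rule square_integral_weak_tendsto[OF wt L't that qlim])
    have wint: "(LINT s|leb 0 1. f s * w n t s) = (\<Sum>k<M n. c n k * (LINT s|leb 0 1. f s * L (\<rho> k) t s))"
      if f: "Lp 2 (leb 0 1) f" for f n
    proof -
      have "(LINT s|leb 0 1. f s * w n t s) = (LINT s|leb 0 1. (\<Sum>k<M n. c n k * (f s * L (\<rho> k) t s)))"
        unfolding w_def sum_distrib_left by (intro Bochner_Integration.integral_cong refl sum.cong) simp
      also have "\<dots> = (\<Sum>k<M n. c n k * (LINT s|leb 0 1. f s * L (\<rho> k) t s))"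
        using square_integrable_mult[OF f LN(1)[OF \<rho>1]] by simp
      finally show ?thesis .
    qed
    \<comment> \<open>A lower bound for the integral of \<open>f s * L N t s\<close> valid for all
      large \<open>N\<close> passes to \<open>L'\<close>, because the weights at stage
      \<open>\<sigma> j\<close> see only large indices. Mean, sign and complementarity of
      \<open>L'\<close> are all instances.\<close>
    have tw: "b \<le> (LINT s|leb 0 1. f s * L' t s)"
      if f: "Lp 2 (leb 0 1) f" and n0: "\<And>N. N \<ge> n0 \<Longrightarrow> N \<ge> 1 \<Longrightarrow> b \<le> (LINT s|leb 0 1. f s * L N t s)" for f b n0
    proof (rule LIMSEQ_le_const[OF wconv[OF f]], intro exI allI impI)
      fix j assume j: "j \<ge> n0"
      have "j \<le> \<sigma> j" by (rule seq_suble[OF \<sigma>(1)])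
      then have "b \<le> (\<Sum>k<M (\<sigma> j). c (\<sigma> j) k * (LINT s|leb 0 1. f s * L (\<rho> k) t s))"
        using j \<rho> by (intro tail_weights_sum_ge[OF c] n0 \<rho>1) (meson le_trans less_imp_le)
      then show "b \<le> (LINT s|leb 0 1. f s * w (\<sigma> j) t s)" by (simp add: wint[OF f])
    qed
    \<comment> \<open>Lower bounds with the test functions 1 and -1 together determine the
      mean.\<close>
    have one: "Lp 2 (leb 0 1) (\<lambda>_. 1)" "Lp 2 (leb 0 1) (\<lambda>_. - 1)" by (rule Lp2_const_leb)+
    have "0 \<le> (LINT s|leb 0 1. 1 * L' t s)"
      by (rule tw[OF one(1), of 0]) (use LN(2) in \<open>simp add: admissible_def\<close>)
    moreover have "0 \<le> (LINT s|leb 0 1. - 1 * L' t s)"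
      by (rule tw[OF one(2), of 0]) (use LN(2) in \<open>simp add: admissible_def\<close>)
    ultimately have mean: "(LINT s|leb 0 1. L' t s) = 0" by simp
    have nonneg: "0 \<le> prim 0 1 (L' t) s" if s: "s \<in> {0..1}" for s
      unfolding prim_def
    proof (rule tw)
      show "Lp 2 (leb 0 1) (indicator {..s})"
        unfolding Lp2_iff
        using prim_integrable[OF Lp2_leb_integrable[OF one(1)], of s] by (auto simp: power2_eq_square indicator_inter_arith[symmetric] intro!: measurable_leb)
      show "0 \<le> (LINT r|leb 0 1. indicator {..s} r * L N t r)" if "N \<ge> 1" for N
        using LN(2)[OF that] s by (simp add: admissible_def prim_def)
    qed
    have Zs: "Lp 2 (leb 0 1) (\<lambda>s. Z t s - s)" by (intro Lp2_diff Z_facts(2)[OF Z] t Lp2_id_leb)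
    have "0 \<le> (LINT s|leb 0 1. (Z t s - s) * L' t s)"
    proof (rule field_le_epsilon)
      fix e :: real assume e: "e > 0"
      \<comment> \<open>The first error is that of the approximate complementarity, the second comes
        from exchanging \<open>X N\<close> for \<open>Z\<close> by Cauchy-Schwarz; both carry the
        bound \<open>sqrt B\<close> for the multiplier derivative.\<close>
      have "(\<lambda>N. (1 / real N + sqrt (LINT s|leb 0 1. (X N t s - Z t s)\<^sup>2)) * sqrt B) \<longlonglongrightarrow> (0 + sqrt 0) * sqrt B"
        by (intro tendsto_intros Z_tendsto[OF Z t] lim_1_over_n)
      then have "\<forall>\<^sub>F N in sequentially. (1 / real N + sqrt (LINT s|leb 0 1. (X N t s - Z t s)\<^sup>2)) * sqrt B < e"
        using e by (intro order_tendstoD) auto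
      then obtain n0 where n0: "\<And>N. N \<ge> n0 \<Longrightarrow> (1 / real N + sqrt (LINT s|leb 0 1. (X N t s - Z t s)\<^sup>2)) * sqrt B < e"
        by (auto simp: eventually_sequentially)
      have "- e \<le> (LINT s|leb 0 1. (Z t s - s) * L' t s)"
      proof (rule tw[OF Zs, of n0])
        fix N assume N: "N \<ge> n0" "N \<ge> (1::nat)"
        note LN = LN[OF N(2)]
        have XZ: "Lp 2 (leb 0 1) (\<lambda>s. X N t s - Z t s)" by (intro Lp2_diff XL(3)[OF N(2) t] Z_facts(2)[OF Z t])
        have Xs: "Lp 2 (leb 0 1) (\<lambda>s. X N t s - s)" by (intro Lp2_diff XL(3)[OF N(2) t] Lp2_id_leb)
        have "(LINT s|leb 0 1. (Z t s - s) * L N t s) = (LINT s|leb 0 1. (X N t s - s) * L N t s - (X N t s - Z t s) * L N t s)"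
          by (intro Bochner_Integration.integral_cong refl) (simp add: algebra_simps)
        also have "\<dots> = (LINT s|leb 0 1. (X N t s - s) * L N t s) - (LINT s|leb 0 1. (X N t s - Z t s) * L N t s)"
          by (rule Bochner_Integration.integral_diff[OF square_integrable_mult[OF Xs LN(1)] square_integrable_mult[OF XZ LN(1)]])
        finally have split: "(LINT s|leb 0 1. (Z t s - s) * L N t s)
            = (LINT s|leb 0 1. (X N t s - s) * L N t s) - (LINT s|leb 0 1. (X N t s - Z t s) * L N t s)" .
        have sB: "sqrt (LINT s|leb 0 1. (L N t s)\<^sup>2) \<le> sqrt B" by (intro real_sqrt_le_mono LN)
        have "(LINT s|leb 0 1. (X N t s - Z t s) * L N t s) \<le> sqrt (LINT s|leb 0 1. (X N t s - Z t s)\<^sup>2) * sqrt B"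
          using integral_mult_le_sqrt[OF XZ LN(1)] mult_left_mono[OF sB, of "sqrt (LINT s|leb 0 1. (X N t s - Z t s)\<^sup>2)"]
          by (simp add: abs_le_iff)
        moreover have "1 / real N * (LINT s|leb 0 1. \<bar>L N t s\<bar>) \<le> 1 / real N * sqrt B"
          by (intro mult_left_mono order_trans[OF integral_abs_le_sqrt_01[OF LN(1)] sB]) auto
        moreover have "(1 / real N + sqrt (LINT s|leb 0 1. (X N t s - Z t s)\<^sup>2)) * sqrt B
            = 1 / real N * sqrt B + sqrt (LINT s|leb 0 1. (X N t s - Z t s)\<^sup>2) * sqrt B" by (rule distrib_right)
        ultimately show "- e \<le> (LINT s|leb 0 1. (Z t s - s) * L N t s)"
          using LN(4) n0[OF N(1)] unfolding split by linarith
      qed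
      then show "0 \<le> (LINT s|leb 0 1. (Z t s - s) * L' t s) + e" by simp
    qed
    moreover have "(LINT s|leb 0 1. (Z t s - s) * m s) \<le> 0" if m: "admissible m" for m
    proof -
      have m2: "Lp 2 (leb 0 1) m" using m by (simp add: admissible_def)
      have XS: "Lp 2 (leb 0 1) (\<lambda>s. X (Suc N) t s - s)" for N by (intro Lp2_diff XL(3)[OF _ t] Lp2_id_leb) simp
      have "(\<lambda>N. LINT s|leb 0 1. ((X (Suc N) t s - s) - (Z t s - s))\<^sup>2) \<longlonglongrightarrow> 0"
        using LIMSEQ_Suc[OF Z_tendsto[OF Z t]] by simp
      from square_integral_weak_tendsto[OF XS Zs m2 this]
      have 1: "(\<lambda>N. LINT s|leb 0 1. (X (Suc N) t s - s) * m s) \<longlonglongrightarrow> (LINT s|leb 0 1. (Z t s - s) * m s)"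
        by (simp add: mult.commute)
      have 2: "(\<lambda>N. 1 / real (Suc N) * (LINT s|leb 0 1. \<bar>m s\<bar>)) \<longlonglongrightarrow> 0 * (LINT s|leb 0 1. \<bar>m s\<bar>)"
        by (intro tendsto_mult tendsto_const LIMSEQ_Suc[OF lim_1_over_n])
      have "(LINT s|leb 0 1. (Z t s - s) * m s) \<le> 0 * (LINT s|leb 0 1. \<bar>m s\<bar>)"
        by (rule LIMSEQ_le[OF 1 2]) (intro exI allI impI LN(5)[OF _ m], simp)
      then show ?thesis by simp
    qed
    ultimately show ?case using mean nonneg L't by (simp add: admissible_def)
  qed
  have "approx_solution T d\<phi> 0 Z L'"
    unfolding approx_solution_def using Z_Lp2[OF Z] L'2 Z_facts(2)[OF Z] evo con by blast
  then show thesis using c lim by (intro that[of M c L']) (auto simp: w_def)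
qed

end

end

section \<open>Existence and weak convergence\<close>

context particle_limit
begin

text \<open>Weak convergence is shown by contradiction. If a functional stayed away from its
  expected limit along a selection of indices, it would, by linearity, stay away along the Mazur
  combinations; but these converge strongly to a multiplier of \<open>Z\<close>, and there is only
  one.\<close>

theorem limit_solution:
  obtains Z \<Lambda>' where "lagrangian_solution T d\<phi> X0 Z \<Lambda>'" "is_limit Z" "L2H1_weakly_tendsto T (\<lambda>N. interp_lin N (\<Lambda> N)) \<Lambda>'"
proof -
  obtain Z where Z: "is_limit Z" using limit_exists by blast
  note lagI = lagrangian_solutionI[OF T Lip d\<phi>m _ Z_C_Lp[OF Z] Z_initial[OF Z] Z_mono[OF Z]]
  \<comment> \<open>The selection \<open>Suc\<close> is the full sequence; it already provides a
    multiplier.\<close>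
  obtain L1 where L1: "approx_solution T d\<phi> 0 Z L1" using limit_multiplier[OF Z, of Suc] by blast
  define \<Lambda>' where "\<Lambda>' t s = prim 0 1 (L1 t) s" for t s
  have lag: "lagrangian_solution T d\<phi> X0 Z \<Lambda>'"
    using lagI[OF L1] by (simp add: \<Lambda>'_def[abs_def])
  have L12: "Lp 2 (leb2 T) (\<lambda>(t, s). L1 t s)" using L1 by (simp add: approx_solution_def)
  have d1: "L2H1_deriv T \<Lambda>' L1" using L2H1_deriv_prim(1)[OF L12] by (simp add: \<Lambda>'_def[abs_def])
  have dN: "L2H1_deriv T (interp_lin N (\<Lambda> N)) (L N)" if "N \<ge> 1" for N by (rule facts(6)[OF that that])
  \<comment> \<open>One-sided, because convex combinations preserve a bound from one side but not a
    lower bound on a distance; the signs 1 and -1 of \<open>\<sigma>\<close> cover both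
    sides.\<close>
  have half: "\<forall>\<^sub>F N in sequentially. \<sigma> * (F (interp_lin N (\<Lambda> N)) - F \<Lambda>') < e"
    if F: "L2H1_dual T F" and e: "e > 0" for F e and \<sigma> :: real
  proof (rule ccontr)
    assume "\<not> (\<forall>\<^sub>F N in sequentially. \<sigma> * (F (interp_lin N (\<Lambda> N)) - F \<Lambda>') < e)"
    then have "\<forall>n. \<exists>N. N > n \<and> e \<le> \<sigma> * (F (interp_lin N (\<Lambda> N)) - F \<Lambda>')"
      unfolding eventually_sequentially by (metis Suc_le_eq not_le)
    from choice[OF this] obtain \<rho> where \<rho>: "\<And>k. k < \<rho> k"
      and ge: "\<And>k. e \<le> \<sigma> * (F (interp_lin (\<rho> k) (\<Lambda> (\<rho> k))) - F \<Lambda>')"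
      by blast
    have \<rho>1: "\<rho> k \<ge> 1" for k using \<rho>[of k] by simp
    obtain c M L2 where c: "\<And>n. tail_weights n (M n) (c n)" and L2: "approx_solution T d\<phi> 0 Z L2"
      and lim: "(\<lambda>n. LINT p|leb2 T. (case p of (t, s) \<Rightarrow> (\<Sum>k<M n. c n k * L (\<rho> k) t s) - L2 t s)\<^sup>2) \<longlonglongrightarrow> 0"
      by (rule limit_multiplier[OF Z \<rho>]) (rule that)
    have L22: "Lp 2 (leb2 T) (\<lambda>(t, s). L2 t s)" using L2 by (simp add: approx_solution_def)
    have same: "AE t in leb 0 T. \<forall>s\<in>{0..1}. \<Lambda>' t s = prim 0 1 (L2 t) s"
      by (rule lagrangian_solution_unique(2)[OF T K Lip d\<phi>m lag lagI[OF L2]])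
    define u where "u n t s = (\<Sum>k<M n. c n k * interp_lin (\<rho> k) (\<Lambda> (\<rho> k)) t s)" for n t s
    define u' where "u' n t s = (\<Sum>k<M n. c n k * L (\<rho> k) t s)" for n t s
    have du: "L2H1_deriv T (u n) (u' n)" for n
      unfolding u_def[abs_def] u'_def[abs_def] by (rule L2H1_deriv_sum[OF dN[OF \<rho>1]])
    \<comment> \<open>The derivatives of the combinations converge to \<open>L2\<close>, which comes
      from a different selection than \<open>L1\<close>. By uniqueness \<open>L2\<close> is a weak
      derivative of \<open>\<Lambda>'\<close> as well, so the estimate for functionals can be
      applied with it.\<close>
    have d2: "L2H1_deriv T \<Lambda>' L2"
    proof (rule L2H1_deriv_cong_AE[OF L2H1_deriv_prim(1)[OF L22]])
      show "(\<lambda>(t, s). \<Lambda>' t s) \<in> borel_measurable (leb2 T)" using d1 by (simp add: L2H1_deriv_def Lp2_iff)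
      show "AE t in leb 0 T. \<forall>s\<in>{0<..<1}. \<Lambda>' t s = prim 0 1 (L2 t) s" using same by eventually_elim auto
    qed
    have D2: "Lp 2 (leb2 T) (\<lambda>(t, s). u' n t s - L2 t s)" for n
      using Lp2_diff[of "leb2 T" "\<lambda>(t, s). u' n t s" "\<lambda>(t, s). L2 t s"] du[of n] L22
      by (simp add: L2H1_deriv_def case_prod_beta')
    have U2: "Lp 2 (leb2 T) (\<lambda>(t, s). u n t s - \<Lambda>' t s)" for n
      using Lp2_diff[of "leb2 T" "\<lambda>(t, s). u n t s" "\<lambda>(t, s). \<Lambda>' t s"] du[of n] d1
      by (simp add: L2H1_deriv_def case_prod_beta')
    have allk: "AE t in leb 0 T. \<forall>k. Lp 2 (leb 0 1) (L (\<rho> k) t) \<and> (\<forall>s\<in>{0..1}. interp_lin (\<rho> k) (\<Lambda> (\<rho> k)) t s = prim 0 1 (L (\<rho> k) t) s)"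
      unfolding AE_all_countable
    proof
      fix k
      show "AE t in leb 0 T. Lp 2 (leb 0 1) (L (\<rho> k) t) \<and> (\<forall>s\<in>{0..1}. interp_lin (\<rho> k) (\<Lambda> (\<rho> k)) t s = prim 0 1 (L (\<rho> k) t) s)"
        using facts(3)[OF \<rho>1 \<rho>1, of k] Lp2_leb2_AE[OF XL(2)[OF \<rho>1[of k]]] by eventually_elim blast
    qed
    have le: "(LINT p|leb2 T. (case p of (t, s) \<Rightarrow> u n t s - \<Lambda>' t s)\<^sup>2) \<le> (LINT p|leb2 T. (case p of (t, s) \<Rightarrow> u' n t s - L2 t s)\<^sup>2)" for n
    proof -
      have P2: "Lp 2 (leb2 T) (\<lambda>(t, s). prim 0 1 (\<lambda>s. u' n t s - L2 t s) s)"
        using L2H1_deriv_prim(1)[OF D2[of n]] by (simp add: L2H1_deriv_def)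
      have "(LINT p|leb2 T. (case p of (t, s) \<Rightarrow> u n t s - \<Lambda>' t s)\<^sup>2) = (LINT p|leb2 T. (case p of (t, s) \<Rightarrow> prim 0 1 (\<lambda>s. u' n t s - L2 t s) s)\<^sup>2)"
        unfolding Lp2_leb2_square_integral(2)[OF U2, symmetric] Lp2_leb2_square_integral(2)[OF P2, symmetric]
      proof (intro integral_cong_AE)
        show "(\<lambda>t. LINT s|leb 0 1. (u n t s - \<Lambda>' t s)\<^sup>2) \<in> borel_measurable (leb 0 T)"
          using Lp2_leb2_square_integral(1)[OF U2] by simp
        show "(\<lambda>t. LINT s|leb 0 1. (prim 0 1 (\<lambda>s. u' n t s - L2 t s) s)\<^sup>2) \<in> borel_measurable (leb 0 T)"
          using Lp2_leb2_square_integral(1)[OF P2] by simp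
        show "AE t in leb 0 T. (LINT s|leb 0 1. (u n t s - \<Lambda>' t s)\<^sup>2) = (LINT s|leb 0 1. (prim 0 1 (\<lambda>s. u' n t s - L2 t s) s)\<^sup>2)"
          using allk same Lp2_leb2_AE[OF L22]
        proof eventually_elim
          case (elim t)
          show ?case
          proof (intro Bochner_Integration.integral_cong refl)
            fix s assume "s \<in> space (leb 0 1)"
            then have s: "s \<in> {0..1}" by auto
            have Li: "integrable (leb 0 1) (L (\<rho> k) t)" for k using elim by (simp add: Lp2_leb_integrable)
            have "u n t s = (\<Sum>k<M n. c n k * prim 0 1 (L (\<rho> k) t) s)"
              unfolding u_def using elim s by (intro sum.cong refl) auto
            also have "\<dots> = prim 0 1 (u' n t) s" unfolding u'_def[abs_def] by (rule prim_sum[OF Li, symmetric])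
            finally have "u n t s - \<Lambda>' t s = prim 0 1 (u' n t) s - prim 0 1 (L2 t) s" using elim s by simp
            also have "\<dots> = prim 0 1 (\<lambda>s. u' n t s - L2 t s) s"
              unfolding u'_def[abs_def] using Li elim
              by (subst prim_diff) (auto intro!: Bochner_Integration.integrable_sum Lp2_leb_integrable)
            finally show "(u n t s - \<Lambda>' t s)\<^sup>2 = (prim 0 1 (\<lambda>s. u' n t s - L2 t s) s)\<^sup>2" by simp
          qed
        qed
      qed
      then show ?thesis using L2H1_deriv_prim(2)[OF D2[of n]] by simp
    qed
    have lim': "(\<lambda>n. LINT p|leb2 T. (case p of (t, s) \<Rightarrow> u' n t s - L2 t s)\<^sup>2) \<longlonglongrightarrow> 0"
      using lim by (simp add: u'_def)
    have lim1: "(\<lambda>n. LINT p|leb2 T. (case p of (t, s) \<Rightarrow> u n t s - \<Lambda>' t s)\<^sup>2) \<longlonglongrightarrow> 0"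
    proof (rule Lim_null_comparison[OF _ lim'])
      show "\<forall>\<^sub>F n in sequentially. norm (LINT p|leb2 T. (case p of (t, s) \<Rightarrow> u n t s - \<Lambda>' t s)\<^sup>2)
         \<le> (LINT p|leb2 T. (case p of (t, s) \<Rightarrow> u' n t s - L2 t s)\<^sup>2)"
        using le by (intro always_eventually allI) simp
    qed
    have "(\<lambda>n. F (u n)) \<longlonglongrightarrow> F \<Lambda>'" by (rule L2H1_dual_tendsto[OF F du d2 lim1 lim'])
    then have lim\<sigma>: "(\<lambda>n. \<sigma> * (F (u n) - F \<Lambda>')) \<longlonglongrightarrow> \<sigma> * (F \<Lambda>' - F \<Lambda>')" by (intro tendsto_intros)
    \<comment> \<open>By linearity and since the weights sum to 1, the combinations inherit the gap
      \<open>e\<close>.\<close>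
    have "e \<le> \<sigma> * (F (u n) - F \<Lambda>')" for n
    proof -
      have "F (u n) = (\<Sum>k<M n. c n k * F (interp_lin (\<rho> k) (\<Lambda> (\<rho> k))))"
        unfolding u_def[abs_def] by (rule L2H1_dual_sum[OF F]) (use dN[OF \<rho>1] in \<open>auto simp: L2H1_def\<close>)
      moreover have "(\<Sum>k<M n. c n k) = 1" using c[of n] by (simp add: tail_weights_def)
      moreover have "(\<Sum>k<M n. c n k * (\<sigma> * (F (interp_lin (\<rho> k) (\<Lambda> (\<rho> k))) - F \<Lambda>')))
          = \<sigma> * (\<Sum>k<M n. c n k * F (interp_lin (\<rho> k) (\<Lambda> (\<rho> k)))) - \<sigma> * F \<Lambda>' * (\<Sum>k<M n. c n k)"
        by (simp add: right_diff_distrib sum_subtractf sum_distrib_left mult_ac)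
      ultimately have "\<sigma> * (F (u n) - F \<Lambda>') = (\<Sum>k<M n. c n k * (\<sigma> * (F (interp_lin (\<rho> k) (\<Lambda> (\<rho> k))) - F \<Lambda>')))"
        by (simp add: right_diff_distrib)
      also have "\<dots> \<ge> e" by (rule tail_weights_sum_ge[OF c]) (rule ge)
      finally show ?thesis .
    qed
    then have "e \<le> \<sigma> * (F \<Lambda>' - F \<Lambda>')" by (intro LIMSEQ_le_const[OF lim\<sigma>] exI allI impI)
    then show False using e by simp
  qed
  have "L2H1_weakly_tendsto T (\<lambda>N. interp_lin N (\<Lambda> N)) \<Lambda>'"
    unfolding L2H1_weakly_tendsto_def
  proof (intro conjI allI impI)
    show "L2H1 T (interp_lin N (\<Lambda> N))" if "N \<ge> 1" for N using dN[OF that] by (auto simp: L2H1_def)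
    show "L2H1 T \<Lambda>'" using d1 by (auto simp: L2H1_def)
    fix F assume F: "L2H1_dual T F"
    show "(\<lambda>N. F (interp_lin N (\<Lambda> N))) \<longlonglongrightarrow> F \<Lambda>'"
    proof (rule tendstoI)
      fix e :: real assume e: "e > 0"
      show "\<forall>\<^sub>F N in sequentially. dist (F (interp_lin N (\<Lambda> N))) (F \<Lambda>') < e"
        using half[OF F e, of 1] half[OF F e, of "-1"]
        by eventually_elim (auto simp: dist_real_def abs_less_iff)
    qed
  qed
  with lag Z show thesis by (rule that)
qed

end

section \<open>The main theorem\<close>

text \<open>Below the threshold \<open>\<eta>\<close> the first term dominates; above it
  \<open>\<bar>y\<bar> powr (p - 2)\<close> is at most its value at \<open>\<eta>\<close>, because
  \<open>p < 2\<close>.\<close>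

lemma powr_interpolation:
  fixes y \<eta> p :: real
  assumes "\<eta> > 0" "1 \<le> p" "p < 2"
  shows "\<bar>y\<bar> powr p \<le> \<eta> powr p + \<eta> powr (p - 2) * y\<^sup>2"
proof (cases "\<bar>y\<bar> \<le> \<eta>")
  case True
  then have "\<bar>y\<bar> powr p \<le> \<eta> powr p" using assms by (intro powr_mono2) auto
  then show ?thesis by (simp add: add_increasing2)
next
  case False
  then have y: "\<bar>y\<bar> > 0" using assms by linarith
  have "\<bar>y\<bar> powr p = \<bar>y\<bar> powr (p - 2) * \<bar>y\<bar> powr 2" by (simp only: powr_add[symmetric]) simp
  also have "\<bar>y\<bar> powr 2 = y\<^sup>2" using y by (simp add: powr_numeral)
  also have "\<bar>y\<bar> powr (p - 2) * y\<^sup>2 \<le> \<eta> powr (p - 2) * y\<^sup>2"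
    using assms False by (intro mult_right_mono powr_mono2') auto
  finally show ?thesis using powr_ge_zero[of \<eta> p] by linarith
qed

lemma Lp_le_L2:
  assumes f: "Lp 2 (leb 0 1) f" and p: "1 \<le> p" "p < 2"
  shows "Lp p (leb 0 1) f" "Lp_norm p (leb 0 1) f \<le> 2 * sqrt (LINT s|leb 0 1. (f s)\<^sup>2)"
proof -
  have fm: "f \<in> borel_measurable (leb 0 1)" "integrable (leb 0 1) (\<lambda>s. (f s)\<^sup>2)" using f by (auto simp: Lp2_iff)
  have ci: "integrable (leb 0 1) (\<lambda>_. c :: real)" for c by (rule Lp2_leb_integrable[OF Lp2_const_leb])
  have pm: "(\<lambda>s. \<bar>f s\<bar> powr p) \<in> borel_measurable (leb 0 1)" using fm by measurable
  have i: "integrable (leb 0 1) (\<lambda>s. \<bar>f s\<bar> powr p)"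
  proof (rule Bochner_Integration.integrable_bound[OF _ pm])
    show "integrable (leb 0 1) (\<lambda>s. 1 powr p + 1 powr (p - 2) * (f s)\<^sup>2)" using ci fm by simp
    show "AE s in leb 0 1. norm (\<bar>f s\<bar> powr p) \<le> norm (1 powr p + 1 powr (p - 2) * (f s)\<^sup>2)"
    proof (rule AE_I2)
      fix s
      show "norm (\<bar>f s\<bar> powr p) \<le> norm (1 powr p + 1 powr (p - 2) * (f s)\<^sup>2)"
        using powr_interpolation[OF zero_less_one p, of "f s"] by simp
    qed
  qed
  then show "Lp p (leb 0 1) f" using fm by (simp add: Lp_def)
  \<comment> \<open>Taking the L2 norm as threshold balances the two terms of the interpolation,
    each becoming \<open>\<eta> powr p\<close>; this gives the factor
    \<open>2 powr (1 / p) \<le> 2\<close>.\<close>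
  define \<eta> where "\<eta> = sqrt (LINT s|leb 0 1. (f s)\<^sup>2)"
  have \<eta>2: "(LINT s|leb 0 1. (f s)\<^sup>2) = \<eta>\<^sup>2" by (simp add: \<eta>_def)
  show "Lp_norm p (leb 0 1) f \<le> 2 * sqrt (LINT s|leb 0 1. (f s)\<^sup>2)"
  proof (cases "\<eta> = 0")
    case True
    then have "(LINT s|leb 0 1. (f s)\<^sup>2) = 0" by (simp add: \<eta>2)
    from square_integral_eq_0[OF f this] have "(LINT s|leb 0 1. \<bar>f s\<bar> powr p) = 0"
      by (intro integral_eq_zero_AE) (auto elim: AE_mp)
    then show ?thesis by (simp add: Lp_norm_def)
  next
    case False
    moreover have "\<eta> \<ge> 0" by (simp add: \<eta>_def)
    ultimately have \<eta>: "\<eta> > 0" by simp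
    have "(LINT s|leb 0 1. \<bar>f s\<bar> powr p) \<le> (LINT s|leb 0 1. \<eta> powr p + \<eta> powr (p - 2) * (f s)\<^sup>2)"
      using i ci fm by (intro integral_mono powr_interpolation \<eta> p) auto
    also have "\<dots> = \<eta> powr p + \<eta> powr (p - 2) * \<eta>\<^sup>2"
      using ci fm by (simp add: \<eta>2 measure_leb)
    also have "\<eta> powr (p - 2) * \<eta>\<^sup>2 = \<eta> powr p"
      using \<eta> by (simp add: powr_diff powr_numeral)
    finally have "(LINT s|leb 0 1. \<bar>f s\<bar> powr p) \<le> 2 * \<eta> powr p" by simp
    then have "Lp_norm p (leb 0 1) f \<le> (2 * \<eta> powr p) powr (1 / p)"
      unfolding Lp_norm_def using p by (intro powr_mono2) auto
    also have "\<dots> = 2 powr (1 / p) * \<eta>" using \<eta> p by (simp add: powr_mult powr_powr)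
    also have "\<dots> \<le> 2 powr 1 * \<eta>" using \<eta> p by (intro mult_right_mono powr_mono) auto
    finally show ?thesis by (simp add: \<eta>_def)
  qed
qed

text \<open>Coercivity turns the energy bound into a bound on the mean of the absolute positions,
  and ordered positions of total width at most \<open>W\<close> pairwise differ by at most
  \<open>W\<close>. So each absolute position exceeds the mean by at most \<open>W\<close>.\<close>

lemma initial_data_bound:
  fixes y :: "nat \<Rightarrow> real"
  assumes N: "N \<ge> 1" and c0: "c0 > 0" and \<phi>: "\<And>z. \<phi> z \<ge> c0 * (1 + \<bar>z\<bar>\<^sup>2)"
    and gap: "\<And>i. i \<in> {1..<N} \<Longrightarrow> y (i + 1) - y i \<ge> 1 / real N"
    and E: "(LINT s|leb 0 1. \<phi> (y (cell N s))) \<le> E" and W: "\<bar>y N - y 1\<bar> \<le> W" and i: "i \<in> {1..N}"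
  shows "\<bar>y i\<bar> \<le> sqrt (E / c0) + W"
proof -
  have mono: "y i \<le> y j" if "i \<in> {1..N}" "j \<in> {1..N}" "i \<le> j" for i j
  proof -
    have "y i - real i / real N \<le> y j - real j / real N" using that by (intro gap_mono gap) auto
    moreover have "real i / real N \<le> real j / real N" using that by (intro divide_right_mono) auto
    ultimately show ?thesis by linarith
  qed
  have y2: "Lp 2 (leb 0 1) (\<lambda>s. y (cell N s))" by (rule Lp2_cell[OF N])
  have ci: "integrable (leb 0 1) (\<lambda>_. c :: real)" for c by (rule Lp2_leb_integrable[OF Lp2_const_leb])
  have "c0 * (LINT s|leb 0 1. (y (cell N s))\<^sup>2) = (LINT s|leb 0 1. c0 * (y (cell N s))\<^sup>2)" by simp
  also have "\<dots> \<le> (LINT s|leb 0 1. \<phi> (y (cell N s)))"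
  proof (rule integral_mono)
    show "integrable (leb 0 1) (\<lambda>s. c0 * (y (cell N s))\<^sup>2)" using y2 by (simp add: Lp2_iff)
    show "integrable (leb 0 1) (\<lambda>s. \<phi> (y (cell N s)))"
      by (rule Lp2_leb_integrable[OF Lp2_cell[OF N, of "\<lambda>i. \<phi> (y i)"]])
    show "c0 * (y (cell N s))\<^sup>2 \<le> \<phi> (y (cell N s))" for s
      using \<phi>[of "y (cell N s)"] c0 by (simp add: distrib_left)
  qed
  also have "\<dots> \<le> E" by (rule E)
  finally have "(LINT s|leb 0 1. (y (cell N s))\<^sup>2) \<le> E / c0" using c0 by (simp add: pos_le_divide_eq mult.commute)
  then have L1: "(LINT s|leb 0 1. \<bar>y (cell N s)\<bar>) \<le> sqrt (E / c0)"
    using integral_abs_le_sqrt_01[OF y2] real_sqrt_le_mono order_trans by blast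
  have "\<bar>y i\<bar> = (LINT s|leb 0 1. \<bar>y i\<bar>)" by (simp add: measure_leb)
  also have "\<dots> \<le> (LINT s|leb 0 1. \<bar>y (cell N s)\<bar> + W)"
  proof (rule integral_mono[OF ci])
    show "integrable (leb 0 1) (\<lambda>s. \<bar>y (cell N s)\<bar> + W)"
      using ci integrable_abs[OF Lp2_leb_integrable[OF y2]] by simp
    fix s assume "s \<in> space (leb 0 1)"
    then have "cell N s \<in> {1..N}" by (intro cell_range[OF N]) simp
    then have "y 1 \<le> y (cell N s)" "y (cell N s) \<le> y N" "y 1 \<le> y i" "y i \<le> y N" using i N by (auto intro!: mono)
    then show "\<bar>y i\<bar> \<le> \<bar>y (cell N s)\<bar> + W" using W by linarith
  qed
  also have "\<dots> = (LINT s|leb 0 1. \<bar>y (cell N s)\<bar>) + W"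
    using ci integrable_abs[OF Lp2_leb_integrable[OF y2]] by (simp add: measure_leb)
  finally show ?thesis using L1 by linarith
qed

theorem theorem1p5:
  fixes T c0 :: real
    and \<phi> d\<phi> dd\<phi> X0 :: "real \<Rightarrow> real"
    and x0 :: "nat \<Rightarrow> nat \<Rightarrow> real"
    and x \<Lambda>p :: "nat \<Rightarrow> nat \<Rightarrow> real \<Rightarrow> real"
  assumes "T > 0"
    and "\<And>y. (\<phi> has_real_derivative d\<phi> y) (at y)"
    and "\<And>y. (d\<phi> has_real_derivative dd\<phi> y) (at y)"
    and "continuous_on UNIV dd\<phi>"
    and "bdd_above (range (\<lambda>y. \<bar>dd\<phi> y\<bar>))"
    and "c0 > 0"
    and "\<And>y. \<phi> y \<ge> c0 * (1 + \<bar>y\<bar>\<^sup>2)"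
    and "\<And>N i. N \<ge> 1 \<Longrightarrow> i \<in> {1..<N} \<Longrightarrow> x0 N (i + 1) - x0 N i \<ge> 1 / real N"
    and "\<And>N. N \<ge> 1 \<Longrightarrow> particle_solution T d\<phi> N (x0 N) (x N) (\<Lambda>p N)"
    and "bdd_above ((\<lambda>N. LINT s|leb 0 1. \<phi> (interp_const N (x N) 0 s)) ` {1..})"
    and "bdd_above ((\<lambda>N. \<bar>x0 N N - x0 N 1\<bar>) ` {1..})"
    and "\<And>s1 s2. 0 \<le> s1 \<Longrightarrow> s1 < s2 \<Longrightarrow> s2 \<le> 1 \<Longrightarrow> X0 s2 - X0 s1 \<ge> s2 - s1"
    and "(\<lambda>N. Lp_norm 1 (leb 0 1) (\<lambda>s. interp_const N (x N) 0 s - X0 s)) \<longlonglongrightarrow> 0"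
  shows "\<exists>X \<Lambda>.
    lagrangian_solution T d\<phi> X0 X \<Lambda> \<and>
    (\<forall>Y M. lagrangian_solution T d\<phi> X0 Y M \<longrightarrow>
       (\<forall>t\<in>{0..T}. AE s in leb 0 1. Y t s = X t s) \<and>
       (AE t in leb 0 T. \<forall>s\<in>{0..1}. M t s = \<Lambda> t s)) \<and>
    (\<forall>p\<in>{1..<2}. C_Lp_tendsto p T (\<lambda>N. interp_const N (x N)) X) \<and>
    L2H1_weakly_tendsto T (\<lambda>N. interp_lin N (\<Lambda>p N)) \<Lambda>"
proof -
  obtain K0 where K0: "\<And>y. \<bar>dd\<phi> y\<bar> \<le> K0" using assms(5) by (auto simp: bdd_above_def)
  \<comment> \<open>The maximum with 1 makes the Lipschitz constant positive outright, as Gronwall's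
    inequality requires.\<close>
  define K where "K = max K0 1"
  have K: "K > 0" and ddK: "\<bar>dd\<phi> y\<bar> \<le> K" for y using K0[of y] by (auto simp: K_def)
  have Lip1: "\<bar>d\<phi> b - d\<phi> a\<bar> \<le> K * \<bar>b - a\<bar>" if ab: "a < b" for a b
  proof -
    obtain z where "d\<phi> b - d\<phi> a = (b - a) * dd\<phi> z" using MVT2[OF ab, of d\<phi> dd\<phi>] assms(3) by blast
    then show ?thesis using ddK[of z] ab by (simp add: abs_mult mult.commute mult_right_mono)
  qed
  have Lip: "\<bar>d\<phi> a - d\<phi> b\<bar> \<le> K * \<bar>a - b\<bar>" for a b
    using Lip1[of a b] Lip1[of b a] by (cases a b rule: linorder_cases) (auto simp: abs_minus_commute)
  have d\<phi>m: "d\<phi> \<in> borel_measurable borel"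
    by (intro borel_measurable_continuous_onI continuous_at_imp_continuous_on ballI) (rule DERIV_isCont[OF assms(3)])
  have X0mono: "X0 s \<le> X0 s'" if "0 \<le> s" "s \<le> s'" "s' \<le> 1" for s s'
    using assms(12)[of s s'] that by (cases "s = s'") auto
  have X0m: "X0 \<in> borel_measurable (leb 0 1)"
    by (intro mono_on_leb_measurable mono_onI X0mono) auto
  define b where "b = max \<bar>X0 0\<bar> \<bar>X0 1\<bar>"
  have X0b: "\<bar>X0 s\<bar> \<le> b" if "s \<in> {0<..<1}" for s
    using X0mono[of 0 s] X0mono[of s 1] that by (auto simp: b_def)
  have X02: "Lp 2 (leb 0 1) X0"
  proof -
    have "integrable (leb 0 1) (\<lambda>s. (X0 s)\<^sup>2)"
    proof (rule finite_measure.integrable_const_bound[OF finite_measure_leb, where B="b\<^sup>2"])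
      show "AE s in leb 0 1. norm ((X0 s)\<^sup>2) \<le> b\<^sup>2"
      proof (rule AE_I2)
        fix s assume "s \<in> space (leb 0 1)"
        then have "\<bar>X0 s\<bar>\<^sup>2 \<le> b\<^sup>2" by (intro power_mono X0b) auto
        then show "norm ((X0 s)\<^sup>2) \<le> b\<^sup>2" by simp
      qed
    qed (use X0m in simp)
    with X0m show ?thesis by (simp add: Lp2_iff)
  qed
  obtain E where E: "\<And>N. N \<ge> 1 \<Longrightarrow> (LINT s|leb 0 1. \<phi> (interp_const N (x N) 0 s)) \<le> E"
    using assms(10) by (auto simp: bdd_above_def)
  obtain W where W: "\<And>N. N \<ge> 1 \<Longrightarrow> \<bar>x0 N N - x0 N 1\<bar> \<le> W"
    using assms(11) by (auto simp: bdd_above_def)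
  have x_init: "x N i 0 = x0 N i" if "N \<ge> 1" "i \<in> {1..N}" for N i
    using assms(9)[OF that(1)] that(2) by (auto simp: particle_solution_def)
  \<comment> \<open>A bound for the initial differences that is uniform in \<open>N\<close> and
    \<open>s\<close>. Their squares are at most \<open>D\<close> times their absolute values, so L1
    convergence becomes L2 convergence.\<close>
  define D where "D = sqrt (E / c0) + W + b"
  have XN: "\<bar>interp_const N (x N) 0 s - X0 s\<bar> \<le> D" if N: "N \<ge> 1" and s: "s \<in> {0<..<1}" for N s
  proof -
    have eq: "interp_const N (x N) 0 r = x0 N (cell N r)" if "r \<in> {0<..<1}" for r
      using x_init[OF N cell_range[OF N that]] by (simp add: interp_const_def)
    have "(LINT r|leb 0 1. \<phi> (x0 N (cell N r))) = (LINT r|leb 0 1. \<phi> (interp_const N (x N) 0 r))"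
      by (intro Bochner_Integration.integral_cong refl) (simp add: eq)
    then have "(LINT r|leb 0 1. \<phi> (x0 N (cell N r))) \<le> E" using E[OF N] by simp
    then have "\<bar>x0 N (cell N s)\<bar> \<le> sqrt (E / c0) + W"
      by (intro initial_data_bound[OF N assms(6,7) assms(8)[OF N] _ W[OF N] cell_range[OF N s]]) auto
    then show ?thesis using X0b[OF s] eq[OF s] by (simp add: D_def)
  qed
  have x_Lp2: "Lp 2 (leb 0 1) (interp_const N (x N) 0)" if "N \<ge> 1" for N
    unfolding interp_const_def[abs_def] by (rule Lp2_cell[OF that, of "\<lambda>i. x N i 0"])
  have init: "(\<lambda>N. LINT s|leb 0 1. (interp_const N (x N) 0 s - X0 s)\<^sup>2) \<longlonglongrightarrow> 0"
  proof (rule Lim_null_comparison)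
    show "(\<lambda>N. D * Lp_norm 1 (leb 0 1) (\<lambda>s. interp_const N (x N) 0 s - X0 s)) \<longlonglongrightarrow> 0"
      using tendsto_mult[OF tendsto_const assms(13), of D] by simp
    show "\<forall>\<^sub>F N in sequentially. norm (LINT s|leb 0 1. (interp_const N (x N) 0 s - X0 s)\<^sup>2)
        \<le> D * Lp_norm 1 (leb 0 1) (\<lambda>s. interp_const N (x N) 0 s - X0 s)"
    proof (intro eventually_sequentiallyI[of 1])
      fix N :: nat assume N: "1 \<le> N"
      note d2 = Lp2_diff[OF x_Lp2[OF N] X02]
      have "(LINT s|leb 0 1. (interp_const N (x N) 0 s - X0 s)\<^sup>2) \<le> (LINT s|leb 0 1. D * \<bar>interp_const N (x N) 0 s - X0 s\<bar>)"
      proof (rule integral_mono)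
        show "(interp_const N (x N) 0 s - X0 s)\<^sup>2 \<le> D * \<bar>interp_const N (x N) 0 s - X0 s\<bar>"
          if "s \<in> space (leb 0 1)" for s
        proof -
          have "\<bar>interp_const N (x N) 0 s - X0 s\<bar> * \<bar>interp_const N (x N) 0 s - X0 s\<bar> \<le> D * \<bar>interp_const N (x N) 0 s - X0 s\<bar>"
            using XN[OF N, of s] that by (intro mult_right_mono) auto
          then show ?thesis by (simp add: power2_eq_square)
        qed
        show "integrable (leb 0 1) (\<lambda>s. (interp_const N (x N) 0 s - X0 s)\<^sup>2)" using d2 by (simp add: Lp2_iff)
        show "integrable (leb 0 1) (\<lambda>s. D * \<bar>interp_const N (x N) 0 s - X0 s\<bar>)"
          by (intro integrable_mult_right integrable_abs Lp2_leb_integrable[OF d2])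
      qed
      then show "norm (LINT s|leb 0 1. (interp_const N (x N) 0 s - X0 s)\<^sup>2)
        \<le> D * Lp_norm 1 (leb 0 1) (\<lambda>s. interp_const N (x N) 0 s - X0 s)"
        by (simp add: Lp_norm_def powr_one' Bochner_Integration.integral_nonneg)
    qed
  qed
  interpret particle_limit T K d\<phi> X0 x0 x \<Lambda>p
    by unfold_locales (use assms(1,9) K Lip d\<phi>m X02 init in auto)
  obtain Z \<Lambda> where lag: "lagrangian_solution T d\<phi> X0 Z \<Lambda>" and Z: "is_limit Z"
    and weak: "L2H1_weakly_tendsto T (\<lambda>N. interp_lin N (\<Lambda>p N)) \<Lambda>" by (rule limit_solution)
  have "C_Lp_tendsto p T (\<lambda>N. interp_const N (x N)) Z" if p: "p \<in> {1..<2}" for p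
    unfolding C_Lp_tendsto_def
  proof (intro conjI allI impI)
    have p': "1 \<le> p" "p < 2" using p by auto
    show "C_Lp p T (interp_const N (x N))" if "N \<ge> 1" for N
      using facts(4)[OF that that, of p] p by (simp add: X_def)
    show "C_Lp p T Z"
      unfolding C_Lp_def
    proof (intro ballI conjI)
      fix t assume t: "t \<in> {0..T}"
      show "Lp p (leb 0 1) (Z t)" by (rule Lp_le_L2(1)[OF Z_facts(2)[OF Z t] p'])
      have lim: "((\<lambda>\<tau>. 2 * sqrt (LINT s|leb 0 1. (Z \<tau> s - Z t s)\<^sup>2)) \<longlongrightarrow> 0) (at t within {0..T})"
      proof -
        have "((\<lambda>\<tau>. LINT s|leb 0 1. (Z \<tau> s - Z t s)\<^sup>2) \<longlongrightarrow> 0) (at t within {0..T})"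
          using Z_C_Lp[OF Z] t by (simp add: C_Lp_def Lp_norm_2_tendsto_iff)
        from tendsto_mult[OF tendsto_const tendsto_real_sqrt[OF this], of 2] show ?thesis by simp
      qed
      show "((\<lambda>\<tau>. Lp_norm p (leb 0 1) (\<lambda>s. Z \<tau> s - Z t s)) \<longlongrightarrow> 0) (at t within {0..T})"
      proof (rule Lim_null_comparison[OF _ lim])
        show "\<forall>\<^sub>F \<tau> in at t within {0..T}. norm (Lp_norm p (leb 0 1) (\<lambda>s. Z \<tau> s - Z t s)) \<le> 2 * sqrt (LINT s|leb 0 1. (Z \<tau> s - Z t s)\<^sup>2)"
          unfolding eventually_at_filter
        proof (intro always_eventually allI impI)
          fix \<tau> assume "\<tau> \<in> {0..T}"
          from Lp_le_L2(2)[OF Lp2_diff[OF Z_facts(2)[OF Z this] Z_facts(2)[OF Z t]] p']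
          show "norm (Lp_norm p (leb 0 1) (\<lambda>s. Z \<tau> s - Z t s)) \<le> 2 * sqrt (LINT s|leb 0 1. (Z \<tau> s - Z t s)\<^sup>2)"
            by (simp add: Lp_norm_def)
        qed
      qed
    qed
    show "uniform_limit {0..T} (\<lambda>N t. Lp_norm p (leb 0 1) (\<lambda>s. interp_const N (x N) t s - Z t s)) (\<lambda>_. 0) sequentially"
    proof (rule uniform_limitI)
      fix e :: real assume e: "e > 0"
      \<comment> \<open>With the factor 2 of \<open>Lp_le_L2\<close> this leaves
        \<open>e / 2\<close>, strictly below \<open>e\<close>.\<close>
      obtain n where n: "n \<ge> 1" "\<And>N t. N \<ge> n \<Longrightarrow> t \<in> {0..T} \<Longrightarrow> (LINT s|leb 0 1. (X N t s - Z t s)\<^sup>2) \<le> (e / 4)\<^sup>2"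
        by (rule Z_conv[OF Z, of "(e / 4)\<^sup>2"]) (use e in auto)
      show "\<forall>\<^sub>F N in sequentially. \<forall>t\<in>{0..T}. dist (Lp_norm p (leb 0 1) (\<lambda>s. interp_const N (x N) t s - Z t s)) 0 < e"
      proof (intro eventually_sequentiallyI[of n] ballI)
        fix N t assume N: "n \<le> N" and t: "t \<in> {0..T}"
        then have N1: "N \<ge> 1" using n by simp
        have "Lp_norm p (leb 0 1) (\<lambda>s. X N t s - Z t s) \<le> 2 * sqrt (LINT s|leb 0 1. (X N t s - Z t s)\<^sup>2)"
          by (rule Lp_le_L2(2)[OF Lp2_diff[OF XL(3)[OF N1 t] Z_facts(2)[OF Z t]] p'])
        also have "\<dots> \<le> 2 * sqrt ((e / 4)\<^sup>2)" using n(2)[OF N t] by (intro mult_left_mono real_sqrt_le_mono) auto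
        also have "\<dots> < e" using e by simp
        finally show "dist (Lp_norm p (leb 0 1) (\<lambda>s. interp_const N (x N) t s - Z t s)) 0 < e"
          by (simp add: X_def dist_real_def Lp_norm_def)
      qed
    qed
  qed
  moreover have "(\<forall>t\<in>{0..T}. AE s in leb 0 1. Y t s = Z t s) \<and> (AE t in leb 0 T. \<forall>s\<in>{0..1}. M t s = \<Lambda> t s)"
    if "lagrangian_solution T d\<phi> X0 Y M" for Y M
    using lagrangian_solution_unique[OF T K Lip d\<phi>m that lag] by blast
  ultimately show ?thesis using lag weak by blast
qed

end
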